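(* Assume (A1)-(A5) (see context) and that $\gamma$ is sufficiently large. Let $(\bar u_{31},\bar u_{32},\bar u_{33})$ be the open-loop Nash equilibrium of Level 3 given by $$\bar u_{3j}=-R_{3j}^{-1}[S_{3j}^\top\hat x+\hat B_{3j}^\top\hat y_j+\hat D_{3j}^\top\hat z_j],\qquad j=1,2,3,$$ where the adapted square-integrable processes $(\hat x,\hat y_1,\hat z_1,\hat y_2,\hat z_2,\hat y_3,\hat z_3)$ satisfy $$\begin{cases}d\hat x=\big[\hat A\hat x+\sum_{k=1}^3\hat B_{3k}\bar u_{3k}\big]dt+\big[\hat C\hat x+\sum_{k=1}^3\hat D_{3k}\bar u_{3k}\big]dW,\\ d\hat y_j=-[\hat A^\top\hat y_j+\hat C^\top\hat z_j+\hat Q_{3j}\hat x+S_{3j}\bar u_{3j}]dt+\hat z_j\,dW,\quad j=1,2,3,\\ \hat x(0)=x_0,\quad\hat y_j(T)=G_{3j}\hat x(T).\end{cases}$$ Suppose that the equation $$\begin{cases}\dot\Phi+\Phi\big(\hat A-\sum_{j=1}^3\hat B_{3j}R_{3j}^{-1}S_{3j}^\top\big)+\mathbf A^\top\Phi+\Phi\mathbf B_1\Phi+\mathbf Q\\ \quad+(\mathbf C^\top+\Phi\mathbf B_2)(I-\Phi\mathbf D_2)^{-1}\big(\Phi\hat C-\sum_{j=1}^3\Phi\hat D_{3j}R_{3j}^{-1}S_{3j}^\top+\Phi\mathbf D_1\Phi\big)=0,\\ \Phi(T)=\mathbf G\end{cases}$$ admits a solution $\Phi(\cdot)$ on $[0,T]$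 such that $I-\Phi\mathbf D_2$ has bounded inverse. Put $\Psi:=(I-\Phi\mathbf D_2)^{-1}\big(\Phi\hat C-\sum_{j=1}^3\Phi\hat D_{3j}R_{3j}^{-1}S_{3j}^\top+\Phi\mathbf D_1\Phi\big)$. Then $$\bar u_{31}(t)=-R_{31}^{-1}\big[S_{31}^\top+(\hat B_{31}^\top\ 0\ 0)\Phi+(\hat D_{31}^\top\ 0\ 0)\Psi\big]\hat x(t),$$ $$\bar u_{32}(t)=-R_{32}^{-1}\big[S_{32}^\top+(0\ \hat B_{32}^\top\ 0)\Phi+(0\ \hat D_{32}^\top\ 0)\Psi\big]\hat x(t),$$ $$\bar u_{33}(t)=-R_{33}^{-1}\big[S_{33}^\top+(0\ 0\ \hat B_{33}^\top)\Phi+(0\ 0\ \hat D_{33}^\top)\Psi\big]\hat x(t),$$ where $\hat x$ satisfies $$\begin{cases}d\hat x=\big[\hat A-\sum_{j=1}^3\hat B_{3j}R_{3j}^{-1}S_{3j}^\top+\mathbf B_1\Phi+\mathbf B_2\Psi\big]\hat x\,dt+\big[\hat C-\sum_{j=1}^3\hat D_{3j}R_{3j}^{-1}S_{3j}^\top+\mathbf D_1\Phi+\mathbf D_2\Psi\big]\hat x\,dW,\\ \hat x(0)=x_0.\end{cases}$$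
   Context: Indices: $i\in\{1,2\}$, $j\in\{1,2,3\}$. Fix $T>0$ and a complete filtered probability space $(\Omega,\mathcal F,\mathbb F,\mathbb P)$ with a one-dimensional Brownian motion $W$, $\mathbb F$ its augmented natural filtration. $L^2_{\mathbb F}(0,T;\mathbb H)$ is the space of $\mathbb F$-progressively measurable $\phi$ with $\mathbb E\int_0^T|\phi|^2dt<\infty$. For symmetric matrix functions, $M\gg0$ means $M(t)\ge\delta I$ for some $\delta>0$. State equation: $$dx=\Big[Ax+\sum_iB_{1i}u_{1i}+\sum_{i,j}B_{2ij}u_{2ij}+\sum_{j,i}B_{3ji}u_{3ji}+Ev\Big]dt+\Big[Cx+\sum_iD_{1i}u_{1i}+\sum_{i,j}D_{2ij}u_{2ij}+\sum_{j,i}D_{3ji}u_{3ji}\Big]dW,\quad x(0)=x_0\in\mathbb R^n,$$ with deterministic bounded coefficients on $[0,T]$; $u_{1i}\in L^2_{\mathbb F}(0,T;\mathbb R^{m_{1i}})$ are controls of Level 1, $u_{2ij}\in L^2_{\mathbb F}(0,T;\mathbb R^{m_{2ij}})$ of player $i$ of Level 2, $u_{3ji}\in L^2_{\mathbb F}(0,T;\mathbb R^{m_{3ji}})$ of player $j$ of Level 3, $v\in L^2_{\mathbb F}(0,T;\mathbb R^{n_v})$ is the disturbance. Write $u_{3j}=\mathrm{col}[u_{3j1},u_{3j2}]$, $u_{ci}=\mathrm{col}[u_{2i1},u_{2i2},u_{2i3},u_{31i},u_{32i},u_{33i}]$. Costs (deterministic bounded symmetric weights): $J^1=\mathbb E\{\int_0^T[\langle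 Q_1x,x\rangle+\sum_i\langle R_iu_{1i},u_{1i}\rangle+\sum_{i,j}\langle R_{1ij}u_{2ij},u_{2ij}\rangle+\sum_{j,i}\langle\bar R_{1ji}u_{3ji},u_{3ji}\rangle]dt+\langle G_1x(T),x(T)\rangle\}$; $J^2_i=\mathbb E\{\int_0^T[\langle Q_{2i}x,x\rangle+\langle R_{2i}u_{1i},u_{1i}\rangle+\sum_j\langle R_{2ij}u_{2ij},u_{2ij}\rangle+\sum_j\langle\bar R_{2ji}u_{3ji},u_{3ji}\rangle]dt+\langle G_{2i}x(T),x(T)\rangle\}$; $J^3_j=\mathbb E\{\int_0^T[\langle Q_{3j}x,x\rangle+\sum_i\langle R_{3ij}u_{2ij},u_{2ij}\rangle+\sum_i\langle\bar R_{3ji}u_{3ji},u_{3ji}\rangle]dt+\langle G_{3j}x(T),x(T)\rangle\}$. (A1) $Q_1,Q_{2i},Q_{3j},G_1,G_{2i},G_{3j}\ge0$. (A2) $R_i,R_{1ij},\bar R_{1ji},R_{2i},R_{2ij},\bar R_{2ji},R_{3ij},\bar R_{3ji}\gg0$. Team-optimal strategy ($\gamma>0$ is the disturbance attenuation level). $B_c=[B_{11},B_{12},B_{211},B_{212},B_{213},B_{221},B_{222},B_{223},B_{311},B_{312},B_{321},B_{322},B_{331},B_{332}]$, $D_c$ likewise from the $D$'s, $R_c=\mathrm{blockdiag}(R_1,R_2,R_{111},R_{112},R_{113},R_{121},R_{122},R_{123},\bar R_{111},\bar R_{112},\bar R_{121},\bar R_{122},\bar R_{131},\bar R_{132})$.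 $P$ denotes the solution (assumed to exist on $[0,T]$, with $I+PD_cR_c^{-1}D_c^\top$ having bounded inverse) of $$\dot P+PA+A^\top P-P(B_cR_c^{-1}B_c^\top-\gamma^{-2}EE^\top)P+Q_1+(C-D_cR_c^{-1}B_c^\top P)^\top(I+PD_cR_c^{-1}D_c^\top)^{-1}P(C-D_cR_c^{-1}B_c^\top P)=0,\ P(T)=G_1,$$ and $\Lambda:=(I+PD_cR_c^{-1}D_c^\top)^{-1}P(C-D_cR_c^{-1}B_c^\top P)$. Put $K_{1i}:=R_i^{-1}(B_{1i}^\top P+D_{1i}^\top\Lambda)$, $K_{2ij}:=R_{1ij}^{-1}(B_{2ij}^\top P+D_{2ij}^\top\Lambda)$, $K_{3ji}:=\bar R_{1ji}^{-1}(B_{3ji}^\top P+D_{3ji}^\top\Lambda)$. The team-optimal trajectory $\bar x$ is the state under $u^*_{1i}=-K_{1i}\bar x$, $u^*_{2ij}=-K_{2ij}\bar x$, $u^*_{3ji}=-K_{3ji}\bar x$, $v^*=\gamma^{-2}E^\top P\bar x$, with $\bar x(0)=x_0$; $u^*_{ci}$ is the corresponding stacked vector. Level 2 game for given continuous $\eta_{1ij}(t)\in\mathbb R^{m_{1i}\times m_{2ij}}$, $\zeta_{1ij}(t)\in\mathbb R^{m_{1i}\times m_{3ji}}$. Set $\xi_{1ij}:=-\frac13K_{1i}+\eta_{1ij}K_{2ij}+\zeta_{1ij}K_{3ji}$. Level 1 announces $u_{1i}=\Gamma_{1i}=\sum_j\xi_{1ij}x+\sum_j\eta_{1ij}u_{2ij}+\sum_j\zeta_{1ij}u_{3ji}$,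 and $v=\gamma^{-2}E^\top Px$. Substituting into the state equation and $J^2_i$ gives $$dx=\Big[\bar Ax+\sum_i\bar B_{ci}u_{ci}\Big]dt+\Big[\bar Cx+\sum_i\bar D_{ci}u_{ci}\Big]dW,\quad x(0)=x_0,$$ $$\bar J^2_i(u_{c1},u_{c2};x_0)=\mathbb E\Big\{\int_0^T[\langle\bar Q_{2i}x,x\rangle+2\langle x,S_{2i}u_{ci}\rangle+\langle R_{ci}u_{ci},u_{ci}\rangle]dt+\langle G_{2i}x(T),x(T)\rangle\Big\},$$ where, with $N_i:=[\eta_{1i1},\eta_{1i2},\eta_{1i3},\zeta_{1i1},\zeta_{1i2},\zeta_{1i3}]$ and $\xi_i:=\sum_j\xi_{1ij}$: $\bar A=A+\gamma^{-2}EE^\top P+\sum_iB_{1i}\xi_i$, $\bar C=C+\sum_iD_{1i}\xi_i$, $\bar B_{ci}=[B_{2i1},B_{2i2},B_{2i3},B_{31i},B_{32i},B_{33i}]+B_{1i}N_i$, $\bar D_{ci}=[D_{2i1},D_{2i2},D_{2i3},D_{31i},D_{32i},D_{33i}]+D_{1i}N_i$, $\bar Q_{2i}=Q_{2i}+\xi_i^\top R_{2i}\xi_i$, $S_{2i}=\xi_i^\top R_{2i}N_i$, $R_{ci}=\mathrm{blockdiag}(R_{2i1},R_{2i2},R_{2i3},\bar R_{21i},\bar R_{22i},\bar R_{23i})+N_i^\top R_{2i}N_i$. Open-loop Nash equilibria of Level 2 are pairs of square-integrable adapted $(u^+_{c1},u^+_{c2})$ at which neither player $i$ can decrease $\bar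 J^2_i$ by changing $u_{ci}$ alone. (A3) $R_{ci}\gg0$. (A4) For each $i$ there is $\delta>0$ with $J_i'(g)\ge\delta\,\mathbb E\int_0^T|g|^2dt$ for all square-integrable adapted $g$, where $J_i'(g)=\mathbb E\{\int_0^T[\langle\bar Q_{2i}z,z\rangle+2\langle z,S_{2i}g\rangle+\langle R_{ci}g,g\rangle]dt+\langle G_{2i}z(T),z(T)\rangle\}$ and $dz=[\bar Az+\bar B_{ci}g]dt+[\bar Cz+\bar D_{ci}g]dW$, $z(0)=0$. Incentive strategy set of Level 1: $\eta^*_{1ij},\zeta^*_{1ij}$ denote fixed continuous parameters (with $\xi^*_{1ij}=-\frac13K_{1i}+\eta^*_{1ij}K_{2ij}+\zeta^*_{1ij}K_{3ji}$ and corresponding strategies $\Gamma^*_{1i}$) such that the resulting Level 2 game has an open-loop Nash equilibrium with $u^+_{ci}=u^*_{ci}$, $i=1,2$; (A3), (A4) are imposed for these parameters. Level 3 game for given continuous $\rho_{2ij}(t)\in\mathbb R^{m_{2ij}\times m_{3ji}}$. Set $\theta_{2ij}:=-K_{2ij}+\rho_{2ij}K_{3ji}$. Level 2 announces $u_{2ij}=\theta_{2ij}x+\rho_{2ij}u_{3ji}$, Level 1 uses $\Gamma^*_{1i}$, and $v=\gamma^{-2}E^\top Px$. Substitution into the state equation and $J^3_j$ gives $$dx=\Big[\hat Ax+\sum_j\hat B_{3j}u_{3j}\Big]dt+\Big[\hat Cx+\sum_j\hat D_{3j}u_{3j}\Big]dW,\quad x(0)=x_0,$$ $$\bar J^3_j(u_{31},u_{32},u_{33};x_0)=\mathbb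 E\Big\{\int_0^T[\langle\hat Q_{3j}x,x\rangle+2\langle x,S_{3j}u_{3j}\rangle+\langle R_{3j}u_{3j},u_{3j}\rangle]dt+\langle G_{3j}x(T),x(T)\rangle\Big\},$$ with $\hat A=A+\gamma^{-2}EE^\top P+\sum_{i,j}B_{1i}(\xi^*_{1ij}+\eta^*_{1ij}\theta_{2ij})+\sum_{i,j}B_{2ij}\theta_{2ij}$, $\hat C=C+\sum_{i,j}D_{1i}(\xi^*_{1ij}+\eta^*_{1ij}\theta_{2ij})+\sum_{i,j}D_{2ij}\theta_{2ij}$, $\hat B_{3ji}=B_{1i}(\eta^*_{1ij}\rho_{2ij}+\zeta^*_{1ij})+B_{2ij}\rho_{2ij}+B_{3ji}$, $\hat D_{3ji}=D_{1i}(\eta^*_{1ij}\rho_{2ij}+\zeta^*_{1ij})+D_{2ij}\rho_{2ij}+D_{3ji}$, $\hat B_{3j}=(\hat B_{3j1},\hat B_{3j2})$, $\hat D_{3j}=(\hat D_{3j1},\hat D_{3j2})$, $\hat Q_{3j}=Q_{3j}+\sum_i\theta_{2ij}^\top R_{3ij}\theta_{2ij}$, $S_{3j}=(\theta_{21j}^\top R_{31j}\rho_{21j},\ \theta_{22j}^\top R_{32j}\rho_{22j})$, $R_{3j}=\mathrm{blockdiag}(\bar R_{3j1}+\rho_{21j}^\top R_{31j}\rho_{21j},\ \bar R_{3j2}+\rho_{22j}^\top R_{32j}\rho_{22j})$. A triple $(\bar u_{31},\bar u_{32},\bar u_{33})$ of square-integrable adapted controls is an open-loop Nash equilibrium of Level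 3 if for each $j$, $\bar J^3_j$ at the triple is $\le$ $\bar J^3_j$ when $\bar u_{3j}$ is replaced by any square-integrable adapted $u_{3j}$. (A5) For each $j$ there is $\delta>0$ with $J_j''(h)\ge\delta\,\mathbb E\int_0^T|h|^2dt$ for all square-integrable adapted $h$, where $J_j''(h)=\mathbb E\{\int_0^T[\langle\hat Q_{3j}z,z\rangle+2\langle z,S_{3j}h\rangle+\langle R_{3j}h,h\rangle]dt+\langle G_{3j}z(T),z(T)\rangle\}$ and $dz=[\hat Az+\hat B_{3j}h]dt+[\hat Cz+\hat D_{3j}h]dW$, $z(0)=0$. Block matrices: $\mathbf B_1$, $\mathbf B_2$, $\mathbf D_1$, $\mathbf D_2$ are the $1\times3$ block rows with $j$-th blocks $-\hat B_{3j}R_{3j}^{-1}\hat B_{3j}^\top$, $-\hat B_{3j}R_{3j}^{-1}\hat D_{3j}^\top$, $-\hat D_{3j}R_{3j}^{-1}\hat B_{3j}^\top$, $-\hat D_{3j}R_{3j}^{-1}\hat D_{3j}^\top$ respectively; $\mathbf A=\mathrm{blockdiag}_j(\hat A-\hat B_{3j}R_{3j}^{-1}S_{3j}^\top)$, $\mathbf C=\mathrm{blockdiag}_j(\hat C-\hat D_{3j}R_{3j}^{-1}S_{3j}^\top)$, $\mathbf Q=\mathrm{col}_j(\hat Q_{3j}-S_{3j}R_{3j}^{-1}S_{3j}^\top)$, $\mathbf G=\mathrm{col}(G_{31},G_{32},G_{33})$. $\Phi$ takes values in $\mathbb R^{3n\times n}$. "$\gamma$ sufficiently large" means $\gamma\ge\gamma_0$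 for some $\gamma_0>0$ depending only on the coefficients of the state equation and of $J^1$ and on $T$. *)

theory Defs
  imports "HOL-Probability.Probability" "Jordan_Normal_Form.Matrix"
    "Jordan_Normal_Form.Gauss_Jordan_Elimination"
begin

(* The dimensions n, n_v, m_{1i}, m_{2ij}, m_{3ji} differ from player to player, so matrices and
   vectors are those of Jordan_Normal_Form, whose dimensions are values.  These types carry no
   topology; measurability, continuity and integrals are therefore taken entrywise. *)

unbundle no vec_syntax
hide_type (open) Finite_Cartesian_Product.vec
hide_const (open) Finite_Cartesian_Product.vec Finite_Cartesian_Product.row
  Finite_Cartesian_Product.rows Finite_Cartesian_Product.mat

type_synonym rvec = "real Matrix.vec"
type_synonym rmat = "real Matrix.mat"
type_synonym mfun = "real \<Rightarrow> rmat"
type_synonym 'a rproc = "real \<Rightarrow> 'a \<Rightarrow> real"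
type_synonym 'a vproc = "real \<Rightarrow> 'a \<Rightarrow> rvec"


section \<open>Matrices\<close>

definition minv :: "rmat \<Rightarrow> rmat" where
  "minv X = the (mat_inverse X)"

definition hcat :: "nat \<Rightarrow> rmat list \<Rightarrow> rmat" where
  "hcat r Ms = mat_of_cols r (concat (map Matrix.cols Ms))"

definition vcat :: "nat \<Rightarrow> rmat list \<Rightarrow> rmat" where
  "vcat c Ms = mat_of_rows c (concat (map Matrix.rows Ms))"

definition colvec :: "rvec list \<Rightarrow> rvec" where
  "colvec vs = foldr (@\<^sub>v) vs (0\<^sub>v 0)"

definition msum :: "nat \<Rightarrow> nat \<Rightarrow> rmat list \<Rightarrow> rmat" where
  "msum r c Ms = foldr (+) Ms (0\<^sub>m r c)"

definition vsum :: "nat \<Rightarrow> rvec list \<Rightarrow> rvec" where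
  "vsum r vs = foldr (+) vs (0\<^sub>v r)"

definition psd_mat :: "nat \<Rightarrow> rmat \<Rightarrow> bool" where
  "psd_mat d X \<longleftrightarrow> (\<forall>v\<in>carrier_vec d. 0 \<le> v \<bullet> (X *\<^sub>v v))"

definition psd_on :: "real \<Rightarrow> nat \<Rightarrow> mfun \<Rightarrow> bool" where
  "psd_on T d X \<longleftrightarrow> (\<forall>t\<in>{0..T}. psd_mat d (X t))"

definition unif_pos_def :: "real \<Rightarrow> nat \<Rightarrow> mfun \<Rightarrow> bool" where
  "unif_pos_def T d X \<longleftrightarrow>
     (\<exists>\<delta>>0. \<forall>t\<in>{0..T}. \<forall>v\<in>carrier_vec d. \<delta> * (v \<bullet> v) \<le> v \<bullet> (X t *\<^sub>v v))"

definition bounded_coeff :: "real \<Rightarrow> nat \<Rightarrow> nat \<Rightarrow> mfun \<Rightarrow> bool" where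
  "bounded_coeff T r c X \<longleftrightarrow>
     (\<forall>t\<in>{0..T}. X t \<in> carrier_mat r c) \<and>
     (\<forall>a<r. \<forall>b<c. (\<lambda>t. X t $$ (a, b)) \<in> borel_measurable (restrict_space borel {0..T})) \<and>
     (\<exists>K. \<forall>t\<in>{0..T}. \<forall>a<r. \<forall>b<c. \<bar>X t $$ (a, b)\<bar> \<le> K)"

definition sym_weight :: "real \<Rightarrow> nat \<Rightarrow> mfun \<Rightarrow> bool" where
  "sym_weight T d X \<longleftrightarrow> bounded_coeff T d d X \<and> (\<forall>t\<in>{0..T}. (X t)\<^sup>T = X t)"

definition sym_terminal :: "nat \<Rightarrow> rmat \<Rightarrow> bool" where
  "sym_terminal d X \<longleftrightarrow> X \<in> carrier_mat d d \<and> X\<^sup>T = X"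

definition continuous_mfun :: "real \<Rightarrow> nat \<Rightarrow> nat \<Rightarrow> mfun \<Rightarrow> bool" where
  "continuous_mfun T r c X \<longleftrightarrow>
     (\<forall>t\<in>{0..T}. X t \<in> carrier_mat r c) \<and>
     (\<forall>a<r. \<forall>b<c. continuous_on {0..T} (\<lambda>t. X t $$ (a, b)))"

definition has_bounded_inverse :: "real \<Rightarrow> nat \<Rightarrow> mfun \<Rightarrow> bool" where
  "has_bounded_inverse T d X \<longleftrightarrow>
     (\<forall>t\<in>{0..T}. X t \<in> carrier_mat d d \<and> invertible_mat (X t)) \<and>
     (\<exists>K. \<forall>t\<in>{0..T}. \<forall>a<d. \<forall>b<d. \<bar>minv (X t) $$ (a, b)\<bar> \<le> K)"

(* Solution on [0,T] of X' + f = 0, X(T) = G.  The coefficients are only bounded and measurable, so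
   this is the absolutely continuous (Caratheodory) solution, written as an integral equation.
   In the Riccati equations below f t is an expression in X t. *)
definition terminal_ode :: "real \<Rightarrow> nat \<Rightarrow> nat \<Rightarrow> mfun \<Rightarrow> rmat \<Rightarrow> mfun \<Rightarrow> bool" where
  "terminal_ode T r c f G X \<longleftrightarrow>
     (\<forall>t\<in>{0..T}. X t \<in> carrier_mat r c) \<and>
     (\<forall>a<r. \<forall>b<c. set_integrable lborel {0..T} (\<lambda>s. f s $$ (a, b)) \<and>
        (\<forall>t\<in>{0..T}. X t $$ (a, b) = G $$ (a, b) + (LINT s:{t..T}|lborel. f s $$ (a, b))))"


section \<open>Brownian motion and the Ito integral\<close>

definition aug_filtration :: "'a measure \<Rightarrow> 'a rproc \<Rightarrow> real \<Rightarrow> 'a measure" where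
  "aug_filtration M W t = sigma (space M)
     ({W s -` B \<inter> space M | s B. s \<in> {0..t} \<and> B \<in> sets borel} \<union> null_sets M)"

definition brownian_basis :: "'a measure \<Rightarrow> real \<Rightarrow> 'a rproc \<Rightarrow> bool" where
  "brownian_basis M T W \<longleftrightarrow>
     prob_space M \<and> complete_measure M \<and>
     (\<forall>t\<in>{0..T}. W t \<in> borel_measurable M) \<and>
     (AE \<omega> in M. W 0 \<omega> = 0) \<and>
     (AE \<omega> in M. continuous_on {0..T} (\<lambda>t. W t \<omega>)) \<and>
     (\<forall>s t. 0 \<le> s \<longrightarrow> s < t \<longrightarrow> t \<le> T \<longrightarrow>
        distributed M lborel (\<lambda>\<omega>. W t \<omega> - W s \<omega>) (normal_density 0 (sqrt (t - s))) \<and>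
        prob_space.indep_set M (sets (aug_filtration M W s))
          (sets (vimage_algebra (space M) (\<lambda>\<omega>. W t \<omega> - W s \<omega>) borel)))"

definition progressive :: "'a measure \<Rightarrow> real \<Rightarrow> 'a rproc \<Rightarrow> 'a rproc \<Rightarrow> bool" where
  "progressive M T W \<phi> \<longleftrightarrow>
     (\<forall>t\<in>{0..T}. (\<lambda>(s, \<omega>). \<phi> s \<omega>) \<in>
        borel_measurable (restrict_space borel {0..t} \<Otimes>\<^sub>M aug_filtration M W t))"

definition L2F :: "'a measure \<Rightarrow> real \<Rightarrow> 'a rproc \<Rightarrow> nat \<Rightarrow> 'a vproc \<Rightarrow> bool" where
  "L2F M T W d \<phi> \<longleftrightarrow>
     (\<forall>t\<in>{0..T}. \<forall>\<omega>\<in>space M. \<phi> t \<omega> \<in> carrier_vec d) \<and>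
     (\<forall>k<d. progressive M T W (\<lambda>t \<omega>. \<phi> t \<omega> $ k)) \<and>
     (\<integral>\<^sup>+\<omega>. (\<integral>\<^sup>+s\<in>{0..T}. ennreal (\<phi> s \<omega> \<bullet> \<phi> s \<omega>) \<partial>lborel) \<partial>M) < \<infinity>"

(* Equality in L2F: almost everywhere with respect to dt x dP on [0,T] x Omega. *)
definition proc_eq :: "'a measure \<Rightarrow> real \<Rightarrow> 'a vproc \<Rightarrow> 'a vproc \<Rightarrow> bool" where
  "proc_eq M T \<phi> \<psi> \<longleftrightarrow>
     (AE (t, \<omega>) in restrict_space lborel {0..T} \<Otimes>\<^sub>M M. \<phi> t \<omega> = \<psi> t \<omega>)"

(* Simple processes sum_{k<N} xi_k 1_{(tau_k, tau_{k+1}]} with xi_k bounded and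
   F_{tau_k}-measurable. *)
definition simple_data ::
  "'a measure \<Rightarrow> real \<Rightarrow> 'a rproc \<Rightarrow> nat \<Rightarrow> (nat \<Rightarrow> real) \<Rightarrow> (nat \<Rightarrow> 'a \<Rightarrow> real) \<Rightarrow> bool" where
  "simple_data M T W N \<tau> \<xi> \<longleftrightarrow>
     (\<forall>k\<le>N. \<tau> k \<in> {0..T}) \<and> (\<forall>k<N. \<tau> k \<le> \<tau> (Suc k)) \<and>
     (\<forall>k<N. \<xi> k \<in> borel_measurable (aug_filtration M W (\<tau> k)) \<and>
        (\<exists>K. \<forall>\<omega>\<in>space M. \<bar>\<xi> k \<omega>\<bar> \<le> K))"

definition simple_proc :: "nat \<Rightarrow> (nat \<Rightarrow> real) \<Rightarrow> (nat \<Rightarrow> 'a \<Rightarrow> real) \<Rightarrow> 'a rproc" where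
  "simple_proc N \<tau> \<xi> s \<omega> = (\<Sum>k<N. \<xi> k \<omega> * indicator {\<tau> k<..\<tau> (Suc k)} s)"

definition simple_integral_W ::
  "'a rproc \<Rightarrow> nat \<Rightarrow> (nat \<Rightarrow> real) \<Rightarrow> (nat \<Rightarrow> 'a \<Rightarrow> real) \<Rightarrow> real \<Rightarrow> 'a \<Rightarrow> real" where
  "simple_integral_W W N \<tau> \<xi> t \<omega> =
     (\<Sum>k<N. \<xi> k \<omega> * (W (min t (\<tau> (Suc k))) \<omega> - W (min t (\<tau> k)) \<omega>))"

(* J is (a version of) the Ito integral of phi over [0,t]: the L^2(P)-limit of the integrals of
   simple processes converging to phi in L^2(dt x dP) on [0,t]. *)
definition has_ito_integral ::
  "'a measure \<Rightarrow> real \<Rightarrow> 'a rproc \<Rightarrow> 'a rproc \<Rightarrow> real \<Rightarrow> ('a \<Rightarrow> real) \<Rightarrow> bool" where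
  "has_ito_integral M T W \<phi> t J \<longleftrightarrow>
     progressive M T W \<phi> \<and> J \<in> borel_measurable M \<and>
     (\<exists>N \<tau> \<xi>. (\<forall>r::nat. simple_data M T W (N r) (\<tau> r) (\<xi> r)) \<and>
        (\<lambda>r. \<integral>\<^sup>+\<omega>. (\<integral>\<^sup>+s\<in>{0..t}.
            ennreal ((simple_proc (N r) (\<tau> r) (\<xi> r) s \<omega> - \<phi> s \<omega>)\<^sup>2) \<partial>lborel) \<partial>M)
          \<longlonglongrightarrow> 0 \<and>
        (\<lambda>r. \<integral>\<^sup>+\<omega>.
            ennreal ((simple_integral_W W (N r) (\<tau> r) (\<xi> r) t \<omega> - J \<omega>)\<^sup>2) \<partial>M)
          \<longlonglongrightarrow> 0)"

(* X is a continuous process in L2F with dX = b dt + sigma dW on [0,T], componentwise. *)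
definition ito_diff ::
  "'a measure \<Rightarrow> real \<Rightarrow> 'a rproc \<Rightarrow> nat \<Rightarrow> 'a vproc \<Rightarrow> 'a vproc \<Rightarrow> 'a vproc \<Rightarrow> bool" where
  "ito_diff M T W d b \<sigma> X \<longleftrightarrow>
     L2F M T W d X \<and>
     (\<forall>k<d. (AE \<omega> in M. continuous_on {0..T} (\<lambda>t. X t \<omega> $ k)) \<and>
        (\<forall>t\<in>{0..T}. \<exists>J. has_ito_integral M T W (\<lambda>s \<omega>. \<sigma> s \<omega> $ k) t J \<and>
           (AE \<omega> in M. set_integrable lborel {0..t} (\<lambda>s. b s \<omega> $ k) \<and>
              X t \<omega> $ k = X 0 \<omega> $ k + (LINT s:{0..t}|lborel. b s \<omega> $ k) + J \<omega>)))"

definition ito_sde ::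
  "'a measure \<Rightarrow> real \<Rightarrow> 'a rproc \<Rightarrow> nat \<Rightarrow> rvec \<Rightarrow> 'a vproc \<Rightarrow> 'a vproc \<Rightarrow> 'a vproc \<Rightarrow> bool" where
  "ito_sde M T W d x0 b \<sigma> X \<longleftrightarrow>
     ito_diff M T W d b \<sigma> X \<and> (AE \<omega> in M. X 0 \<omega> = x0)"


section \<open>Linear-quadratic games and open-loop Nash equilibria\<close>

record lq_game =
  lq_players :: "nat list"
  lq_hor :: real
  lq_dim :: nat
  lq_udim :: "nat \<Rightarrow> nat"
  lq_A :: mfun
  lq_C :: mfun
  lq_B :: "nat \<Rightarrow> mfun"
  lq_D :: "nat \<Rightarrow> mfun"
  lq_Q :: "nat \<Rightarrow> mfun"
  lq_S :: "nat \<Rightarrow> mfun"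
  lq_R :: "nat \<Rightarrow> mfun"
  lq_G :: "nat \<Rightarrow> rmat"

(* State driven by the controls of the players listed in ks, the other controls being absent. *)
definition lq_state ::
  "'a measure \<Rightarrow> 'a rproc \<Rightarrow> lq_game \<Rightarrow> nat list \<Rightarrow> rvec \<Rightarrow> (nat \<Rightarrow> 'a vproc) \<Rightarrow> 'a vproc \<Rightarrow> bool" where
  "lq_state M W \<G> ks x0 u x \<longleftrightarrow>
     ito_sde M (lq_hor \<G>) W (lq_dim \<G>) x0
       (\<lambda>t \<omega>. lq_A \<G> t *\<^sub>v x t \<omega> + vsum (lq_dim \<G>) [lq_B \<G> k t *\<^sub>v u k t \<omega>. k \<leftarrow> ks])
       (\<lambda>t \<omega>. lq_C \<G> t *\<^sub>v x t \<omega> + vsum (lq_dim \<G>) [lq_D \<G> k t *\<^sub>v u k t \<omega>. k \<leftarrow> ks]) x"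

definition lq_cost :: "'a measure \<Rightarrow> lq_game \<Rightarrow> nat \<Rightarrow> 'a vproc \<Rightarrow> 'a vproc \<Rightarrow> real" where
  "lq_cost M \<G> k x w =
     (LINT \<omega>|M. (LINT t:{0..lq_hor \<G>}|lborel.
          (lq_Q \<G> k t *\<^sub>v x t \<omega>) \<bullet> x t \<omega> + 2 * (x t \<omega> \<bullet> (lq_S \<G> k t *\<^sub>v w t \<omega>))
          + (lq_R \<G> k t *\<^sub>v w t \<omega>) \<bullet> w t \<omega>)
        + (lq_G \<G> k *\<^sub>v x (lq_hor \<G>) \<omega>) \<bullet> x (lq_hor \<G>) \<omega>)"

definition open_loop_nash ::
  "'a measure \<Rightarrow> 'a rproc \<Rightarrow> lq_game \<Rightarrow> rvec \<Rightarrow> (nat \<Rightarrow> 'a vproc) \<Rightarrow> bool" where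
  "open_loop_nash M W \<G> x0 u \<longleftrightarrow>
     (\<forall>k\<in>set (lq_players \<G>). L2F M (lq_hor \<G>) W (lq_udim \<G> k) (u k)) \<and>
     (\<forall>k\<in>set (lq_players \<G>). \<forall>w x x'.
        L2F M (lq_hor \<G>) W (lq_udim \<G> k) w \<longrightarrow>
        lq_state M W \<G> (lq_players \<G>) x0 u x \<longrightarrow>
        lq_state M W \<G> (lq_players \<G>) x0 (u(k := w)) x' \<longrightarrow>
        lq_cost M \<G> k x (u k) \<le> lq_cost M \<G> k x' w)"

(* Uniform convexity of player k's cost in its own control: only player k acts, from state 0. *)
definition unif_convex :: "'a measure \<Rightarrow> 'a rproc \<Rightarrow> lq_game \<Rightarrow> nat \<Rightarrow> bool" where
  "unif_convex M W \<G> k \<longleftrightarrow>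
     (\<exists>\<delta>>0. \<forall>h z. L2F M (lq_hor \<G>) W (lq_udim \<G> k) h \<longrightarrow>
        lq_state M W \<G> [k] (0\<^sub>v (lq_dim \<G>)) (\<lambda>_. h) z \<longrightarrow>
        \<delta> * (LINT \<omega>|M. (LINT t:{0..lq_hor \<G>}|lborel. h t \<omega> \<bullet> h t \<omega>)) \<le> lq_cost M \<G> k z h)"


section \<open>The three-level game\<close>

abbreviation I2 :: "nat list" where "I2 \<equiv> [1, 2]"
abbreviation I3 :: "nat list" where "I3 \<equiv> [1, 2, 3]"

(* Horizon, coefficients of the state equation and weights of J^1.  The argument order is that of
   the subscripts: i j for Level 2 objects, j i for Level 3 objects. *)
record leader_data =
  hor :: real
  dx :: nat
  dv :: nat
  d1 :: "nat \<Rightarrow> nat"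
  d2 :: "nat \<Rightarrow> nat \<Rightarrow> nat"
  d3 :: "nat \<Rightarrow> nat \<Rightarrow> nat"
  cA :: mfun
  cB1 :: "nat \<Rightarrow> mfun"
  cB2 :: "nat \<Rightarrow> nat \<Rightarrow> mfun"
  cB3 :: "nat \<Rightarrow> nat \<Rightarrow> mfun"
  cE :: mfun
  cC :: mfun
  cD1 :: "nat \<Rightarrow> mfun"
  cD2 :: "nat \<Rightarrow> nat \<Rightarrow> mfun"
  cD3 :: "nat \<Rightarrow> nat \<Rightarrow> mfun"
  wQ1 :: mfun                               (* Q_1 *)
  wR1 :: "nat \<Rightarrow> mfun"                       (* R_i *)
  wR12 :: "nat \<Rightarrow> nat \<Rightarrow> mfun"               (* R_{1ij} *)
  wRb1 :: "nat \<Rightarrow> nat \<Rightarrow> mfun"               (* \bar R_{1ji} *)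
  wG1 :: rmat                               (* G_1 *)

record game = leader_data +
  wQ2 :: "nat \<Rightarrow> mfun"                       (* Q_{2i} *)
  wR2 :: "nat \<Rightarrow> mfun"                       (* R_{2i} *)
  wR22 :: "nat \<Rightarrow> nat \<Rightarrow> mfun"               (* R_{2ij} *)
  wRb2 :: "nat \<Rightarrow> nat \<Rightarrow> mfun"               (* \bar R_{2ji} *)
  wG2 :: "nat \<Rightarrow> rmat"                       (* G_{2i} *)
  wQ3 :: "nat \<Rightarrow> mfun"                       (* Q_{3j} *)
  wR3 :: "nat \<Rightarrow> nat \<Rightarrow> mfun"                (* R_{3ij} *)
  wRb3 :: "nat \<Rightarrow> nat \<Rightarrow> mfun"               (* \bar R_{3ji} *)
  wG3 :: "nat \<Rightarrow> rmat"                       (* G_{3j} *)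
  xinit :: rvec
  gam :: real
  teamP :: mfun                             (* P *)
  eta :: "nat \<Rightarrow> nat \<Rightarrow> mfun"                (* \eta^*_{1ij} *)
  zeta :: "nat \<Rightarrow> nat \<Rightarrow> mfun"               (* \zeta^*_{1ij} *)
  rho :: "nat \<Rightarrow> nat \<Rightarrow> mfun"                (* \rho_{2ij} *)

definition well_formed :: "game \<Rightarrow> bool" where
  "well_formed g \<longleftrightarrow> 0 < hor g \<and> xinit g \<in> carrier_vec (dx g) \<and>
     bounded_coeff (hor g) (dx g) (dx g) (cA g) \<and>
     bounded_coeff (hor g) (dx g) (dx g) (cC g) \<and>
     bounded_coeff (hor g) (dx g) (dv g) (cE g) \<and>
     sym_weight (hor g) (dx g) (wQ1 g) \<and> sym_terminal (dx g) (wG1 g) \<and>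
     (\<forall>i\<in>{1,2}.
        bounded_coeff (hor g) (dx g) (d1 g i) (cB1 g i) \<and>
        bounded_coeff (hor g) (dx g) (d1 g i) (cD1 g i) \<and>
        sym_weight (hor g) (d1 g i) (wR1 g i) \<and>
        sym_weight (hor g) (dx g) (wQ2 g i) \<and> sym_terminal (dx g) (wG2 g i) \<and>
        sym_weight (hor g) (d1 g i) (wR2 g i)) \<and>
     (\<forall>j\<in>{1,2,3}. sym_weight (hor g) (dx g) (wQ3 g j) \<and> sym_terminal (dx g) (wG3 g j)) \<and>
     (\<forall>i\<in>{1,2}. \<forall>j\<in>{1,2,3}.
        bounded_coeff (hor g) (dx g) (d2 g i j) (cB2 g i j) \<and>
        bounded_coeff (hor g) (dx g) (d2 g i j) (cD2 g i j) \<and>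
        bounded_coeff (hor g) (dx g) (d3 g j i) (cB3 g j i) \<and>
        bounded_coeff (hor g) (dx g) (d3 g j i) (cD3 g j i) \<and>
        sym_weight (hor g) (d2 g i j) (wR12 g i j) \<and>
        sym_weight (hor g) (d3 g j i) (wRb1 g j i) \<and>
        sym_weight (hor g) (d2 g i j) (wR22 g i j) \<and>
        sym_weight (hor g) (d3 g j i) (wRb2 g j i) \<and>
        sym_weight (hor g) (d2 g i j) (wR3 g i j) \<and>
        sym_weight (hor g) (d3 g j i) (wRb3 g j i) \<and>
        continuous_mfun (hor g) (d1 g i) (d2 g i j) (eta g i j) \<and>
        continuous_mfun (hor g) (d1 g i) (d3 g j i) (zeta g i j) \<and>
        continuous_mfun (hor g) (d2 g i j) (d3 g j i) (rho g i j))"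

definition state_weights_psd :: "game \<Rightarrow> bool" where
  "state_weights_psd g \<longleftrightarrow>
     psd_on (hor g) (dx g) (wQ1 g) \<and> psd_mat (dx g) (wG1 g) \<and>
     (\<forall>i\<in>{1,2}. psd_on (hor g) (dx g) (wQ2 g i) \<and> psd_mat (dx g) (wG2 g i)) \<and>
     (\<forall>j\<in>{1,2,3}. psd_on (hor g) (dx g) (wQ3 g j) \<and> psd_mat (dx g) (wG3 g j))"

definition control_weights_pos :: "game \<Rightarrow> bool" where
  "control_weights_pos g \<longleftrightarrow>
     (\<forall>i\<in>{1,2}. unif_pos_def (hor g) (d1 g i) (wR1 g i) \<and>
        unif_pos_def (hor g) (d1 g i) (wR2 g i)) \<and>
     (\<forall>i\<in>{1,2}. \<forall>j\<in>{1,2,3}.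
        unif_pos_def (hor g) (d2 g i j) (wR12 g i j) \<and>
        unif_pos_def (hor g) (d3 g j i) (wRb1 g j i) \<and>
        unif_pos_def (hor g) (d2 g i j) (wR22 g i j) \<and>
        unif_pos_def (hor g) (d3 g j i) (wRb2 g j i) \<and>
        unif_pos_def (hor g) (d2 g i j) (wR3 g i j) \<and>
        unif_pos_def (hor g) (d3 g j i) (wRb3 g j i))"

definition state_eq ::
  "'a measure \<Rightarrow> 'a rproc \<Rightarrow> game \<Rightarrow> (nat \<Rightarrow> 'a vproc) \<Rightarrow> (nat \<Rightarrow> nat \<Rightarrow> 'a vproc) \<Rightarrow>
   (nat \<Rightarrow> nat \<Rightarrow> 'a vproc) \<Rightarrow> 'a vproc \<Rightarrow> 'a vproc \<Rightarrow> bool" where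
  "state_eq M W g u1 u2 u3 v x \<longleftrightarrow>
     ito_sde M (hor g) W (dx g) (xinit g)
       (\<lambda>t \<omega>. cA g t *\<^sub>v x t \<omega>
          + vsum (dx g) [cB1 g i t *\<^sub>v u1 i t \<omega>. i \<leftarrow> I2]
          + vsum (dx g) [cB2 g i j t *\<^sub>v u2 i j t \<omega>. i \<leftarrow> I2, j \<leftarrow> I3]
          + vsum (dx g) [cB3 g j i t *\<^sub>v u3 j i t \<omega>. j \<leftarrow> I3, i \<leftarrow> I2]
          + cE g t *\<^sub>v v t \<omega>)
       (\<lambda>t \<omega>. cC g t *\<^sub>v x t \<omega>
          + vsum (dx g) [cD1 g i t *\<^sub>v u1 i t \<omega>. i \<leftarrow> I2]
          + vsum (dx g) [cD2 g i j t *\<^sub>v u2 i j t \<omega>. i \<leftarrow> I2, j \<leftarrow> I3]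
          + vsum (dx g) [cD3 g j i t *\<^sub>v u3 j i t \<omega>. j \<leftarrow> I3, i \<leftarrow> I2]) x"


subsection \<open>Team-optimal strategy\<close>

definition Bc :: "game \<Rightarrow> mfun" where
  "Bc g t = hcat (dx g) ([cB1 g i t. i \<leftarrow> I2] @ [cB2 g i j t. i \<leftarrow> I2, j \<leftarrow> I3]
     @ [cB3 g j i t. j \<leftarrow> I3, i \<leftarrow> I2])"

definition Dc :: "game \<Rightarrow> mfun" where
  "Dc g t = hcat (dx g) ([cD1 g i t. i \<leftarrow> I2] @ [cD2 g i j t. i \<leftarrow> I2, j \<leftarrow> I3]
     @ [cD3 g j i t. j \<leftarrow> I3, i \<leftarrow> I2])"

definition Rc :: "game \<Rightarrow> mfun" where
  "Rc g t = diag_block_mat ([wR1 g i t. i \<leftarrow> I2] @ [wR12 g i j t. i \<leftarrow> I2, j \<leftarrow> I3]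
     @ [wRb1 g j i t. j \<leftarrow> I3, i \<leftarrow> I2])"

definition teamM :: "game \<Rightarrow> mfun" where
  "teamM g t = 1\<^sub>m (dx g) + teamP g t * Dc g t * minv (Rc g t) * (Dc g t)\<^sup>T"

definition teamC :: "game \<Rightarrow> mfun" where
  "teamC g t = cC g t - Dc g t * minv (Rc g t) * (Bc g t)\<^sup>T * teamP g t"

definition Lam :: "game \<Rightarrow> mfun" where
  "Lam g t = minv (teamM g t) * teamP g t * teamC g t"

definition team_rhs :: "game \<Rightarrow> mfun" where
  "team_rhs g t = teamP g t * cA g t + (cA g t)\<^sup>T * teamP g t
     - teamP g t * (Bc g t * minv (Rc g t) * (Bc g t)\<^sup>T
         - (1 / (gam g)\<^sup>2) \<cdot>\<^sub>m (cE g t * (cE g t)\<^sup>T)) * teamP g t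
     + wQ1 g t
     + (teamC g t)\<^sup>T * minv (teamM g t) * teamP g t * teamC g t"

definition team_riccati :: "game \<Rightarrow> bool" where
  "team_riccati g \<longleftrightarrow>
     terminal_ode (hor g) (dx g) (dx g) (team_rhs g) (wG1 g) (teamP g) \<and>
     has_bounded_inverse (hor g) (dx g) (teamM g)"

definition K1 :: "game \<Rightarrow> nat \<Rightarrow> mfun" where
  "K1 g i t = minv (wR1 g i t) * ((cB1 g i t)\<^sup>T * teamP g t + (cD1 g i t)\<^sup>T * Lam g t)"

definition K2 :: "game \<Rightarrow> nat \<Rightarrow> nat \<Rightarrow> mfun" where
  "K2 g i j t = minv (wR12 g i j t) * ((cB2 g i j t)\<^sup>T * teamP g t + (cD2 g i j t)\<^sup>T * Lam g t)"

definition K3 :: "game \<Rightarrow> nat \<Rightarrow> nat \<Rightarrow> mfun" where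
  "K3 g j i t = minv (wRb1 g j i t) * ((cB3 g j i t)\<^sup>T * teamP g t + (cD3 g j i t)\<^sup>T * Lam g t)"

definition team_u1 :: "game \<Rightarrow> 'a vproc \<Rightarrow> nat \<Rightarrow> 'a vproc" where
  "team_u1 g x i t \<omega> = - (K1 g i t *\<^sub>v x t \<omega>)"

definition team_u2 :: "game \<Rightarrow> 'a vproc \<Rightarrow> nat \<Rightarrow> nat \<Rightarrow> 'a vproc" where
  "team_u2 g x i j t \<omega> = - (K2 g i j t *\<^sub>v x t \<omega>)"

definition team_u3 :: "game \<Rightarrow> 'a vproc \<Rightarrow> nat \<Rightarrow> nat \<Rightarrow> 'a vproc" where
  "team_u3 g x j i t \<omega> = - (K3 g j i t *\<^sub>v x t \<omega>)"

definition team_v :: "game \<Rightarrow> 'a vproc \<Rightarrow> 'a vproc" where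
  "team_v g x t \<omega> = ((1 / (gam g)\<^sup>2) \<cdot>\<^sub>m ((cE g t)\<^sup>T * teamP g t)) *\<^sub>v x t \<omega>"

definition team_uc :: "game \<Rightarrow> 'a vproc \<Rightarrow> nat \<Rightarrow> 'a vproc" where
  "team_uc g x i t \<omega> =
     colvec ([team_u2 g x i j t \<omega>. j \<leftarrow> I3] @ [team_u3 g x j i t \<omega>. j \<leftarrow> I3])"

definition team_trajectory :: "'a measure \<Rightarrow> 'a rproc \<Rightarrow> game \<Rightarrow> 'a vproc \<Rightarrow> bool" where
  "team_trajectory M W g x \<longleftrightarrow>
     state_eq M W g (team_u1 g x) (team_u2 g x) (team_u3 g x) (team_v g x) x"


subsection \<open>Level 2\<close>

definition xi :: "game \<Rightarrow> nat \<Rightarrow> nat \<Rightarrow> mfun" where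
  "xi g i j t = (- (1 / 3)) \<cdot>\<^sub>m K1 g i t + eta g i j t * K2 g i j t + zeta g i j t * K3 g j i t"

definition xis :: "game \<Rightarrow> nat \<Rightarrow> mfun" where
  "xis g i t = msum (d1 g i) (dx g) [xi g i j t. j \<leftarrow> I3]"

definition Nmat :: "game \<Rightarrow> nat \<Rightarrow> mfun" where
  "Nmat g i t = hcat (d1 g i) ([eta g i j t. j \<leftarrow> I3] @ [zeta g i j t. j \<leftarrow> I3])"

definition dc :: "game \<Rightarrow> nat \<Rightarrow> nat" where
  "dc g i = sum_list ([d2 g i j. j \<leftarrow> I3] @ [d3 g j i. j \<leftarrow> I3])"

definition barA :: "game \<Rightarrow> mfun" where
  "barA g t = cA g t + (1 / (gam g)\<^sup>2) \<cdot>\<^sub>m (cE g t * (cE g t)\<^sup>T * teamP g t)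
     + msum (dx g) (dx g) [cB1 g i t * xis g i t. i \<leftarrow> I2]"

definition barC :: "game \<Rightarrow> mfun" where
  "barC g t = cC g t + msum (dx g) (dx g) [cD1 g i t * xis g i t. i \<leftarrow> I2]"

definition barB :: "game \<Rightarrow> nat \<Rightarrow> mfun" where
  "barB g i t = hcat (dx g) ([cB2 g i j t. j \<leftarrow> I3] @ [cB3 g j i t. j \<leftarrow> I3])
     + cB1 g i t * Nmat g i t"

definition barD :: "game \<Rightarrow> nat \<Rightarrow> mfun" where
  "barD g i t = hcat (dx g) ([cD2 g i j t. j \<leftarrow> I3] @ [cD3 g j i t. j \<leftarrow> I3])
     + cD1 g i t * Nmat g i t"

definition barQ2 :: "game \<Rightarrow> nat \<Rightarrow> mfun" where
  "barQ2 g i t = wQ2 g i t + (xis g i t)\<^sup>T * wR2 g i t * xis g i t"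

definition S2 :: "game \<Rightarrow> nat \<Rightarrow> mfun" where
  "S2 g i t = (xis g i t)\<^sup>T * wR2 g i t * Nmat g i t"

definition Rc2 :: "game \<Rightarrow> nat \<Rightarrow> mfun" where
  "Rc2 g i t = diag_block_mat ([wR22 g i j t. j \<leftarrow> I3] @ [wRb2 g j i t. j \<leftarrow> I3])
     + (Nmat g i t)\<^sup>T * wR2 g i t * Nmat g i t"

(* The state equation and J^2_i after substituting
   u_{1i} = sum_j (xi_{1ij} x + eta_{1ij} u_{2ij} + zeta_{1ij} u_{3ji}) and v = gamma^{-2} E^T P x;
   player i controls u_{ci} = col[u_{2i1}, u_{2i2}, u_{2i3}, u_{31i}, u_{32i}, u_{33i}]. *)
definition level2_game :: "game \<Rightarrow> lq_game" where
  "level2_game g = \<lparr> lq_players = I2, lq_hor = hor g, lq_dim = dx g, lq_udim = dc g,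
     lq_A = barA g, lq_C = barC g, lq_B = barB g, lq_D = barD g,
     lq_Q = barQ2 g, lq_S = S2 g, lq_R = Rc2 g, lq_G = wG2 g \<rparr>"


subsection \<open>Level 3\<close>

definition theta :: "game \<Rightarrow> nat \<Rightarrow> nat \<Rightarrow> mfun" where
  "theta g i j t = - K2 g i j t + rho g i j t * K3 g j i t"

definition hatA :: "game \<Rightarrow> mfun" where
  "hatA g t = cA g t + (1 / (gam g)\<^sup>2) \<cdot>\<^sub>m (cE g t * (cE g t)\<^sup>T * teamP g t)
     + msum (dx g) (dx g)
         [cB1 g i t * (xi g i j t + eta g i j t * theta g i j t). i \<leftarrow> I2, j \<leftarrow> I3]
     + msum (dx g) (dx g) [cB2 g i j t * theta g i j t. i \<leftarrow> I2, j \<leftarrow> I3]"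

definition hatC :: "game \<Rightarrow> mfun" where
  "hatC g t = cC g t
     + msum (dx g) (dx g)
         [cD1 g i t * (xi g i j t + eta g i j t * theta g i j t). i \<leftarrow> I2, j \<leftarrow> I3]
     + msum (dx g) (dx g) [cD2 g i j t * theta g i j t. i \<leftarrow> I2, j \<leftarrow> I3]"

definition hatB3 :: "game \<Rightarrow> nat \<Rightarrow> mfun" where
  "hatB3 g j t = hcat (dx g)
     [cB1 g i t * (eta g i j t * rho g i j t + zeta g i j t) + cB2 g i j t * rho g i j t
        + cB3 g j i t. i \<leftarrow> I2]"

definition hatD3 :: "game \<Rightarrow> nat \<Rightarrow> mfun" where
  "hatD3 g j t = hcat (dx g)
     [cD1 g i t * (eta g i j t * rho g i j t + zeta g i j t) + cD2 g i j t * rho g i j t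
        + cD3 g j i t. i \<leftarrow> I2]"

definition hatQ3 :: "game \<Rightarrow> nat \<Rightarrow> mfun" where
  "hatQ3 g j t = wQ3 g j t
     + msum (dx g) (dx g) [(theta g i j t)\<^sup>T * wR3 g i j t * theta g i j t. i \<leftarrow> I2]"

definition S3 :: "game \<Rightarrow> nat \<Rightarrow> mfun" where
  "S3 g j t = hcat (dx g) [(theta g i j t)\<^sup>T * wR3 g i j t * rho g i j t. i \<leftarrow> I2]"

(* The composite weight of player j of Level 3 (not the entries R_{3ij}, which are wR3). *)
definition Rc3 :: "game \<Rightarrow> nat \<Rightarrow> mfun" where
  "Rc3 g j t = diag_block_mat
     [wRb3 g j i t + (rho g i j t)\<^sup>T * wR3 g i j t * rho g i j t. i \<leftarrow> I2]"

definition du3 :: "game \<Rightarrow> nat \<Rightarrow> nat" where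
  "du3 g j = d3 g j 1 + d3 g j 2"

(* The state equation and J^3_j after substituting, in addition,
   u_{2ij} = theta_{2ij} x + rho_{2ij} u_{3ji}; player j controls u_{3j} = col[u_{3j1}, u_{3j2}]. *)
definition level3_game :: "game \<Rightarrow> lq_game" where
  "level3_game g = \<lparr> lq_players = I3, lq_hor = hor g, lq_dim = dx g, lq_udim = du3 g,
     lq_A = hatA g, lq_C = hatC g, lq_B = hatB3 g, lq_D = hatD3 g,
     lq_Q = hatQ3 g, lq_S = S3 g, lq_R = Rc3 g, lq_G = wG3 g \<rparr>"

definition nash_fbsde ::
  "'a measure \<Rightarrow> 'a rproc \<Rightarrow> game \<Rightarrow> (nat \<Rightarrow> 'a vproc) \<Rightarrow> 'a vproc \<Rightarrow> (nat \<Rightarrow> 'a vproc) \<Rightarrow>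
   (nat \<Rightarrow> 'a vproc) \<Rightarrow> bool" where
  "nash_fbsde M W g u x y z \<longleftrightarrow>
     lq_state M W (level3_game g) I3 (xinit g) u x \<and>
     (\<forall>j\<in>{1,2,3}.
        L2F M (hor g) W (dx g) (z j) \<and>
        ito_diff M (hor g) W (dx g)
          (\<lambda>t \<omega>. - ((hatA g t)\<^sup>T *\<^sub>v y j t \<omega> + (hatC g t)\<^sup>T *\<^sub>v z j t \<omega>
             + hatQ3 g j t *\<^sub>v x t \<omega> + S3 g j t *\<^sub>v u j t \<omega>))
          (z j) (y j) \<and>
        (AE \<omega> in M. y j (hor g) \<omega> = wG3 g j *\<^sub>v x (hor g) \<omega>))"


subsection \<open>The Riccati equation for Phi\<close>

definition blkB1 :: "game \<Rightarrow> mfun" where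
  "blkB1 g t = hcat (dx g) [- (hatB3 g j t * minv (Rc3 g j t) * (hatB3 g j t)\<^sup>T). j \<leftarrow> I3]"

definition blkB2 :: "game \<Rightarrow> mfun" where
  "blkB2 g t = hcat (dx g) [- (hatB3 g j t * minv (Rc3 g j t) * (hatD3 g j t)\<^sup>T). j \<leftarrow> I3]"

definition blkD1 :: "game \<Rightarrow> mfun" where
  "blkD1 g t = hcat (dx g) [- (hatD3 g j t * minv (Rc3 g j t) * (hatB3 g j t)\<^sup>T). j \<leftarrow> I3]"

definition blkD2 :: "game \<Rightarrow> mfun" where
  "blkD2 g t = hcat (dx g) [- (hatD3 g j t * minv (Rc3 g j t) * (hatD3 g j t)\<^sup>T). j \<leftarrow> I3]"

definition blkA :: "game \<Rightarrow> mfun" where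
  "blkA g t = diag_block_mat
     [hatA g t - hatB3 g j t * minv (Rc3 g j t) * (S3 g j t)\<^sup>T. j \<leftarrow> I3]"

definition blkC :: "game \<Rightarrow> mfun" where
  "blkC g t = diag_block_mat
     [hatC g t - hatD3 g j t * minv (Rc3 g j t) * (S3 g j t)\<^sup>T. j \<leftarrow> I3]"

definition blkQ :: "game \<Rightarrow> mfun" where
  "blkQ g t = vcat (dx g)
     [hatQ3 g j t - S3 g j t * minv (Rc3 g j t) * (S3 g j t)\<^sup>T. j \<leftarrow> I3]"

definition blkG :: "game \<Rightarrow> rmat" where
  "blkG g = vcat (dx g) [wG3 g j. j \<leftarrow> I3]"

definition PhiM :: "game \<Rightarrow> mfun \<Rightarrow> mfun" where
  "PhiM g \<Phi> t = 1\<^sub>m (3 * dx g) - \<Phi> t * blkD2 g t"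

definition Psi :: "game \<Rightarrow> mfun \<Rightarrow> mfun" where
  "Psi g \<Phi> t = minv (PhiM g \<Phi> t) *
     (\<Phi> t * hatC g t
       - msum (3 * dx g) (dx g) [\<Phi> t * hatD3 g j t * minv (Rc3 g j t) * (S3 g j t)\<^sup>T. j \<leftarrow> I3]
       + \<Phi> t * blkD1 g t * \<Phi> t)"

definition Phi_rhs :: "game \<Rightarrow> mfun \<Rightarrow> mfun" where
  "Phi_rhs g \<Phi> t =
     \<Phi> t * (hatA g t
       - msum (dx g) (dx g) [hatB3 g j t * minv (Rc3 g j t) * (S3 g j t)\<^sup>T. j \<leftarrow> I3])
     + (blkA g t)\<^sup>T * \<Phi> t + \<Phi> t * blkB1 g t * \<Phi> t + blkQ g t
     + ((blkC g t)\<^sup>T + \<Phi> t * blkB2 g t) * Psi g \<Phi> t"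

definition Phi_riccati :: "game \<Rightarrow> mfun \<Rightarrow> bool" where
  "Phi_riccati g \<Phi> \<longleftrightarrow>
     terminal_ode (hor g) (3 * dx g) (dx g) (Phi_rhs g \<Phi>) (blkG g) \<Phi> \<and>
     has_bounded_inverse (hor g) (3 * dx g) (PhiM g \<Phi>)"

(* The 1 x 3 block row with X in block j and zero blocks elsewhere, e.g. (0  X  0) for j = 2. *)
definition row_at :: "game \<Rightarrow> nat \<Rightarrow> rmat \<Rightarrow> rmat" where
  "row_at g j X =
     hcat (dim_row X) [if k = j then X else 0\<^sub>m (dim_row X) (dx g). k \<leftarrow> I3]"

end

theory Submission
  imports Defs "Jordan_Normal_Form.Determinant"
begin

text \<open>Put \<open>Y = col(y\<^sub>1, y\<^sub>2, y\<^sub>3)\<close>, \<open>Z = col(z\<^sub>1, z\<^sub>2, z\<^sub>3)\<close>, let \<open>\<sigma>\<close> be the diffusion coefficient of the state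
  \<open>x\<close>, and consider \<open>\<eta> = Y - \<Phi> x\<close> and \<open>\<zeta> = Z - \<Phi> \<sigma>\<close>. By the product rule and the equation for \<open>\<Phi>\<close>, the
  pair \<open>(\<eta>, \<zeta>)\<close> solves a linear backward equation with bounded coefficients and \<open>\<eta>(T) = 0\<close>, so it
  vanishes; then \<open>Y = \<Phi> x\<close> and, \<open>I - \<Phi> D\<^sub>2\<close> being invertible, \<open>Z = \<Psi> x\<close>, which are inserted into the
  equilibrium. The Ito formula is avoided: writing \<open>\<eta>(a) + \<integral>\<zeta> dW = - \<integral>f ds\<close> over \<open>[a, b]\<close>, where \<open>\<eta>(b) = 0\<close>
  and \<open>f\<close> is the drift, the two terms on the left are orthogonal, hence
  \<open>E|\<eta>(a)|^2 + E\<integral>|\<zeta>|^2 ds \<le> (b - a) E\<integral>|f|^2 ds\<close>, which forces \<open>\<eta> = 0\<close> and \<open>\<zeta> = 0\<close> on short intervals and,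
  going backwards, on \<open>[0, T]\<close>.\<close>

section \<open>Square integrable functions\<close>

text \<open>What makes the estimate close is that the drift is bounded by \<open>\<eta>\<close> and
  \<open>\<zeta>\<close> alone. The quadratic terms threaten this: they contain the defect Z -
  \<Psi> x, which is not one of the two unknowns. It equals (I - \<Phi> D2)^{-1} (\<zeta> + \<Phi>
  D1 \<eta>), so it is linear in the pair, with a bounded factor. The energy estimate controls
  \<open>\<zeta>\<close> over an interval but \<open>\<eta>\<close> only at its left end; used from
  every later start point and integrated in time, it controls \<open>\<eta>\<close> over the
  interval as well. The product rule concerns a deterministic factor, so there is no covariation
  term. \<Phi> is only absolutely continuous, since the coefficients are merely measurable, but the
  right side of its equation is bounded, so its entries are Lipschitz, and this is enough. An Ito
  integral is handled as a pair (integrand, random variable) in the closure of the elementary pairs;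
  isometry and orthogonality are computed for elementary pairs and pass to the closure.\<close>

definition Lsq :: "'b measure \<Rightarrow> ('b \<Rightarrow> real) \<Rightarrow> bool" where
  "Lsq N f \<longleftrightarrow> f \<in> borel_measurable N \<and> integrable N (\<lambda>x. (f x)\<^sup>2)"

lemma LsqD: "Lsq N f \<Longrightarrow> f \<in> borel_measurable N" "Lsq N f \<Longrightarrow> integrable N (\<lambda>x. (f x)\<^sup>2)"
  by (auto simp: Lsq_def)

lemma Lsq_mult_integrable:
  assumes "Lsq N f" "Lsq N g"
  shows "integrable N (\<lambda>x. f x * g x)"
proof (rule Bochner_Integration.integrable_bound)
  show "integrable N (\<lambda>x. (f x)\<^sup>2 + (g x)\<^sup>2)" using assms by (auto simp: Lsq_def)
  show "(\<lambda>x. f x * g x) \<in> borel_measurable N" using assms by (auto simp: Lsq_def)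
  have "\<bar>a * b\<bar> \<le> a\<^sup>2 + b\<^sup>2" for a b :: real
  proof -
    have "0 \<le> (\<bar>a\<bar> - \<bar>b\<bar>)\<^sup>2" "0 \<le> \<bar>a\<bar> * \<bar>b\<bar>" by auto
    then show ?thesis unfolding abs_mult power2_diff power2_abs by linarith
  qed
  then show "AE x in N. norm (f x * g x) \<le> norm ((f x)\<^sup>2 + (g x)\<^sup>2)" by auto
qed

lemma Lsq_0 [simp]: "Lsq N (\<lambda>x. 0)"
  by (simp add: Lsq_def)

lemma Lsq_bounded_mult:
  assumes f: "Lsq N f" and h: "h \<in> borel_measurable N" and K: "\<And>x. x \<in> space N \<Longrightarrow> \<bar>h x\<bar> \<le> K"
  shows "Lsq N (\<lambda>x. h x * f x)"
  unfolding Lsq_def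
proof
  show "(\<lambda>x. h x * f x) \<in> borel_measurable N" using f h by (auto simp: Lsq_def)
  show "integrable N (\<lambda>x. (h x * f x)\<^sup>2)"
  proof (rule Bochner_Integration.integrable_bound)
    show "integrable N (\<lambda>x. K\<^sup>2 * (f x)\<^sup>2)" using f by (auto simp: Lsq_def)
    show "(\<lambda>x. (h x * f x)\<^sup>2) \<in> borel_measurable N" using f h by (auto simp: Lsq_def)
    show "AE x in N. norm ((h x * f x)\<^sup>2) \<le> norm (K\<^sup>2 * (f x)\<^sup>2)"
    proof (rule AE_I2)
      fix x assume "x \<in> space N"
      then have "(h x)\<^sup>2 \<le> K\<^sup>2" using K[of x] by (metis abs_ge_zero power2_abs power_mono)
      then show "norm ((h x * f x)\<^sup>2) \<le> norm (K\<^sup>2 * (f x)\<^sup>2)"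
        by (simp add: power_mult_distrib mult_right_mono)
    qed
  qed
qed

lemma Lsq_cmult: "Lsq N f \<Longrightarrow> Lsq N (\<lambda>x. c * f x)"
  by (rule Lsq_bounded_mult[where K = "\<bar>c\<bar>"]) auto

lemma Lsq_add:
  assumes "Lsq N f" "Lsq N g"
  shows "Lsq N (\<lambda>x. f x + g x)"
proof -
  have "integrable N (\<lambda>x. (f x)\<^sup>2 + (g x)\<^sup>2 + 2 * (f x * g x))"
    using assms Lsq_mult_integrable[OF assms] by (auto simp: Lsq_def)
  moreover have "(\<lambda>x. (f x)\<^sup>2 + (g x)\<^sup>2 + 2 * (f x * g x)) = (\<lambda>x. (f x + g x)\<^sup>2)"
    by (simp add: power2_sum algebra_simps)
  ultimately show ?thesis using assms by (auto simp: Lsq_def)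
qed

lemma Lsq_uminus: "Lsq N f \<Longrightarrow> Lsq N (\<lambda>x. - f x)"
  using Lsq_cmult[of N f "-1"] by simp

lemma Lsq_diff: "Lsq N f \<Longrightarrow> Lsq N g \<Longrightarrow> Lsq N (\<lambda>x. f x - g x)"
  using Lsq_add[of N f "\<lambda>x. - g x"] Lsq_uminus[of N g] by simp

lemma Lsq_sum: "(\<And>i. i \<in> I \<Longrightarrow> Lsq N (f i)) \<Longrightarrow> Lsq N (\<lambda>x. \<Sum>i\<in>I. f i x)"
  by (induction I rule: infinite_finite_induct) (auto intro: Lsq_add)

lemma Lsq_cong_AE:
  assumes "Lsq N f" "g \<in> borel_measurable N" "AE x in N. f x = g x"
  shows "Lsq N g"
proof -
  have "AE x in N. (f x)\<^sup>2 = (g x)\<^sup>2" using assms(3) by auto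
  then show ?thesis using assms
    by (auto simp: Lsq_def intro: integrable_cong_AE_imp)
qed

lemma Lsq_cong: "(\<And>x. x \<in> space N \<Longrightarrow> f x = g x) \<Longrightarrow> Lsq N f = Lsq N g"
  unfolding Lsq_def by (intro conj_cong measurable_cong Bochner_Integration.integrable_cong) auto

lemma (in finite_measure) Lsq_bounded:
  assumes "f \<in> borel_measurable M" "\<And>x. x \<in> space M \<Longrightarrow> \<bar>f x\<bar> \<le> K"
  shows "Lsq M f"
proof -
  have "Lsq M (\<lambda>x. 1)" by (simp add: Lsq_def)
  then show ?thesis using Lsq_bounded_mult[of M "\<lambda>x. 1" f K] assms by simp
qed

lemma (in finite_measure) Lsq_integrable: "Lsq M f \<Longrightarrow> integrable M f"
  using Lsq_mult_integrable[of M f "\<lambda>x. 1"] by (simp add: Lsq_def)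

lemma Lsq_Cauchy_Schwarz:
  assumes f: "Lsq N f" and g: "Lsq N g"
  shows "(\<integral>x. f x * g x \<partial>N)\<^sup>2 \<le> (\<integral>x. (f x)\<^sup>2 \<partial>N) * (\<integral>x. (g x)\<^sup>2 \<partial>N)"
proof -
  let ?a = "\<integral>x. (f x)\<^sup>2 \<partial>N" and ?b = "\<integral>x. f x * g x \<partial>N" and ?c = "\<integral>x. (g x)\<^sup>2 \<partial>N"
  \<comment> \<open>The integral of (s f - t g)^2 as a quadratic form in (s, t). At (c, b) it equals
    c (a c - b^2), which settles the case of nonzero c.\<close>
  have q: "0 \<le> ?a * s\<^sup>2 - 2 * ?b * s * t + ?c * t\<^sup>2" for s t
  proof -
    have "0 \<le> (\<integral>x. (s * f x - t * g x)\<^sup>2 \<partial>N)" by simp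
    also have "\<dots> = (\<integral>x. s\<^sup>2 * (f x)\<^sup>2 - 2 * s * t * (f x * g x) + t\<^sup>2 * (g x)\<^sup>2 \<partial>N)"
      by (rule Bochner_Integration.integral_cong) (auto simp: power2_eq_square algebra_simps)
    also have "\<dots> = ?a * s\<^sup>2 - 2 * ?b * s * t + ?c * t\<^sup>2"
      using Lsq_mult_integrable[OF f g] f g by (simp add: Lsq_def)
    finally show ?thesis .
  qed
  have c: "0 \<le> ?c" by simp
  show ?thesis
  proof (cases "?c = 0")
    case False
    then have "0 < ?c" using c by linarith
    moreover have "0 \<le> ?c * (?a * ?c - ?b\<^sup>2)"
      using q[of ?c ?b] by (simp add: power2_eq_square algebra_simps)
    ultimately show ?thesis by (simp add: zero_le_mult_iff algebra_simps)
  next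
    case True
    have "?b = 0"
    proof (rule ccontr)
      assume b: "?b \<noteq> 0"
      \<comment> \<open>For c = 0 the form is linear in t, and this t gives it the value -1.\<close>
      have "0 \<le> ?a - 2 * ?b * ((?a + 1) / (2 * ?b))" using q[of 1 "(?a + 1) / (2 * ?b)"] True by simp
      then show False using b by simp
    qed
    then show ?thesis by simp
  qed
qed

text \<open>A triangle inequality free of square roots. Its factor 2 is the reason for the quarters
  of \<epsilon> in the closure arguments below.\<close>

lemma Lsq_integral_add_sq_le:
  assumes f: "Lsq N f" and g: "Lsq N g"
  shows "(\<integral>x. (f x + g x)\<^sup>2 \<partial>N) \<le> 2 * (\<integral>x. (f x)\<^sup>2 \<partial>N) + 2 * (\<integral>x. (g x)\<^sup>2 \<partial>N)"
proof -
  have "(\<integral>x. (f x + g x)\<^sup>2 \<partial>N) \<le> (\<integral>x. 2 * (f x)\<^sup>2 + 2 * (g x)\<^sup>2 \<partial>N)"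
  proof (rule integral_mono)
    show "integrable N (\<lambda>x. (f x + g x)\<^sup>2)" using Lsq_add[OF f g] by (simp add: Lsq_def)
    show "integrable N (\<lambda>x. 2 * (f x)\<^sup>2 + 2 * (g x)\<^sup>2)" using f g by (simp add: Lsq_def)
    fix x show "(f x + g x)\<^sup>2 \<le> 2 * (f x)\<^sup>2 + 2 * (g x)\<^sup>2"
      using zero_le_power2[of "f x - g x"] by (simp add: power2_eq_square algebra_simps)
  qed
  then show ?thesis using f g by (simp add: Lsq_def)
qed

lemma Lsq_integral_triangle_sq:
  assumes f: "Lsq N f" and g: "Lsq N g" and h: "Lsq N h"
  shows "(\<integral>x. (f x - h x)\<^sup>2 \<partial>N) \<le> 2 * (\<integral>x. (f x - g x)\<^sup>2 \<partial>N) + 2 * (\<integral>x. (g x - h x)\<^sup>2 \<partial>N)"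
  using Lsq_integral_add_sq_le[OF Lsq_diff[OF f g] Lsq_diff[OF g h]] by simp

text \<open>Each term of (fr - f)(gr - g) + (fr - f) g + f (gr - g) contains a factor that vanishes
  in mean square. Isometry and orthogonality pass from step processes to limits through this
  lemma.\<close>

lemma Lsq_inner_tendsto:
  assumes f: "Lsq N f" and fr: "\<And>r. Lsq N (fr r)" and g: "Lsq N g" and gr: "\<And>r. Lsq N (gr r)"
    and cf: "(\<lambda>r. \<integral>x. (fr r x - f x)\<^sup>2 \<partial>N) \<longlonglongrightarrow> 0"
    and cg: "(\<lambda>r. \<integral>x. (gr r x - g x)\<^sup>2 \<partial>N) \<longlonglongrightarrow> 0"
  shows "(\<lambda>r. \<integral>x. fr r x * gr r x \<partial>N) \<longlonglongrightarrow> (\<integral>x. f x * g x \<partial>N)"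
proof -
  have cs: "\<bar>\<integral>x. a x * b x \<partial>N\<bar> \<le> sqrt (\<integral>x. (a x)\<^sup>2 \<partial>N) * sqrt (\<integral>x. (b x)\<^sup>2 \<partial>N)"
    if "Lsq N a" "Lsq N b" for a b
    using real_sqrt_le_mono[OF Lsq_Cauchy_Schwarz[OF that]] by (simp add: real_sqrt_mult)
  define F where "F r = sqrt (\<integral>x. (fr r x - f x)\<^sup>2 \<partial>N)" for r
  define G where "G r = sqrt (\<integral>x. (gr r x - g x)\<^sup>2 \<partial>N)" for r
  have F: "F \<longlonglongrightarrow> 0" and G: "G \<longlonglongrightarrow> 0"
    unfolding F_def[abs_def] G_def[abs_def] using tendsto_real_sqrt[OF cf] tendsto_real_sqrt[OF cg] by simp_all
  define B where "B r = F r * G r + F r * sqrt (\<integral>x. (g x)\<^sup>2 \<partial>N) + sqrt (\<integral>x. (f x)\<^sup>2 \<partial>N) * G r" for r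
  have B: "B \<longlonglongrightarrow> 0"
    unfolding B_def[abs_def]
    by (rule tendsto_eq_rhs[OF tendsto_add[OF tendsto_add[OF tendsto_mult[OF F G] tendsto_mult[OF F tendsto_const]]
          tendsto_mult[OF tendsto_const G]]]) simp
  have "\<bar>(\<integral>x. fr r x * gr r x \<partial>N) - (\<integral>x. f x * g x \<partial>N)\<bar> \<le> B r" for r
  proof -
    note d = Lsq_diff[OF fr[of r] f] Lsq_diff[OF gr[of r] g]
    have "(\<integral>x. fr r x * gr r x \<partial>N) - (\<integral>x. f x * g x \<partial>N)
        = (\<integral>x. fr r x * gr r x - f x * g x \<partial>N)"
      by (intro Bochner_Integration.integral_diff[symmetric] Lsq_mult_integrable f g fr gr)
    also have "\<dots> = (\<integral>x. (fr r x - f x) * (gr r x - g x) + (fr r x - f x) * g x + f x * (gr r x - g x) \<partial>N)"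
      by (rule Bochner_Integration.integral_cong) (auto simp: algebra_simps)
    also have "\<dots> = (\<integral>x. (fr r x - f x) * (gr r x - g x) \<partial>N) + (\<integral>x. (fr r x - f x) * g x \<partial>N)
        + (\<integral>x. f x * (gr r x - g x) \<partial>N)"
      using Lsq_mult_integrable[OF d] Lsq_mult_integrable[OF d(1) g] Lsq_mult_integrable[OF f d(2)]
      by simp
    finally show ?thesis
      using cs[OF d] cs[OF d(1) g] cs[OF f d(2)] unfolding B_def F_def G_def by linarith
  qed
  then have "(\<lambda>r. (\<integral>x. fr r x * gr r x \<partial>N) - (\<integral>x. f x * g x \<partial>N)) \<longlonglongrightarrow> 0"
    by (intro Lim_null_comparison[OF _ B] always_eventually) auto
  then show ?thesis by (simp add: LIM_zero_iff)
qed

lemma Lsq_integral_eq_0_AE: "Lsq N f \<Longrightarrow> (\<integral>x. (f x)\<^sup>2 \<partial>N) = 0 \<Longrightarrow> AE x in N. f x = 0"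
  by (subst (asm) integral_nonneg_eq_0_iff_AE) (auto simp: Lsq_def)

lemma Lsq_nn_integral: "Lsq N f \<Longrightarrow> (\<integral>\<^sup>+x. ennreal ((f x)\<^sup>2) \<partial>N) = ennreal (\<integral>x. (f x)\<^sup>2 \<partial>N)"
  by (intro nn_integral_eq_integral) (auto simp: Lsq_def)

lemma LsqI_nn_integral:
  "f \<in> borel_measurable N \<Longrightarrow> (\<integral>\<^sup>+x. ennreal ((f x)\<^sup>2) \<partial>N) < \<infinity> \<Longrightarrow> Lsq N f"
  unfolding Lsq_def by (auto intro!: integrableI_bounded)

section \<open>Elementary stochastic integrals\<close>

locale wiener =
  fixes M :: "'a measure" and T :: real and W :: "'a rproc"
  assumes basis: "brownian_basis M T W" and T_pos: "0 < T"
begin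

abbreviation Fil :: "real \<Rightarrow> 'a measure" where "Fil \<equiv> aug_filtration M W"

sublocale prob_space M
  using basis by (simp add: brownian_basis_def)

section \<open>The augmented filtration and the increments of W\<close>

lemma W_meas: "t \<in> {0..T} \<Longrightarrow> W t \<in> borel_measurable M"
  using basis by (simp add: brownian_basis_def)

text \<open>The side condition under which \<open>sigma\<close> is the generated sigma-algebra on
  \<open>space M\<close>.\<close>

lemma Fil_gen_Pow:
  "{W s -` B \<inter> space M |s B. s \<in> {0..t} \<and> B \<in> sets borel} \<union> null_sets M \<subseteq> Pow (space M)"
  using sets.sets_into_space by (force dest: null_setsD2)

lemma space_Fil [simp]: "space (Fil t) = space M"
  unfolding aug_filtration_def by (rule space_measure_of) (rule Fil_gen_Pow)

lemma sets_Fil: "sets (Fil t) = sigma_sets (space M)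
   ({W s -` B \<inter> space M |s B. s \<in> {0..t} \<and> B \<in> sets borel} \<union> null_sets M)"
  unfolding aug_filtration_def using Fil_gen_Pow by (rule sets_measure_of)

lemma sets_Fil_mono: "s \<le> t \<Longrightarrow> sets (Fil s) \<subseteq> sets (Fil t)"
  unfolding sets_Fil by (rule sigma_sets_mono') fastforce

lemma sets_Fil_le: "t \<le> T \<Longrightarrow> sets (Fil t) \<subseteq> sets M"
  unfolding sets_Fil
  by (rule sets.sigma_sets_subset) (auto intro!: measurable_sets[OF W_meas])

lemma meas_Fil_mono: "f \<in> borel_measurable (Fil s) \<Longrightarrow> s \<le> t \<Longrightarrow> f \<in> borel_measurable (Fil t)"
  by (rule measurable_mono[THEN subsetD, of borel borel "Fil s"]) (auto dest: sets_Fil_mono)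

lemma meas_Fil_M: "f \<in> borel_measurable (Fil s) \<Longrightarrow> s \<le> T \<Longrightarrow> f \<in> borel_measurable M"
  by (rule measurable_mono[THEN subsetD, of borel borel "Fil s"]) (auto dest: sets_Fil_le)

lemma W_meas_Fil: "0 \<le> s \<Longrightarrow> s \<le> t \<Longrightarrow> W s \<in> borel_measurable (Fil t)"
  by (rule measurableI) (auto simp: sets_Fil intro!: sigma_sets.Basic)

lemma incr_distr:
  "0 \<le> s \<Longrightarrow> s < t \<Longrightarrow> t \<le> T \<Longrightarrow>
    distributed M lborel (\<lambda>\<omega>. W t \<omega> - W s \<omega>) (normal_density 0 (sqrt (t - s)))"
  using basis by (simp add: brownian_basis_def)

text \<open>The basis states independence of two sigma-algebras. A variable measurable at time s
  generates a part of the first, and the increment generates a part of the second.\<close>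

lemma incr_indep_var:
  assumes "0 \<le> s" "s < t" "t \<le> T" and f: "f \<in> borel_measurable (Fil s)"
  shows "indep_var borel f borel (\<lambda>\<omega>. W t \<omega> - W s \<omega>)"
proof -
  have ind: "indep_set (sets (Fil s)) (sets (vimage_algebra (space M) (\<lambda>\<omega>. W t \<omega> - W s \<omega>) borel))"
    using basis assms by (simp add: brownian_basis_def)
  have 1: "{f -` A \<inter> space M |A. A \<in> sets borel} \<subseteq> sets (Fil s)"
    using measurable_sets[OF f] by auto
  have 2: "{(\<lambda>\<omega>. W t \<omega> - W s \<omega>) -` A \<inter> space M |A. A \<in> sets borel}
      \<subseteq> sets (vimage_algebra (space M) (\<lambda>\<omega>. W t \<omega> - W s \<omega>) borel)"
    by (auto simp: in_vimage_algebra)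
  have 3: "sigma_sets (space M) {f -` A \<inter> space M |A. A \<in> sets borel} \<subseteq> sets (Fil s)"
    using sets.sigma_sets_subset[OF 1] by simp
  have 4: "sigma_sets (space M) {(\<lambda>\<omega>. W t \<omega> - W s \<omega>) -` A \<inter> space M |A. A \<in> sets borel}
      \<subseteq> sets (vimage_algebra (space M) (\<lambda>\<omega>. W t \<omega> - W s \<omega>) borel)"
    using sets.sigma_sets_subset[OF 2] by simp
  have m: "(\<lambda>\<omega>. W t \<omega> - W s \<omega>) \<in> borel_measurable M" "f \<in> borel_measurable M"
    using assms W_meas[of s] W_meas[of t] meas_Fil_M[OF f] by auto
  have "indep_set (sigma_sets (space M) {f -` A \<inter> space M |A. A \<in> sets borel})
     (sigma_sets (space M) {(\<lambda>\<omega>. W t \<omega> - W s \<omega>) -` A \<inter> space M |A. A \<in> sets borel})"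
    using ind 3 4 unfolding indep_sets2_eq by (meson order_trans subsetD)
  then show ?thesis using m by (simp add: indep_var_eq)
qed

lemma incr_integrable: "0 \<le> s \<Longrightarrow> s < t \<Longrightarrow> t \<le> T \<Longrightarrow> integrable M (\<lambda>\<omega>. (W t \<omega> - W s \<omega>) ^ k)"
  using distributed_integrable[OF incr_distr, of s t "\<lambda>x. x ^ k"]
    integrable_normal_moment[of "sqrt (t - s)" 0 k]
  by simp

lemma incr_Lsq:
  assumes "0 \<le> s" "s \<le> t" "t \<le> T"
  shows "Lsq M (\<lambda>\<omega>. W t \<omega> - W s \<omega>)"
\<comment> \<open>\<open>incr_distr\<close> speaks of positive variance only; for s = t the
  increment is identically 0.\<close>
proof (cases "s = t")
  case False
  then show ?thesis using incr_integrable[of s t 2] assms W_meas[of s] W_meas[of t]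
    by (auto simp: Lsq_def)
qed simp

lemma incr_mean: "0 \<le> s \<Longrightarrow> s < t \<Longrightarrow> t \<le> T \<Longrightarrow> expectation (\<lambda>\<omega>. W t \<omega> - W s \<omega>) = 0"
  by (rule normal_distributed_expectation[OF _ incr_distr]) auto

lemma incr_var: "0 \<le> s \<Longrightarrow> s < t \<Longrightarrow> t \<le> T \<Longrightarrow> expectation (\<lambda>\<omega>. (W t \<omega> - W s \<omega>)\<^sup>2) = t - s"
  using normal_distributed_variance[OF _ incr_distr[of s t]] incr_mean[of s t] by simp

text \<open>Independence factorises the expectation and the increment has mean 0. All orthogonality
  below comes from this martingale property.\<close>

lemma incr_mult:
  assumes st: "0 \<le> s" "s \<le> t" "t \<le> T" and f: "f \<in> borel_measurable (Fil s)" "integrable M f"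
  shows "integrable M (\<lambda>\<omega>. f \<omega> * (W t \<omega> - W s \<omega>))"
    "expectation (\<lambda>\<omega>. f \<omega> * (W t \<omega> - W s \<omega>)) = 0"
proof -
  have "integrable M (\<lambda>\<omega>. f \<omega> * (W t \<omega> - W s \<omega>)) \<and> expectation (\<lambda>\<omega>. f \<omega> * (W t \<omega> - W s \<omega>)) = 0"
  proof (cases "s = t")
    case False
    then have "s < t" using st by simp
    note i = incr_indep_var[OF st(1) this st(3) f(1)] incr_integrable[OF st(1) this st(3), of 1]
    show ?thesis
      using indep_var_integrable[OF i(1) f(2)] indep_var_lebesgue_integral[OF i(1) f(2)] i(2)
        incr_mean[OF st(1) \<open>s < t\<close> st(3)] by simp
  qed simp
  then show "integrable M (\<lambda>\<omega>. f \<omega> * (W t \<omega> - W s \<omega>))"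
    "expectation (\<lambda>\<omega>. f \<omega> * (W t \<omega> - W s \<omega>)) = 0" by auto
qed

lemma incr_mult_sq:
  assumes st: "0 \<le> s" "s \<le> t" "t \<le> T" and f: "f \<in> borel_measurable (Fil s)" "integrable M f"
  shows "integrable M (\<lambda>\<omega>. f \<omega> * (W t \<omega> - W s \<omega>)\<^sup>2)"
    "expectation (\<lambda>\<omega>. f \<omega> * (W t \<omega> - W s \<omega>)\<^sup>2) = (t - s) * expectation f"
proof -
  have "integrable M (\<lambda>\<omega>. f \<omega> * (W t \<omega> - W s \<omega>)\<^sup>2) \<and>
    expectation (\<lambda>\<omega>. f \<omega> * (W t \<omega> - W s \<omega>)\<^sup>2) = (t - s) * expectation f"
  proof (cases "s = t")
    case False
    then have "s < t" using st by simp
    note i = incr_indep_var[OF st(1) this st(3) f(1)] incr_integrable[OF st(1) this st(3), of 2]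
    have j: "indep_var borel f borel (\<lambda>\<omega>. (W t \<omega> - W s \<omega>)\<^sup>2)"
      using indep_var_compose[OF i(1), of "\<lambda>x. x" borel "\<lambda>x. x\<^sup>2" borel] by (simp add: comp_def)
    show ?thesis
      using indep_var_integrable[OF j f(2)] indep_var_lebesgue_integral[OF j f(2)] i(2)
        incr_var[OF st(1) \<open>s < t\<close> st(3)] by simp
  qed simp
  then show "integrable M (\<lambda>\<omega>. f \<omega> * (W t \<omega> - W s \<omega>)\<^sup>2)"
    "expectation (\<lambda>\<omega>. f \<omega> * (W t \<omega> - W s \<omega>)\<^sup>2) = (t - s) * expectation f" by auto
qed

text \<open>An elementary integrand \<open>(a, b, \<xi>)\<close> stands for the process \<open>\<xi> 1\<^bsub>(a, b]\<^esub>\<close>. Lists of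
  them need not be ordered in time, which makes sums of simple processes immediate.\<close>

definition elementary :: "real \<times> real \<times> ('a \<Rightarrow> real) \<Rightarrow> bool" where
  "elementary e = (case e of (a, b, \<xi>) \<Rightarrow> 0 \<le> a \<and> a \<le> b \<and> b \<le> T \<and> \<xi> \<in> borel_measurable (Fil a) \<and>
     (\<exists>K. \<forall>\<omega>\<in>space M. \<bar>\<xi> \<omega>\<bar> \<le> K))"

definition elem_proc :: "real \<times> real \<times> ('a \<Rightarrow> real) \<Rightarrow> real \<Rightarrow> 'a \<Rightarrow> real" where
  "elem_proc e s \<omega> = (case e of (a, b, \<xi>) \<Rightarrow> \<xi> \<omega> * indicator {a<..b} s)"

text \<open>The integral over the whole of [0, T]. There is no time parameter: an integral up to t
  is that of a triple cut off at t.\<close>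

definition elem_int :: "real \<times> real \<times> ('a \<Rightarrow> real) \<Rightarrow> 'a \<Rightarrow> real" where
  "elem_int e \<omega> = (case e of (a, b, \<xi>) \<Rightarrow> \<xi> \<omega> * (W b \<omega> - W a \<omega>))"

lemma elementaryD:
  assumes "elementary (a, b, \<xi>)"
  shows "0 \<le> a" "a \<le> b" "b \<le> T" "\<xi> \<in> borel_measurable (Fil a)" "\<exists>K. \<forall>\<omega>\<in>space M. \<bar>\<xi> \<omega>\<bar> \<le> K"
  using assms by (simp_all add: elementary_def)

lemma elementary_meas: "elementary (a, b, \<xi>) \<Longrightarrow> \<xi> \<in> borel_measurable M"
  by (rule meas_Fil_M[OF elementaryD(4)]) (use elementaryD in fastforce)+

lemma elementary_Lsq:
  assumes "elementary (a, b, \<xi>)" shows "Lsq M \<xi>"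
proof -
  obtain K where "\<forall>\<omega>\<in>space M. \<bar>\<xi> \<omega>\<bar> \<le> K" using elementaryD(5)[OF assms] by blast
  then show ?thesis by (intro Lsq_bounded[OF elementary_meas[OF assms], of K]) blast
qed

lemma elem_int_Lsq:
  assumes "elementary e" shows "Lsq M (elem_int e)"
proof -
  obtain a b \<xi> where e: "e = (a, b, \<xi>)" by (rule prod_cases3)
  note e' = assms[unfolded e]
  obtain K where K: "\<forall>\<omega>\<in>space M. \<bar>\<xi> \<omega>\<bar> \<le> K" using elementaryD(5)[OF e'] by blast
  have "Lsq M (\<lambda>\<omega>. \<xi> \<omega> * (W b \<omega> - W a \<omega>))"
    by (rule Lsq_bounded_mult[OF incr_Lsq[OF elementaryD(1-3)[OF e']] elementary_meas[OF e'], of K]) (use K in blast)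
  then show ?thesis by (simp add: e elem_int_def[abs_def])
qed

text \<open>The form needed after an interval has been cut in two: a pointwise decomposition and one
  expectation for each piece.\<close>

lemma expectation_add_eqI:
  "integrable M f \<Longrightarrow> integrable M g \<Longrightarrow> (\<And>\<omega>. h \<omega> = f \<omega> + g \<omega>) \<Longrightarrow>
    expectation f = u \<Longrightarrow> expectation g = v \<Longrightarrow> expectation h = u + (v::real)"
  by (subgoal_tac "h = (\<lambda>\<omega>. f \<omega> + g \<omega>)") auto

text \<open>The product g \<xi> is known at time a, hence independent of the increment after
  a.\<close>

lemma elem_int_adapted_orth:
  assumes e: "elementary (a, b, \<xi>)" and g: "g \<in> borel_measurable (Fil a)" "Lsq M g"
  shows "expectation (\<lambda>\<omega>. g \<omega> * elem_int (a, b, \<xi>) \<omega>) = 0"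
proof -
  have "expectation (\<lambda>\<omega>. (g \<omega> * \<xi> \<omega>) * (W b \<omega> - W a \<omega>)) = 0"
    using e g Lsq_mult_integrable[OF g(2) elementary_Lsq[OF e]]
    by (intro incr_mult) (auto simp: elementary_def)
  then show ?thesis by (simp add: elem_int_def mult.assoc)
qed

lemma elem_int_meas_Fil:
  assumes "elementary (a, b, \<xi>)" "b \<le> t"
  shows "elem_int (a, b, \<xi>) \<in> borel_measurable (Fil t)"
proof -
  have "\<xi> \<in> borel_measurable (Fil t)" "W a \<in> borel_measurable (Fil t)" "W b \<in> borel_measurable (Fil t)"
    using assms by (auto simp: elementary_def intro: meas_Fil_mono W_meas_Fil)
  then show ?thesis by (simp add: elem_int_def[abs_def])
qed

text \<open>Cut the longer interval at b. On (a, b] the squared increment contributes its mean b -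
  a; the integral over (b, c] is orthogonal to the first factor, which is known at b.\<close>

lemma elem_int_same_start:
  assumes e: "elementary (a, b, \<xi>)" "elementary (a, c, \<zeta>)" and bc: "b \<le> c"
  shows "expectation (\<lambda>\<omega>. elem_int (a, b, \<xi>) \<omega> * elem_int (a, c, \<zeta>) \<omega>) = (b - a) * expectation (\<lambda>\<omega>. \<xi> \<omega> * \<zeta> \<omega>)"
proof -
  have e': "elementary (b, c, \<zeta>)" using e bc by (auto simp: elementary_def intro: meas_Fil_mono)
  have i: "integrable M (\<lambda>\<omega>. \<xi> \<omega> * \<zeta> \<omega>)"
    using e by (intro Lsq_mult_integrable elementary_Lsq)
  have m: "(\<lambda>\<omega>. \<xi> \<omega> * \<zeta> \<omega>) \<in> borel_measurable (Fil a)"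
    using e by (auto simp: elementary_def)
  have "expectation (\<lambda>\<omega>. elem_int (a, b, \<xi>) \<omega> * elem_int (a, c, \<zeta>) \<omega>)
    = (b - a) * expectation (\<lambda>\<omega>. \<xi> \<omega> * \<zeta> \<omega>) + 0"
  proof (rule expectation_add_eqI)
    show "integrable M (\<lambda>\<omega>. \<xi> \<omega> * \<zeta> \<omega> * (W b \<omega> - W a \<omega>)\<^sup>2)"
      "expectation (\<lambda>\<omega>. \<xi> \<omega> * \<zeta> \<omega> * (W b \<omega> - W a \<omega>)\<^sup>2) = (b - a) * expectation (\<lambda>\<omega>. \<xi> \<omega> * \<zeta> \<omega>)"
      using incr_mult_sq[OF _ _ _ m i, of b] e by (auto simp: elementary_def)
    show "integrable M (\<lambda>\<omega>. elem_int (a, b, \<xi>) \<omega> * elem_int (b, c, \<zeta>) \<omega>)"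
      using e e' by (intro Lsq_mult_integrable elem_int_Lsq)
    show "expectation (\<lambda>\<omega>. elem_int (a, b, \<xi>) \<omega> * elem_int (b, c, \<zeta>) \<omega>) = 0"
      by (rule elem_int_adapted_orth[OF e' elem_int_meas_Fil[OF e(1)] elem_int_Lsq[OF e(1)]]) simp
    show "elem_int (a, b, \<xi>) \<omega> * elem_int (a, c, \<zeta>) \<omega> =
      \<xi> \<omega> * \<zeta> \<omega> * (W b \<omega> - W a \<omega>)\<^sup>2 + elem_int (a, b, \<xi>) \<omega> * elem_int (b, c, \<zeta>) \<omega>" for \<omega>
      by (simp add: elem_int_def power2_eq_square algebra_simps)
  qed
  then show ?thesis by simp
qed

text \<open>Length of the intersection of (a, b] and (c, d].\<close>

definition overlap :: "real \<Rightarrow> real \<Rightarrow> real \<Rightarrow> real \<Rightarrow> real" where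
  "overlap a b c d = max 0 (min b d - max a c)"

lemma overlap_commute: "overlap a b c d = overlap c d a b"
  by (simp add: overlap_def min.commute max.commute)

text \<open>What the first integral collects up to time c is known at c and hence orthogonal to the
  second. If b > c, what remains starts at c like the second one, and
  \<open>elem_int_same_start\<close> applies, in the order decided by b and d.\<close>

lemma elem_int_cov_aux:
  assumes e: "elementary (a, b, \<xi>)" "elementary (c, d, \<zeta>)" and ac: "a \<le> c"
  shows "expectation (\<lambda>\<omega>. elem_int (a, b, \<xi>) \<omega> * elem_int (c, d, \<zeta>) \<omega>)
    = overlap a b c d * expectation (\<lambda>\<omega>. \<xi> \<omega> * \<zeta> \<omega>)"
proof (cases "b \<le> c")
  case True
  then have "expectation (\<lambda>\<omega>. elem_int (a, b, \<xi>) \<omega> * elem_int (c, d, \<zeta>) \<omega>) = 0"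
    by (intro elem_int_adapted_orth[OF e(2) elem_int_meas_Fil[OF e(1)] elem_int_Lsq[OF e(1)]])
  then show ?thesis using True ac by (simp add: overlap_def max_def min_def)
next
  case False
  have e1: "elementary (a, c, \<xi>)" "elementary (c, b, \<xi>)" using e False ac
    by (auto simp: elementary_def intro: meas_Fil_mono)
  have cd: "c \<le> d" using e by (simp add: elementary_def)
  have o: "overlap a b c d = min b d - c" using False ac cd by (simp add: overlap_def)
  have "expectation (\<lambda>\<omega>. elem_int (a, b, \<xi>) \<omega> * elem_int (c, d, \<zeta>) \<omega>)
    = 0 + (min b d - c) * expectation (\<lambda>\<omega>. \<xi> \<omega> * \<zeta> \<omega>)"
  proof (rule expectation_add_eqI)
    show "integrable M (\<lambda>\<omega>. elem_int (a, c, \<xi>) \<omega> * elem_int (c, d, \<zeta>) \<omega>)"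
      "integrable M (\<lambda>\<omega>. elem_int (c, b, \<xi>) \<omega> * elem_int (c, d, \<zeta>) \<omega>)"
      using e e1 by (auto intro!: Lsq_mult_integrable elem_int_Lsq)
    show "expectation (\<lambda>\<omega>. elem_int (a, c, \<xi>) \<omega> * elem_int (c, d, \<zeta>) \<omega>) = 0"
      by (intro elem_int_adapted_orth[OF e(2) elem_int_meas_Fil[OF e1(1)] elem_int_Lsq[OF e1(1)]]) simp
    show "expectation (\<lambda>\<omega>. elem_int (c, b, \<xi>) \<omega> * elem_int (c, d, \<zeta>) \<omega>)
      = (min b d - c) * expectation (\<lambda>\<omega>. \<xi> \<omega> * \<zeta> \<omega>)"
      using elem_int_same_start[OF e1(2) e(2)] elem_int_same_start[OF e(2) e1(2)]
      by (cases "b \<le> d") (simp_all add: mult.commute)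
    show "elem_int (a, b, \<xi>) \<omega> * elem_int (c, d, \<zeta>) \<omega> =
      elem_int (a, c, \<xi>) \<omega> * elem_int (c, d, \<zeta>) \<omega> + elem_int (c, b, \<xi>) \<omega> * elem_int (c, d, \<zeta>) \<omega>" for \<omega>
      by (simp add: elem_int_def algebra_simps)
  qed
  then show ?thesis using o by simp
qed

lemma elem_int_cov:
  assumes e: "elementary (a, b, \<xi>)" "elementary (c, d, \<zeta>)"
  shows "expectation (\<lambda>\<omega>. elem_int (a, b, \<xi>) \<omega> * elem_int (c, d, \<zeta>) \<omega>)
    = overlap a b c d * expectation (\<lambda>\<omega>. \<xi> \<omega> * \<zeta> \<omega>)"
  using elem_int_cov_aux[OF e] elem_int_cov_aux[OF e(2) e(1)] overlap_commute[of a b c d]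
  by (cases "a \<le> c") (simp_all add: mult.commute)

section \<open>The measure dt x dP and its square integrable processes\<close>

abbreviation dt_dP :: "(real \<times> 'a) measure" where
  "dt_dP \<equiv> restrict_space lborel {0..T} \<Otimes>\<^sub>M M"

lemma finite_dt: "finite_measure (restrict_space lborel {0..T})"
  using T_pos by (intro finite_measureI) (simp add: emeasure_restrict_space)

sublocale P: pair_sigma_finite "restrict_space lborel {0..T}" M
proof -
  interpret dt: finite_measure "restrict_space lborel {0..T}" by (rule finite_dt)
  show "pair_sigma_finite (restrict_space lborel {0..T}) M" ..
qed

lemma finite_dt_dP: "finite_measure dt_dP"
  by (rule finite_measure_pair_measure[OF finite_measure_axioms finite_dt])

lemma space_dt_dP: "space dt_dP = {0..T} \<times> space M"
  by (simp add: space_pair_measure)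

text \<open>\<open>L2F\<close> and \<open>has_ito_integral\<close> integrate over time inside and
  over outcomes outside; this is the passage from them to the product measure.\<close>

lemma nn_integral_dt_dP:
  "f \<in> borel_measurable dt_dP \<Longrightarrow>
    (\<integral>\<^sup>+p. f p \<partial>dt_dP) = (\<integral>\<^sup>+\<omega>. (\<integral>\<^sup>+s\<in>{0..T}. f (s, \<omega>) \<partial>lborel) \<partial>M)"
  by (subst P.nn_integral_snd[symmetric]) (simp_all add: nn_integral_restrict_space)

text \<open>Take the progressive measurability at the horizon: \<open>Fil T\<close> lies inside the
  sigma-algebra of \<open>M\<close>, so measurability passes to \<open>dt_dP\<close>.\<close>

lemma progressive_meas_dt_dP:
  assumes "progressive M T W \<phi>"
  shows "(\<lambda>(s, \<omega>). \<phi> s \<omega>) \<in> borel_measurable dt_dP"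
proof -
  have "(\<lambda>(s, \<omega>). \<phi> s \<omega>) \<in> borel_measurable (restrict_space borel {0..T} \<Otimes>\<^sub>M Fil T)"
    using assms T_pos by (simp add: progressive_def)
  moreover have "(\<lambda>p. (fst p, snd p)) \<in> dt_dP \<rightarrow>\<^sub>M restrict_space borel {0..T} \<Otimes>\<^sub>M Fil T"
  proof (rule measurable_Pair)
    have "(\<lambda>x. x) \<in> restrict_space lborel {0..T} \<rightarrow>\<^sub>M restrict_space borel {0..T}"
      by (rule measurable_ident_sets) (simp add: sets_restrict_space)
    then show "fst \<in> dt_dP \<rightarrow>\<^sub>M restrict_space borel {0..T}"
      using measurable_comp[OF measurable_fst] by (simp add: comp_def) 
    have "(\<lambda>x. x) \<in> M \<rightarrow>\<^sub>M Fil T"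
      using sets_Fil_le[of T] by (intro measurableI) auto
    then show "snd \<in> dt_dP \<rightarrow>\<^sub>M Fil T"
      using measurable_comp[OF measurable_snd] by (simp add: comp_def)
  qed
  ultimately show ?thesis
    using measurable_comp by (fastforce simp: comp_def)
qed

abbreviation L2_proc :: "'a rproc \<Rightarrow> bool" where "L2_proc \<phi> \<equiv> Lsq dt_dP (\<lambda>(s, \<omega>). \<phi> s \<omega>)"

lemma indicator_meas_dt_dP:
  assumes "A \<in> sets borel"
  shows "(\<lambda>(s, \<omega>). indicator A s :: real) \<in> borel_measurable dt_dP"
proof -
  have "(indicator A :: real \<Rightarrow> real) \<in> borel_measurable (restrict_space lborel {0..T})"
    using assms by (intro measurable_restrict_space1 borel_measurable_indicator) simp
  then show ?thesis unfolding split_beta' by (rule measurable_compose[OF measurable_fst])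
qed

lemma L2_proc_indicator:
  assumes "L2_proc \<phi>" "A \<in> sets borel" shows "L2_proc (\<lambda>s \<omega>. \<phi> s \<omega> * indicator A s)"
proof -
  have "Lsq dt_dP (\<lambda>x. (\<lambda>(s, \<omega>). indicator A s :: real) x * (\<lambda>(s, \<omega>). \<phi> s \<omega>) x)"
    by (rule Lsq_bounded_mult[OF assms(1) indicator_meas_dt_dP[OF assms(2)], of 1])
      (auto simp: indicator_def)
  then show ?thesis by (simp add: split_beta' mult.commute)
qed

lemma Lsq_compose_snd:
  assumes "Lsq M f" shows "L2_proc (\<lambda>s \<omega>. f \<omega>)"
proof (rule LsqI_nn_integral)
  show m: "(\<lambda>(s, \<omega>). f \<omega>) \<in> borel_measurable dt_dP"
    using LsqD(1)[OF assms] by simp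
  have "(\<integral>\<^sup>+p. ennreal (((\<lambda>(s, \<omega>). f \<omega>) p)\<^sup>2) \<partial>dt_dP)
    = (\<integral>\<^sup>+\<omega>. (\<integral>\<^sup>+s\<in>{0..T}. ennreal ((f \<omega>)\<^sup>2) \<partial>lborel) \<partial>M)"
    using m by (subst nn_integral_dt_dP) auto
  also have "\<dots> = (\<integral>\<^sup>+\<omega>. ennreal ((f \<omega>)\<^sup>2) * ennreal T \<partial>M)"
    using T_pos by (simp add: nn_integral_cmult_indicator)
  also have "\<dots> = (\<integral>\<^sup>+\<omega>. ennreal ((f \<omega>)\<^sup>2) \<partial>M) * ennreal T"
    using LsqD(1)[OF assms] by (intro nn_integral_multc) simp
  also have "\<dots> < \<infinity>" using Lsq_nn_integral[OF assms] by (simp add: ennreal_mult_less_top)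
  finally show "(\<integral>\<^sup>+p. ennreal (((\<lambda>(s, \<omega>). f \<omega>) p)\<^sup>2) \<partial>dt_dP) < \<infinity>" .
qed

lemma elem_proc_L2:
  assumes "elementary e" shows "L2_proc (elem_proc e)"
proof -
  obtain a b \<xi> where e: "e = (a, b, \<xi>)" by (rule prod_cases3)
  show ?thesis
    using L2_proc_indicator[OF Lsq_compose_snd[OF elementary_Lsq[OF assms[unfolded e]]], of "{a<..b}"]
    by (simp add: e elem_proc_def)
qed

text \<open>By Fubini the two indicators multiply to that of the intersection. The value is that of
  \<open>elem_int_cov\<close>, and the agreement is the Ito isometry for elementary
  integrands.\<close>

lemma elem_proc_inner:
  assumes e: "elementary (a, b, \<xi>)" "elementary (c, d, \<zeta>)"
  shows "(\<integral>p. (\<lambda>(s, \<omega>). elem_proc (a, b, \<xi>) s \<omega>) p * (\<lambda>(s, \<omega>). elem_proc (c, d, \<zeta>) s \<omega>) p \<partial>dt_dP)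
    = overlap a b c d * expectation (\<lambda>\<omega>. \<xi> \<omega> * \<zeta> \<omega>)"
proof -
  let ?f = "\<lambda>p. (\<lambda>(s, \<omega>). elem_proc (a, b, \<xi>) s \<omega>) p * (\<lambda>(s, \<omega>). elem_proc (c, d, \<zeta>) s \<omega>) p"
  let ?A = "{max a c<..min b d}"
  have i: "integrable dt_dP ?f" by (intro Lsq_mult_integrable elem_proc_L2 e)
  have ind: "indicator {a<..b} s * indicator {c<..d} s = (indicator ?A s :: real)" for s
    by (auto simp: indicator_def)
  have "(\<integral>p. ?f p \<partial>dt_dP) = (\<integral>s. (\<integral>\<omega>. ?f (s, \<omega>) \<partial>M) \<partial>restrict_space lborel {0..T})"
    using P.integral_fst'[OF i] by simp
  also have "\<dots> = (\<integral>s. expectation (\<lambda>\<omega>. \<xi> \<omega> * \<zeta> \<omega>) * indicator ?A s \<partial>restrict_space lborel {0..T})"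
  proof (rule Bochner_Integration.integral_cong[OF refl])
    fix s
    have "?f (s, \<omega>) = indicator ?A s * (\<xi> \<omega> * \<zeta> \<omega>)" for \<omega>
      using ind[of s] by (simp add: elem_proc_def)
    then show "(\<integral>\<omega>. ?f (s, \<omega>) \<partial>M) = expectation (\<lambda>\<omega>. \<xi> \<omega> * \<zeta> \<omega>) * indicator ?A s"
      by (simp add: mult.commute)
  qed
  also have "\<dots> = expectation (\<lambda>\<omega>. \<xi> \<omega> * \<zeta> \<omega>) * (\<integral>s. indicator ?A s \<partial>restrict_space lborel {0..T})"
    by simp
  also have "(\<integral>s. indicator ?A s \<partial>restrict_space lborel {0..T}) = overlap a b c d"
  proof -
    have "?A \<subseteq> {0..T}" using e by (auto simp: elementary_def)
    then have "(\<integral>s. indicator ?A s \<partial>restrict_space lborel {0..T}) = measure lborel ?A"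
      by (simp add: measure_restrict_space Int_absorb2)
    moreover have "measure lborel ?A = overlap a b c d"
    proof (cases "max a c \<le> min b d")
      case True
      then show ?thesis using measure_lborel_Ioc[OF True] unfolding overlap_def by linarith
    next
      case False
      then have "?A = {}" "min b d - max a c \<le> 0" by (auto intro: greaterThanAtMost_empty)
      then show ?thesis unfolding overlap_def by simp
    qed
    ultimately show ?thesis by simp
  qed
  finally show ?thesis by simp
qed

section \<open>Finite sums of elementary integrands and their isometry\<close>

definition step_proc :: "(real \<times> real \<times> ('a \<Rightarrow> real)) list \<Rightarrow> real \<Rightarrow> 'a \<Rightarrow> real" where
  "step_proc L s \<omega> = (\<Sum>e\<leftarrow>L. elem_proc e s \<omega>)"

definition step_int :: "(real \<times> real \<times> ('a \<Rightarrow> real)) list \<Rightarrow> 'a \<Rightarrow> real" where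
  "step_int L \<omega> = (\<Sum>e\<leftarrow>L. elem_int e \<omega>)"

definition elementary_list :: "(real \<times> real \<times> ('a \<Rightarrow> real)) list \<Rightarrow> bool" where
  [simp]: "elementary_list L \<longleftrightarrow> (\<forall>e\<in>set L. elementary e)"

lemma step_proc_simps [simp]: "step_proc [] = (\<lambda>s \<omega>. 0)"
    "step_proc (e # L) = (\<lambda>s \<omega>. elem_proc e s \<omega> + step_proc L s \<omega>)"
    "step_proc (L @ L') = (\<lambda>s \<omega>. step_proc L s \<omega> + step_proc L' s \<omega>)"
  and step_int_simps [simp]: "step_int [] = (\<lambda>\<omega>. 0)" "step_int (e # L) = (\<lambda>\<omega>. elem_int e \<omega> + step_int L \<omega>)"
    "step_int (L @ L') = (\<lambda>\<omega>. step_int L \<omega> + step_int L' \<omega>)"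
  by (auto simp: step_proc_def[abs_def] step_int_def[abs_def])

lemma L2_proc_add: "L2_proc \<phi> \<Longrightarrow> L2_proc \<psi> \<Longrightarrow> L2_proc (\<lambda>s \<omega>. \<phi> s \<omega> + \<psi> s \<omega>)"
  using Lsq_add[of dt_dP "\<lambda>(s, \<omega>). \<phi> s \<omega>" "\<lambda>(s, \<omega>). \<psi> s \<omega>"] by (simp add: split_beta')

lemma L2_proc_diff: "L2_proc \<phi> \<Longrightarrow> L2_proc \<psi> \<Longrightarrow> L2_proc (\<lambda>s \<omega>. \<phi> s \<omega> - \<psi> s \<omega>)"
  using Lsq_diff[of dt_dP "\<lambda>(s, \<omega>). \<phi> s \<omega>" "\<lambda>(s, \<omega>). \<psi> s \<omega>"] by (simp add: split_beta')

lemma L2_proc_cmult: "L2_proc \<phi> \<Longrightarrow> L2_proc (\<lambda>s \<omega>. c * \<phi> s \<omega>)"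
  using Lsq_cmult[of dt_dP "\<lambda>(s, \<omega>). \<phi> s \<omega>" c] by (simp add: split_beta')

lemma L2_proc_0: "L2_proc (\<lambda>s \<omega>. 0)"
  using Lsq_0[of dt_dP] by (simp add: split_beta')

lemma L2_proc_sum: "(\<And>i. i \<in> I \<Longrightarrow> L2_proc (\<phi> i)) \<Longrightarrow> L2_proc (\<lambda>s \<omega>. \<Sum>i\<in>I. \<phi> i s \<omega>)"
  by (induction I rule: infinite_finite_induct) (auto intro: L2_proc_add L2_proc_0)

lemma step_proc_L2: "elementary_list L \<Longrightarrow> L2_proc (step_proc L)"
  by (induction L) (auto intro: L2_proc_add L2_proc_0 elem_proc_L2)

lemma step_int_Lsq: "elementary_list L \<Longrightarrow> Lsq M (step_int L)"
  by (induction L) (auto intro: Lsq_add elem_int_Lsq)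

definition inner_dt_dP :: "'a rproc \<Rightarrow> 'a rproc \<Rightarrow> real" where
  "inner_dt_dP \<phi> \<psi> = (\<integral>p. \<phi> (fst p) (snd p) * \<psi> (fst p) (snd p) \<partial>dt_dP)"

lemma inner_dt_dP_add_left:
  assumes "L2_proc \<phi>" "L2_proc \<phi>'" "L2_proc \<psi>"
  shows "inner_dt_dP (\<lambda>s \<omega>. \<phi> s \<omega> + \<phi>' s \<omega>) \<psi> = inner_dt_dP \<phi> \<psi> + inner_dt_dP \<phi>' \<psi>"
  using Lsq_mult_integrable[OF assms(1,3)] Lsq_mult_integrable[OF assms(2,3)]
  by (simp add: inner_dt_dP_def distrib_right split_beta')

lemma inner_dt_dP_commute: "inner_dt_dP \<phi> \<psi> = inner_dt_dP \<psi> \<phi>"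
  by (simp add: inner_dt_dP_def mult.commute)

lemma elem_isometry:
  assumes "elementary e" "elementary e'"
  shows "expectation (\<lambda>\<omega>. elem_int e \<omega> * elem_int e' \<omega>) = inner_dt_dP (elem_proc e) (elem_proc e')"
proof -
  obtain a b \<xi> where e: "e = (a, b, \<xi>)" by (rule prod_cases3)
  obtain c d \<zeta> where e': "e' = (c, d, \<zeta>)" by (rule prod_cases3)
  show ?thesis using elem_int_cov[OF assms[unfolded e e']] elem_proc_inner[OF assms[unfolded e e']]
    by (simp add: e e' inner_dt_dP_def split_beta')
qed

lemma step_int_isometry1:
  assumes "elementary e" "elementary_list L"
  shows "expectation (\<lambda>\<omega>. step_int L \<omega> * elem_int e \<omega>) = inner_dt_dP (step_proc L) (elem_proc e)"
  using assms(2)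
proof (induction L)
  case (Cons e' L)
  then have l: "elementary e'" "elementary_list L" by auto
  show ?case
    using Cons.IH[OF l(2)] elem_isometry[OF l(1) assms(1)]
      Lsq_mult_integrable[OF elem_int_Lsq[OF l(1)] elem_int_Lsq[OF assms(1)]]
      Lsq_mult_integrable[OF step_int_Lsq[OF l(2)] elem_int_Lsq[OF assms(1)]]
      inner_dt_dP_add_left[OF elem_proc_L2[OF l(1)] step_proc_L2[OF l(2)] elem_proc_L2[OF assms(1)]]
    by (simp add: distrib_right)
qed (simp add: inner_dt_dP_def)

text \<open>Bilinearity, one argument at a time. The intervals may overlap in any way, because
  \<open>elem_isometry\<close> already covers mixed products.\<close>

lemma step_int_isometry:
  assumes "elementary_list L" "elementary_list L'"
  shows "expectation (\<lambda>\<omega>. step_int L' \<omega> * step_int L \<omega>) = inner_dt_dP (step_proc L') (step_proc L)"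
  using assms(2)
proof (induction L')
  case (Cons e' L')
  then have l: "elementary e'" "elementary_list L'" by auto
  show ?case
    using Cons.IH[OF l(2)] step_int_isometry1[OF l(1) assms(1), unfolded inner_dt_dP_commute[of _ "elem_proc e'"]]
      Lsq_mult_integrable[OF elem_int_Lsq[OF l(1)] step_int_Lsq[OF assms(1)]]
      Lsq_mult_integrable[OF step_int_Lsq[OF l(2)] step_int_Lsq[OF assms(1)]]
      inner_dt_dP_add_left[OF elem_proc_L2[OF l(1)] step_proc_L2[OF l(2)] step_proc_L2[OF assms(1)]]
    by (simp add: distrib_right mult.commute[of "step_int L _"])
qed (simp add: inner_dt_dP_def)

end

section \<open>The Ito integral as a closed isometry\<close>

context wiener begin

abbreviation sqnorm :: "'a rproc \<Rightarrow> real" where "sqnorm \<phi> \<equiv> (\<integral>p. (\<phi> (fst p) (snd p))\<^sup>2 \<partial>dt_dP)"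

lemma sqnorm_eq_inner: "sqnorm \<phi> = inner_dt_dP \<phi> \<phi>"
  by (simp add: inner_dt_dP_def power2_eq_square)

lemma L2_procD: "L2_proc \<phi> \<Longrightarrow> Lsq dt_dP (\<lambda>p. \<phi> (fst p) (snd p))"
  by (simp add: split_beta')

definition ito :: "'a rproc \<Rightarrow> ('a \<Rightarrow> real) \<Rightarrow> bool" where
  "ito \<phi> J \<longleftrightarrow> L2_proc \<phi> \<and> Lsq M J \<and> (\<forall>\<epsilon>>0. \<exists>L. elementary_list L \<and>
     sqnorm (\<lambda>s \<omega>. step_proc L s \<omega> - \<phi> s \<omega>) < \<epsilon> \<and> expectation (\<lambda>\<omega>. (step_int L \<omega> - J \<omega>)\<^sup>2) < \<epsilon>)"

lemma itoD: "ito \<phi> J \<Longrightarrow> L2_proc \<phi>" "ito \<phi> J \<Longrightarrow> Lsq M J"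
  by (auto simp: ito_def)

lemma itoI:
  assumes "L2_proc \<phi>" "Lsq M J"
    and "\<And>\<epsilon>. 0 < \<epsilon> \<Longrightarrow> \<exists>L. elementary_list L \<and>
     sqnorm (\<lambda>s \<omega>. step_proc L s \<omega> - \<phi> s \<omega>) < \<epsilon> \<and> expectation (\<lambda>\<omega>. (step_int L \<omega> - J \<omega>)\<^sup>2) < \<epsilon>"
  shows "ito \<phi> J"
  using assms by (simp add: ito_def)

lemma itoE:
  assumes "ito \<phi> J" "0 < \<epsilon>"
  obtains L where "elementary_list L" "sqnorm (\<lambda>s \<omega>. step_proc L s \<omega> - \<phi> s \<omega>) < \<epsilon>"
    "expectation (\<lambda>\<omega>. (step_int L \<omega> - J \<omega>)\<^sup>2) < \<epsilon>"
  using assms by (auto simp: ito_def)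

text \<open>It is enough to approximate by pairs already in the closure. This handles changes on
  null sets and the product rule without constructing new step processes.\<close>

lemma ito_closed:
  assumes \<phi>: "L2_proc \<phi>" and J: "Lsq M J"
    and ap: "\<And>\<epsilon>. 0 < \<epsilon> \<Longrightarrow> \<exists>\<psi> K. ito \<psi> K \<and>
      sqnorm (\<lambda>s \<omega>. \<psi> s \<omega> - \<phi> s \<omega>) < \<epsilon> \<and> expectation (\<lambda>\<omega>. (K \<omega> - J \<omega>)\<^sup>2) < \<epsilon>"
  shows "ito \<phi> J"
proof (rule itoI[OF \<phi> J])
  fix \<epsilon> :: real assume \<epsilon>: "0 < \<epsilon>"
  \<comment> \<open>Quarters, because the triangle inequality for squares doubles each term.\<close>
  obtain \<psi> K where K: "ito \<psi> K" "sqnorm (\<lambda>s \<omega>. \<psi> s \<omega> - \<phi> s \<omega>) < \<epsilon> / 4"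
    "expectation (\<lambda>\<omega>. (K \<omega> - J \<omega>)\<^sup>2) < \<epsilon> / 4" using ap[of "\<epsilon> / 4"] \<epsilon> by auto
  obtain L where L: "elementary_list L" "sqnorm (\<lambda>s \<omega>. step_proc L s \<omega> - \<psi> s \<omega>) < \<epsilon> / 4"
    "expectation (\<lambda>\<omega>. (step_int L \<omega> - K \<omega>)\<^sup>2) < \<epsilon> / 4" using itoE[OF K(1), of "\<epsilon> / 4"] \<epsilon> by auto
  have "sqnorm (\<lambda>s \<omega>. step_proc L s \<omega> - \<phi> s \<omega>) < \<epsilon>"
    using Lsq_integral_triangle_sq[OF L2_procD[OF step_proc_L2[OF L(1)]] L2_procD[OF itoD(1)[OF K(1)]] L2_procD[OF \<phi>]]
      K(2) L(2) by linarith
  moreover have "expectation (\<lambda>\<omega>. (step_int L \<omega> - J \<omega>)\<^sup>2) < \<epsilon>"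
    using Lsq_integral_triangle_sq[OF step_int_Lsq[OF L(1)] itoD(2)[OF K(1)] J] K(3) L(3) by linarith
  ultimately show "\<exists>L. elementary_list L \<and> sqnorm (\<lambda>s \<omega>. step_proc L s \<omega> - \<phi> s \<omega>) < \<epsilon> \<and>
      expectation (\<lambda>\<omega>. (step_int L \<omega> - J \<omega>)\<^sup>2) < \<epsilon>" using L(1) by blast
qed

lemma ito_add:
  assumes a: "ito \<phi> J" and b: "ito \<psi> K"
  shows "ito (\<lambda>s \<omega>. \<phi> s \<omega> + \<psi> s \<omega>) (\<lambda>\<omega>. J \<omega> + K \<omega>)"
proof (rule itoI)
  show "L2_proc (\<lambda>s \<omega>. \<phi> s \<omega> + \<psi> s \<omega>)" "Lsq M (\<lambda>\<omega>. J \<omega> + K \<omega>)"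
    using a b by (auto intro: L2_proc_add Lsq_add dest: itoD)
  fix \<epsilon> :: real assume \<epsilon>: "0 < \<epsilon>"
  obtain L where L: "elementary_list L" "sqnorm (\<lambda>s \<omega>. step_proc L s \<omega> - \<phi> s \<omega>) < \<epsilon> / 4"
    "expectation (\<lambda>\<omega>. (step_int L \<omega> - J \<omega>)\<^sup>2) < \<epsilon> / 4" using itoE[OF a, of "\<epsilon> / 4"] \<epsilon> by auto
  obtain N where N: "elementary_list N" "sqnorm (\<lambda>s \<omega>. step_proc N s \<omega> - \<psi> s \<omega>) < \<epsilon> / 4"
    "expectation (\<lambda>\<omega>. (step_int N \<omega> - K \<omega>)\<^sup>2) < \<epsilon> / 4" using itoE[OF b, of "\<epsilon> / 4"] \<epsilon> by auto
  have e: "elementary_list (L @ N)" using L N by auto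
  have "sqnorm (\<lambda>s \<omega>. step_proc (L @ N) s \<omega> - (\<phi> s \<omega> + \<psi> s \<omega>)) < \<epsilon>"
    using Lsq_integral_add_sq_le[OF L2_procD[OF L2_proc_diff[OF step_proc_L2[OF L(1)] itoD(1)[OF a]]]
      L2_procD[OF L2_proc_diff[OF step_proc_L2[OF N(1)] itoD(1)[OF b]]]] L(2) N(2)
    by (simp add: algebra_simps)
  moreover have "expectation (\<lambda>\<omega>. (step_int (L @ N) \<omega> - (J \<omega> + K \<omega>))\<^sup>2) < \<epsilon>"
    using Lsq_integral_add_sq_le[OF Lsq_diff[OF step_int_Lsq[OF L(1)] itoD(2)[OF a]]
      Lsq_diff[OF step_int_Lsq[OF N(1)] itoD(2)[OF b]]] L(3) N(3)
    by (simp add: algebra_simps)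
  ultimately show "\<exists>L. elementary_list L \<and> sqnorm (\<lambda>s \<omega>. step_proc L s \<omega> - (\<phi> s \<omega> + \<psi> s \<omega>)) < \<epsilon> \<and>
      expectation (\<lambda>\<omega>. (step_int L \<omega> - (J \<omega> + K \<omega>))\<^sup>2) < \<epsilon>" using e by blast
qed

lemma ito_0: "ito (\<lambda>s \<omega>. 0) (\<lambda>\<omega>. 0)"
proof (rule itoI[OF L2_proc_0])
  show "\<exists>L. elementary_list L \<and> sqnorm (\<lambda>s \<omega>. step_proc L s \<omega> - 0) < \<epsilon> \<and> expectation (\<lambda>\<omega>. (step_int L \<omega> - 0)\<^sup>2) < \<epsilon>"
    if "0 < \<epsilon>" for \<epsilon> by (rule exI[of _ "[]"]) (use that in simp)
qed simp

lemma step_scale: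
  fixes c :: real
  defines "sc \<equiv> (\<lambda>(a :: real, b :: real, \<xi> :: 'a \<Rightarrow> real). (a, b, \<lambda>\<omega>. c * \<xi> \<omega>))"
  assumes "elementary_list L"
  shows "elementary_list (map sc L)" "step_proc (map sc L) = (\<lambda>s \<omega>. c * step_proc L s \<omega>)"
    "step_int (map sc L) = (\<lambda>\<omega>. c * step_int L \<omega>)"
proof -
  have "elementary (sc e)" if e: "elementary e" for e
  proof -
    obtain a b \<xi> where ab: "e = (a, b, \<xi>)" by (rule prod_cases3)
    note e' = e[unfolded ab]
    obtain K where K: "\<forall>\<omega>\<in>space M. \<bar>\<xi> \<omega>\<bar> \<le> K" using elementaryD(5)[OF e'] by blast
    have "\<forall>\<omega>\<in>space M. \<bar>c * \<xi> \<omega>\<bar> \<le> \<bar>c\<bar> * K" using K by (simp add: abs_mult mult_left_mono)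
    then show ?thesis using elementaryD(1-4)[OF e'] by (auto simp: sc_def ab elementary_def)
  qed
  then show "elementary_list (map sc L)" using assms(2) by auto
  have "elem_proc (sc e) s \<omega> = c * elem_proc e s \<omega>" "elem_int (sc e) \<omega> = c * elem_int e \<omega>" for e s \<omega>
    by (auto simp: sc_def elem_proc_def elem_int_def split: prod.splits)
  then show "step_proc (map sc L) = (\<lambda>s \<omega>. c * step_proc L s \<omega>)" "step_int (map sc L) = (\<lambda>\<omega>. c * step_int L \<omega>)"
    by (induction L) (auto simp: distrib_left)
qed

lemma ito_cmult:
  assumes a: "ito \<phi> J"
  shows "ito (\<lambda>s \<omega>. c * \<phi> s \<omega>) (\<lambda>\<omega>. c * J \<omega>)"
proof (rule itoI)
  show "L2_proc (\<lambda>s \<omega>. c * \<phi> s \<omega>)" "Lsq M (\<lambda>\<omega>. c * J \<omega>)"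
    using a by (auto intro: L2_proc_cmult Lsq_cmult dest: itoD)
  fix \<epsilon> :: real assume \<epsilon>: "0 < \<epsilon>"
  \<comment> \<open>The summand 1 keeps the quotient meaningful for c = 0, and c^2 times a
    nonnegative number below it stays below \<epsilon>.\<close>
  let ?e = "\<epsilon> / (c\<^sup>2 + 1)"
  have c: "0 < c\<^sup>2 + 1" by (simp add: add_nonneg_pos)
  then have e: "0 < ?e" using \<epsilon> by simp
  have lt: "c\<^sup>2 * x < \<epsilon>" if "0 \<le> x" "x < ?e" for x
  proof -
    have "x * (c\<^sup>2 + 1) < \<epsilon>" using that(2) c by (simp add: pos_less_divide_eq)
    then show ?thesis using that(1) by (simp add: algebra_simps)
  qed
  obtain L where L: "elementary_list L" "sqnorm (\<lambda>s \<omega>. step_proc L s \<omega> - \<phi> s \<omega>) < ?e"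
    "expectation (\<lambda>\<omega>. (step_int L \<omega> - J \<omega>)\<^sup>2) < ?e" using itoE[OF a e] .
  note g = step_scale[OF L(1), of c]
  have "sqnorm (\<lambda>s \<omega>. c * step_proc L s \<omega> - c * \<phi> s \<omega>) < \<epsilon>"
    using lt[OF _ L(2)] by (simp add: power_mult_distrib flip: right_diff_distrib)
  moreover have "expectation (\<lambda>\<omega>. (c * step_int L \<omega> - c * J \<omega>)\<^sup>2) < \<epsilon>"
    using lt[OF _ L(3)] by (simp add: power_mult_distrib flip: right_diff_distrib)
  ultimately show "\<exists>L. elementary_list L \<and> sqnorm (\<lambda>s \<omega>. step_proc L s \<omega> - c * \<phi> s \<omega>) < \<epsilon> \<and>
      expectation (\<lambda>\<omega>. (step_int L \<omega> - c * J \<omega>)\<^sup>2) < \<epsilon>"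
    using g by (intro exI[of _ "map (\<lambda>(a, b, \<xi>). (a, b, \<lambda>\<omega>. c * \<xi> \<omega>)) L"]) (auto simp del: set_map)
qed

lemma ito_minus: "ito \<phi> J \<Longrightarrow> ito \<psi> K \<Longrightarrow> ito (\<lambda>s \<omega>. \<phi> s \<omega> - \<psi> s \<omega>) (\<lambda>\<omega>. J \<omega> - K \<omega>)"
  using ito_add[of \<phi> J "\<lambda>s \<omega>. - 1 * \<psi> s \<omega>" "\<lambda>\<omega>. - 1 * K \<omega>"] ito_cmult[of \<psi> K "- 1"] by simp

lemma ito_sum: "finite I \<Longrightarrow> (\<And>i. i \<in> I \<Longrightarrow> ito (\<phi> i) (J i)) \<Longrightarrow>
    ito (\<lambda>s \<omega>. \<Sum>i\<in>I. \<phi> i s \<omega>) (\<lambda>\<omega>. \<Sum>i\<in>I. J i \<omega>)"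
  by (induction I rule: finite_induct) (auto intro: ito_add ito_0)

lemma sqnorm_cong_AE:
  assumes "L2_proc \<phi>" "L2_proc \<psi>" "AE p in dt_dP. \<phi> (fst p) (snd p) = \<psi> (fst p) (snd p)"
  shows "sqnorm \<phi> = sqnorm \<psi>"
  using assms LsqD(2)[OF L2_procD[OF assms(1)]] LsqD(2)[OF L2_procD[OF assms(2)]]
  by (intro integral_cong_AE) auto

lemma ito_cong_AE:
  assumes a: "ito \<phi> J" and p: "L2_proc \<psi>" "AE p in dt_dP. \<phi> (fst p) (snd p) = \<psi> (fst p) (snd p)"
    and k: "Lsq M K" "AE \<omega> in M. J \<omega> = K \<omega>"
  shows "ito \<psi> K"
proof (rule ito_closed[OF p(1) k(1)])
  fix \<epsilon> :: real assume e: "0 < \<epsilon>"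
  \<comment> \<open>The original pair approximates the modified one with error exactly 0.\<close>
  have "sqnorm (\<lambda>s \<omega>. \<phi> s \<omega> - \<psi> s \<omega>) = sqnorm (\<lambda>s \<omega>. 0)"
    using p(2) by (intro sqnorm_cong_AE L2_proc_diff itoD(1)[OF a] p(1) L2_proc_0) auto
  moreover have "expectation (\<lambda>\<omega>. (J \<omega> - K \<omega>)\<^sup>2) = expectation (\<lambda>\<omega>. 0)"
    using k(2) LsqD(1)[OF k(1)] LsqD(1)[OF itoD(2)[OF a]] by (intro integral_cong_AE) auto
  ultimately show "\<exists>\<psi>' K'. ito \<psi>' K' \<and> sqnorm (\<lambda>s \<omega>. \<psi>' s \<omega> - \<psi> s \<omega>) < \<epsilon> \<and>
      expectation (\<lambda>\<omega>. (K' \<omega> - K \<omega>)\<^sup>2) < \<epsilon>" using a e by (intro exI[of _ \<phi>] exI[of _ J]) simp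
qed

lemma inverse_Suc_tendsto_0:
  fixes f :: "nat \<Rightarrow> real"
  assumes "\<And>r. 0 \<le> f r" "\<And>r. f r < 1 / real (Suc r)"
  shows "f \<longlonglongrightarrow> 0"
proof (rule Lim_null_comparison)
  show "(\<lambda>r. 1 / real (Suc r)) \<longlonglongrightarrow> 0" by (rule lim_1_over_n[THEN LIMSEQ_Suc])
  show "\<forall>\<^sub>F r in sequentially. norm (f r) \<le> 1 / real (Suc r)"
    using assms by (intro always_eventually) (simp add: less_imp_le)
qed

lemma ito_seq:
  assumes "ito \<phi> J"
  obtains L where "\<forall>r. elementary_list (L r)" "(\<lambda>r. sqnorm (\<lambda>s \<omega>. step_proc (L r) s \<omega> - \<phi> s \<omega>)) \<longlonglongrightarrow> 0"
    "(\<lambda>r. expectation (\<lambda>\<omega>. (step_int (L r) \<omega> - J \<omega>)\<^sup>2)) \<longlonglongrightarrow> 0"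
proof -
  have "\<exists>L. \<forall>r. elementary_list (L r) \<and> sqnorm (\<lambda>s \<omega>. step_proc (L r) s \<omega> - \<phi> s \<omega>) < 1 / real (Suc r) \<and>
      expectation (\<lambda>\<omega>. (step_int (L r) \<omega> - J \<omega>)\<^sup>2) < 1 / real (Suc r)"
    by (rule choice, rule allI) (use assms in \<open>simp add: ito_def del: of_nat_Suc\<close>)
  then obtain L where L': "\<forall>r. elementary_list (L r) \<and> sqnorm (\<lambda>s \<omega>. step_proc (L r) s \<omega> - \<phi> s \<omega>) < 1 / real (Suc r) \<and>
      expectation (\<lambda>\<omega>. (step_int (L r) \<omega> - J \<omega>)\<^sup>2) < 1 / real (Suc r)" by (rule exE)
  have L: "elementary_list (L r)" "sqnorm (\<lambda>s \<omega>. step_proc (L r) s \<omega> - \<phi> s \<omega>) < 1 / real (Suc r)"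
    "expectation (\<lambda>\<omega>. (step_int (L r) \<omega> - J \<omega>)\<^sup>2) < 1 / real (Suc r)" for r
    using spec[OF L', of r] by (simp_all only:)
  show thesis
  proof (rule that)
    show "\<forall>r. elementary_list (L r)" using L(1) by blast
    show "(\<lambda>r. sqnorm (\<lambda>s \<omega>. step_proc (L r) s \<omega> - \<phi> s \<omega>)) \<longlonglongrightarrow> 0"
      by (rule inverse_Suc_tendsto_0) (simp_all add: L(2) del: of_nat_Suc)
    show "(\<lambda>r. expectation (\<lambda>\<omega>. (step_int (L r) \<omega> - J \<omega>)\<^sup>2)) \<longlonglongrightarrow> 0"
      by (rule inverse_Suc_tendsto_0) (simp_all add: L(3) del: of_nat_Suc)
  qed
qed

text \<open>One sequence of step processes converges to \<phi> while its integrals converge to J, so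
  the isometry for step processes can be followed to the limit on both sides.\<close>

lemma ito_isometry:
  assumes "ito \<phi> J"
  shows "expectation (\<lambda>\<omega>. (J \<omega>)\<^sup>2) = sqnorm \<phi>"
proof -
  obtain L where L': "\<forall>r. elementary_list (L r)" "(\<lambda>r. sqnorm (\<lambda>s \<omega>. step_proc (L r) s \<omega> - \<phi> s \<omega>)) \<longlonglongrightarrow> 0"
    "(\<lambda>r. expectation (\<lambda>\<omega>. (step_int (L r) \<omega> - J \<omega>)\<^sup>2)) \<longlonglongrightarrow> 0" by (rule ito_seq[OF assms])
  note L = spec[OF L'(1)] L'(2,3)
  note \<phi> = itoD(1)[OF assms] and J = itoD(2)[OF assms]
  have "(\<lambda>r. expectation (\<lambda>\<omega>. step_int (L r) \<omega> * step_int (L r) \<omega>)) \<longlonglongrightarrow> expectation (\<lambda>\<omega>. J \<omega> * J \<omega>)"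
    by (intro Lsq_inner_tendsto J step_int_Lsq L)
  moreover have "(\<lambda>r. inner_dt_dP (step_proc (L r)) (step_proc (L r))) \<longlonglongrightarrow> inner_dt_dP \<phi> \<phi>"
    unfolding inner_dt_dP_def by (intro Lsq_inner_tendsto L2_procD \<phi> step_proc_L2 L)
  ultimately have "expectation (\<lambda>\<omega>. J \<omega> * J \<omega>) = inner_dt_dP \<phi> \<phi>"
    unfolding step_int_isometry[OF L(1) L(1)] by (rule LIMSEQ_unique)
  then show ?thesis unfolding sqnorm_eq_inner by (simp add: power2_eq_square)
qed

text \<open>If a > t, the interval degenerates to (t, t], and \<xi>, known only at time a, has to be
  replaced by 0 to be measurable at the new start t. No such replacement occurs in
  \<open>elem_after\<close>, where the start only moves forward.\<close>

definition elem_until :: "real \<Rightarrow> real \<times> real \<times> ('a \<Rightarrow> real) \<Rightarrow> real \<times> real \<times> ('a \<Rightarrow> real)" where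
  "elem_until t e = (case e of (a, b, \<xi>) \<Rightarrow> (min t a, min t b, \<lambda>\<omega>. if a \<le> t then \<xi> \<omega> else 0))"

definition elem_after :: "real \<Rightarrow> real \<times> real \<times> ('a \<Rightarrow> real) \<Rightarrow> real \<times> real \<times> ('a \<Rightarrow> real)" where
  "elem_after t e = (case e of (a, b, \<xi>) \<Rightarrow> (max t a, max t b, \<xi>))"

lemma elem_until_elementary:
  assumes "elementary e" "0 \<le> t" "t \<le> T" shows "elementary (elem_until t e)"
proof -
  obtain a b \<xi> where ab: "e = (a, b, \<xi>)" by (rule prod_cases3)
  note e = elementaryD[OF assms(1)[unfolded ab]]
  obtain K where K: "\<forall>\<omega>\<in>space M. \<bar>\<xi> \<omega>\<bar> \<le> K" using e(5) by blast
  show ?thesis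
  proof (cases "a \<le> t")
    case True
    then show ?thesis using e assms by (auto simp: elem_until_def ab elementary_def min_def)
  next
    case False
    then show ?thesis using e assms by (auto simp: elem_until_def ab elementary_def)
  qed
qed

lemma elem_after_elementary:
  assumes "elementary e" "0 \<le> t" "t \<le> T" shows "elementary (elem_after t e)"
proof -
  obtain a b \<xi> where ab: "e = (a, b, \<xi>)" by (rule prod_cases3)
  note e = elementaryD[OF assms(1)[unfolded ab]]
  have "\<xi> \<in> borel_measurable (Fil (max t a))" by (rule meas_Fil_mono[OF e(4)]) simp
  then show ?thesis using e assms by (auto simp: elem_after_def ab elementary_def)
qed

lemma elem_proc_until: "elem_proc (elem_until t e) s \<omega> = elem_proc e s \<omega> * indicator {..t} s"
  by (auto simp: elem_until_def elem_proc_def indicator_def split: prod.splits)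

lemma elem_int_split:
  assumes "elementary e"
  shows "elem_int e \<omega> = elem_int (elem_until t e) \<omega> + elem_int (elem_after t e) \<omega>"
proof -
  obtain a b \<xi> where ab: "e = (a, b, \<xi>)" by (rule prod_cases3)
  note e = elementaryD[OF assms(1)[unfolded ab]]
  show ?thesis using e(2)
    by (auto simp: ab elem_until_def elem_after_def elem_int_def min_def max_def algebra_simps)
qed

lemma step_int_split:
  "elementary_list L \<Longrightarrow> step_int L \<omega> = step_int (map (elem_until t) L) \<omega> + step_int (map (elem_after t) L) \<omega>"
  by (induction L) (auto simp: elem_int_split[of _ _ t])

lemma step_proc_until: "step_proc (map (elem_until t) L) s \<omega> = step_proc L s \<omega> * indicator {..t} s"
  by (induction L) (auto simp: elem_proc_until distrib_right)

lemma step_int_after_orth: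
  assumes "elementary_list L" "0 \<le> t" "t \<le> T" and g: "g \<in> borel_measurable (Fil t)" "Lsq M g"
  shows "expectation (\<lambda>\<omega>. g \<omega> * step_int (map (elem_after t) L) \<omega>) = 0"
  using assms(1)
proof (induction L)
  case (Cons e L)
  then have l: "elementary e" "elementary_list L" by auto
  obtain a b \<xi> where ab: "e = (a, b, \<xi>)" by (rule prod_cases3)
  have h: "elementary (max t a, max t b, \<xi>)" using elem_after_elementary[OF l(1) assms(2,3)] by (simp add: ab elem_after_def)
  have 0: "expectation (\<lambda>\<omega>. g \<omega> * elem_int (elem_after t e) \<omega>) = 0"
    using elem_int_adapted_orth[OF h meas_Fil_mono[OF g(1)] g(2)] by (simp add: ab elem_after_def)
  have el: "elementary_list (map (elem_after t) L)" using l(2) elem_after_elementary[OF _ assms(2,3)] by auto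
  show ?case
    using Cons.IH[OF l(2)] 0 Lsq_mult_integrable[OF g(2) elem_int_Lsq[OF elem_after_elementary[OF l(1) assms(2,3)]]]
      Lsq_mult_integrable[OF g(2) step_int_Lsq[OF el]]
    by (simp add: distrib_left)
qed simp

text \<open>An approximant may charge times up to t, but \<phi> vanishes there, so that part is no
  larger than the distance of the approximant to \<phi> and disappears in the limit. The part after
  t is orthogonal to whatever is known at t.\<close>

lemma ito_orth:
  assumes ito: "ito \<phi> J" and t: "0 \<le> t" "t \<le> T" and g: "g \<in> borel_measurable (Fil t)" "Lsq M g"
    and z: "\<And>s \<omega>. s \<le> t \<Longrightarrow> \<phi> s \<omega> = 0"
  shows "expectation (\<lambda>\<omega>. g \<omega> * J \<omega>) = 0"
proof -
  obtain L where L': "\<forall>r. elementary_list (L r)" "(\<lambda>r. sqnorm (\<lambda>s \<omega>. step_proc (L r) s \<omega> - \<phi> s \<omega>)) \<longlonglongrightarrow> 0"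
    "(\<lambda>r. expectation (\<lambda>\<omega>. (step_int (L r) \<omega> - J \<omega>)\<^sup>2)) \<longlonglongrightarrow> 0" by (rule ito_seq[OF ito])
  note L = spec[OF L'(1)] L'(2,3)
  note \<phi> = itoD(1)[OF ito] and J = itoD(2)[OF ito]
  define I where "I r = step_int (map (elem_until t) (L r))" for r
  have el: "elementary_list (map (elem_until t) (L r))" and eh: "elementary_list (map (elem_after t) (L r))" for r
    using L(1)[of r] elem_until_elementary[OF _ t] elem_after_elementary[OF _ t] by auto
  have le: "expectation (\<lambda>\<omega>. (I r \<omega>)\<^sup>2) \<le> sqnorm (\<lambda>s \<omega>. step_proc (L r) s \<omega> - \<phi> s \<omega>)" for r
  proof -
    have "expectation (\<lambda>\<omega>. (I r \<omega>)\<^sup>2) = sqnorm (step_proc (map (elem_until t) (L r)))"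
      unfolding sqnorm_eq_inner using step_int_isometry[OF el el] by (simp add: I_def power2_eq_square)
    also have "\<dots> \<le> sqnorm (\<lambda>s \<omega>. step_proc (L r) s \<omega> - \<phi> s \<omega>)"
    proof (rule integral_mono)
      show "integrable dt_dP (\<lambda>p. (step_proc (map (elem_until t) (L r)) (fst p) (snd p))\<^sup>2)"
        by (intro LsqD(2) L2_procD step_proc_L2 el)
      show "integrable dt_dP (\<lambda>p. (step_proc (L r) (fst p) (snd p) - \<phi> (fst p) (snd p))\<^sup>2)"
        using LsqD(2)[OF L2_procD[OF L2_proc_diff[OF step_proc_L2[OF L(1)] \<phi>]]] by simp
      show "(step_proc (map (elem_until t) (L r)) (fst p) (snd p))\<^sup>2
        \<le> (step_proc (L r) (fst p) (snd p) - \<phi> (fst p) (snd p))\<^sup>2" for p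
        by (cases "fst p \<le> t") (simp_all add: step_proc_until z)
    qed
    finally show ?thesis .
  qed
  have "(\<lambda>r. expectation (\<lambda>\<omega>. (I r \<omega> - 0)\<^sup>2)) \<longlonglongrightarrow> 0"
    by (rule Lim_null_comparison[OF _ L(2)]) (use le in simp)
  moreover have I: "Lsq M (I r)" for r unfolding I_def by (rule step_int_Lsq[OF el])
  ultimately have "(\<lambda>r. expectation (\<lambda>\<omega>. g \<omega> * I r \<omega>)) \<longlonglongrightarrow> expectation (\<lambda>\<omega>. g \<omega> * 0)"
    by (intro Lsq_inner_tendsto[OF g(2) g(2)]) simp_all
  moreover have "expectation (\<lambda>\<omega>. g \<omega> * I r \<omega>) = expectation (\<lambda>\<omega>. g \<omega> * step_int (L r) \<omega>)" for r
    using step_int_after_orth[OF L(1) t g] Lsq_mult_integrable[OF g(2) I[of r]]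
      Lsq_mult_integrable[OF g(2) step_int_Lsq[OF eh[of r]]]
    by (simp add: step_int_split[OF L(1), where t = t] distrib_left I_def)
  moreover have "(\<lambda>r. expectation (\<lambda>\<omega>. g \<omega> * step_int (L r) \<omega>)) \<longlonglongrightarrow> expectation (\<lambda>\<omega>. g \<omega> * J \<omega>)"
    by (intro Lsq_inner_tendsto[OF g(2) g(2) J step_int_Lsq _ L(3)] L(1)) simp
  ultimately show ?thesis using LIMSEQ_unique by fastforce
qed

text \<open>Connects the integral of the game's definitions with the closure \<open>ito\<close>. An
  integral up to t becomes an integral over [0, T] of the integrand restricted to (0, t].\<close>

lemma has_ito_integral_ito:
  assumes h: "has_ito_integral M T W \<phi> t J" and t: "0 \<le> t" "t \<le> T" and \<phi>: "L2_proc \<phi>"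
  shows "ito (\<lambda>s \<omega>. \<phi> s \<omega> * indicator {0<..t} s) J"
proof -
  obtain N \<tau> \<xi> where sd: "\<And>r::nat. simple_data M T W (N r) (\<tau> r) (\<xi> r)"
    and c1: "(\<lambda>r. \<integral>\<^sup>+\<omega>. (\<integral>\<^sup>+s\<in>{0..t}.
            ennreal ((simple_proc (N r) (\<tau> r) (\<xi> r) s \<omega> - \<phi> s \<omega>)\<^sup>2) \<partial>lborel) \<partial>M) \<longlonglongrightarrow> 0"
    and c2: "(\<lambda>r. \<integral>\<^sup>+\<omega>.
            ennreal ((simple_integral_W W (N r) (\<tau> r) (\<xi> r) t \<omega> - J \<omega>)\<^sup>2) \<partial>M) \<longlonglongrightarrow> 0"
    and J: "J \<in> borel_measurable M"
    using h unfolding has_ito_integral_def by blast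
  \<comment> \<open>The simple processes are compared with \<phi> on [0, t] only and may be anything
    later, so they are cut at t.\<close>
  define L where "L r = map (\<lambda>k. elem_until t (\<tau> r k, \<tau> r (Suc k), \<xi> r k)) [0..<N r]" for r
  have el0: "elementary (\<tau> r k, \<tau> r (Suc k), \<xi> r k)" if "k < N r" for r k
  proof -
    have "\<tau> r k \<in> {0..T}" "\<tau> r (Suc k) \<in> {0..T}" "\<tau> r k \<le> \<tau> r (Suc k)"
      "\<xi> r k \<in> borel_measurable (Fil (\<tau> r k))" "\<exists>K. \<forall>\<omega>\<in>space M. \<bar>\<xi> r k \<omega>\<bar> \<le> K"
      using sd[of r] that by (auto simp: simple_data_def)
    then show ?thesis by (simp add: elementary_def)
  qed
  have el: "elementary_list (L r)" for r using elem_until_elementary[OF el0 t] by (auto simp: L_def)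
  have gp: "step_proc (L r) s \<omega> = simple_proc (N r) (\<tau> r) (\<xi> r) s \<omega> * indicator {..t} s" for r s \<omega>
  proof -
    have "step_proc (L r) s \<omega> = (\<Sum>k<N r. elem_proc (\<tau> r k, \<tau> r (Suc k), \<xi> r k) s \<omega> * indicator {..t} s)"
      by (simp add: step_proc_def L_def comp_def elem_proc_until interv_sum_list_conv_sum_set_nat atLeast0LessThan)
    also have "\<dots> = simple_proc (N r) (\<tau> r) (\<xi> r) s \<omega> * indicator {..t} s"
      unfolding simple_proc_def elem_proc_def sum_distrib_right prod.case ..
    finally show ?thesis .
  qed
  have gi: "step_int (L r) \<omega> = simple_integral_W W (N r) (\<tau> r) (\<xi> r) t \<omega>" for r \<omega>
  proof -
    have "elem_int (elem_until t (\<tau> r k, \<tau> r (Suc k), \<xi> r k)) \<omega>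
      = \<xi> r k \<omega> * (W (min t (\<tau> r (Suc k))) \<omega> - W (min t (\<tau> r k)) \<omega>)" if "k < N r" for k
      using elementaryD(2)[OF el0[OF that]] by (auto simp: elem_until_def elem_int_def min_def)
    then show ?thesis
      by (simp add: step_int_def L_def comp_def simple_integral_W_def
        interv_sum_list_conv_sum_set_nat atLeast0LessThan)
  qed
  let ?\<psi> = "\<lambda>s \<omega>. \<phi> s \<omega> * indicator {0<..t} s"
  have \<psi>: "L2_proc ?\<psi>" by (rule L2_proc_indicator[OF \<phi>]) simp
  have d: "Lsq dt_dP (\<lambda>p. step_proc (L r) (fst p) (snd p) - ?\<psi> (fst p) (snd p))" for r
    using L2_procD[OF L2_proc_diff[OF step_proc_L2[OF el] \<psi>]] by simp
  have n1: "(\<integral>\<^sup>+\<omega>. (\<integral>\<^sup>+s\<in>{0..t}. ennreal ((simple_proc (N r) (\<tau> r) (\<xi> r) s \<omega> - \<phi> s \<omega>)\<^sup>2) \<partial>lborel) \<partial>M)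
     = ennreal (sqnorm (\<lambda>s \<omega>. step_proc (L r) s \<omega> - ?\<psi> s \<omega>))" for r
  proof -
    have "ennreal (sqnorm (\<lambda>s \<omega>. step_proc (L r) s \<omega> - ?\<psi> s \<omega>))
       = (\<integral>\<^sup>+p. ennreal ((step_proc (L r) (fst p) (snd p) - ?\<psi> (fst p) (snd p))\<^sup>2) \<partial>dt_dP)"
      using Lsq_nn_integral[OF d[of r]] by simp
    also have "\<dots> = (\<integral>\<^sup>+\<omega>. (\<integral>\<^sup>+s\<in>{0..T}. ennreal ((step_proc (L r) s \<omega> - ?\<psi> s \<omega>)\<^sup>2) \<partial>lborel) \<partial>M)"
      using LsqD(1)[OF d[of r]] by (subst nn_integral_dt_dP) simp_all
    also have "\<dots> = (\<integral>\<^sup>+\<omega>. (\<integral>\<^sup>+s\<in>{0..t}. ennreal ((simple_proc (N r) (\<tau> r) (\<xi> r) s \<omega> - \<phi> s \<omega>)\<^sup>2) \<partial>lborel) \<partial>M)"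
    proof (rule nn_integral_cong, rule nn_integral_cong_AE)
      fix \<omega>
      show "AE s in lborel. ennreal ((step_proc (L r) s \<omega> - ?\<psi> s \<omega>)\<^sup>2) * indicator {0..T} s =
        ennreal ((simple_proc (N r) (\<tau> r) (\<xi> r) s \<omega> - \<phi> s \<omega>)\<^sup>2) * indicator {0..t} s"
        \<comment> \<open>At time 0 the integrands can differ: the definition measures the error on
          the closed interval, the restricted process vanishes there.\<close>
        using AE_lborel_singleton[of "0::real"]
        by eventually_elim (use t in \<open>auto simp: gp indicator_def\<close>)
    qed
    finally show ?thesis by simp
  qed
  have s1: "(\<lambda>r. sqnorm (\<lambda>s \<omega>. step_proc (L r) s \<omega> - ?\<psi> s \<omega>)) \<longlonglongrightarrow> 0"
    using c1 unfolding n1 by (subst (asm) tendsto_ennreal_iff[of _ _ 0, unfolded ennreal_0]) auto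
  \<comment> \<open>\<open>has_ito_integral\<close> gives J as measurable only. Being at finite mean
    square distance from one step integral makes it square integrable.\<close>
  have "\<forall>\<^sub>F r in sequentially. (\<integral>\<^sup>+\<omega>. ennreal ((step_int (L r) \<omega> - J \<omega>)\<^sup>2) \<partial>M) < 1"
    using order_tendstoD(2)[OF c2, of 1] by (simp add: gi)
  then obtain r0 where r0: "(\<integral>\<^sup>+\<omega>. ennreal ((step_int (L r0) \<omega> - J \<omega>)\<^sup>2) \<partial>M) < 1"
    using eventually_happens by fastforce
  have "Lsq M (\<lambda>\<omega>. step_int (L r0) \<omega> - J \<omega>)"
  proof (rule LsqI_nn_integral)
    show "(\<lambda>\<omega>. step_int (L r0) \<omega> - J \<omega>) \<in> borel_measurable M"
      using LsqD(1)[OF step_int_Lsq[OF el[of r0]]] J by simp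
    show "(\<integral>\<^sup>+\<omega>. ennreal ((step_int (L r0) \<omega> - J \<omega>)\<^sup>2) \<partial>M) < \<infinity>"
      using r0 by (rule order_less_trans) simp
  qed
  from Lsq_diff[OF step_int_Lsq[OF el[of r0]] this] have JL: "Lsq M J" by simp
  have s2: "(\<lambda>r. expectation (\<lambda>\<omega>. (step_int (L r) \<omega> - J \<omega>)\<^sup>2)) \<longlonglongrightarrow> 0"
    using c2 unfolding gi[symmetric] Lsq_nn_integral[OF Lsq_diff[OF step_int_Lsq[OF el] JL]]
    by (subst (asm) tendsto_ennreal_iff[of _ _ 0, unfolded ennreal_0]) auto
  show ?thesis
  proof (rule itoI[OF \<psi> JL])
    fix \<epsilon> :: real assume "0 < \<epsilon>"
    then have "\<forall>\<^sub>F r in sequentially. sqnorm (\<lambda>s \<omega>. step_proc (L r) s \<omega> - ?\<psi> s \<omega>) < \<epsilon> \<and>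
        expectation (\<lambda>\<omega>. (step_int (L r) \<omega> - J \<omega>)\<^sup>2) < \<epsilon>"
      by (intro eventually_conj order_tendstoD(2)[OF s1] order_tendstoD(2)[OF s2])
    then obtain r where "sqnorm (\<lambda>s \<omega>. step_proc (L r) s \<omega> - ?\<psi> s \<omega>) < \<epsilon>"
        "expectation (\<lambda>\<omega>. (step_int (L r) \<omega> - J \<omega>)\<^sup>2) < \<epsilon>"
      using eventually_happens by fastforce
    then show "\<exists>L. elementary_list L \<and> sqnorm (\<lambda>s \<omega>. step_proc L s \<omega> - ?\<psi> s \<omega>) < \<epsilon> \<and>
      expectation (\<lambda>\<omega>. (step_int L \<omega> - J \<omega>)\<^sup>2) < \<epsilon>" using el by blast
  qed
qed

end

section \<open>Ito processes\<close>

context wiener begin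

section \<open>Pathwise time integrals\<close>

abbreviation dt :: "real measure" where "dt \<equiv> restrict_space lborel {0..T}"

lemma AE_dt_dP_path:
  assumes "AE p in dt_dP. P p"
  shows "AE \<omega> in M. AE s in dt. P (s, \<omega>)"
proof -
  interpret Q: pair_sigma_finite M dt ..
  have "AE p in M \<Otimes>\<^sub>M dt. P ((\<lambda>(x, y). (y, x)) p)"
    by (rule AE_distrD[where M' = dt_dP, OF measurable_pair_swap'])
      (rule assms[unfolded arg_cong[OF P.distr_pair_swap, of "\<lambda>N. almost_everywhere N P"]])
  then have "AE p in M \<Otimes>\<^sub>M dt. P (snd p, fst p)" by (simp add: split_beta')
  from Q.AE_pair[OF this] show ?thesis by simp
qed

lemma L2_proc_path:
  assumes "L2_proc \<phi>" shows "AE \<omega> in M. Lsq dt (\<lambda>s. \<phi> s \<omega>)"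
proof -
  interpret Q: pair_sigma_finite M dt ..
  have m: "(\<lambda>(s, \<omega>). \<phi> s \<omega>) \<in> borel_measurable dt_dP" using LsqD(1)[OF assms] .
  have "integrable dt_dP (\<lambda>p. (\<phi> (fst p) (snd p))\<^sup>2)" by (rule LsqD(2)[OF L2_procD[OF assms]])
  from P.integrable_product_swap[OF this] have "integrable (M \<Otimes>\<^sub>M dt) (\<lambda>p. (\<phi> (snd p) (fst p))\<^sup>2)"
    by (simp add: split_beta')
  from Q.AE_integrable_fst'[OF this] AE_space show ?thesis
  proof eventually_elim
    case (elim \<omega>)
    have "(\<lambda>s. \<phi> s \<omega>) \<in> borel_measurable dt"
      using measurable_compose[OF measurable_Pair2'[OF elim(2)] m] by simp
    then show ?case using elim(1) by (simp add: Lsq_def)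
  qed
qed

text \<open>Half-open cells written as a weight: adjacent cells add up exactly, and Cauchy-Schwarz
  against the indicator produces the length of the cell.\<close>

definition tint :: "real \<Rightarrow> real \<Rightarrow> 'a rproc \<Rightarrow> 'a \<Rightarrow> real" where
  "tint a b f \<omega> = (\<integral>r. f r \<omega> * indicator {a<..b} r \<partial>dt)"

lemma indicator_dt [measurable]: "A \<in> sets borel \<Longrightarrow> (indicator A :: real \<Rightarrow> real) \<in> borel_measurable dt"
  by (intro measurable_restrict_space1 borel_measurable_indicator) simp

lemma Lsq_indicator_dt:
  assumes "A \<in> sets borel" shows "Lsq dt (indicator A :: real \<Rightarrow> real)"
  by (rule finite_measure.Lsq_bounded[OF finite_dt indicator_dt[OF assms], of 1]) (simp add: indicator_def)

lemma integral_indicator_dt: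
  assumes "0 \<le> a" "a \<le> b" "b \<le> T"
  shows "(\<integral>r. indicator {a<..b} r \<partial>dt) = b - a"
proof -
  have "{a<..b} \<subseteq> {0..T}" using assms by auto
  then have "(\<integral>r. indicator {a<..b} r \<partial>dt) = measure lborel {a<..b}"
    by (simp add: measure_restrict_space Int_absorb2)
  then show ?thesis using assms by simp
qed

lemma Lsq_dt_ind_integrable: "Lsq dt f \<Longrightarrow> integrable dt (\<lambda>r. f r * indicator {a<..b} r)"
  by (rule Lsq_mult_integrable[OF _ Lsq_indicator_dt]) simp_all

lemma L2_proc_meas_tint: "(\<lambda>(s, \<omega>). f s \<omega>) \<in> borel_measurable dt_dP \<Longrightarrow> tint a b f \<in> borel_measurable M"
proof -
  assume "(\<lambda>(s, \<omega>). f s \<omega>) \<in> borel_measurable dt_dP"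
  from borel_measurable_times[OF this indicator_meas_dt_dP[of "{a<..b}"]]
  have "(\<lambda>(s, \<omega>). f s \<omega> * indicator {a<..b} s) \<in> borel_measurable dt_dP" by (simp add: split_beta')
  from measurable_pair_swap[OF this]
  have "(\<lambda>(\<omega>, s). f s \<omega> * indicator {a<..b} s) \<in> borel_measurable (M \<Otimes>\<^sub>M dt)" by simp
  from P.M1.borel_measurable_lebesgue_integral[OF this]
  show ?thesis unfolding tint_def[abs_def] .
qed

text \<open>Cauchy-Schwarz on each path against the indicator of (a, b], then integration over
  outcomes. The factor b - a is what makes short intervals contract in the uniqueness proof.\<close>

lemma tint_Lsq:
  assumes f: "L2_proc f" and ab: "0 \<le> a" "a \<le> b" "b \<le> T"
  shows "Lsq M (tint a b f)"
    "expectation (\<lambda>\<omega>. (tint a b f \<omega>)\<^sup>2) \<le> (b - a) * sqnorm (\<lambda>s \<omega>. f s \<omega> * indicator {a<..b} s)"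
proof -
  interpret Q: pair_sigma_finite M dt ..
  let ?g = "\<lambda>s \<omega>. f s \<omega> * indicator {a<..b} s"
  let ?G = "\<lambda>\<omega>. \<integral>s. (?g s \<omega>)\<^sup>2 \<partial>dt"
  have g: "L2_proc ?g" by (rule L2_proc_indicator[OF f]) simp
  have m: "tint a b f \<in> borel_measurable M" by (rule L2_proc_meas_tint[OF LsqD(1)[OF f]])
  have path: "AE \<omega> in M. (tint a b f \<omega>)\<^sup>2 \<le> (b - a) * ?G \<omega>"
    using L2_proc_path[OF g]
  proof eventually_elim
    case (elim \<omega>)
    have "(\<integral>r. indicator {a<..b} r * ?g r \<omega> \<partial>dt)\<^sup>2
       \<le> (\<integral>r. (indicator {a<..b} r)\<^sup>2 \<partial>dt) * ?G \<omega>"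
      by (rule Lsq_Cauchy_Schwarz[OF Lsq_indicator_dt elim]) simp
    moreover have "(indicator {a<..b} r :: real)\<^sup>2 = indicator {a<..b} r"
      "indicator {a<..b} r * ?g r \<omega> = f r \<omega> * indicator {a<..b} r" for r
      by (auto simp: indicator_def)
    ultimately show ?case using integral_indicator_dt[OF ab] by (simp add: tint_def)
  qed
  have i: "integrable dt_dP (\<lambda>p. (?g (fst p) (snd p))\<^sup>2)" by (rule LsqD(2)[OF L2_procD[OF g]])
  have i': "integrable (M \<Otimes>\<^sub>M dt) (\<lambda>p. (?g (snd p) (fst p))\<^sup>2)"
    using P.integrable_product_swap[OF i] by (simp add: split_beta')
  have iG: "integrable M ?G" using Q.integrable_fst'[OF i'] by simp
  have eG: "expectation ?G = sqnorm ?g"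
    using Q.integral_fst'[OF i'] P.integral_product_swap[OF borel_measurable_integrable[OF i]]
    by (simp add: split_beta')
  have it: "integrable M (\<lambda>\<omega>. (tint a b f \<omega>)\<^sup>2)"
  proof (rule Bochner_Integration.integrable_bound)
    show "integrable M (\<lambda>\<omega>. (b - a) * ?G \<omega>)" using iG by simp
    show "(\<lambda>\<omega>. (tint a b f \<omega>)\<^sup>2) \<in> borel_measurable M" using m by simp
    show "AE \<omega> in M. norm ((tint a b f \<omega>)\<^sup>2) \<le> norm ((b - a) * ?G \<omega>)"
      using path by eventually_elim (auto intro: order_trans)
  qed
  then show "Lsq M (tint a b f)" using m by (simp add: Lsq_def)
  have "expectation (\<lambda>\<omega>. (tint a b f \<omega>)\<^sup>2) \<le> expectation (\<lambda>\<omega>. (b - a) * ?G \<omega>)"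
    using it iG path by (intro integral_mono_AE) auto
  then show "expectation (\<lambda>\<omega>. (tint a b f \<omega>)\<^sup>2) \<le> (b - a) * sqnorm ?g"
    using eG by simp
qed

lemma tint_diff_AE:
  assumes "L2_proc f" "L2_proc g"
  shows "AE \<omega> in M. tint a b (\<lambda>s \<omega>. f s \<omega> - g s \<omega>) \<omega> = tint a b f \<omega> - tint a b g \<omega>"
  using L2_proc_path[OF assms(1)] L2_proc_path[OF assms(2)]
  by eventually_elim
    (simp add: tint_def left_diff_distrib Bochner_Integration.integral_diff Lsq_dt_ind_integrable)

text \<open>The factor may depend on the outcome: it is a frozen value of \<phi> in one use and a
  value of the process at a grid point in the other.\<close>

lemma tint_cmult: "tint a b (\<lambda>s \<omega>. c \<omega> * f s \<omega>) \<omega> = c \<omega> * tint a b f \<omega>"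
  by (simp add: tint_def mult.assoc)

lemma tint_join_AE:
  assumes "L2_proc f" "a \<le> b" "b \<le> c"
  shows "AE \<omega> in M. tint a c f \<omega> = tint a b f \<omega> + tint b c f \<omega>"
  using L2_proc_path[OF assms(1)]
proof eventually_elim
  case (elim \<omega>)
  have "indicator {a<..c} r = (indicator {a<..b} r + indicator {b<..c} r :: real)" for r
    using assms(2,3) by (auto simp: indicator_def)
  then show ?case
    by (simp add: tint_def distrib_left Bochner_Integration.integral_add Lsq_dt_ind_integrable elim)
qed

lemma tint_cong_AE:
  assumes "AE p in dt_dP. f (fst p) (snd p) = g (fst p) (snd p)"
    and "L2_proc f" "L2_proc g"
  shows "AE \<omega> in M. tint a b f \<omega> = tint a b g \<omega>"
  using AE_dt_dP_path[OF assms(1)] L2_proc_path[OF assms(2)] L2_proc_path[OF assms(3)]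
proof eventually_elim
  case (elim \<omega>)
  note m = borel_measurable_integrable[OF Lsq_dt_ind_integrable[OF elim(2)]]
    borel_measurable_integrable[OF Lsq_dt_ind_integrable[OF elim(3)]]
  show ?case unfolding tint_def
    by (rule integral_cong_AE[OF m]) (use elim(1) in auto)
qed

lemma sqnorm_ind_le_sqnorm:
  assumes "L2_proc f" "A \<in> sets borel"
  shows "sqnorm (\<lambda>s \<omega>. f s \<omega> * indicator A s) \<le> sqnorm f"
proof (rule integral_mono)
  show "integrable dt_dP (\<lambda>p. (f (fst p) (snd p) * indicator A (fst p))\<^sup>2)"
    using LsqD(2)[OF L2_procD[OF L2_proc_indicator[OF assms]]] by simp
  show "integrable dt_dP (\<lambda>p. (f (fst p) (snd p))\<^sup>2)" by (rule LsqD(2)[OF L2_procD[OF assms(1)]])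
qed (simp add: indicator_def)

lemma sqnorm_join:
  assumes "L2_proc f" "a \<le> b" "b \<le> c"
  shows "sqnorm (\<lambda>s \<omega>. f s \<omega> * indicator {a<..c} s)
    = sqnorm (\<lambda>s \<omega>. f s \<omega> * indicator {a<..b} s) + sqnorm (\<lambda>s \<omega>. f s \<omega> * indicator {b<..c} s)"
proof -
  have "(f s \<omega> * indicator {a<..c} s)\<^sup>2 = (f s \<omega> * indicator {a<..b} s)\<^sup>2 + (f s \<omega> * indicator {b<..c} s)\<^sup>2"
    for s \<omega> using assms(2,3) by (auto simp: indicator_def)
  then show ?thesis
    using LsqD(2)[OF L2_procD[OF L2_proc_indicator[OF assms(1), of "{a<..b}"]]]
      LsqD(2)[OF L2_procD[OF L2_proc_indicator[OF assms(1), of "{b<..c}"]]] by simp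
qed

lemma sqnorm_le_sections:
  assumes f: "L2_proc f" and ab: "0 \<le> a" "a \<le> b" "b \<le> T"
    and c: "\<And>s. a < s \<Longrightarrow> s \<le> b \<Longrightarrow> expectation (\<lambda>\<omega>. (f s \<omega>)\<^sup>2) \<le> c"
  shows "sqnorm (\<lambda>s \<omega>. f s \<omega> * indicator {a<..b} s) \<le> (b - a) * c"
proof -
  have i: "integrable dt_dP (\<lambda>p. (f (fst p) (snd p) * indicator {a<..b} (fst p))\<^sup>2)"
    using LsqD(2)[OF L2_procD[OF L2_proc_indicator[OF f, of "{a<..b}"]]] by simp
  have "sqnorm (\<lambda>s \<omega>. f s \<omega> * indicator {a<..b} s)
    = (\<integral>s. expectation (\<lambda>\<omega>. (f s \<omega> * indicator {a<..b} s)\<^sup>2) \<partial>dt)"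
    using P.integral_fst'[OF i] by simp
  also have "\<dots> \<le> (\<integral>s. c * indicator {a<..b} s \<partial>dt)"
  proof (rule integral_mono)
    show "integrable dt (\<lambda>s. expectation (\<lambda>\<omega>. (f s \<omega> * indicator {a<..b} s)\<^sup>2))"
      using P.integrable_fst'[OF i] by simp
    show "integrable dt (\<lambda>s. c * indicator {a<..b} s)"
      using finite_measure.Lsq_integrable[OF finite_dt Lsq_indicator_dt[of "{a<..b}"]] by simp
    show "expectation (\<lambda>\<omega>. (f s \<omega> * indicator {a<..b} s)\<^sup>2) \<le> c * indicator {a<..b} s" for s
      using c[of s] by (auto simp: indicator_def)
  qed
  also have "\<dots> = (b - a) * c" using integral_indicator_dt[OF ab] by simp
  finally show ?thesis .
qed

text \<open>Absolute continuity of the integral, uniform in the position of the interval: what f^2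
  has above a high level n is small in the mean, and the rest contributes at most n times the
  length.\<close>

lemma sqnorm_small_intervals:
  assumes f: "L2_proc f" and e: "0 < \<epsilon>"
  obtains \<delta> where "0 < \<delta>" "\<And>a b. 0 \<le> a \<Longrightarrow> a \<le> b \<Longrightarrow> b \<le> T \<Longrightarrow> b - a \<le> \<delta> \<Longrightarrow>
    sqnorm (\<lambda>s \<omega>. f s \<omega> * indicator {a<..b} s) < \<epsilon>"
proof -
  let ?q = "\<lambda>p. (f (fst p) (snd p))\<^sup>2"
  have q: "integrable dt_dP ?q" by (rule LsqD(2)[OF L2_procD[OF f]])
  have mq: "?q \<in> borel_measurable dt_dP" using q by simp
  have "(\<lambda>n. \<integral>p. min (?q p) (real n) \<partial>dt_dP) \<longlonglongrightarrow> (\<integral>p. ?q p \<partial>dt_dP)"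
  proof (rule integral_dominated_convergence[where w = ?q])
    show "AE p in dt_dP. (\<lambda>n. min (?q p) (real n)) \<longlonglongrightarrow> ?q p"
    proof (rule AE_I2)
      fix p
      obtain m :: nat where "?q p \<le> real m" using real_arch_simple by blast
      then have "\<forall>n\<ge>m. min (?q p) (real n) = ?q p" by (auto simp: min_def)
      then show "(\<lambda>n. min (?q p) (real n)) \<longlonglongrightarrow> ?q p"
        by (intro tendsto_eventually) (auto simp: eventually_sequentially)
    qed
  qed (use mq q in auto)
  from order_tendstoD(1)[OF this, of "(\<integral>p. ?q p \<partial>dt_dP) - \<epsilon> / 2"] e
  obtain n :: nat where n: "(\<integral>p. ?q p \<partial>dt_dP) - \<epsilon> / 2 < (\<integral>p. min (?q p) (real n) \<partial>dt_dP)"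
    using eventually_happens by fastforce
  have im: "integrable dt_dP (\<lambda>p. min (?q p) (real n))"
    by (rule Bochner_Integration.integrable_bound[OF q]) (use mq in auto)
  show thesis
  \<comment> \<open>Half of \<epsilon> is for the part above level n, half for n (b - a).
    \<open>Suc n\<close> allows n = 0.\<close>
  proof (rule that[of "\<epsilon> / (2 * real (Suc n))"])
    show "0 < \<epsilon> / (2 * real (Suc n))" using e by simp
    fix a b :: real assume ab: "0 \<le> a" "a \<le> b" "b \<le> T" "b - a \<le> \<epsilon> / (2 * real (Suc n))"
    have one: "L2_proc (\<lambda>s \<omega>. 1 :: real)" by (rule Lsq_compose_snd) (simp add: Lsq_def)
    have i1: "integrable dt_dP (\<lambda>p. indicator {a<..b} (fst p) :: real)"
      using finite_measure.Lsq_integrable[OF finite_dt_dP L2_procD[OF L2_proc_indicator[OF one, of "{a<..b}"]]] by simp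
    have e1: "(\<integral>p. indicator {a<..b} (fst p) \<partial>dt_dP) = b - a"
      using P.integral_fst'[OF i1] integral_indicator_dt[OF ab(1-3)] by (simp add: prob_space)
    have "sqnorm (\<lambda>s \<omega>. f s \<omega> * indicator {a<..b} s)
      \<le> (\<integral>p. (?q p - min (?q p) (real n)) + real n * indicator {a<..b} (fst p) \<partial>dt_dP)"
    proof (rule integral_mono)
      show "integrable dt_dP (\<lambda>p. (f (fst p) (snd p) * indicator {a<..b} (fst p))\<^sup>2)"
        using LsqD(2)[OF L2_procD[OF L2_proc_indicator[OF f, of "{a<..b}"]]] by simp
      show "integrable dt_dP (\<lambda>p. (?q p - min (?q p) (real n)) + real n * indicator {a<..b} (fst p))"
        using q im i1 by simp
    qed (auto simp: indicator_def min_def)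
    also have "\<dots> = (\<integral>p. ?q p \<partial>dt_dP) - (\<integral>p. min (?q p) (real n) \<partial>dt_dP) + real n * (b - a)"
      using q im i1 e1 by simp
    also have "\<dots> < \<epsilon>"
    proof -
      have "real n * (b - a) \<le> real (Suc n) * (\<epsilon> / (2 * real (Suc n)))"
        using ab by (intro mult_mono) auto
      also have "\<dots> = \<epsilon> / 2" by (simp del: of_nat_Suc)
      finally show ?thesis using n by linarith
    qed
    finally show "sqnorm (\<lambda>s \<omega>. f s \<omega> * indicator {a<..b} s) < \<epsilon>" .
  qed
qed

text \<open>Increments over all intervals, with measurability and second moments at every single
  time and not just almost every one: the energy estimate evaluates the process at interval ends.
  Integrability of the drift is in L^2, so that its time integrals are square integrable
  too.\<close>

definition itoproc :: "'a rproc \<Rightarrow> 'a rproc \<Rightarrow> 'a rproc \<Rightarrow> bool" where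
  "itoproc b \<sigma> X \<longleftrightarrow> L2_proc b \<and> L2_proc \<sigma> \<and> L2_proc X \<and>
     (\<forall>t\<in>{0..T}. X t \<in> borel_measurable (Fil t) \<and> Lsq M (X t)) \<and>
     (\<forall>s t. 0 \<le> s \<longrightarrow> s \<le> t \<longrightarrow> t \<le> T \<longrightarrow>
       (\<exists>J. ito (\<lambda>r \<omega>. \<sigma> r \<omega> * indicator {s<..t} r) J \<and>
          (AE \<omega> in M. X t \<omega> - X s \<omega> = tint s t b \<omega> + J \<omega>)))"

lemma itoprocD:
  assumes "itoproc b \<sigma> X"
  shows "L2_proc b" "L2_proc \<sigma>" "L2_proc X" "t \<in> {0..T} \<Longrightarrow> X t \<in> borel_measurable (Fil t)"
    "t \<in> {0..T} \<Longrightarrow> Lsq M (X t)"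
  using assms by (auto simp: itoproc_def)

lemma itoprocE:
  assumes "itoproc b \<sigma> X" "0 \<le> s" "s \<le> t" "t \<le> T"
  obtains J where "ito (\<lambda>r \<omega>. \<sigma> r \<omega> * indicator {s<..t} r) J"
    "AE \<omega> in M. X t \<omega> - X s \<omega> = tint s t b \<omega> + J \<omega>"
  using assms unfolding itoproc_def by blast

lemma itoproc_diff:
  assumes X: "itoproc b \<sigma> X" and Y: "itoproc b' \<sigma>' Y"
  shows "itoproc (\<lambda>s \<omega>. b s \<omega> - b' s \<omega>) (\<lambda>s \<omega>. \<sigma> s \<omega> - \<sigma>' s \<omega>) (\<lambda>s \<omega>. X s \<omega> - Y s \<omega>)"
  unfolding itoproc_def
proof (intro conjI ballI allI impI)
  show "L2_proc (\<lambda>s \<omega>. b s \<omega> - b' s \<omega>)" "L2_proc (\<lambda>s \<omega>. \<sigma> s \<omega> - \<sigma>' s \<omega>)" "L2_proc (\<lambda>s \<omega>. X s \<omega> - Y s \<omega>)"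
    by (intro L2_proc_diff itoprocD(1-3)[OF X] itoprocD(1-3)[OF Y])+
  show "(\<lambda>\<omega>. X t \<omega> - Y t \<omega>) \<in> borel_measurable (Fil t)" "Lsq M (\<lambda>\<omega>. X t \<omega> - Y t \<omega>)"
    if "t \<in> {0..T}" for t
    using itoprocD(4,5)[OF X that] itoprocD(4,5)[OF Y that] by (auto intro: Lsq_diff)
  fix s t assume st: "0 \<le> s" "s \<le> t" "t \<le> T"
  obtain J where J: "ito (\<lambda>r \<omega>. \<sigma> r \<omega> * indicator {s<..t} r) J"
    "AE \<omega> in M. X t \<omega> - X s \<omega> = tint s t b \<omega> + J \<omega>" by (rule itoprocE[OF X st])
  obtain K where K: "ito (\<lambda>r \<omega>. \<sigma>' r \<omega> * indicator {s<..t} r) K"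
    "AE \<omega> in M. Y t \<omega> - Y s \<omega> = tint s t b' \<omega> + K \<omega>" by (rule itoprocE[OF Y st])
  have "ito (\<lambda>r \<omega>. (\<sigma> r \<omega> - \<sigma>' r \<omega>) * indicator {s<..t} r) (\<lambda>\<omega>. J \<omega> - K \<omega>)"
    using ito_minus[OF J(1) K(1)] by (simp add: left_diff_distrib)
  moreover have "AE \<omega> in M. X t \<omega> - Y t \<omega> - (X s \<omega> - Y s \<omega>)
      = tint s t (\<lambda>s \<omega>. b s \<omega> - b' s \<omega>) \<omega> + (J \<omega> - K \<omega>)"
    using J(2) K(2) tint_diff_AE[OF itoprocD(1)[OF X] itoprocD(1)[OF Y], of s t]
    by eventually_elim simp
  ultimately show "\<exists>J. ito (\<lambda>r \<omega>. (\<sigma> r \<omega> - \<sigma>' r \<omega>) * indicator {s<..t} r) J \<and>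
    (AE \<omega> in M. X t \<omega> - Y t \<omega> - (X s \<omega> - Y s \<omega>)
      = tint s t (\<lambda>s \<omega>. b s \<omega> - b' s \<omega>) \<omega> + J \<omega>)" by blast
qed

lemma itoproc_diff_sum:
  assumes Y: "itoproc b' \<sigma>' Y" and X: "\<And>i. i \<in> I \<Longrightarrow> itoproc (b i) (\<sigma> i) (X i)" and "finite I"
  shows "itoproc (\<lambda>s \<omega>. b' s \<omega> - (\<Sum>i\<in>I. b i s \<omega>)) (\<lambda>s \<omega>. \<sigma>' s \<omega> - (\<Sum>i\<in>I. \<sigma> i s \<omega>))
    (\<lambda>s \<omega>. Y s \<omega> - (\<Sum>i\<in>I. X i s \<omega>))"
  using assms(3) X
proof (induction I rule: finite_induct)
  case (insert i I)
  from itoproc_diff[OF insert.IH insert.prems[of i]] insert.hyps insert.prems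
  show ?case by (simp add: diff_diff_eq add.commute)
qed (simp add: Y)

lemma itoproc_cong_AE:
  assumes X: "itoproc b \<sigma> X" and b: "L2_proc b'" "AE p in dt_dP. b (fst p) (snd p) = b' (fst p) (snd p)"
    and s: "L2_proc \<sigma>'" "AE p in dt_dP. \<sigma> (fst p) (snd p) = \<sigma>' (fst p) (snd p)"
  shows "itoproc b' \<sigma>' X"
  unfolding itoproc_def
proof (intro conjI ballI allI impI b s itoprocD(3-5)[OF X])
  fix u t assume ut: "0 \<le> u" "u \<le> t" "t \<le> T"
  obtain J where J: "ito (\<lambda>r \<omega>. \<sigma> r \<omega> * indicator {u<..t} r) J"
    "AE \<omega> in M. X t \<omega> - X u \<omega> = tint u t b \<omega> + J \<omega>" by (rule itoprocE[OF X ut])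
  have "ito (\<lambda>r \<omega>. \<sigma>' r \<omega> * indicator {u<..t} r) J"
    using s by (intro ito_cong_AE[OF J(1)] L2_proc_indicator itoD(2)[OF J(1)]) auto
  moreover have "AE \<omega> in M. X t \<omega> - X u \<omega> = tint u t b' \<omega> + J \<omega>"
    using J(2) tint_cong_AE[OF b(2) itoprocD(1)[OF X] b(1), of u t] by eventually_elim simp
  ultimately show "\<exists>J. ito (\<lambda>r \<omega>. \<sigma>' r \<omega> * indicator {u<..t} r) J \<and>
     (AE \<omega> in M. X t \<omega> - X u \<omega> = tint u t b' \<omega> + J \<omega>)" by blast
qed

lemma itoproc_incr_le:
  assumes X: "itoproc b \<sigma> X" and st: "0 \<le> s" "s \<le> t" "t \<le> T"
  shows "expectation (\<lambda>\<omega>. (X t \<omega> - X s \<omega>)\<^sup>2) \<le>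
    2 * (t - s) * sqnorm b + 2 * sqnorm (\<lambda>r \<omega>. \<sigma> r \<omega> * indicator {s<..t} r)"
proof -
  obtain J where J: "ito (\<lambda>r \<omega>. \<sigma> r \<omega> * indicator {s<..t} r) J"
    "AE \<omega> in M. X t \<omega> - X s \<omega> = tint s t b \<omega> + J \<omega>" by (rule itoprocE[OF X st])
  note L = tint_Lsq[OF itoprocD(1)[OF X] st] and LJ = itoD(2)[OF J(1)]
  have m: "(\<lambda>\<omega>. X t \<omega> - X s \<omega>) \<in> borel_measurable M"
    using LsqD(1)[OF itoprocD(5)[OF X, of s]] LsqD(1)[OF itoprocD(5)[OF X, of t]] st by simp
  have "expectation (\<lambda>\<omega>. (X t \<omega> - X s \<omega>)\<^sup>2) = expectation (\<lambda>\<omega>. (tint s t b \<omega> + J \<omega>)\<^sup>2)"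
    using J(2) m LsqD(1)[OF L(1)] LsqD(1)[OF LJ] by (intro integral_cong_AE) auto
  also have "\<dots> \<le> 2 * expectation (\<lambda>\<omega>. (tint s t b \<omega>)\<^sup>2) + 2 * expectation (\<lambda>\<omega>. (J \<omega>)\<^sup>2)"
    by (rule Lsq_integral_add_sq_le[OF L(1) LJ])
  also have "expectation (\<lambda>\<omega>. (J \<omega>)\<^sup>2) = sqnorm (\<lambda>r \<omega>. \<sigma> r \<omega> * indicator {s<..t} r)"
    using ito_isometry[OF J(1)] by simp
  also have "expectation (\<lambda>\<omega>. (tint s t b \<omega>)\<^sup>2) \<le> (t - s) * sqnorm b"
    using L(2) mult_left_mono[OF sqnorm_ind_le_sqnorm[OF itoprocD(1)[OF X], of "{s<..t}"], of "t - s"] st by simp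
  finally show ?thesis by (simp only: mult.assoc)
qed

text \<open>In \<open>itoproc_incr_le\<close> the drift term carries the factor t - s, and the mass
  of the diffusion on short intervals is uniformly small.\<close>

lemma itoproc_equicont:
  assumes X: "itoproc b \<sigma> X" and e: "0 < \<epsilon>"
  obtains \<delta> where "0 < \<delta>" "\<And>s t. 0 \<le> s \<Longrightarrow> s \<le> t \<Longrightarrow> t \<le> T \<Longrightarrow> t - s \<le> \<delta> \<Longrightarrow>
    expectation (\<lambda>\<omega>. (X t \<omega> - X s \<omega>)\<^sup>2) < \<epsilon>"
proof -
  obtain \<delta> where d: "0 < \<delta>" "\<And>a b. 0 \<le> a \<Longrightarrow> a \<le> b \<Longrightarrow> b \<le> T \<Longrightarrow> b - a \<le> \<delta> \<Longrightarrow>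
    sqnorm (\<lambda>s \<omega>. \<sigma> s \<omega> * indicator {a<..b} s) < \<epsilon> / 4"
    using sqnorm_small_intervals[OF itoprocD(2)[OF X], of "\<epsilon> / 4"] e by auto
  define B where "B = sqnorm b"
  have B: "0 \<le> B" by (simp add: B_def)
  \<comment> \<open>Each of the two terms of the increment bound gets half of \<epsilon>; B + 1
    allows a vanishing drift.\<close>
  define d' where "d' = min \<delta> (\<epsilon> / (4 * (B + 1)))"
  show thesis
  proof (rule that[of d'])
    show "0 < d'" using d(1) e B unfolding d'_def by (simp add: add_nonneg_pos)
    fix s t :: real assume st: "0 \<le> s" "s \<le> t" "t \<le> T" "t - s \<le> d'"
    have "(t - s) * B \<le> \<epsilon> / (4 * (B + 1)) * B"
      using st(4) B by (intro mult_right_mono) (auto simp: d'_def)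
    also have "\<dots> \<le> \<epsilon> / 4"
    proof -
      have "B / (B + 1) \<le> 1" using B by simp
      from mult_left_mono[OF this, of "\<epsilon> / 4"] e show ?thesis by simp
    qed
    finally have "2 * (t - s) * B \<le> \<epsilon> / 2" unfolding mult.assoc by linarith
    moreover have "sqnorm (\<lambda>r \<omega>. \<sigma> r \<omega> * indicator {s<..t} r) < \<epsilon> / 4"
      using d(2) st by (simp add: d'_def)
    ultimately show "expectation (\<lambda>\<omega>. (X t \<omega> - X s \<omega>)\<^sup>2) < \<epsilon>"
      using itoproc_incr_le[OF X st(1-3)] unfolding B_def by linarith
  qed
qed

end

section \<open>Uniform grids\<close>

definition gridpt :: "real \<Rightarrow> real \<Rightarrow> nat \<Rightarrow> nat \<Rightarrow> real" where
  "gridpt s t N k = s + real k * ((t - s) / real N)"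

lemma gridpt_0: "gridpt s t N 0 = s"
  by (simp add: gridpt_def)

lemma gridpt_N: "0 < N \<Longrightarrow> gridpt s t N N = t"
  by (simp add: gridpt_def)

lemma gridpt_Suc: "gridpt s t N (Suc k) = gridpt s t N k + (t - s) / real N"
  unfolding gridpt_def of_nat_Suc distrib_right by simp

lemma gridpt_mono: "s \<le> t \<Longrightarrow> k \<le> l \<Longrightarrow> gridpt s t N k \<le> gridpt s t N l"
  unfolding gridpt_def by (intro add_left_mono mult_right_mono) auto

lemma gridpt_bounds:
  assumes "s \<le> t" "0 < N" "k \<le> N"
  shows "s \<le> gridpt s t N k" "gridpt s t N k \<le> t"
  using gridpt_mono[OF assms(1), of 0 k N] gridpt_mono[OF assms(1,3), of N] assms(2)
  by (simp_all add: gridpt_0 gridpt_N)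

text \<open>Exactly one cell contains r, even if neighbouring grid points coincide, since such cells
  are empty. In the second part f is quantified inside, so that the cell depends on r only.\<close>

lemma sum_grid_indicator:
  fixes f p :: "nat \<Rightarrow> real"
  assumes mono: "\<And>k. k < N \<Longrightarrow> p k \<le> p (Suc k)"
  shows "r \<notin> {p 0<..p N} \<Longrightarrow> (\<Sum>k<N. f k * indicator {p k<..p (Suc k)} r) = 0"
    and "r \<in> {p 0<..p N} \<Longrightarrow> \<exists>k<N. r \<in> {p k<..p (Suc k)} \<and>
      (\<forall>f :: nat \<Rightarrow> real. (\<Sum>k<N. f k * indicator {p k<..p (Suc k)} r) = f k)"
proof -
  have le: "i \<le> j \<Longrightarrow> j \<le> N \<Longrightarrow> p i \<le> p j" for i j
    by (induction j) (auto simp: le_Suc_eq intro: order_trans[OF _ mono])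
  show "(\<Sum>k<N. f k * indicator {p k<..p (Suc k)} r) = 0" if r: "r \<notin> {p 0<..p N}"
  proof (rule sum.neutral, rule ballI)
    fix k assume "k \<in> {..<N}"
    then have "p 0 \<le> p k" "p (Suc k) \<le> p N" by (auto intro: le)
    then show "f k * indicator {p k<..p (Suc k)} r = 0" using r by (auto simp: indicator_def)
  qed
  show "\<exists>k<N. r \<in> {p k<..p (Suc k)} \<and>
      (\<forall>f :: nat \<Rightarrow> real. (\<Sum>k<N. f k * indicator {p k<..p (Suc k)} r) = f k)" if r: "r \<in> {p 0<..p N}"
  proof -
    \<comment> \<open>The right end of the cell: the first index whose grid point is not left of r.
      It is positive because r > p 0.\<close>
    define m where "m = (LEAST m. r \<le> p m)"
    have m: "r \<le> p m" unfolding m_def by (rule LeastI[of "\<lambda>m. r \<le> p m" N]) (use r in simp)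
    have mN: "m \<le> N" unfolding m_def by (rule Least_le[of "\<lambda>m. r \<le> p m" N]) (use r in simp)
    have "m \<noteq> 0" using m r by (intro notI) auto
    then obtain k where k: "m = Suc k" by (cases m) auto
    have "\<not> r \<le> p k" using not_less_Least[of k "\<lambda>m. r \<le> p m"] k by (simp add: m_def)
    then have rk: "r \<in> {p k<..p (Suc k)}" using m k by auto
    have "(\<Sum>l<N. f l * indicator {p l<..p (Suc l)} r) = f k" for f :: "nat \<Rightarrow> real"
    proof -
      have "(\<Sum>l<N. f l * indicator {p l<..p (Suc l)} r) = (\<Sum>l\<in>{k}. f l * indicator {p l<..p (Suc l)} r)"
      proof (rule sum.mono_neutral_right)
        show "\<forall>l\<in>{..<N} - {k}. f l * indicator {p l<..p (Suc l)} r = 0"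
        proof
          fix l assume l: "l \<in> {..<N} - {k}"
          then consider "Suc l \<le> k" | "Suc k \<le> l" by fastforce
          then have "r \<notin> {p l<..p (Suc l)}"
          proof cases
            case 1
            then have "p (Suc l) \<le> p k" using k mN by (intro le) auto
            then show ?thesis using rk by auto
          next
            case 2
            then have "p (Suc k) \<le> p l" using l by (intro le) auto
            then show ?thesis using rk by auto
          qed
          then show "f l * indicator {p l<..p (Suc l)} r = 0" by simp
        qed
      qed (use k mN in auto)
      moreover have "(\<Sum>l\<in>{k}. g l) = g k" for g :: "nat \<Rightarrow> real" by simp
      ultimately show ?thesis using rk by (simp only: indicator_simps mult_1_right)
    qed
    then show ?thesis using rk k mN by (intro exI[of _ k]) auto
  qed
qed

context wiener begin

section \<open>Products with a deterministic Lipschitz factor\<close>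

lemma L2_proc_det_mult:
  assumes f: "L2_proc f" and h: "h \<in> borel_measurable dt" "\<And>s. s \<in> {0..T} \<Longrightarrow> \<bar>h s\<bar> \<le> K"
  shows "L2_proc (\<lambda>s \<omega>. h s * f s \<omega>)"
proof -
  have m: "(\<lambda>p. h (fst p)) \<in> borel_measurable dt_dP" by (rule measurable_compose[OF measurable_fst h(1)])
  have "Lsq dt_dP (\<lambda>p. h (fst p) * f (fst p) (snd p))"
    by (rule Lsq_bounded_mult[OF L2_procD[OF f] m, of K]) (use h(2) in \<open>auto simp: space_dt_dP\<close>)
  then show ?thesis by (simp add: split_beta')
qed

lemma tint_sum_grid_AE:
  assumes "L2_proc f" and mono: "\<And>k. k < N \<Longrightarrow> p k \<le> p (Suc k)"
  shows "AE \<omega> in M. (\<Sum>k<N. tint (p k) (p (Suc k)) f \<omega>) = tint (p 0) (p N) f \<omega>"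
  using mono
proof (induction N)
  case 0
  then show ?case by (simp add: tint_def)
next
  case (Suc N)
  have "i \<le> N \<Longrightarrow> p 0 \<le> p i" for i
    by (induction i) (auto intro: order_trans[OF _ Suc.prems])
  then have "AE \<omega> in M. tint (p 0) (p (Suc N)) f \<omega> = tint (p 0) (p N) f \<omega> + tint (p N) (p (Suc N)) f \<omega>"
    using Suc.prems by (intro tint_join_AE assms(1)) auto
  moreover have "AE \<omega> in M. (\<Sum>k<N. tint (p k) (p (Suc k)) f \<omega>) = tint (p 0) (p N) f \<omega>"
    using Suc by auto
  ultimately show ?case by eventually_elim simp
qed

text \<open>Cauchy-Schwarz for the sum. The loss of N^2 is affordable: in the product rule the
  second moment of a cell error is h^2 times something arbitrarily small, and N h is the length of
  the interval.\<close>

lemma expectation_sum_sq_le: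
  assumes "\<And>k. k < N \<Longrightarrow> Lsq M (f k)" "\<And>k. k < N \<Longrightarrow> expectation (\<lambda>\<omega>. (f k \<omega>)\<^sup>2) \<le> c"
  shows "expectation (\<lambda>\<omega>. (\<Sum>k<N. f k \<omega>)\<^sup>2) \<le> (real N)\<^sup>2 * c"
proof -
  have L: "Lsq M (\<lambda>\<omega>. \<Sum>k<N. f k \<omega>)" using assms(1) by (intro Lsq_sum) auto
  have "expectation (\<lambda>\<omega>. (\<Sum>k<N. f k \<omega>)\<^sup>2) \<le> expectation (\<lambda>\<omega>. (\<Sum>k<N. (f k \<omega>)\<^sup>2) * real N)"
  proof (rule integral_mono)
    show "integrable M (\<lambda>\<omega>. (\<Sum>k<N. f k \<omega>)\<^sup>2)" by (rule LsqD(2)[OF L])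
    show "integrable M (\<lambda>\<omega>. (\<Sum>k<N. (f k \<omega>)\<^sup>2) * real N)"
      using assms(1) by (intro integrable_mult_left Bochner_Integration.integrable_sum) (auto dest: LsqD)
    show "(\<Sum>k<N. f k \<omega>)\<^sup>2 \<le> (\<Sum>k<N. (f k \<omega>)\<^sup>2) * real N" for \<omega>
      using sum_squared_le_sum_of_squares[of "\<lambda>k. f k \<omega>" "{..<N}"] by simp
  qed
  also have "\<dots> = (\<Sum>k<N. expectation (\<lambda>\<omega>. (f k \<omega>)\<^sup>2)) * real N"
    using assms(1) by (simp add: Bochner_Integration.integral_sum LsqD(2))
  also have "\<dots> \<le> (\<Sum>k<N. c) * real N"
    using assms(2) by (intro mult_right_mono sum_mono) auto
  finally show ?thesis by (simp add: power2_eq_square algebra_simps)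
qed

text \<open>Freezing the deterministic factor at the left end of
  each cell of a uniform grid gives an exact Ito integral; summation by parts shows that the error
  is a time integral, which vanishes with the mesh because the process is continuous in mean square.\<close>

lemma itoproc_mult:
  assumes X: "itoproc b \<sigma> X"
    and \<phi>: "\<phi> \<in> borel_measurable dt" "\<And>s. s \<in> {0..T} \<Longrightarrow> \<bar>\<phi> s\<bar> \<le> K"
    and d: "\<phi>' \<in> borel_measurable dt" "\<And>s. s \<in> {0..T} \<Longrightarrow> \<bar>\<phi>' s\<bar> \<le> K"
    and ftc: "\<And>s t. 0 \<le> s \<Longrightarrow> s \<le> t \<Longrightarrow> t \<le> T \<Longrightarrow>
      \<phi> t - \<phi> s = (\<integral>r. \<phi>' r * indicator {s<..t} r \<partial>dt)"
  shows "itoproc (\<lambda>s \<omega>. \<phi>' s * X s \<omega> + \<phi> s * b s \<omega>) (\<lambda>s \<omega>. \<phi> s * \<sigma> s \<omega>) (\<lambda>s \<omega>. \<phi> s * X s \<omega>)"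
  unfolding itoproc_def
proof (intro conjI ballI allI impI)
  note Lb = itoprocD(1)[OF X] and Ls = itoprocD(2)[OF X] and LX = itoprocD(3)[OF X]
  show LD: "L2_proc (\<lambda>s \<omega>. \<phi>' s * X s \<omega> + \<phi> s * b s \<omega>)"
    by (intro L2_proc_add L2_proc_det_mult[OF LX d] L2_proc_det_mult[OF Lb \<phi>])
  show LS: "L2_proc (\<lambda>s \<omega>. \<phi> s * \<sigma> s \<omega>)" by (rule L2_proc_det_mult[OF Ls \<phi>])
  show "L2_proc (\<lambda>s \<omega>. \<phi> s * X s \<omega>)" by (rule L2_proc_det_mult[OF LX \<phi>])
  show "(\<lambda>\<omega>. \<phi> t * X t \<omega>) \<in> borel_measurable (Fil t)" "Lsq M (\<lambda>\<omega>. \<phi> t * X t \<omega>)"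
    if "t \<in> {0..T}" for t
    using itoprocD(4,5)[OF X that] by (auto intro: Lsq_cmult)
  have K: "0 \<le> K" using d(2)[of 0] T_pos by (auto intro: order_trans[OF abs_ge_zero])
  \<comment> \<open>The derivative is bounded by K, so the replacement of \<phi> by its value at the
    left end of a cell costs at most K h.\<close>
  have lip: "\<bar>\<phi> t - \<phi> s\<bar> \<le> K * (t - s)" if st: "0 \<le> s" "s \<le> t" "t \<le> T" for s t
  proof -
    have Ld: "Lsq dt \<phi>'" by (rule finite_measure.Lsq_bounded[OF finite_dt d(1), of K]) (use d(2) in auto)
    have iI: "integrable dt (\<lambda>r. indicator {s<..t} r :: real)"
      by (rule finite_measure.Lsq_integrable[OF finite_dt Lsq_indicator_dt]) simp
    have "\<bar>\<phi> t - \<phi> s\<bar> = \<bar>\<integral>r. \<phi>' r * indicator {s<..t} r \<partial>dt\<bar>" using ftc[OF st] by simp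
    also have "\<dots> \<le> (\<integral>r. \<bar>\<phi>' r * indicator {s<..t} r\<bar> \<partial>dt)"
      using integral_norm_bound[of dt "\<lambda>r. \<phi>' r * indicator {s<..t} r"] by simp
    also have "\<dots> \<le> (\<integral>r. K * indicator {s<..t} r \<partial>dt)"
    proof (rule integral_mono)
      show "integrable dt (\<lambda>r. \<bar>\<phi>' r * indicator {s<..t} r\<bar>)"
        by (rule integrable_abs[OF Lsq_dt_ind_integrable[OF Ld]])
      show "integrable dt (\<lambda>r. K * indicator {s<..t} r)" using iI by simp
      show "\<bar>\<phi>' r * indicator {s<..t} r\<bar> \<le> K * indicator {s<..t} r" if "r \<in> space dt" for r
        using d(2)[of r] that by (auto simp: indicator_def)
    qed
    also have "\<dots> = K * (t - s)" using integral_indicator_dt[OF st] by simp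
    finally show ?thesis .
  qed
  fix s t assume st: "0 \<le> s" "s \<le> t" "t \<le> T"
  let ?D = "\<lambda>r \<omega>. \<phi>' r * X r \<omega> + \<phi> r * b r \<omega>"
  \<comment> \<open>What the increment leaves once its time integral is removed. It remains to
    recognise this as the Ito integral of \<phi> \<sigma>.\<close>
  define J where "J \<omega> = \<phi> t * X t \<omega> - \<phi> s * X s \<omega> - tint s t ?D \<omega>" for \<omega>
  have LXs: "Lsq M (X u)" if "s \<le> u" "u \<le> t" for u using itoprocD(5)[OF X, of u] that st by auto
  have LJ: "Lsq M J" unfolding J_def[abs_def]
    using st by (intro Lsq_diff Lsq_cmult LXs tint_Lsq(1)[OF LD]) auto
  have "ito (\<lambda>r \<omega>. \<phi> r * \<sigma> r \<omega> * indicator {s<..t} r) J"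
  proof (rule ito_closed[OF L2_proc_indicator[OF LS] LJ])
    fix \<epsilon> :: real assume e: "0 < \<epsilon>"
    define Sb where "Sb = sqnorm b"
    define Ss where "Ss = sqnorm \<sigma>"
    have S0: "0 \<le> Sb" "0 \<le> Ss" by (simp_all add: Sb_def Ss_def)
    \<comment> \<open>Makes (t - s)^2 * 2 K^2 * e1 at most \<epsilon> / 4; the added 1s exclude
      division by 0.\<close>
    define e1 where "e1 = \<epsilon> / (8 * (K\<^sup>2 + 1) * ((t - s)\<^sup>2 + 1))"
    have pos: "0 < K\<^sup>2 + 1" "0 < (t - s)\<^sup>2 + 1" by (simp_all add: add_nonneg_pos)
    then have e1: "0 < e1" using e by (simp add: e1_def)
    obtain \<delta> where \<delta>: "0 < \<delta>" "\<And>u v. 0 \<le> u \<Longrightarrow> u \<le> v \<Longrightarrow> v \<le> T \<Longrightarrow> v - u \<le> \<delta> \<Longrightarrow>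
      expectation (\<lambda>\<omega>. (X v \<omega> - X u \<omega>)\<^sup>2) < e1" using itoproc_equicont[OF X e1] by blast
    have "(\<lambda>N. (t - s) * (1 / real (Suc N))) \<longlonglongrightarrow> (t - s) * 0"
      by (intro tendsto_mult tendsto_const lim_1_over_n[THEN LIMSEQ_Suc])
    then have h0: "(\<lambda>N. (t - s) / real (Suc N)) \<longlonglongrightarrow> 0" by simp
    have "(\<lambda>N. K\<^sup>2 * ((t - s) / real (Suc N))\<^sup>2 * Ss) \<longlonglongrightarrow> K\<^sup>2 * 0\<^sup>2 * Ss"
      by (intro tendsto_mult tendsto_const tendsto_power h0)
    then have ev1: "\<forall>\<^sub>F N in sequentially. K\<^sup>2 * ((t - s) / real (Suc N))\<^sup>2 * Ss < \<epsilon>"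
      using order_tendstoD(2)[of _ 0 sequentially \<epsilon>] e by simp
    have "(\<lambda>N. (t - s) * (2 * K\<^sup>2 * ((t - s) / real (Suc N)) * ((t - s) * Sb))) \<longlonglongrightarrow> (t - s) * (2 * K\<^sup>2 * 0 * ((t - s) * Sb))"
      by (intro tendsto_mult tendsto_const h0)
    then have lim2: "(\<lambda>N. (t - s) * (2 * K\<^sup>2 * ((t - s) / real (Suc N)) * ((t - s) * Sb))) \<longlonglongrightarrow> 0"
      by (simp only: mult_zero_left mult_zero_right)
    have ev2: "\<forall>\<^sub>F N in sequentially. (t - s) * (2 * K\<^sup>2 * ((t - s) / real (Suc N)) * ((t - s) * Sb)) < \<epsilon> / 2"
      by (rule order_tendstoD(2)[OF lim2]) (use e in simp)
    have ev3: "\<forall>\<^sub>F N in sequentially. (t - s) / real (Suc N) < \<delta>"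
      by (rule order_tendstoD(2)[OF h0 \<delta>(1)])
    obtain N0 where N0: "K\<^sup>2 * ((t - s) / real (Suc N0))\<^sup>2 * Ss < \<epsilon>"
      "(t - s) * (2 * K\<^sup>2 * ((t - s) / real (Suc N0)) * ((t - s) * Sb)) < \<epsilon> / 2"
      "(t - s) / real (Suc N0) < \<delta>"
      using eventually_happens[OF eventually_conj[OF ev1 eventually_conj[OF ev2 ev3]]] by auto
    define N where "N = Suc N0"
    have N: "0 < N" by (simp add: N_def)
    define h where "h = (t - s) / real N"
    have h: "0 \<le> h" "h < \<delta>" "K\<^sup>2 * h\<^sup>2 * Ss < \<epsilon>" "(t - s) * (2 * K\<^sup>2 * h * ((t - s) * Sb)) < \<epsilon> / 2"
      "real N * h = t - s"
      using N0 st by (simp_all add: h_def N_def del: of_nat_Suc)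
    define p where "p k = gridpt s t N k" for k
    have pS: "p (Suc k) = p k + h" for k by (simp add: p_def h_def gridpt_Suc)
    have pm: "p k \<le> p (Suc k)" for k using h by (simp add: pS)
    have p0: "p 0 = s" "p N = t" using N by (simp_all add: p_def gridpt_0 gridpt_N)
    have pb: "s \<le> p k" "p k \<le> t" if "k \<le> N" for k
      using gridpt_bounds[OF st(2) N that] by (simp_all add: p_def)
    have pc: "0 \<le> p k" "p k \<le> p (Suc k)" "p (Suc k) \<le> T" if "k < N" for k
      using pb[of k] pb[of "Suc k"] pm[of k] st that by auto
    have "\<exists>J. \<forall>k. k < N \<longrightarrow> ito (\<lambda>r \<omega>. \<sigma> r \<omega> * indicator {p k<..p (Suc k)} r) (J k) \<and>
      (AE \<omega> in M. X (p (Suc k)) \<omega> - X (p k) \<omega> = tint (p k) (p (Suc k)) b \<omega> + J k \<omega>)"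
      using itoprocE[OF X pc] by (intro choice) blast
    then obtain Jc where Jc: "\<And>k. k < N \<Longrightarrow> ito (\<lambda>r \<omega>. \<sigma> r \<omega> * indicator {p k<..p (Suc k)} r) (Jc k)"
      "\<And>k. k < N \<Longrightarrow> AE \<omega> in M. X (p (Suc k)) \<omega> - X (p k) \<omega> = tint (p k) (p (Suc k)) b \<omega> + Jc k \<omega>"
      by blast
    define \<psi> where "\<psi> r \<omega> = (\<Sum>k<N. \<phi> (p k) * (\<sigma> r \<omega> * indicator {p k<..p (Suc k)} r))" for r \<omega>
    define JN where "JN \<omega> = (\<Sum>k<N. \<phi> (p k) * Jc k \<omega>)" for \<omega>
    have ito: "ito \<psi> JN" unfolding \<psi>_def[abs_def] JN_def[abs_def]
      by (intro ito_sum ito_cmult Jc) auto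
    have sq1: "sqnorm (\<lambda>r \<omega>. \<psi> r \<omega> - \<phi> r * \<sigma> r \<omega> * indicator {s<..t} r) < \<epsilon>"
    proof -
      have "sqnorm (\<lambda>r \<omega>. \<psi> r \<omega> - \<phi> r * \<sigma> r \<omega> * indicator {s<..t} r) \<le> (\<integral>q. (K * h)\<^sup>2 * (\<sigma> (fst q) (snd q))\<^sup>2 \<partial>dt_dP)"
      proof (rule integral_mono)
        show "integrable dt_dP (\<lambda>q. (\<psi> (fst q) (snd q) - \<phi> (fst q) * \<sigma> (fst q) (snd q) * indicator {s<..t} (fst q))\<^sup>2)"
          using LsqD(2)[OF L2_procD[OF L2_proc_diff[OF itoD(1)[OF ito] L2_proc_indicator[OF LS, of "{s<..t}"]]]] by simp
        show "integrable dt_dP (\<lambda>q. (K * h)\<^sup>2 * (\<sigma> (fst q) (snd q))\<^sup>2)" using LsqD(2)[OF L2_procD[OF Ls]] by simp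
        fix q :: "real \<times> 'a" assume "q \<in> space dt_dP"
        obtain r \<omega> where q: "q = (r, \<omega>)" by (cases q)
        have \<psi>': "\<psi> r \<omega> = (\<Sum>k<N. (\<phi> (p k) * \<sigma> r \<omega>) * indicator {p k<..p (Suc k)} r)"
          by (simp add: \<psi>_def mult.assoc)
        have "(\<psi> r \<omega> - \<phi> r * \<sigma> r \<omega> * indicator {s<..t} r)\<^sup>2 \<le> (K * h)\<^sup>2 * (\<sigma> r \<omega>)\<^sup>2"
        proof (cases "r \<in> {s<..t}")
          case False
          then have "\<psi> r \<omega> = 0" unfolding \<psi>' using p0 by (intro sum_grid_indicator(1) pm) auto
          then show ?thesis using False by simp
        next
          case True
          then have "r \<in> {p 0<..p N}" using p0 by simp
          from sum_grid_indicator(2)[where p = p, OF pm this] obtain k where k0: "k < N" "r \<in> {p k<..p (Suc k)}"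
            and all: "\<forall>f :: nat \<Rightarrow> real. (\<Sum>k<N. f k * indicator {p k<..p (Suc k)} r) = f k" by (elim exE conjE)
          have k: "k < N" "r \<in> {p k<..p (Suc k)}" "\<psi> r \<omega> = \<phi> (p k) * \<sigma> r \<omega>"
            using k0 spec[OF all, of "\<lambda>k. \<phi> (p k) * \<sigma> r \<omega>"] unfolding \<psi>' by (simp_all only:)
          have "\<bar>\<phi> r - \<phi> (p k)\<bar> \<le> K * (r - p k)" using k pc[OF k(1)] by (intro lip) auto
          also have "\<dots> \<le> K * h" using k pS[of k] K by (intro mult_left_mono) auto
          finally have "\<bar>\<phi> r - \<phi> (p k)\<bar> \<le> K * h" .
          then have "\<bar>\<phi> (p k) - \<phi> r\<bar> \<le> \<bar>K * h\<bar>" by (simp add: abs_minus_commute)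
          then have "(\<phi> (p k) - \<phi> r)\<^sup>2 \<le> (K * h)\<^sup>2" by (simp only: abs_le_square_iff)
          moreover have "\<psi> r \<omega> - \<phi> r * \<sigma> r \<omega> * indicator {s<..t} r = (\<phi> (p k) - \<phi> r) * \<sigma> r \<omega>"
            using True k(3) by (simp add: left_diff_distrib)
          ultimately show ?thesis by (simp add: power_mult_distrib mult_right_mono)
        qed
        then show "(\<psi> (fst q) (snd q) - \<phi> (fst q) * \<sigma> (fst q) (snd q) * indicator {s<..t} (fst q))\<^sup>2
          \<le> (K * h)\<^sup>2 * (\<sigma> (fst q) (snd q))\<^sup>2" by (simp add: q)
      qed
      then show ?thesis using h(3) by (simp add: Ss_def power_mult_distrib)
    qed
    \<comment> \<open>The error integrand of one cell. It comes from the increment of \<phi> X over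
      the cell, which is \<phi>(p_k) times the increment of X plus X(p_{k+1}) times the increment of
      \<phi>. The value of X at the right end is not known at p_k, which is harmless because it
      occurs in time integrals only.\<close>
    let ?H = "\<lambda>k r \<omega>. (\<phi> r - \<phi> (p k)) * b r \<omega> + \<phi>' r * (X r \<omega> - X (p (Suc k)) \<omega>)"
    let ?E = "\<lambda>k. tint (p k) (p (Suc k)) (?H k)"
    have mk: "(\<lambda>r. \<phi> r - \<phi> (p k)) \<in> borel_measurable dt" for k using \<phi>(1) by simp
    have bk: "\<bar>\<phi> r - \<phi> (p k)\<bar> \<le> 2 * K" if "k < N" "r \<in> {0..T}" for k r
      using \<phi>(2)[OF that(2)] \<phi>(2)[of "p k"] pc[OF that(1)] by auto
    have LXk: "L2_proc (\<lambda>r \<omega>. X r \<omega> - X (p (Suc k)) \<omega>)" if "k < N" for k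
      using pb[of "Suc k"] that by (intro L2_proc_diff LX Lsq_compose_snd LXs) auto
    have L1: "L2_proc (\<lambda>r \<omega>. (\<phi> r - \<phi> (p k)) * b r \<omega>)" if "k < N" for k
      by (rule L2_proc_det_mult[OF Lb mk bk[OF that]])
    have L2: "L2_proc (\<lambda>r \<omega>. \<phi>' r * (X r \<omega> - X (p (Suc k)) \<omega>))" if "k < N" for k
      by (rule L2_proc_det_mult[OF LXk[OF that] d])
    have LH: "L2_proc (?H k)" if "k < N" for k by (intro L2_proc_add L1 L2 that)
    have Eb: "expectation (\<lambda>\<omega>. (?E k \<omega>)\<^sup>2) \<le> h * (2 * (K\<^sup>2 * h\<^sup>2 * Sb) + 2 * (K\<^sup>2 * (h * e1)))" if k: "k < N" for k
    proof -
      let ?I = "{p k<..p (Suc k)}"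
      have sqi: "(\<phi> r - \<phi> (p k))\<^sup>2 \<le> (K * h)\<^sup>2" if r: "r \<in> ?I" for r
      proof -
        have "\<bar>\<phi> r - \<phi> (p k)\<bar> \<le> K * (r - p k)" using r pc[OF k] by (intro lip) auto
        also have "\<dots> \<le> K * h" using r pS[of k] K by (intro mult_left_mono) auto
        finally have "\<bar>\<phi> r - \<phi> (p k)\<bar> \<le> \<bar>K * h\<bar>" by simp
        then show ?thesis by (simp only: abs_le_square_iff)
      qed
      have a: "sqnorm (\<lambda>r \<omega>. (\<phi> r - \<phi> (p k)) * b r \<omega> * indicator ?I r) \<le> K\<^sup>2 * h\<^sup>2 * Sb"
      proof -
        have "sqnorm (\<lambda>r \<omega>. (\<phi> r - \<phi> (p k)) * b r \<omega> * indicator ?I r) \<le> (\<integral>q. (K * h)\<^sup>2 * (b (fst q) (snd q))\<^sup>2 \<partial>dt_dP)"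
        proof (rule integral_mono)
          show "integrable dt_dP (\<lambda>q. ((\<phi> (fst q) - \<phi> (p k)) * b (fst q) (snd q) * indicator ?I (fst q))\<^sup>2)"
            using LsqD(2)[OF L2_procD[OF L2_proc_indicator[OF L1[OF k], of ?I]]] by simp
          show "integrable dt_dP (\<lambda>q. (K * h)\<^sup>2 * (b (fst q) (snd q))\<^sup>2)" using LsqD(2)[OF L2_procD[OF Lb]] by simp
          show "((\<phi> (fst q) - \<phi> (p k)) * b (fst q) (snd q) * indicator ?I (fst q))\<^sup>2
            \<le> (K * h)\<^sup>2 * (b (fst q) (snd q))\<^sup>2" for q
            using sqi[of "fst q"]
            by (cases "fst q \<in> ?I") (simp_all add: power_mult_distrib mult_right_mono)
        qed
        then show ?thesis by (simp add: Sb_def power_mult_distrib)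
      qed
      have c: "sqnorm (\<lambda>r \<omega>. \<phi>' r * (X r \<omega> - X (p (Suc k)) \<omega>) * indicator ?I r) \<le> K\<^sup>2 * (h * e1)"
      proof -
        have "sqnorm (\<lambda>r \<omega>. \<phi>' r * (X r \<omega> - X (p (Suc k)) \<omega>) * indicator ?I r)
          \<le> (\<integral>q. K\<^sup>2 * ((X (fst q) (snd q) - X (p (Suc k)) (snd q)) * indicator ?I (fst q))\<^sup>2 \<partial>dt_dP)"
        proof (rule integral_mono)
          show "integrable dt_dP (\<lambda>q. (\<phi>' (fst q) * (X (fst q) (snd q) - X (p (Suc k)) (snd q)) * indicator ?I (fst q))\<^sup>2)"
            using LsqD(2)[OF L2_procD[OF L2_proc_indicator[OF L2[OF k], of ?I]]] by simp
          show "integrable dt_dP (\<lambda>q. K\<^sup>2 * ((X (fst q) (snd q) - X (p (Suc k)) (snd q)) * indicator ?I (fst q))\<^sup>2)"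
            using LsqD(2)[OF L2_procD[OF L2_proc_indicator[OF LXk[OF k], of ?I]]] by simp
          fix q :: "real \<times> 'a" assume "q \<in> space dt_dP"
          then have "\<bar>\<phi>' (fst q)\<bar> \<le> \<bar>K\<bar>" using d(2)[of "fst q"] by (auto simp: space_dt_dP)
          then have "(\<phi>' (fst q))\<^sup>2 \<le> K\<^sup>2" by (simp only: abs_le_square_iff)
          then show "(\<phi>' (fst q) * (X (fst q) (snd q) - X (p (Suc k)) (snd q)) * indicator ?I (fst q))\<^sup>2
            \<le> K\<^sup>2 * ((X (fst q) (snd q) - X (p (Suc k)) (snd q)) * indicator ?I (fst q))\<^sup>2"
            by (simp add: power_mult_distrib mult.assoc mult_right_mono)
        qed
        also have "\<dots> = K\<^sup>2 * sqnorm (\<lambda>r \<omega>. (X r \<omega> - X (p (Suc k)) \<omega>) * indicator ?I r)" by simp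
        also have "\<dots> \<le> K\<^sup>2 * ((p (Suc k) - p k) * e1)"
        proof (rule mult_left_mono)
          show "sqnorm (\<lambda>r \<omega>. (X r \<omega> - X (p (Suc k)) \<omega>) * indicator ?I r) \<le> (p (Suc k) - p k) * e1"
          proof (rule sqnorm_le_sections[OF LXk[OF k] pc[OF k]])
            fix r assume r: "p k < r" "r \<le> p (Suc k)"
            have "expectation (\<lambda>\<omega>. (X (p (Suc k)) \<omega> - X r \<omega>)\<^sup>2) < e1"
              using r pc[OF k] pS[of k] h(2) by (intro \<delta>(2)) auto
            then show "expectation (\<lambda>\<omega>. (X r \<omega> - X (p (Suc k)) \<omega>)\<^sup>2) \<le> e1"
              by (simp add: power2_commute)
          qed
        qed simp
        also have "\<dots> = K\<^sup>2 * (h * e1)" by (simp add: pS)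
        finally show ?thesis .
      qed
      have "expectation (\<lambda>\<omega>. (?E k \<omega>)\<^sup>2) \<le> (p (Suc k) - p k) * sqnorm (\<lambda>r \<omega>. ?H k r \<omega> * indicator ?I r)"
        by (rule tint_Lsq(2)[OF LH[OF k] pc[OF k]])
      also have "\<dots> = h * sqnorm (\<lambda>r \<omega>. (\<phi> r - \<phi> (p k)) * b r \<omega> * indicator ?I r
          + \<phi>' r * (X r \<omega> - X (p (Suc k)) \<omega>) * indicator ?I r)"
        by (simp add: pS distrib_right)
      also have "\<dots> \<le> h * (2 * sqnorm (\<lambda>r \<omega>. (\<phi> r - \<phi> (p k)) * b r \<omega> * indicator ?I r)
          + 2 * sqnorm (\<lambda>r \<omega>. \<phi>' r * (X r \<omega> - X (p (Suc k)) \<omega>) * indicator ?I r))"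
        by (intro mult_left_mono h Lsq_integral_add_sq_le L2_procD[OF L2_proc_indicator[OF L1[OF k]]]
          L2_procD[OF L2_proc_indicator[OF L2[OF k]]]) simp_all
      also have "\<dots> \<le> h * (2 * (K\<^sup>2 * h\<^sup>2 * Sb) + 2 * (K\<^sup>2 * (h * e1)))"
        using a c h(1) by (intro mult_left_mono add_mono) auto
      finally show ?thesis .
    qed
    have id: "AE \<omega> in M. JN \<omega> - J \<omega> = (\<Sum>k<N. ?E k \<omega>)"
    proof -
      have A1: "AE \<omega> in M. \<forall>k\<in>{..<N}. X (p (Suc k)) \<omega> - X (p k) \<omega> = tint (p k) (p (Suc k)) b \<omega> + Jc k \<omega>"
        using Jc(2) by (intro AE_finite_allI) auto
      have A2: "AE \<omega> in M. (\<Sum>k<N. tint (p k) (p (Suc k)) ?D \<omega>) = tint s t ?D \<omega>"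
        using tint_sum_grid_AE[OF LD, of N p] pm p0 by simp
      have A3: "AE \<omega> in M. \<forall>k\<in>{..<N}. ?E k \<omega> = tint (p k) (p (Suc k)) ?D \<omega>
        - \<phi> (p k) * tint (p k) (p (Suc k)) b \<omega> - X (p (Suc k)) \<omega> * (\<phi> (p (Suc k)) - \<phi> (p k))"
      proof (rule AE_finite_allI)
        fix k assume "k \<in> {..<N}"
        then have k: "k < N" by simp
        have LXc: "L2_proc (\<lambda>r \<omega>. \<phi>' r * X (p (Suc k)) \<omega>)"
          using pb[of "Suc k"] k by (intro L2_proc_det_mult[OF _ d] Lsq_compose_snd LXs) auto
        have "AE \<omega> in M. tint (p k) (p (Suc k)) (\<lambda>r \<omega>. (?D r \<omega> - \<phi> (p k) * b r \<omega>) - \<phi>' r * X (p (Suc k)) \<omega>) \<omega>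
          = tint (p k) (p (Suc k)) (\<lambda>r \<omega>. ?D r \<omega> - \<phi> (p k) * b r \<omega>) \<omega>
            - tint (p k) (p (Suc k)) (\<lambda>r \<omega>. \<phi>' r * X (p (Suc k)) \<omega>) \<omega>"
          by (intro tint_diff_AE LXc L2_proc_diff LD L2_proc_cmult Lb)
        moreover have "AE \<omega> in M. tint (p k) (p (Suc k)) (\<lambda>r \<omega>. ?D r \<omega> - \<phi> (p k) * b r \<omega>) \<omega>
          = tint (p k) (p (Suc k)) ?D \<omega> - tint (p k) (p (Suc k)) (\<lambda>r \<omega>. \<phi> (p k) * b r \<omega>) \<omega>"
          by (intro tint_diff_AE LD L2_proc_cmult Lb)
        moreover have "tint (p k) (p (Suc k)) (\<lambda>r \<omega>. \<phi> (p k) * b r \<omega>) \<omega> = \<phi> (p k) * tint (p k) (p (Suc k)) b \<omega>" for \<omega>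
          using tint_cmult[of "p k" "p (Suc k)" "\<lambda>_. \<phi> (p k)" b \<omega>] by simp
        moreover have "tint (p k) (p (Suc k)) (\<lambda>r \<omega>. \<phi>' r * X (p (Suc k)) \<omega>) \<omega>
          = X (p (Suc k)) \<omega> * (\<phi> (p (Suc k)) - \<phi> (p k))" for \<omega>
          using tint_cmult[of "p k" "p (Suc k)" "X (p (Suc k))" "\<lambda>r _. \<phi>' r" \<omega>] ftc[OF pc[OF k]]
          by (simp add: mult.commute tint_def)
        moreover have "(\<lambda>r \<omega>. (?D r \<omega> - \<phi> (p k) * b r \<omega>) - \<phi>' r * X (p (Suc k)) \<omega>) = ?H k"
          by (simp add: algebra_simps)
        ultimately show "AE \<omega> in M. ?E k \<omega> = tint (p k) (p (Suc k)) ?D \<omega>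
          - \<phi> (p k) * tint (p k) (p (Suc k)) b \<omega> - X (p (Suc k)) \<omega> * (\<phi> (p (Suc k)) - \<phi> (p k))"
          by auto
      qed simp
      from A1 A2 A3 show ?thesis
      proof eventually_elim
        case (elim \<omega>)
        have tele: "\<phi> t * X t \<omega> - \<phi> s * X s \<omega> = (\<Sum>k<N. \<phi> (p (Suc k)) * X (p (Suc k)) \<omega> - \<phi> (p k) * X (p k) \<omega>)"
          using sum_lessThan_telescope[of "\<lambda>k. \<phi> (p k) * X (p k) \<omega>" N] p0 by simp
        have "JN \<omega> - J \<omega> = (\<Sum>k<N. \<phi> (p k) * Jc k \<omega> - (\<phi> (p (Suc k)) * X (p (Suc k)) \<omega> - \<phi> (p k) * X (p k) \<omega>)
            + tint (p k) (p (Suc k)) ?D \<omega>)"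
          by (simp add: JN_def J_def tele elim(2)[symmetric] sum.distrib sum_subtractf)
        also have "\<dots> = (\<Sum>k<N. ?E k \<omega>)"
        proof (rule sum.cong[OF refl])
          fix k assume k: "k \<in> {..<N}"
          have jc: "Jc k \<omega> = X (p (Suc k)) \<omega> - X (p k) \<omega> - tint (p k) (p (Suc k)) b \<omega>"
            using bspec[OF elim(1) k] by simp
          then show "\<phi> (p k) * Jc k \<omega> - (\<phi> (p (Suc k)) * X (p (Suc k)) \<omega> - \<phi> (p k) * X (p k) \<omega>)
            + tint (p k) (p (Suc k)) ?D \<omega> = ?E k \<omega>"
            unfolding bspec[OF elim(3) k] jc by (simp add: algebra_simps)
        qed
        finally show ?case .
      qed
    qed
    have LE: "Lsq M (?E k)" if "k < N" for k by (rule tint_Lsq(1)[OF LH[OF that] pc[OF that]])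
    have LSE: "Lsq M (\<lambda>\<omega>. \<Sum>k<N. ?E k \<omega>)" by (intro Lsq_sum LE) simp
    have "expectation (\<lambda>\<omega>. (JN \<omega> - J \<omega>)\<^sup>2) = expectation (\<lambda>\<omega>. (\<Sum>k<N. ?E k \<omega>)\<^sup>2)"
      using id LsqD(1)[OF LSE] LsqD(1)[OF itoD(2)[OF ito]] LsqD(1)[OF LJ]
      by (intro integral_cong_AE) auto
    also have "\<dots> \<le> (real N)\<^sup>2 * (h * (2 * (K\<^sup>2 * h\<^sup>2 * Sb) + 2 * (K\<^sup>2 * (h * e1))))"
      by (rule expectation_sum_sq_le[OF LE Eb])
    \<comment> \<open>The two powers of N are absorbed by N h = t - s. The first term keeps a factor
      h, the second is governed by e1.\<close>
    also have "\<dots> = (real N * h) * (2 * K\<^sup>2 * h * ((real N * h) * Sb)) + (real N * h)\<^sup>2 * (2 * K\<^sup>2 * e1)"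
      by (simp add: power2_eq_square algebra_simps)
    also have "\<dots> = (t - s) * (2 * K\<^sup>2 * h * ((t - s) * Sb)) + (t - s)\<^sup>2 * (2 * K\<^sup>2 * e1)"
      unfolding h(5) ..
    also have "\<dots> < \<epsilon>"
    proof -
      have "(t - s)\<^sup>2 * (2 * K\<^sup>2 * e1) \<le> ((t - s)\<^sup>2 + 1) * (2 * (K\<^sup>2 + 1) * e1)"
        using e1 by (intro mult_mono) auto
      also have "\<dots> = \<epsilon> / 4"
      proof -
        have "v * (2 * w * (\<epsilon> / (8 * w * v))) = \<epsilon> / 4" if "v \<noteq> 0" "w \<noteq> 0" for v w :: real
          using that by simp
        then show ?thesis using pos unfolding e1_def by (metis less_irrefl)
      qed
      finally show ?thesis using h(4) e by linarith
    qed
    finally have sq2: "expectation (\<lambda>\<omega>. (JN \<omega> - J \<omega>)\<^sup>2) < \<epsilon>" .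
    show "\<exists>\<psi> K. ito \<psi> K \<and> sqnorm (\<lambda>r \<omega>. \<psi> r \<omega> - \<phi> r * \<sigma> r \<omega> * indicator {s<..t} r) < \<epsilon> \<and>
      expectation (\<lambda>\<omega>. (K \<omega> - J \<omega>)\<^sup>2) < \<epsilon>" using ito sq1 sq2 by blast
  qed simp
  moreover have "AE \<omega> in M. \<phi> t * X t \<omega> - \<phi> s * X s \<omega> = tint s t ?D \<omega> + J \<omega>" by (simp add: J_def)
  ultimately show "\<exists>J. ito (\<lambda>r \<omega>. \<phi> r * \<sigma> r \<omega> * indicator {s<..t} r) J \<and>
    (AE \<omega> in M. \<phi> t * X t \<omega> - \<phi> s * X s \<omega> = tint s t ?D \<omega> + J \<omega>)" by blast
qed

end

section \<open>Uniqueness for linear backward equations\<close>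

context wiener begin

lemma itoproc_energy:
  assumes X: "itoproc f \<zeta> \<eta>" and ab: "0 \<le> a" "a \<le> b" "b \<le> T" and z: "AE \<omega> in M. \<eta> b \<omega> = 0"
  shows "expectation (\<lambda>\<omega>. (\<eta> a \<omega>)\<^sup>2) + sqnorm (\<lambda>r \<omega>. \<zeta> r \<omega> * indicator {a<..b} r)
    \<le> (b - a) * sqnorm (\<lambda>r \<omega>. f r \<omega> * indicator {a<..b} r)"
proof -
  obtain J where J: "ito (\<lambda>r \<omega>. \<zeta> r \<omega> * indicator {a<..b} r) J"
    "AE \<omega> in M. \<eta> b \<omega> - \<eta> a \<omega> = tint a b f \<omega> + J \<omega>" by (rule itoprocE[OF X ab])
  note L = tint_Lsq[OF itoprocD(1)[OF X] ab] and LJ = itoD(2)[OF J(1)]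
  have a: "a \<in> {0..T}" using ab by simp
  note La = itoprocD(5)[OF X a]
  have o: "expectation (\<lambda>\<omega>. \<eta> a \<omega> * J \<omega>) = 0"
    by (rule ito_orth[OF J(1) _ _ itoprocD(4)[OF X a] La]) (use ab in auto)
  have "expectation (\<lambda>\<omega>. (tint a b f \<omega>)\<^sup>2) = expectation (\<lambda>\<omega>. (\<eta> a \<omega>)\<^sup>2 + 2 * (\<eta> a \<omega> * J \<omega>) + (J \<omega>)\<^sup>2)"
  proof (rule integral_cong_AE)
    show "AE \<omega> in M. (tint a b f \<omega>)\<^sup>2 = (\<eta> a \<omega>)\<^sup>2 + 2 * (\<eta> a \<omega> * J \<omega>) + (J \<omega>)\<^sup>2"
      using z J(2)
    proof eventually_elim
      case (elim \<omega>)
      then have t: "tint a b f \<omega> = - (\<eta> a \<omega> + J \<omega>)" by simp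
      show ?case unfolding t by (simp add: power2_eq_square algebra_simps)
    qed
  qed (use LsqD(1)[OF L(1)] LsqD(1)[OF La] LsqD(1)[OF LJ] in simp_all)
  also have "\<dots> = expectation (\<lambda>\<omega>. (\<eta> a \<omega>)\<^sup>2) + expectation (\<lambda>\<omega>. (J \<omega>)\<^sup>2)"
    using LsqD(2)[OF La] LsqD(2)[OF LJ] Lsq_mult_integrable[OF La LJ] o by simp
  finally show ?thesis using L(2) ito_isometry[OF J(1)] by simp
qed

lemma L2_proc_sq_AE_eq_0:
  assumes "L2_proc f" "sqnorm f = 0" shows "AE p in dt_dP. f (fst p) (snd p) = 0"
  by (rule Lsq_integral_eq_0_AE[OF L2_procD[OF assms(1)] assms(2)])

text \<open>The cells (a, b] never contain time 0, and this loses only a null set.\<close>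

lemma AE_dt_dP_pos: "AE p in dt_dP. 0 < fst p"
proof (rule P.AE_pair_measure)
  show "{p \<in> space dt_dP. 0 < fst p} \<in> sets dt_dP"
  proof -
    have "fst \<in> borel_measurable dt_dP"
      by (rule measurable_compose[OF measurable_fst]) (auto intro: measurable_restrict_space1)
    then show ?thesis by simp
  qed
  have "AE s in lborel. s \<in> {0..T} \<longrightarrow> 0 < (s :: real)"
    using AE_lborel_singleton[of "0 :: real"] by eventually_elim auto
  then show "AE s in dt. AE \<omega> in M. 0 < fst (s, \<omega>)"
    by (simp add: AE_restrict_space_iff)
qed

text \<open>With D the energy of all \<open>\<eta>\<close> and \<open>\<zeta>\<close> on (a, b], the
  drift has energy at most a constant times D. The energy estimate then bounds D by itself with a
  small factor when b - a is small.\<close>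

lemma linear_bsde_unique:
  fixes m :: nat
  assumes X: "\<And>c. c < m \<Longrightarrow> itoproc (f c) (\<zeta> c) (\<eta> c)"
    and z: "\<And>c. c < m \<Longrightarrow> AE \<omega> in M. \<eta> c T \<omega> = 0"
    and bnd: "\<And>c. c < m \<Longrightarrow> AE p in dt_dP. \<bar>f c (fst p) (snd p)\<bar> \<le>
      K * (\<Sum>k<m. \<bar>\<eta> k (fst p) (snd p)\<bar> + \<bar>\<zeta> k (fst p) (snd p)\<bar>)"
  shows "\<And>c. c < m \<Longrightarrow> AE p in dt_dP. \<eta> c (fst p) (snd p) = 0"
    and "\<And>c. c < m \<Longrightarrow> AE p in dt_dP. \<zeta> c (fst p) (snd p) = 0"
proof -
  note Le = itoprocD(3)[OF X] and Lz = itoprocD(2)[OF X] and Lf = itoprocD(1)[OF X]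
  let ?e = "\<lambda>c a b. sqnorm (\<lambda>r \<omega>. \<eta> c r \<omega> * indicator {a<..b} r)"
  let ?z = "\<lambda>c a b. sqnorm (\<lambda>r \<omega>. \<zeta> c r \<omega> * indicator {a<..b} r)"
  let ?f = "\<lambda>c a b. sqnorm (\<lambda>r \<omega>. f c r \<omega> * indicator {a<..b} r)"
  define D where "D a b = (\<Sum>c<m. ?e c a b + ?z c a b)" for a b
  have e0: "0 \<le> ?e c a b" and z0: "0 \<le> ?z c a b" for c a b by simp_all
  have D0: "0 \<le> D a b" for a b unfolding D_def by (intro sum_nonneg add_nonneg_nonneg e0 z0)
  have Djoin: "D a c = D a b + D b c" if "a \<le> b" "b \<le> c" for a b c
    unfolding D_def sum.distrib[symmetric]
    by (intro sum.cong refl) (simp add: sqnorm_join[OF Le that] sqnorm_join[OF Lz that])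
  \<comment> \<open>One drift component has energy at most K^2 * 2 m times D: m from Cauchy-Schwarz
    over the sum, 2 from (u + v)^2 <= 2 (u^2 + v^2). The outer m sums over the components.\<close>
  define C where "C = real m * (K\<^sup>2 * (2 * real m))"
  have C0: "0 \<le> C" by (simp add: C_def)
  have fD: "?f c a b \<le> K\<^sup>2 * (2 * real m) * D a b" if c: "c < m" for c a b
  proof -
    let ?I = "\<lambda>p. indicator {a<..b} (fst p) :: real"
    have ie: "integrable dt_dP (\<lambda>p. (\<eta> k (fst p) (snd p) * ?I p)\<^sup>2)" if "k < m" for k
      using LsqD(2)[OF L2_procD[OF L2_proc_indicator[OF Le[OF that], of "{a<..b}"]]] by simp
    have iz: "integrable dt_dP (\<lambda>p. (\<zeta> k (fst p) (snd p) * ?I p)\<^sup>2)" if "k < m" for k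
      using LsqD(2)[OF L2_procD[OF L2_proc_indicator[OF Lz[OF that], of "{a<..b}"]]] by simp
    have "?f c a b \<le> (\<integral>p. K\<^sup>2 * (2 * real m) *
      (\<Sum>k<m. (\<eta> k (fst p) (snd p) * ?I p)\<^sup>2 + (\<zeta> k (fst p) (snd p) * ?I p)\<^sup>2) \<partial>dt_dP)"
    proof (rule integral_mono_AE)
      show "integrable dt_dP (\<lambda>p. (f c (fst p) (snd p) * ?I p)\<^sup>2)"
        using LsqD(2)[OF L2_procD[OF L2_proc_indicator[OF Lf[OF c], of "{a<..b}"]]] by simp
      show "integrable dt_dP (\<lambda>p. K\<^sup>2 * (2 * real m) *
        (\<Sum>k<m. (\<eta> k (fst p) (snd p) * ?I p)\<^sup>2 + (\<zeta> k (fst p) (snd p) * ?I p)\<^sup>2))"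
        using ie iz by (intro integrable_mult_right Bochner_Integration.integrable_sum Bochner_Integration.integrable_add) auto
      show "AE p in dt_dP. (f c (fst p) (snd p) * ?I p)\<^sup>2 \<le> K\<^sup>2 * (2 * real m) *
        (\<Sum>k<m. (\<eta> k (fst p) (snd p) * ?I p)\<^sup>2 + (\<zeta> k (fst p) (snd p) * ?I p)\<^sup>2)"
        using bnd[OF c]
      proof eventually_elim
        case (elim p)
        let ?u = "\<lambda>k. \<bar>\<eta> k (fst p) (snd p)\<bar>" and ?v = "\<lambda>k. \<bar>\<zeta> k (fst p) (snd p)\<bar>"
        have "\<bar>f c (fst p) (snd p)\<bar> \<le> \<bar>K * (\<Sum>k<m. ?u k + ?v k)\<bar>"
          using elim by linarith
        then have "(f c (fst p) (snd p))\<^sup>2 \<le> (K * (\<Sum>k<m. ?u k + ?v k))\<^sup>2"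
          by (simp only: abs_le_square_iff)
        also have "\<dots> = K\<^sup>2 * (\<Sum>k<m. ?u k + ?v k)\<^sup>2" by (simp add: power_mult_distrib)
        also have "\<dots> \<le> K\<^sup>2 * ((\<Sum>k<m. (?u k + ?v k)\<^sup>2) * real m)"
          using sum_squared_le_sum_of_squares[of "\<lambda>k. ?u k + ?v k" "{..<m}"] by (intro mult_left_mono) simp_all
        also have "\<dots> \<le> K\<^sup>2 * ((\<Sum>k<m. 2 * ((\<eta> k (fst p) (snd p))\<^sup>2 + (\<zeta> k (fst p) (snd p))\<^sup>2)) * real m)"
        proof (intro mult_left_mono mult_right_mono sum_mono)
          fix k
          have "0 \<le> (?u k - ?v k)\<^sup>2" by simp
          then show "(?u k + ?v k)\<^sup>2 \<le> 2 * ((\<eta> k (fst p) (snd p))\<^sup>2 + (\<zeta> k (fst p) (snd p))\<^sup>2)"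
            by (simp add: power2_sum power2_diff)
        qed simp_all
        also have "\<dots> = K\<^sup>2 * (2 * real m) * (\<Sum>k<m. (\<eta> k (fst p) (snd p))\<^sup>2 + (\<zeta> k (fst p) (snd p))\<^sup>2)"
          unfolding sum_distrib_left[symmetric] by (simp only: mult_ac)
        finally have *: "(f c (fst p) (snd p))\<^sup>2 \<le> K\<^sup>2 * (2 * real m) * (\<Sum>k<m. (\<eta> k (fst p) (snd p))\<^sup>2 + (\<zeta> k (fst p) (snd p))\<^sup>2)" .
        show ?case using * by (cases "fst p \<in> {a<..b}") simp_all
      qed
    qed
    also have "\<dots> = K\<^sup>2 * (2 * real m) * D a b"
      using ie iz by (simp add: D_def Bochner_Integration.integral_sum)
    finally show ?thesis .
  qed
  have en: "(\<Sum>c<m. expectation (\<lambda>\<omega>. (\<eta> c a \<omega>)\<^sup>2) + ?z c a b) \<le> (b - a) * (C * D a b)"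
    if ab: "0 \<le> a" "a \<le> b" "b \<le> T" and zb: "\<And>c. c < m \<Longrightarrow> AE \<omega> in M. \<eta> c b \<omega> = 0" for a b
  proof -
    have "(\<Sum>c<m. expectation (\<lambda>\<omega>. (\<eta> c a \<omega>)\<^sup>2) + ?z c a b) \<le> (\<Sum>c<m. (b - a) * (K\<^sup>2 * (2 * real m) * D a b))"
    proof (rule sum_mono)
      fix c assume "c \<in> {..<m}"
      then have c: "c < m" by simp
      show "expectation (\<lambda>\<omega>. (\<eta> c a \<omega>)\<^sup>2) + ?z c a b \<le> (b - a) * (K\<^sup>2 * (2 * real m) * D a b)"
        using itoproc_energy[OF X[OF c] ab zb[OF c]] mult_left_mono[OF fD[OF c, of a b], of "b - a"] ab
        by linarith
    qed
    then show ?thesis by (simp add: C_def algebra_simps)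
  qed
  \<comment> \<open>Under the two smallness conditions the \<open>\<eta>\<close> part and the
    \<open>\<zeta>\<close> part of D are each at most D / 4, so D = 0. That \<open>\<eta>\<close>
    also vanishes at the time a itself is the terminal condition for the next interval to the
    left.\<close>
  have step: "D a b = 0 \<and> (\<forall>c<m. \<forall>a'. a \<le> a' \<and> a' \<le> b \<longrightarrow> (AE \<omega> in M. \<eta> c a' \<omega> = 0))"
    if ab: "0 \<le> a" "a \<le> b" "b \<le> T" and zb: "\<And>c. c < m \<Longrightarrow> AE \<omega> in M. \<eta> c b \<omega> = 0"
      and small: "b - a \<le> 1" "(b - a) * (C * 4) \<le> 1" for a b
  proof -
    have sec: "(\<Sum>c<m. expectation (\<lambda>\<omega>. (\<eta> c a' \<omega>)\<^sup>2)) \<le> (b - a) * (C * D a b)"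
      if a': "a \<le> a'" "a' \<le> b" for a'
    proof -
      have "(\<Sum>c<m. expectation (\<lambda>\<omega>. (\<eta> c a' \<omega>)\<^sup>2)) \<le> (\<Sum>c<m. expectation (\<lambda>\<omega>. (\<eta> c a' \<omega>)\<^sup>2) + ?z c a' b)"
        by (intro sum_mono) simp
      also have "\<dots> \<le> (b - a') * (C * D a' b)" using a' ab by (intro en zb) auto
      also have "\<dots> \<le> (b - a) * (C * D a b)"
        using a' ab C0 D0[of a a'] D0[of a' b] Djoin[OF a'] by (intro mult_mono mult_nonneg_nonneg) auto
      finally show ?thesis .
    qed
    \<comment> \<open>The second factor b - a comes from integrating in time the bound on the second
      moments at single times.\<close>
    have E: "(\<Sum>c<m. ?e c a b) \<le> (b - a) * ((b - a) * (C * D a b))"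
    proof -
      have i: "integrable dt_dP (\<lambda>p. (\<eta> c (fst p) (snd p) * indicator {a<..b} (fst p))\<^sup>2)" if "c < m" for c
        using LsqD(2)[OF L2_procD[OF L2_proc_indicator[OF Le[OF that], of "{a<..b}"]]] by simp
      have "(\<Sum>c<m. ?e c a b) = (\<Sum>c<m. \<integral>s. expectation (\<lambda>\<omega>. (\<eta> c s \<omega> * indicator {a<..b} s)\<^sup>2) \<partial>dt)"
        using P.integral_fst'[OF i] by simp
      also have "\<dots> = (\<integral>s. (\<Sum>c<m. expectation (\<lambda>\<omega>. (\<eta> c s \<omega> * indicator {a<..b} s)\<^sup>2)) \<partial>dt)"
        using P.integrable_fst'[OF i] by (intro Bochner_Integration.integral_sum[symmetric]) simp
      also have "\<dots> \<le> (\<integral>s. ((b - a) * (C * D a b)) * indicator {a<..b} s \<partial>dt)"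
      proof (rule integral_mono)
        show "integrable dt (\<lambda>s. \<Sum>c<m. expectation (\<lambda>\<omega>. (\<eta> c s \<omega> * indicator {a<..b} s)\<^sup>2))"
          using P.integrable_fst'[OF i] by (intro Bochner_Integration.integrable_sum) simp
        show "integrable dt (\<lambda>s. ((b - a) * (C * D a b)) * indicator {a<..b} s)"
          using finite_measure.Lsq_integrable[OF finite_dt Lsq_indicator_dt[of "{a<..b}"]]
          by (intro integrable_mult_right) simp
        show "(\<Sum>c<m. expectation (\<lambda>\<omega>. (\<eta> c s \<omega> * indicator {a<..b} s)\<^sup>2))
            \<le> ((b - a) * (C * D a b)) * indicator {a<..b} s" for s
          using sec[of s] by (cases "s \<in> {a<..b}") simp_all
      qed
      also have "\<dots> = (b - a) * ((b - a) * (C * D a b))"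
        using integral_indicator_dt[OF ab] by simp
      finally show ?thesis .
    qed
    have Z: "(\<Sum>c<m. ?z c a b) \<le> (b - a) * (C * D a b)"
    proof -
      have "(\<Sum>c<m. ?z c a b) \<le> (\<Sum>c<m. expectation (\<lambda>\<omega>. (\<eta> c a \<omega>)\<^sup>2) + ?z c a b)"
        by (intro sum_mono) simp
      then show ?thesis using en[OF ab zb] by linarith
    qed
    have q: "(b - a) * (C * D a b) \<le> D a b / 4"
      using mult_right_mono[OF small(2) D0[of a b]] by (simp add: algebra_simps)
    have "(b - a) * ((b - a) * (C * D a b)) \<le> 1 * ((b - a) * (C * D a b))"
      using small ab C0 D0[of a b] by (intro mult_right_mono mult_nonneg_nonneg) auto
    moreover have "D a b = (\<Sum>c<m. ?e c a b) + (\<Sum>c<m. ?z c a b)" by (simp add: D_def sum.distrib)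
    ultimately have D: "D a b = 0" using E Z q D0[of a b] by linarith
    have "AE \<omega> in M. \<eta> c a' \<omega> = 0" if c: "c < m" and a': "a \<le> a'" "a' \<le> b" for c a'
    proof (rule Lsq_integral_eq_0_AE)
      show "Lsq M (\<eta> c a')" using a' ab by (intro itoprocD(5)[OF X[OF c]]) auto
      have "(\<Sum>c<m. expectation (\<lambda>\<omega>. (\<eta> c a' \<omega>)\<^sup>2)) \<le> 0" using sec[OF a'] D by simp
      moreover have "expectation (\<lambda>\<omega>. (\<eta> c a' \<omega>)\<^sup>2) \<le> (\<Sum>c<m. expectation (\<lambda>\<omega>. (\<eta> c a' \<omega>)\<^sup>2))"
        using c by (intro member_le_sum) auto
      ultimately show "expectation (\<lambda>\<omega>. (\<eta> c a' \<omega>)\<^sup>2) = 0"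
        by (intro antisym) auto
    qed
    then show ?thesis using D by blast
  qed
  \<comment> \<open>Intervals of this length satisfy both smallness conditions, also when C =
    0.\<close>
  define \<delta> where "\<delta> = 1 / (4 * C + 1)"
  have \<delta>: "0 < \<delta>" "\<delta> \<le> 1" "\<delta> * (C * 4) \<le> 1" using C0 by (simp_all add: \<delta>_def)
  \<comment> \<open>Backwards from T in steps of length \<delta>; \<open>max 0\<close> shortens the
    last one so that it ends at time 0.\<close>
  have ind: "D (max 0 (T - real n * \<delta>)) T = 0 \<and>
      (\<forall>c<m. AE \<omega> in M. \<eta> c (max 0 (T - real n * \<delta>)) \<omega> = 0)" for n :: nat
  proof (induction n)
    case 0
    have "max 0 (T - real 0 * \<delta>) = T" using T_pos by simp
    then show ?case using z by (simp add: D_def)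
  next
    case (Suc n)
    let ?b = "max 0 (T - real n * \<delta>)" and ?a = "max 0 (T - real (Suc n) * \<delta>)"
    have ab: "0 \<le> ?a" "?a \<le> ?b" "?b \<le> T" "?b - ?a \<le> \<delta>"
      using \<delta>(1) T_pos by (auto simp: distrib_right)
    have "(?b - ?a) * (C * 4) \<le> \<delta> * (C * 4)" using ab(4) C0 by (intro mult_right_mono) auto
    then have s: "?b - ?a \<le> 1" "(?b - ?a) * (C * 4) \<le> 1" using ab(4) \<delta> by linarith+
    have "D ?a ?b = 0 \<and> (\<forall>c<m. \<forall>a'. ?a \<le> a' \<and> a' \<le> ?b \<longrightarrow> (AE \<omega> in M. \<eta> c a' \<omega> = 0))"
      by (rule step[OF ab(1-3) _ s]) (use Suc in blast)
    moreover have "D ?a T = D ?a ?b + D ?b T" by (rule Djoin[OF ab(2,3)])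
    ultimately show ?case using Suc ab(2) by auto
  qed
  obtain n :: nat where "T / \<delta> \<le> real n" using real_arch_simple by blast
  then have "T - real n * \<delta> \<le> 0" using \<delta>(1) by (simp add: field_simps)
  then have D: "D 0 T = 0" using ind[of n] by (simp add: max_def split: if_splits)
  have eq0: "?e c 0 T = 0 \<and> ?z c 0 T = 0" if c: "c < m" for c
  proof -
    have "?e c 0 T + ?z c 0 T \<le> D 0 T" unfolding D_def
      using c by (intro member_le_sum[of c "{..<m}" "\<lambda>c. ?e c 0 T + ?z c 0 T"]) auto
    then show ?thesis using D e0[of c 0 T] z0[of c 0 T] by linarith
  qed
  have T: "AE p in dt_dP. fst p \<in> {0<..T}"
    using AE_dt_dP_pos AE_space by eventually_elim (auto simp: space_dt_dP)
  show "AE p in dt_dP. \<eta> c (fst p) (snd p) = 0" if c: "c < m" for c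
    using L2_proc_sq_AE_eq_0[OF L2_proc_indicator[OF Le[OF c], of "{0<..T}"]] eq0[OF c] T by auto
  show "AE p in dt_dP. \<zeta> c (fst p) (snd p) = 0" if c: "c < m" for c
    using L2_proc_sq_AE_eq_0[OF L2_proc_indicator[OF Lz[OF c], of "{0<..T}"]] eq0[OF c] T by auto
qed

end

section \<open>Bounded measurable matrix functions\<close>

definition bdd_meas :: "real \<Rightarrow> (real \<Rightarrow> real) \<Rightarrow> bool" where
  "bdd_meas T f \<longleftrightarrow> f \<in> borel_measurable (restrict_space borel {0..T}) \<and>
     (\<exists>K. \<forall>t\<in>{0..T}. \<bar>f t\<bar> \<le> K)"

lemma bdd_meas_cong: "(\<And>t. t \<in> {0..T} \<Longrightarrow> f t = g t) \<Longrightarrow> bdd_meas T f \<longleftrightarrow> bdd_meas T g"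
  unfolding bdd_meas_def by (intro conj_cong measurable_cong) auto

lemma bdd_meas_const [simp]: "bdd_meas T (\<lambda>t. c)"
  by (auto simp: bdd_meas_def)

lemma bdd_meas_add:
  assumes "bdd_meas T f" "bdd_meas T g" shows "bdd_meas T (\<lambda>t. f t + g t)"
proof -
  obtain K L where "\<forall>t\<in>{0..T}. \<bar>f t\<bar> \<le> K" "\<forall>t\<in>{0..T}. \<bar>g t\<bar> \<le> L"
    using assms by (auto simp: bdd_meas_def)
  then have "\<forall>t\<in>{0..T}. \<bar>f t + g t\<bar> \<le> K + L" by (meson abs_triangle_ineq add_mono order_trans)
  then show ?thesis using assms by (auto simp: bdd_meas_def)
qed

lemma bdd_meas_mult:
  assumes "bdd_meas T f" "bdd_meas T g" shows "bdd_meas T (\<lambda>t. f t * g t)"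
proof -
  obtain K L where "\<forall>t\<in>{0..T}. \<bar>f t\<bar> \<le> K" "\<forall>t\<in>{0..T}. \<bar>g t\<bar> \<le> L"
    using assms by (auto simp: bdd_meas_def)
  then have "\<forall>t\<in>{0..T}. \<bar>f t * g t\<bar> \<le> \<bar>K\<bar> * \<bar>L\<bar>"
    unfolding abs_mult by (intro ballI mult_mono) (auto intro: order_trans[OF _ abs_ge_self])
  then show ?thesis using assms by (auto simp: bdd_meas_def)
qed

lemma bdd_meas_uminus: "bdd_meas T f \<Longrightarrow> bdd_meas T (\<lambda>t. - f t)"
  using bdd_meas_mult[of T "\<lambda>t. - 1" f] by simp

lemma bdd_meas_diff: "bdd_meas T f \<Longrightarrow> bdd_meas T g \<Longrightarrow> bdd_meas T (\<lambda>t. f t - g t)"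
  using bdd_meas_add[of T f "\<lambda>t. - g t"] bdd_meas_uminus[of T g] by simp

lemma bdd_meas_sum: "(\<And>i. i \<in> I \<Longrightarrow> bdd_meas T (f i)) \<Longrightarrow> bdd_meas T (\<lambda>t. \<Sum>i\<in>I. f i t)"
  by (induction I rule: infinite_finite_induct) (auto intro: bdd_meas_add)

lemma bdd_meas_prod: "(\<And>i. i \<in> I \<Longrightarrow> bdd_meas T (f i)) \<Longrightarrow> bdd_meas T (\<lambda>t. \<Prod>i\<in>I. f i t)"
  by (induction I rule: infinite_finite_induct) (auto intro: bdd_meas_mult)

text \<open>One bound for all entries against one bound for each: the sum of the absolute bounds
  serves for all. After this, coefficients can be treated entry by entry.\<close>

lemma bounded_coeff_iff:
  "bounded_coeff T r c X \<longleftrightarrow> (\<forall>t\<in>{0..T}. X t \<in> carrier_mat r c) \<and>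
     (\<forall>a<r. \<forall>b<c. bdd_meas T (\<lambda>t. X t $$ (a, b)))" (is "_ \<longleftrightarrow> ?R")
proof
  assume "bounded_coeff T r c X"
  then show ?R by (fastforce simp: bounded_coeff_def bdd_meas_def)
next
  assume R: ?R
  then have "\<forall>a\<in>{..<r}. \<forall>b\<in>{..<c}. \<exists>K. \<forall>t\<in>{0..T}. \<bar>X t $$ (a, b)\<bar> \<le> K"
    by (auto simp: bdd_meas_def)
  then obtain K where K: "\<forall>a\<in>{..<r}. \<forall>b\<in>{..<c}. \<forall>t\<in>{0..T}. \<bar>X t $$ (a, b)\<bar> \<le> K a b" by metis
  have "\<bar>X t $$ (a, b)\<bar> \<le> (\<Sum>a<r. \<Sum>b<c. \<bar>K a b\<bar>)" if "t \<in> {0..T}" "a < r" "b < c" for t a b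
  proof -
    have "\<bar>X t $$ (a, b)\<bar> \<le> \<bar>K a b\<bar>" using K that by force
    also have "\<dots> \<le> (\<Sum>b<c. \<bar>K a b\<bar>)" using that by (intro member_le_sum) auto
    also have "\<dots> \<le> (\<Sum>a<r. \<Sum>b<c. \<bar>K a b\<bar>)"
      using that by (intro member_le_sum[of a "{..<r}" "\<lambda>a. \<Sum>b<c. \<bar>K a b\<bar>"]) (auto intro: sum_nonneg)
    finally show ?thesis .
  qed
  then have "\<exists>K. \<forall>t\<in>{0..T}. \<forall>a<r. \<forall>b<c. \<bar>X t $$ (a, b)\<bar> \<le> K" by blast
  then show "bounded_coeff T r c X" using R by (simp add: bounded_coeff_def bdd_meas_def)
qed

lemma bounded_coeffI:
  "(\<And>t. t \<in> {0..T} \<Longrightarrow> X t \<in> carrier_mat r c) \<Longrightarrow>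
    (\<And>a b. a < r \<Longrightarrow> b < c \<Longrightarrow> bdd_meas T (\<lambda>t. X t $$ (a, b))) \<Longrightarrow> bounded_coeff T r c X"
  by (simp add: bounded_coeff_iff)

lemma bounded_coeffD:
  assumes "bounded_coeff T r c X"
  shows "t \<in> {0..T} \<Longrightarrow> X t \<in> carrier_mat r c" "a < r \<Longrightarrow> b < c \<Longrightarrow> bdd_meas T (\<lambda>t. X t $$ (a, b))"
  using assms by (auto simp: bounded_coeff_iff)

lemma bounded_coeffI2:
  assumes "\<And>t. t \<in> {0..T} \<Longrightarrow> X t \<in> carrier_mat r c"
    and "\<And>a b t. a < r \<Longrightarrow> b < c \<Longrightarrow> t \<in> {0..T} \<Longrightarrow> X t $$ (a, b) = f a b t"
    and "\<And>a b. a < r \<Longrightarrow> b < c \<Longrightarrow> bdd_meas T (f a b)"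
  shows "bounded_coeff T r c X"
proof (rule bounded_coeffI[OF assms(1)])
  fix a b assume ab: "a < r" "b < c"
  show "bdd_meas T (\<lambda>t. X t $$ (a, b))"
    using assms(3)[OF ab] bdd_meas_cong[of T "\<lambda>t. X t $$ (a, b)" "f a b"] assms(2)[OF ab] by blast
qed

lemma bounded_coeff_const: "X \<in> carrier_mat r c \<Longrightarrow> bounded_coeff T r c (\<lambda>t. X)"
  by (rule bounded_coeffI) auto

lemma bounded_coeff_add:
  assumes X: "bounded_coeff T r c X" and Y: "bounded_coeff T r c Y"
  shows "bounded_coeff T r c (\<lambda>t. X t + Y t)"
proof (rule bounded_coeffI2[where f = "\<lambda>a b t. X t $$ (a, b) + Y t $$ (a, b)"])
  show "X t + Y t \<in> carrier_mat r c" "\<And>a b. a < r \<Longrightarrow> b < c \<Longrightarrow> (X t + Y t) $$ (a, b) = X t $$ (a, b) + Y t $$ (a, b)"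
    if "t \<in> {0..T}" for t
    using bounded_coeffD(1)[OF X that] bounded_coeffD(1)[OF Y that] by auto
qed (intro bdd_meas_add bounded_coeffD(2)[OF X] bounded_coeffD(2)[OF Y])

lemma bounded_coeff_diff:
  assumes X: "bounded_coeff T r c X" and Y: "bounded_coeff T r c Y"
  shows "bounded_coeff T r c (\<lambda>t. X t - Y t)"
proof (rule bounded_coeffI2[where f = "\<lambda>a b t. X t $$ (a, b) - Y t $$ (a, b)"])
  show "X t - Y t \<in> carrier_mat r c" "\<And>a b. a < r \<Longrightarrow> b < c \<Longrightarrow> (X t - Y t) $$ (a, b) = X t $$ (a, b) - Y t $$ (a, b)"
    if "t \<in> {0..T}" for t
    using bounded_coeffD(1)[OF X that] bounded_coeffD(1)[OF Y that] by auto
qed (intro bdd_meas_diff bounded_coeffD(2)[OF X] bounded_coeffD(2)[OF Y])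

lemma bounded_coeff_uminus:
  assumes X: "bounded_coeff T r c X" shows "bounded_coeff T r c (\<lambda>t. - X t)"
proof (rule bounded_coeffI2[where f = "\<lambda>a b t. - X t $$ (a, b)"])
  show "- X t \<in> carrier_mat r c" "\<And>a b. a < r \<Longrightarrow> b < c \<Longrightarrow> (- X t) $$ (a, b) = - X t $$ (a, b)"
    if "t \<in> {0..T}" for t
    using bounded_coeffD(1)[OF X that] by auto
qed (intro bdd_meas_uminus bounded_coeffD(2)[OF X])

lemma bounded_coeff_smult:
  assumes X: "bounded_coeff T r c X" shows "bounded_coeff T r c (\<lambda>t. k \<cdot>\<^sub>m X t)"
proof (rule bounded_coeffI2[where f = "\<lambda>a b t. k * X t $$ (a, b)"])
  show "k \<cdot>\<^sub>m X t \<in> carrier_mat r c" "\<And>a b. a < r \<Longrightarrow> b < c \<Longrightarrow> (k \<cdot>\<^sub>m X t) $$ (a, b) = k * X t $$ (a, b)"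
    if "t \<in> {0..T}" for t
    using bounded_coeffD(1)[OF X that] by auto
qed (intro bdd_meas_mult bdd_meas_const bounded_coeffD(2)[OF X])

lemma bounded_coeff_transpose:
  assumes X: "bounded_coeff T r c X" shows "bounded_coeff T c r (\<lambda>t. (X t)\<^sup>T)"
proof (rule bounded_coeffI2[where f = "\<lambda>a b t. X t $$ (b, a)"])
  show "(X t)\<^sup>T \<in> carrier_mat c r" "\<And>a b. a < c \<Longrightarrow> b < r \<Longrightarrow> ((X t)\<^sup>T) $$ (a, b) = X t $$ (b, a)"
    if "t \<in> {0..T}" for t
    using bounded_coeffD(1)[OF X that] by auto
qed (intro bounded_coeffD(2)[OF X])

lemma bounded_coeff_mult:
  assumes X: "bounded_coeff T r k X" and Y: "bounded_coeff T k c Y"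
  shows "bounded_coeff T r c (\<lambda>t. X t * Y t)"
proof (rule bounded_coeffI2[where f = "\<lambda>a b t. \<Sum>i<k. X t $$ (a, i) * Y t $$ (i, b)"])
  show "X t * Y t \<in> carrier_mat r c"
    "\<And>a b. a < r \<Longrightarrow> b < c \<Longrightarrow> (X t * Y t) $$ (a, b) = (\<Sum>i<k. X t $$ (a, i) * Y t $$ (i, b))"
    if "t \<in> {0..T}" for t
    using bounded_coeffD(1)[OF X that] bounded_coeffD(1)[OF Y that]
    by (auto simp: scalar_prod_def atLeast0LessThan intro!: sum.cong)
qed (intro bdd_meas_sum bdd_meas_mult bounded_coeffD(2)[OF X] bounded_coeffD(2)[OF Y], simp_all)

section \<open>Block rows, block columns and block diagonals\<close>

lemma hcat_carrier: "hcat r Ms \<in> carrier_mat r (sum_list (map dim_col Ms))"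
  by (induction Ms) (auto simp: hcat_def mat_of_cols_def)

lemma vcat_carrier: "vcat c Ms \<in> carrier_mat (sum_list (map dim_row Ms)) c"
  by (induction Ms) (auto simp: vcat_def mat_of_rows_def)

lemma hcat_Nil: "hcat r [] = 0\<^sub>m r 0"
  by (rule eq_matI) (auto simp: hcat_def mat_of_cols_def)

lemma vcat_Nil: "vcat c [] = 0\<^sub>m 0 c"
  by (rule eq_matI) (auto simp: vcat_def mat_of_rows_def)

text \<open>Peels off one block. Boundedness of block rows and their products with stacked vectors
  are both obtained by recursion on the list along this identity.\<close>

lemma hcat_Cons:
  assumes "X \<in> carrier_mat r c" "hcat r Xs \<in> carrier_mat r c'"
  shows "hcat r (X # Xs) = Matrix.mat r (c + c')
    (\<lambda>(i, j). if j < c then X $$ (i, j) else hcat r Xs $$ (i, j - c))"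
proof -
  have "length (concat (map cols Xs)) = c'" using assms(2) by (auto simp: hcat_def mat_of_cols_def)
  then show ?thesis using assms(1)
    by (intro eq_matI) (auto simp: hcat_def mat_of_cols_def nth_append)
qed

lemma vcat_Cons:
  assumes "X \<in> carrier_mat r c" "vcat c Xs \<in> carrier_mat r' c"
  shows "vcat c (X # Xs) = Matrix.mat (r + r') c
    (\<lambda>(i, j). if i < r then X $$ (i, j) else vcat c Xs $$ (i - r, j))"
proof -
  have "length (concat (map Matrix.rows Xs)) = r'" using assms(2) by (auto simp: vcat_def mat_of_rows_def)
  then show ?thesis using assms(1)
    by (intro eq_matI) (auto simp: vcat_def mat_of_rows_def nth_append)
qed

lemma bounded_coeff_hcat_Cons:
  assumes X: "bounded_coeff T r c X" and Y: "bounded_coeff T r c' (\<lambda>t. hcat r (Xs t))"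
  shows "bounded_coeff T r (c + c') (\<lambda>t. hcat r (X t # Xs t))"
proof (rule bounded_coeffI2[where f = "\<lambda>a b t. if b < c then X t $$ (a, b) else hcat r (Xs t) $$ (a, b - c)"])
  show "hcat r (X t # Xs t) \<in> carrier_mat r (c + c')"
    "\<And>a b. a < r \<Longrightarrow> b < c + c' \<Longrightarrow> hcat r (X t # Xs t) $$ (a, b) =
      (if b < c then X t $$ (a, b) else hcat r (Xs t) $$ (a, b - c))" if "t \<in> {0..T}" for t
    using hcat_Cons[OF bounded_coeffD(1)[OF X that] bounded_coeffD(1)[OF Y that]] by auto
  show "bdd_meas T (\<lambda>t. if b < c then X t $$ (a, b) else hcat r (Xs t) $$ (a, b - c))"
    if "a < r" "b < c + c'" for a b
    using bounded_coeffD(2)[OF X that(1), of b] bounded_coeffD(2)[OF Y that(1), of "b - c"] that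
    by (cases "b < c") auto
qed

lemma bounded_coeff_vcat_Cons:
  assumes X: "bounded_coeff T r c X" and Y: "bounded_coeff T r' c (\<lambda>t. vcat c (Xs t))"
  shows "bounded_coeff T (r + r') c (\<lambda>t. vcat c (X t # Xs t))"
proof (rule bounded_coeffI2[where f = "\<lambda>a b t. if a < r then X t $$ (a, b) else vcat c (Xs t) $$ (a - r, b)"])
  show "vcat c (X t # Xs t) \<in> carrier_mat (r + r') c"
    "\<And>a b. a < r + r' \<Longrightarrow> b < c \<Longrightarrow> vcat c (X t # Xs t) $$ (a, b) =
      (if a < r then X t $$ (a, b) else vcat c (Xs t) $$ (a - r, b))" if "t \<in> {0..T}" for t
    using vcat_Cons[OF bounded_coeffD(1)[OF X that] bounded_coeffD(1)[OF Y that]] by auto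
  show "bdd_meas T (\<lambda>t. if a < r then X t $$ (a, b) else vcat c (Xs t) $$ (a - r, b))"
    if "a < r + r'" "b < c" for a b
    using bounded_coeffD(2)[OF X _ that(2), of a] bounded_coeffD(2)[OF Y _ that(2), of "a - r"] that
    by (cases "a < r") auto
qed

lemma bounded_coeff_diag_Cons:
  assumes X: "bounded_coeff T r c X" and Y: "bounded_coeff T r' c' (\<lambda>t. diag_block_mat (Xs t))"
  shows "bounded_coeff T (r + r') (c + c') (\<lambda>t. diag_block_mat (X t # Xs t))"
proof (rule bounded_coeffI2[where f = "\<lambda>a b t. if a < r then if b < c then X t $$ (a, b) else 0
    else if b < c then 0 else diag_block_mat (Xs t) $$ (a - r, b - c)"])
  show "diag_block_mat (X t # Xs t) \<in> carrier_mat (r + r') (c + c')"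
    "\<And>a b. a < r + r' \<Longrightarrow> b < c + c' \<Longrightarrow> diag_block_mat (X t # Xs t) $$ (a, b) =
      (if a < r then if b < c then X t $$ (a, b) else 0
    else if b < c then 0 else diag_block_mat (Xs t) $$ (a - r, b - c))" if "t \<in> {0..T}" for t
    using bounded_coeffD(1)[OF X that] bounded_coeffD(1)[OF Y that] by (auto simp: Let_def)
  show "bdd_meas T (\<lambda>t. if a < r then if b < c then X t $$ (a, b) else 0
    else if b < c then 0 else diag_block_mat (Xs t) $$ (a - r, b - c))"
    if "a < r + r'" "b < c + c'" for a b
    using bounded_coeffD(2)[OF X, of a b] bounded_coeffD(2)[OF Y, of "a - r" "b - c"] that
    by (cases "a < r"; cases "b < c") auto
qed

lemma bounded_coeff_Nil:
  "bounded_coeff T r 0 (\<lambda>t. hcat r [])" "bounded_coeff T 0 c (\<lambda>t. vcat c [])"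
  "bounded_coeff T 0 0 (\<lambda>t. diag_block_mat [])"
  by (auto simp: hcat_Nil vcat_Nil intro: bounded_coeff_const)

lemma bounded_coeff_msum_Cons:
  assumes "bounded_coeff T r c X" "bounded_coeff T r c (\<lambda>t. msum r c (Xs t))"
  shows "bounded_coeff T r c (\<lambda>t. msum r c (X t # Xs t))"
  using bounded_coeff_add[OF assms] by (simp add: msum_def)

lemma bounded_coeff_msum_Nil: "bounded_coeff T r c (\<lambda>t. msum r c [])"
  by (auto simp: msum_def intro: bounded_coeff_const)

text \<open>\<open>invertible_mat\<close> supplies an inverse of unspecified dimensions. Once these
  are read off from the two identities, X is a unit of the matrix ring, so
  \<open>mat_inverse\<close> does return a value and \<open>the\<close> is harmless.\<close>

lemma minv_inverse:
  assumes X: "X \<in> carrier_mat d d" and inv: "invertible_mat X"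
  shows "minv X \<in> carrier_mat d d" "X * minv X = 1\<^sub>m d" "minv X * X = 1\<^sub>m d"
proof -
  obtain B where B: "X * B = 1\<^sub>m (dim_row X)" "B * X = 1\<^sub>m (dim_row B)"
    using inv by (auto simp: invertible_mat_def inverts_mat_def)
  have "dim_col B = d" using arg_cong[OF B(1), of dim_col] X by simp
  moreover have "dim_row B = d" using arg_cong[OF B(2), of dim_col] X by simp
  ultimately have "B \<in> carrier_mat d d" by auto
  then have "X \<in> Units (ring_mat TYPE(real) d ())"
    using B X unfolding Units_def ring_mat_simps by auto
  then obtain C where C: "mat_inverse X = Some C" using mat_inverse(1)[OF X, where b = "()"] by (cases "mat_inverse X") auto
  then show "minv X \<in> carrier_mat d d" "X * minv X = 1\<^sub>m d" "minv X * X = 1\<^sub>m d"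
    using mat_inverse(2)[OF X C] by (auto simp: minv_def)
qed

text \<open>Cramer's rule. Its purpose is measurability in time: elimination branches on pivots,
  whereas this is a quotient of polynomials in the entries.\<close>

lemma minv_entry:
  assumes X: "X \<in> carrier_mat d d" and inv: "invertible_mat X" and ab: "a < d" "b < d"
  shows "minv X $$ (a, b) = cofactor X b a / Determinant.det X"
proof -
  note I = minv_inverse[OF X inv]
  have "Determinant.det X * Determinant.det (minv X) = 1"
    using det_mult[OF X I(1)] I(2) by simp
  then have d0: "Determinant.det X \<noteq> 0" by auto
  have "adj_mat X = (minv X * X) * adj_mat X" using adj_mat(1)[OF X] I(3) by simp
  also have "\<dots> = minv X * (Determinant.det X \<cdot>\<^sub>m 1\<^sub>m d)"
    using assoc_mult_mat[OF I(1) X adj_mat(1)[OF X]] adj_mat(2)[OF X] by simp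
  also have "\<dots> = Determinant.det X \<cdot>\<^sub>m minv X"
    using I(1) by (simp add: mult_smult_distrib[OF I(1) one_carrier_mat])
  finally have "adj_mat X $$ (a, b) = Determinant.det X * minv X $$ (a, b)" using I(1) ab by simp
  then show ?thesis using X ab d0 by (simp add: adj_mat_def)
qed

text \<open>The Leibniz formula is a polynomial in the entries.\<close>

lemma bdd_meas_det:
  assumes X: "bounded_coeff T d d X"
  shows "bdd_meas T (\<lambda>t. Determinant.det (X t))"
proof -
  have "bdd_meas T (\<lambda>t. \<Sum>p\<in>{p. p permutes {0..<d}}. signof p * (\<Prod>i = 0..<d. X t $$ (i, p i)))"
    by (intro bdd_meas_sum bdd_meas_mult bdd_meas_prod bdd_meas_const bounded_coeffD(2)[OF X])
      (auto dest: permutes_in_image)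
  then show ?thesis using bounded_coeffD(1)[OF X] det_def'
    by (subst bdd_meas_cong) (auto simp: det_def')
qed

lemma bounded_coeff_mat_delete:
  assumes X: "bounded_coeff T d d X" and ij: "i < d" "j < d"
  shows "bounded_coeff T (d - 1) (d - 1) (\<lambda>t. mat_delete (X t) i j)"
proof (rule bounded_coeffI2[where f = "\<lambda>a b t. X t $$ (if a < i then a else Suc a, if b < j then b else Suc b)"])
  show "mat_delete (X t) i j \<in> carrier_mat (d - 1) (d - 1)"
    "\<And>a b. a < d - 1 \<Longrightarrow> b < d - 1 \<Longrightarrow> mat_delete (X t) i j $$ (a, b)
      = X t $$ (if a < i then a else Suc a, if b < j then b else Suc b)" if "t \<in> {0..T}" for t
    using bounded_coeffD(1)[OF X that] by (auto simp: mat_delete_def)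
qed (rule bounded_coeffD(2)[OF X], use ij in auto)

lemma bounded_coeff_minv:
  assumes X: "bounded_coeff T d d X" and inv: "\<And>t. t \<in> {0..T} \<Longrightarrow> invertible_mat (X t)"
    and bd: "\<And>t a b. t \<in> {0..T} \<Longrightarrow> a < d \<Longrightarrow> b < d \<Longrightarrow> \<bar>minv (X t) $$ (a, b)\<bar> \<le> K"
  shows "bounded_coeff T d d (\<lambda>t. minv (X t))"
proof (rule bounded_coeffI)
  note Xc = bounded_coeffD(1)[OF X]
  show "minv (X t) \<in> carrier_mat d d" if "t \<in> {0..T}" for t
    by (rule minv_inverse(1)[OF Xc[OF that] inv[OF that]])
  fix a b assume ab: "a < d" "b < d"
  have m: "bdd_meas T (\<lambda>t. Determinant.det (X t))" "bdd_meas T (\<lambda>t. cofactor (X t) b a)"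
    using bdd_meas_det[OF X] bdd_meas_det[OF bounded_coeff_mat_delete[OF X ab(2,1)]]
    unfolding cofactor_def by (auto intro: bdd_meas_mult)
  then have "(\<lambda>t. cofactor (X t) b a / Determinant.det (X t)) \<in> borel_measurable (restrict_space borel {0..T})"
    by (intro borel_measurable_divide) (simp_all add: bdd_meas_def)
  then have "(\<lambda>t. minv (X t) $$ (a, b)) \<in> borel_measurable (restrict_space borel {0..T})"
    by (subst measurable_cong[where g = "\<lambda>t. cofactor (X t) b a / Determinant.det (X t)"])
      (auto intro!: minv_entry[OF Xc inv ab])
  then show "bdd_meas T (\<lambda>t. minv (X t) $$ (a, b))"
    unfolding bdd_meas_def using bd[OF _ ab] by (intro conjI exI[of _ K] ballI)
qed

lemma bounded_coeff_minv_bounded_inverse: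
  assumes "bounded_coeff T d d X" "has_bounded_inverse T d X"
  shows "bounded_coeff T d d (\<lambda>t. minv (X t))"
proof -
  obtain K where "\<forall>t\<in>{0..T}. \<forall>a<d. \<forall>b<d. \<bar>minv (X t) $$ (a, b)\<bar> \<le> K"
    using assms(2) by (auto simp: has_bounded_inverse_def)
  then show ?thesis using assms(2)
    by (intro bounded_coeff_minv[OF assms(1), of K]) (auto simp: has_bounded_inverse_def)
qed

text \<open>Column b of the inverse solves X w = e_b, so coercivity gives \<delta> |w|^2 <= w_b.
  Since w_b is at most |w|, the whole column has length at most 1 / \<delta>, a bound that is
  uniform in time when \<delta> is.\<close>

lemma pos_def_inverse:
  assumes X: "X \<in> carrier_mat d d" and \<delta>: "0 < \<delta>"
    and pos: "\<And>v. v \<in> carrier_vec d \<Longrightarrow> \<delta> * (v \<bullet> v) \<le> v \<bullet> (X *\<^sub>v v)"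
  shows "invertible_mat X" "a < d \<Longrightarrow> b < d \<Longrightarrow> \<bar>minv X $$ (a, b)\<bar> \<le> 1 / \<delta>"
proof -
  have sq0: "0 \<le> v \<bullet> v" for v :: rvec by (auto simp: scalar_prod_def intro: sum_nonneg)
  have "Determinant.det X \<noteq> 0"
  proof
    assume "Determinant.det X = 0"
    then obtain v where v: "v \<in> carrier_vec d" "v \<noteq> 0\<^sub>v d" "X *\<^sub>v v = 0\<^sub>v d"
      using det_0_iff_vec_prod_zero[OF X] by auto
    have "\<delta> * (v \<bullet> v) \<le> 0" using pos[OF v(1)] v by simp
    then have "v \<bullet> v = 0" using \<delta> sq0[of v] by (simp add: mult_le_0_iff)
    then have "(\<Sum>i\<in>{0..<d}. v $ i * v $ i) = 0" using v(1) by (simp add: scalar_prod_def)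
    then have "\<forall>i\<in>{0..<d}. v $ i * v $ i = 0" by (subst (asm) sum_nonneg_eq_0_iff) auto
    then have "v = 0\<^sub>v d" using v(1) by (intro eq_vecI) auto
    then show False using v(2) by simp
  qed
  then have "X \<in> Units (ring_mat TYPE(real) d ())" by (rule det_non_zero_imp_unit[OF X])
  then obtain B where "B \<in> carrier_mat d d" "X * B = 1\<^sub>m d" "B * X = 1\<^sub>m d"
    unfolding Units_def ring_mat_simps by auto
  then show inv: "invertible_mat X" using X unfolding invertible_mat_def inverts_mat_def by auto
  assume ab: "a < d" "b < d"
  note I = minv_inverse[OF X inv]
  let ?w = "Matrix.col (minv X) b"
  have w: "?w \<in> carrier_vec d" using I(1) ab by simp
  have "X *\<^sub>v ?w = Matrix.col (X * minv X) b" using I(1) ab by (simp add: col_mult2[OF X I(1)])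
  also have "\<dots> = unit_vec d b" using I(2) ab by simp
  finally have "\<delta> * (?w \<bullet> ?w) \<le> ?w $ b" using pos[OF w] w ab by simp
  moreover have comp: "(?w $ i)\<^sup>2 \<le> ?w \<bullet> ?w" if "i < d" for i
  proof -
    have "(?w $ i)\<^sup>2 = ?w $ i * ?w $ i" by (simp add: power2_eq_square)
    also have "\<dots> \<le> (\<Sum>i\<in>{0..<d}. ?w $ i * ?w $ i)"
      using that by (intro member_le_sum[of i "{0..<d}" "\<lambda>i. ?w $ i * ?w $ i"]) auto
    also have "\<dots> = ?w \<bullet> ?w" using carrier_vecD[OF w] unfolding scalar_prod_def by (simp only:)
    finally show ?thesis .
  qed
  ultimately have le: "\<delta> * (?w \<bullet> ?w) \<le> ?w $ b" "(?w $ b)\<^sup>2 \<le> ?w \<bullet> ?w" using ab by auto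
  have "?w \<bullet> ?w \<le> (1 / \<delta>)\<^sup>2"
  proof -
    have "\<delta> * (?w $ b)\<^sup>2 \<le> ?w $ b" using le mult_left_mono[OF le(2), of \<delta>] \<delta> by linarith
    then have "?w $ b \<le> 1 / \<delta>"
    proof (cases "?w $ b \<le> 0")
      case True then show ?thesis using \<delta> by (meson divide_nonneg_pos order_trans zero_le_one)
    next
      case False
      then have "\<delta> * ?w $ b \<le> 1" using \<open>\<delta> * (?w $ b)\<^sup>2 \<le> ?w $ b\<close>
        by (simp add: power2_eq_square)
      then show ?thesis using \<delta> by (simp add: field_simps)
    qed
    then have "\<delta> * (?w \<bullet> ?w) \<le> 1 / \<delta>" using le by linarith
    then show ?thesis using \<delta> by (simp add: field_simps power2_eq_square)
  qed
  then have "(?w $ a)\<^sup>2 \<le> (1 / \<delta>)\<^sup>2" using comp[OF ab(1)] by linarith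
  then have "\<bar>?w $ a\<bar> \<le> 1 / \<delta>" using \<delta> by (simp add: abs_le_square_iff[symmetric])
  then show "\<bar>minv X $$ (a, b)\<bar> \<le> 1 / \<delta>" using I(1) ab by simp
qed

lemma unif_pos_def_minv:
  assumes X: "bounded_coeff T d d X" and pos: "unif_pos_def T d X"
  shows "bounded_coeff T d d (\<lambda>t. minv (X t))" "t \<in> {0..T} \<Longrightarrow> invertible_mat (X t)"
proof -
  obtain \<delta> where \<delta>: "0 < \<delta>" "\<forall>t\<in>{0..T}. \<forall>v\<in>carrier_vec d. \<delta> * (v \<bullet> v) \<le> v \<bullet> (X t *\<^sub>v v)"
    using pos by (auto simp: unif_pos_def_def)
  show inv: "invertible_mat (X t)" if "t \<in> {0..T}" for t
    by (rule pos_def_inverse(1)[OF bounded_coeffD(1)[OF X that] \<delta>(1)]) (use \<delta>(2) that in blast)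
  show "bounded_coeff T d d (\<lambda>t. minv (X t))"
  proof (rule bounded_coeff_minv[OF X inv])
    show "\<bar>minv (X t) $$ (a, b)\<bar> \<le> 1 / \<delta>" if "t \<in> {0..T}" "a < d" "b < d" for t a b
      by (rule pos_def_inverse(2)[OF bounded_coeffD(1)[OF X that(1)] \<delta>(1) _ that(2,3)])
        (use \<delta>(2) that in blast)
  qed
qed

text \<open>The transposed inverse inverts the transpose. Symmetry matters where products B R^{-1}
  S^T are transposed in the costate equations.\<close>

lemma minv_symmetric:
  assumes X: "X \<in> carrier_mat d d" and inv: "invertible_mat X" and s: "X\<^sup>T = X"
  shows "(minv X)\<^sup>T = minv X"
proof -
  note I = minv_inverse[OF X inv]
  have It: "(minv X)\<^sup>T \<in> carrier_mat d d" using I(1) by simp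
  have "(minv X)\<^sup>T = (minv X)\<^sup>T * (X * minv X)" using I(1,2) by simp
  also have "\<dots> = ((minv X)\<^sup>T * X\<^sup>T) * minv X"
    using assoc_mult_mat[OF It X I(1)] s by simp
  also have "(minv X)\<^sup>T * X\<^sup>T = 1\<^sub>m d" using transpose_mult[OF X I(1)] I(2) by simp
  finally show ?thesis using I(1) by simp
qed

lemma unif_pos_def_add_psd:
  assumes "unif_pos_def T d X" "\<And>t v. t \<in> {0..T} \<Longrightarrow> v \<in> carrier_vec d \<Longrightarrow> 0 \<le> v \<bullet> (Y t *\<^sub>v v)"
    and "bounded_coeff T d d X" "bounded_coeff T d d Y"
  shows "unif_pos_def T d (\<lambda>t. X t + Y t)"
proof -
  obtain \<delta> where \<delta>: "0 < \<delta>" "\<forall>t\<in>{0..T}. \<forall>v\<in>carrier_vec d. \<delta> * (v \<bullet> v) \<le> v \<bullet> (X t *\<^sub>v v)"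
    using assms(1) by (auto simp: unif_pos_def_def)
  have "\<delta> * (v \<bullet> v) \<le> v \<bullet> ((X t + Y t) *\<^sub>v v)" if t: "t \<in> {0..T}" and v: "v \<in> carrier_vec d" for t v
  proof -
    note c = bounded_coeffD(1)[OF assms(3) t] bounded_coeffD(1)[OF assms(4) t]
    have "v \<bullet> ((X t + Y t) *\<^sub>v v) = v \<bullet> (X t *\<^sub>v v) + v \<bullet> (Y t *\<^sub>v v)"
      using c v by (simp add: add_mult_distrib_mat_vec[OF c v] scalar_prod_add_distrib[of v d])
    then show ?thesis using \<delta>(2) t v assms(2)[OF t v] by fastforce
  qed
  then show ?thesis using \<delta>(1) by (auto simp: unif_pos_def_def)
qed

lemma psd_congruence:
  assumes R: "unif_pos_def T k R" and Rc: "bounded_coeff T k k R" and P: "bounded_coeff T k d P"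
    and t: "t \<in> {0..T}" and v: "v \<in> carrier_vec d"
  shows "0 \<le> v \<bullet> (((P t)\<^sup>T * R t * P t) *\<^sub>v v)"
proof -
  note Pt = bounded_coeffD(1)[OF P t] and Rt = bounded_coeffD(1)[OF Rc t]
  let ?w = "P t *\<^sub>v v"
  have w: "?w \<in> carrier_vec k" using Pt v by simp
  obtain \<delta> where \<delta>: "0 < \<delta>" "\<delta> * (?w \<bullet> ?w) \<le> ?w \<bullet> (R t *\<^sub>v ?w)"
    using R t w by (auto simp: unif_pos_def_def)
  have "0 \<le> ?w \<bullet> ?w" by (auto simp: scalar_prod_def intro: sum_nonneg)
  then have "0 \<le> ?w \<bullet> (R t *\<^sub>v ?w)" using \<delta> by (meson mult_nonneg_nonneg less_imp_le order_trans)
  also have "\<dots> = v \<bullet> ((P t)\<^sup>T *\<^sub>v (R t *\<^sub>v ?w))"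
    using transpose_vec_mult_scalar[of "(P t)\<^sup>T" d k "R t *\<^sub>v ?w" v] Pt Rt v w
    by simp
  also have "\<dots> = v \<bullet> (((P t)\<^sup>T * R t * P t) *\<^sub>v v)"
    using Pt Rt v w by (simp add: assoc_mult_mat_vec[of _ d k _ d] assoc_mult_mat_vec[of _ d k _ k])
  finally show ?thesis .
qed

lemma unif_pos_def_diag_Cons:
  assumes X: "bounded_coeff T d d X" "unif_pos_def T d X"
    and Y: "bounded_coeff T d' d' (\<lambda>t. diag_block_mat (Xs t))" "unif_pos_def T d' (\<lambda>t. diag_block_mat (Xs t))"
  shows "unif_pos_def T (d + d') (\<lambda>t. diag_block_mat (X t # Xs t))"
proof -
  obtain \<delta> where \<delta>: "0 < \<delta>" "\<forall>t\<in>{0..T}. \<forall>v\<in>carrier_vec d. \<delta> * (v \<bullet> v) \<le> v \<bullet> (X t *\<^sub>v v)"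
    using X(2) by (auto simp: unif_pos_def_def)
  obtain \<epsilon> where \<epsilon>: "0 < \<epsilon>" "\<forall>t\<in>{0..T}. \<forall>v\<in>carrier_vec d'. \<epsilon> * (v \<bullet> v) \<le> v \<bullet> (diag_block_mat (Xs t) *\<^sub>v v)"
    using Y(2) by (auto simp: unif_pos_def_def)
  have "min \<delta> \<epsilon> * (v \<bullet> v) \<le> v \<bullet> (diag_block_mat (X t # Xs t) *\<^sub>v v)"
    if t: "t \<in> {0..T}" and v: "v \<in> carrier_vec (d + d')" for t v
  proof -
    note Xt = bounded_coeffD(1)[OF X(1) t] and Yt = bounded_coeffD(1)[OF Y(1) t]
    define v1 where "v1 = vec_first v d"
    define v2 where "v2 = vec_last v d'"
    have v12: "v = v1 @\<^sub>v v2" "v1 \<in> carrier_vec d" "v2 \<in> carrier_vec d'"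
      using v by (auto simp: v1_def v2_def)
    have n: "0 \<le> w \<bullet> w" for w :: rvec by (auto simp: scalar_prod_def intro: sum_nonneg)
    have "diag_block_mat (X t # Xs t) *\<^sub>v v = (X t *\<^sub>v v1) @\<^sub>v (diag_block_mat (Xs t) *\<^sub>v v2)"
      using Xt Yt mult_mat_vec_split[OF Xt Yt v12(2,3)] by (simp add: Let_def v12(1))
    then have "v \<bullet> (diag_block_mat (X t # Xs t) *\<^sub>v v)
      = v1 \<bullet> (X t *\<^sub>v v1) + v2 \<bullet> (diag_block_mat (Xs t) *\<^sub>v v2)"
      using Xt Yt v12 by (simp add: scalar_prod_append[of _ d _ d'])
    moreover have "v \<bullet> v = v1 \<bullet> v1 + v2 \<bullet> v2" using v12 by (simp add: scalar_prod_append[of _ d _ d'])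
    moreover have "min \<delta> \<epsilon> * (v1 \<bullet> v1) \<le> \<delta> * (v1 \<bullet> v1)" "min \<delta> \<epsilon> * (v2 \<bullet> v2) \<le> \<epsilon> * (v2 \<bullet> v2)"
      by (intro mult_right_mono n; simp)+
    moreover have "\<delta> * (v1 \<bullet> v1) \<le> v1 \<bullet> (X t *\<^sub>v v1)"
      "\<epsilon> * (v2 \<bullet> v2) \<le> v2 \<bullet> (diag_block_mat (Xs t) *\<^sub>v v2)" using \<delta> \<epsilon> t v12 by auto
    ultimately show ?thesis by (simp add: distrib_left)
  qed
  then show ?thesis using \<delta>(1) \<epsilon>(1) unfolding unif_pos_def_def
    by (intro exI[of _ "min \<delta> \<epsilon>"]) auto
qed

lemma unif_pos_def_diag_Nil: "unif_pos_def T 0 (\<lambda>t. diag_block_mat [])"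
  by (auto simp: unif_pos_def_def scalar_prod_def intro!: exI[of _ 1])

section \<open>Block matrices acting on stacked vectors\<close>

lemma hcat_Cons_mult:
  assumes X: "X \<in> carrier_mat r c" and Y: "hcat r Xs \<in> carrier_mat r c'"
    and v: "v \<in> carrier_vec c" and w: "w \<in> carrier_vec c'"
  shows "hcat r (X # Xs) *\<^sub>v (v @\<^sub>v w) = X *\<^sub>v v + hcat r Xs *\<^sub>v w"
proof (rule eq_vecI)
  fix i assume "i < dim_vec (X *\<^sub>v v + hcat r Xs *\<^sub>v w)"
  then have i: "i < r" using Y by simp
  have "Matrix.row (hcat r (X # Xs)) i = Matrix.row X i @\<^sub>v Matrix.row (hcat r Xs) i"
    using i X Y by (intro eq_vecI) (auto simp: hcat_Cons[OF X Y])
  then show "(hcat r (X # Xs) *\<^sub>v (v @\<^sub>v w)) $ i = (X *\<^sub>v v + hcat r Xs *\<^sub>v w) $ i"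
    using i X Y v w by (simp add: hcat_Cons[OF X Y] scalar_prod_append[of _ c _ c'])
qed (use Y in \<open>simp add: hcat_Cons[OF X Y]\<close>)

lemma vcat_Cons_mult:
  assumes X: "X \<in> carrier_mat r c" and Y: "vcat c Xs \<in> carrier_mat r' c" and v: "v \<in> carrier_vec c"
  shows "vcat c (X # Xs) *\<^sub>v v = (X *\<^sub>v v) @\<^sub>v (vcat c Xs *\<^sub>v v)"
proof (rule eq_vecI)
  fix i assume "i < dim_vec ((X *\<^sub>v v) @\<^sub>v (vcat c Xs *\<^sub>v v))"
  then have i: "i < r + r'" using X Y by simp
  have "Matrix.row (vcat c (X # Xs)) i = (if i < r then Matrix.row X i else Matrix.row (vcat c Xs) (i - r))"
    using i X Y by (intro eq_vecI) (auto simp: vcat_Cons[OF X Y])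
  then show "(vcat c (X # Xs) *\<^sub>v v) $ i = ((X *\<^sub>v v) @\<^sub>v (vcat c Xs *\<^sub>v v)) $ i"
    using i X Y by (simp add: vcat_Cons[OF X Y])
qed (use X Y in \<open>simp add: vcat_Cons[OF X Y]\<close>)

lemma diag_Cons_transpose_mult:
  assumes X: "X \<in> carrier_mat d d" and Y: "diag_block_mat Xs \<in> carrier_mat d' d'"
    and v: "v \<in> carrier_vec d" and w: "w \<in> carrier_vec d'"
  shows "(diag_block_mat (X # Xs))\<^sup>T *\<^sub>v (v @\<^sub>v w) = (X\<^sup>T *\<^sub>v v) @\<^sub>v ((diag_block_mat Xs)\<^sup>T *\<^sub>v w)"
proof -
  have "(diag_block_mat (X # Xs))\<^sup>T = four_block_mat X\<^sup>T (0\<^sub>m d d') (0\<^sub>m d' d) (diag_block_mat Xs)\<^sup>T"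
    using X Y transpose_four_block_mat[OF X zero_carrier_mat zero_carrier_mat Y] by (simp add: Let_def)
  then show ?thesis
    using mult_mat_vec_split[of "X\<^sup>T" d "(diag_block_mat Xs)\<^sup>T" d' v w] X Y v w by simp
qed

lemma mult_mat_vec_index_sum:
  "X \<in> carrier_mat r c \<Longrightarrow> v \<in> carrier_vec c \<Longrightarrow> i < r \<Longrightarrow>
    (X *\<^sub>v v) $ i = (\<Sum>k<c. X $$ (i, k) * v $ k)"
  by (auto simp: scalar_prod_def atLeast0LessThan intro!: sum.cong)

lemma bounded_coeff_entry_bound:
  assumes "bounded_coeff T r c X"
  obtains K where "0 \<le> K" "\<And>t a b. t \<in> {0..T} \<Longrightarrow> a < r \<Longrightarrow> b < c \<Longrightarrow> \<bar>X t $$ (a, b)\<bar> \<le> K"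
proof -
  obtain K where K: "\<forall>t\<in>{0..T}. \<forall>a<r. \<forall>b<c. \<bar>X t $$ (a, b)\<bar> \<le> K"
    using assms by (auto simp: bounded_coeff_def)
  show thesis by (rule that[of "\<bar>K\<bar>"]) (use K in \<open>force intro: order_trans[OF _ abs_ge_self]\<close>)+
qed

context wiener begin

section \<open>Progressive square integrable vector processes\<close>

lemma bdd_meas_dt: "bdd_meas T f \<Longrightarrow> f \<in> borel_measurable dt"
  unfolding bdd_meas_def
  by (subst measurable_cong_sets[of dt "restrict_space borel {0..T}" borel borel])
    (auto simp: sets_restrict_space)

lemma L2_proc_bdd_meas_mult:
  assumes "L2_proc f" "bdd_meas T h" shows "L2_proc (\<lambda>s \<omega>. h s * f s \<omega>)"
proof -
  obtain K where "\<forall>t\<in>{0..T}. \<bar>h t\<bar> \<le> K" using assms(2) by (auto simp: bdd_meas_def)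
  then show ?thesis by (intro L2_proc_det_mult[OF assms(1) bdd_meas_dt[OF assms(2)], of K]) auto
qed

lemma L2_proc_cong:
  "(\<And>s \<omega>. s \<in> {0..T} \<Longrightarrow> \<omega> \<in> space M \<Longrightarrow> f s \<omega> = g s \<omega>) \<Longrightarrow> L2_proc f \<longleftrightarrow> L2_proc g"
  by (rule Lsq_cong) (auto simp: space_dt_dP)

lemma progressive_cong:
  assumes "\<And>s \<omega>. s \<in> {0..T} \<Longrightarrow> \<omega> \<in> space M \<Longrightarrow> f s \<omega> = g s \<omega>"
  shows "progressive M T W f \<longleftrightarrow> progressive M T W g"
  unfolding progressive_def using assms
  by (intro ball_cong refl measurable_cong) (auto simp: space_pair_measure)

lemma progressive_add:
  "progressive M T W f \<Longrightarrow> progressive M T W g \<Longrightarrow> progressive M T W (\<lambda>s \<omega>. f s \<omega> + g s \<omega>)"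
  unfolding progressive_def split_beta' by (auto intro: borel_measurable_add)

lemma progressive_0: "progressive M T W (\<lambda>s \<omega>. 0)"
  unfolding progressive_def split_beta' by auto

lemma progressive_sum:
  "(\<And>i. i \<in> I \<Longrightarrow> progressive M T W (f i)) \<Longrightarrow> progressive M T W (\<lambda>s \<omega>. \<Sum>i\<in>I. f i s \<omega>)"
  by (induction I rule: infinite_finite_induct) (auto intro: progressive_add progressive_0)

lemma progressive_bdd_meas_mult:
  assumes f: "progressive M T W f" and h: "bdd_meas T h"
  shows "progressive M T W (\<lambda>s \<omega>. h s * f s \<omega>)"
  unfolding progressive_def split_beta'
proof
  fix t assume t: "t \<in> {0..T}"
  have "h \<in> borel_measurable (restrict_space borel {0..T})" using h by (simp add: bdd_meas_def)
  then have "h \<in> borel_measurable (restrict_space borel {0..t})"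
    by (rule measurable_restrict_mono) (use t in auto)
  from measurable_compose[OF measurable_fst this]
  have "(\<lambda>p. h (fst p)) \<in> borel_measurable (restrict_space borel {0..t} \<Otimes>\<^sub>M Fil t)" .
  moreover have "(\<lambda>p. f (fst p) (snd p)) \<in> borel_measurable (restrict_space borel {0..t} \<Otimes>\<^sub>M Fil t)"
    using f t by (simp add: progressive_def split_beta')
  ultimately show "(\<lambda>p. h (fst p) * f (fst p) (snd p)) \<in> borel_measurable (restrict_space borel {0..t} \<Otimes>\<^sub>M Fil t)"
    by (rule borel_measurable_times)
qed

lemma progressive_section:
  assumes f: "progressive M T W f" and t: "t \<in> {0..T}"
  shows "f t \<in> borel_measurable (Fil t)"
proof -
  have "(\<lambda>(s, \<omega>). f s \<omega>) \<in> borel_measurable (restrict_space borel {0..t} \<Otimes>\<^sub>M Fil t)"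
    using f t by (simp add: progressive_def)
  from measurable_compose[OF measurable_Pair1' this, of t] show ?thesis using t by simp
qed

text \<open>The componentwise form of \<open>L2F\<close>, with square integrability on the product
  measure; unlike the iterated integral of the norm, it is immediately stable under bounded
  matrices, sums and stacking.\<close>

definition L2_vec :: "nat \<Rightarrow> 'a vproc \<Rightarrow> bool" where
  "L2_vec d \<phi> \<longleftrightarrow> (\<forall>t\<in>{0..T}. \<forall>\<omega>\<in>space M. \<phi> t \<omega> \<in> carrier_vec d) \<and>
     (\<forall>k<d. progressive M T W (\<lambda>t \<omega>. \<phi> t \<omega> $ k) \<and> L2_proc (\<lambda>t \<omega>. \<phi> t \<omega> $ k))"

lemma L2_vecD:
  assumes "L2_vec d \<phi>"
  shows "t \<in> {0..T} \<Longrightarrow> \<omega> \<in> space M \<Longrightarrow> \<phi> t \<omega> \<in> carrier_vec d"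
    "k < d \<Longrightarrow> progressive M T W (\<lambda>t \<omega>. \<phi> t \<omega> $ k)" "k < d \<Longrightarrow> L2_proc (\<lambda>t \<omega>. \<phi> t \<omega> $ k)"
  using assms by (auto simp: L2_vec_def)

lemma L2F_L2_vec:
  assumes "L2F M T W d \<phi>" shows "L2_vec d \<phi>"
  unfolding L2_vec_def
proof (intro conjI allI impI)
  show c: "\<forall>t\<in>{0..T}. \<forall>\<omega>\<in>space M. \<phi> t \<omega> \<in> carrier_vec d" using assms by (simp add: L2F_def)
  fix k assume k: "k < d"
  show p: "progressive M T W (\<lambda>t \<omega>. \<phi> t \<omega> $ k)" using assms k by (simp add: L2F_def)
  show "L2_proc (\<lambda>t \<omega>. \<phi> t \<omega> $ k)"
  proof (rule LsqI_nn_integral)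
    show m: "(\<lambda>(t, \<omega>). \<phi> t \<omega> $ k) \<in> borel_measurable dt_dP" by (rule progressive_meas_dt_dP[OF p])
    have "(\<integral>\<^sup>+q. ennreal (((\<lambda>(t, \<omega>). \<phi> t \<omega> $ k) q)\<^sup>2) \<partial>dt_dP)
      = (\<integral>\<^sup>+\<omega>. (\<integral>\<^sup>+s\<in>{0..T}. ennreal ((\<phi> s \<omega> $ k)\<^sup>2) \<partial>lborel) \<partial>M)"
      using m by (subst nn_integral_dt_dP) simp_all
    also have "\<dots> \<le> (\<integral>\<^sup>+\<omega>. (\<integral>\<^sup>+s\<in>{0..T}. ennreal (\<phi> s \<omega> \<bullet> \<phi> s \<omega>) \<partial>lborel) \<partial>M)"
    proof (intro nn_integral_mono)
      fix \<omega> s assume w: "\<omega> \<in> space M"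
      show "ennreal ((\<phi> s \<omega> $ k)\<^sup>2) * indicator {0..T} s \<le> ennreal (\<phi> s \<omega> \<bullet> \<phi> s \<omega>) * indicator {0..T} s"
      proof (cases "s \<in> {0..T}")
        case True
        then have "dim_vec (\<phi> s \<omega>) = d" using c w by auto
        then have "(\<phi> s \<omega> $ k)\<^sup>2 \<le> \<phi> s \<omega> \<bullet> \<phi> s \<omega>"
          using member_le_sum[of k "{0..<d}" "\<lambda>i. \<phi> s \<omega> $ i * \<phi> s \<omega> $ i"] k
          by (simp add: scalar_prod_def power2_eq_square)
        then show ?thesis using True by (simp add: ennreal_leI)
      qed simp
    qed
    also have "\<dots> < \<infinity>" using assms by (simp add: L2F_def)
    finally show "(\<integral>\<^sup>+q. ennreal (((\<lambda>(t, \<omega>). \<phi> t \<omega> $ k) q)\<^sup>2) \<partial>dt_dP) < \<infinity>" .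
  qed
qed

lemma L2_vecI:
  assumes "\<And>t \<omega>. t \<in> {0..T} \<Longrightarrow> \<omega> \<in> space M \<Longrightarrow> \<phi> t \<omega> \<in> carrier_vec d"
    and "\<And>t \<omega> k. t \<in> {0..T} \<Longrightarrow> \<omega> \<in> space M \<Longrightarrow> k < d \<Longrightarrow> \<phi> t \<omega> $ k = f k t \<omega>"
    and "\<And>k. k < d \<Longrightarrow> progressive M T W (f k)" "\<And>k. k < d \<Longrightarrow> L2_proc (f k)"
  shows "L2_vec d \<phi>"
  unfolding L2_vec_def
proof (intro conjI allI impI ballI assms(1))
  fix k assume k: "k < d"
  show "progressive M T W (\<lambda>t \<omega>. \<phi> t \<omega> $ k)"
    using assms(3)[OF k] progressive_cong[of "\<lambda>t \<omega>. \<phi> t \<omega> $ k" "f k"] assms(2)[OF _ _ k] by blast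
  show "L2_proc (\<lambda>t \<omega>. \<phi> t \<omega> $ k)"
    using assms(4)[OF k] L2_proc_cong[of "\<lambda>t \<omega>. \<phi> t \<omega> $ k" "f k"] assms(2)[OF _ _ k] by blast
qed

lemma L2_vec_mat_mult:
  assumes X: "bounded_coeff T r c X" and \<phi>: "L2_vec c \<phi>"
  shows "L2_vec r (\<lambda>t \<omega>. X t *\<^sub>v \<phi> t \<omega>)"
proof (rule L2_vecI)
  note Xd = bounded_coeffD[OF X] and pd = L2_vecD[OF \<phi>]
  show "X t *\<^sub>v \<phi> t \<omega> \<in> carrier_vec r" "\<And>k. k < r \<Longrightarrow> (X t *\<^sub>v \<phi> t \<omega>) $ k = (\<Sum>i<c. X t $$ (k, i) * \<phi> t \<omega> $ i)"
    if "t \<in> {0..T}" "\<omega> \<in> space M" for t \<omega>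
    using Xd(1)[OF that(1)] pd(1)[OF that] by (auto simp del: index_mult_mat_vec intro: mult_mat_vec_index_sum)
  fix k assume k: "k < r"
  show "progressive M T W (\<lambda>t \<omega>. \<Sum>i<c. X t $$ (k, i) * \<phi> t \<omega> $ i)"
    using Xd(2)[OF k] pd(2) by (intro progressive_sum progressive_bdd_meas_mult) auto
  show "L2_proc (\<lambda>t \<omega>. \<Sum>i<c. X t $$ (k, i) * \<phi> t \<omega> $ i)"
    using Xd(2)[OF k] pd(3) by (intro L2_proc_sum L2_proc_bdd_meas_mult) auto
qed

lemma L2_vec_add:
  assumes \<phi>: "L2_vec d \<phi>" and \<psi>: "L2_vec d \<psi>"
  shows "L2_vec d (\<lambda>t \<omega>. \<phi> t \<omega> + \<psi> t \<omega>)"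
proof (rule L2_vecI[where f = "\<lambda>k t \<omega>. \<phi> t \<omega> $ k + \<psi> t \<omega> $ k"])
  show "\<phi> t \<omega> + \<psi> t \<omega> \<in> carrier_vec d" "\<And>k. k < d \<Longrightarrow> (\<phi> t \<omega> + \<psi> t \<omega>) $ k = \<phi> t \<omega> $ k + \<psi> t \<omega> $ k"
    if "t \<in> {0..T}" "\<omega> \<in> space M" for t \<omega>
    using L2_vecD(1)[OF \<phi> that] L2_vecD(1)[OF \<psi> that] by auto
qed (intro progressive_add L2_proc_add L2_vecD(2,3)[OF \<phi>] L2_vecD(2,3)[OF \<psi>]; assumption)+

lemma L2_vec_uminus:
  assumes \<phi>: "L2_vec d \<phi>"
  shows "L2_vec d (\<lambda>t \<omega>. - \<phi> t \<omega>)"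
proof (rule L2_vecI[where f = "\<lambda>k t \<omega>. - 1 * \<phi> t \<omega> $ k"])
  show "- \<phi> t \<omega> \<in> carrier_vec d" "\<And>k. k < d \<Longrightarrow> (- \<phi> t \<omega>) $ k = - 1 * \<phi> t \<omega> $ k"
    if "t \<in> {0..T}" "\<omega> \<in> space M" for t \<omega>
    using L2_vecD(1)[OF \<phi> that] by auto
  show "progressive M T W (\<lambda>t \<omega>. - 1 * \<phi> t \<omega> $ k)" if "k < d" for k
    by (rule progressive_bdd_meas_mult[OF L2_vecD(2)[OF \<phi> that]]) simp
  show "L2_proc (\<lambda>t \<omega>. - 1 * \<phi> t \<omega> $ k)" if "k < d" for k
    by (rule L2_proc_cmult[OF L2_vecD(3)[OF \<phi> that]])
qed

lemma L2_vec_append: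
  assumes \<phi>: "L2_vec d \<phi>" and \<psi>: "L2_vec d' \<psi>"
  shows "L2_vec (d + d') (\<lambda>t \<omega>. \<phi> t \<omega> @\<^sub>v \<psi> t \<omega>)"
proof (rule L2_vecI[where f = "\<lambda>k t \<omega>. if k < d then \<phi> t \<omega> $ k else \<psi> t \<omega> $ (k - d)"])
  show "\<phi> t \<omega> @\<^sub>v \<psi> t \<omega> \<in> carrier_vec (d + d')"
    "\<And>k. k < d + d' \<Longrightarrow> (\<phi> t \<omega> @\<^sub>v \<psi> t \<omega>) $ k = (if k < d then \<phi> t \<omega> $ k else \<psi> t \<omega> $ (k - d))"
    if "t \<in> {0..T}" "\<omega> \<in> space M" for t \<omega>
    using L2_vecD(1)[OF \<phi> that] L2_vecD(1)[OF \<psi> that] by auto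
  fix k assume "k < d + d'"
  then show "progressive M T W (\<lambda>t \<omega>. if k < d then \<phi> t \<omega> $ k else \<psi> t \<omega> $ (k - d))"
    "L2_proc (\<lambda>t \<omega>. if k < d then \<phi> t \<omega> $ k else \<psi> t \<omega> $ (k - d))"
    using L2_vecD(2,3)[OF \<phi>, of k] L2_vecD(2,3)[OF \<psi>, of "k - d"] by (cases "k < d"; auto)+
qed

section \<open>Between the differentials of the game and \<open>itoproc\<close>\<close>

lemma AE_dt_neq: "AE r in dt. r \<noteq> t"
  using AE_lborel_singleton[of t] by (simp add: AE_restrict_space_iff) (auto elim: eventually_mono)

text \<open>The definitions use closed intervals and \<open>lborel\<close>, \<open>tint\<close> uses
  half-open ones and \<open>dt\<close>. The difference is the point 0, and almost every path is
  square integrable, hence integrable, on [0, T].\<close>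

lemma LINT_tint_AE:
  assumes b: "L2_proc b" and t: "0 \<le> t" "t \<le> T"
  shows "AE \<omega> in M. set_integrable lborel {0..t} (\<lambda>s. b s \<omega>) \<and>
    (LINT s:{0..t}|lborel. b s \<omega>) = tint 0 t b \<omega>"
  using L2_proc_path[OF b]
proof eventually_elim
  case (elim \<omega>)
  have m: "(\<lambda>s. b s \<omega>) \<in> borel_measurable dt" by (rule LsqD(1)[OF elim])
  have "integrable dt (\<lambda>s. b s \<omega>)" by (rule finite_measure.Lsq_integrable[OF finite_dt elim])
  then have "set_integrable lborel {0..T} (\<lambda>s. b s \<omega>)"
    by (simp add: set_integrable_def integrable_restrict_space)
  then have "set_integrable lborel {0..t} (\<lambda>s. b s \<omega>)"
    by (rule set_integrable_subset) (use t in auto)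
  moreover have "(LINT s:{0..t}|lborel. b s \<omega>) = tint 0 t b \<omega>"
  proof -
    have "(LINT s:{0..t}|lborel. b s \<omega>) = (\<integral>s. b s \<omega> * indicator {0..t} s \<partial>dt)"
      unfolding set_lebesgue_integral_def by (subst integral_restrict_space)
        (use t in \<open>auto simp: indicator_def intro!: Bochner_Integration.integral_cong\<close>)
    also have "\<dots> = tint 0 t b \<omega>" unfolding tint_def
    proof (rule integral_cong_AE)
      show "(\<lambda>s. b s \<omega> * indicator {0..t} s) \<in> borel_measurable dt"
        "(\<lambda>s. b s \<omega> * indicator {0<..t} s) \<in> borel_measurable dt"
        using m by (auto intro!: borel_measurable_times indicator_dt)
      show "AE s in dt. b s \<omega> * indicator {0..t} s = b s \<omega> * indicator {0<..t} s"
        using AE_dt_neq[of 0] by eventually_elim (auto simp: indicator_def)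
    qed
    finally show ?thesis .
  qed
  ultimately show ?case by blast
qed

text \<open>\<open>ito_diff\<close> gives square integrability in dt x dP but no second moment at a
  fixed time. One such moment, at t0, is carried to all other times by the increments. The state
  uses t0 = 0, the costates t0 = T.\<close>

lemma ito_diff_itoproc:
  assumes X: "ito_diff M T W d b \<sigma> X" and b: "L2_vec d b" and s: "L2_vec d \<sigma>"
    and t0: "t0 \<in> {0..T}" and init: "\<And>k. k < d \<Longrightarrow> Lsq M (\<lambda>\<omega>. X t0 \<omega> $ k)" and k: "k < d"
  shows "itoproc (\<lambda>t \<omega>. b t \<omega> $ k) (\<lambda>t \<omega>. \<sigma> t \<omega> $ k) (\<lambda>t \<omega>. X t \<omega> $ k)"
proof -
  note bk = L2_vecD(3)[OF b k] and sk = L2_vecD(3)[OF s k]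
  have XL: "L2_vec d X" using X by (intro L2F_L2_vec) (simp add: ito_diff_def)
  note Xk = L2_vecD(2,3)[OF XL k]
  have ex: "\<exists>J. ito (\<lambda>r \<omega>. \<sigma> r \<omega> $ k * indicator {0<..t} r) J \<and>
      (AE \<omega> in M. X t \<omega> $ k - X 0 \<omega> $ k = tint 0 t (\<lambda>t \<omega>. b t \<omega> $ k) \<omega> + J \<omega>)" if t: "t \<in> {0..T}" for t
  proof -
    obtain J where J: "has_ito_integral M T W (\<lambda>s \<omega>. \<sigma> s \<omega> $ k) t J"
      "AE \<omega> in M. set_integrable lborel {0..t} (\<lambda>s. b s \<omega> $ k) \<and>
              X t \<omega> $ k = X 0 \<omega> $ k + (LINT s:{0..t}|lborel. b s \<omega> $ k) + J \<omega>"
      using X k t unfolding ito_diff_def by meson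
    have "ito (\<lambda>r \<omega>. \<sigma> r \<omega> $ k * indicator {0<..t} r) J"
      using has_ito_integral_ito[OF J(1) _ _ sk] t by auto
    moreover have "AE \<omega> in M. X t \<omega> $ k - X 0 \<omega> $ k = tint 0 t (\<lambda>t \<omega>. b t \<omega> $ k) \<omega> + J \<omega>"
      using J(2) LINT_tint_AE[OF bk, of t] t by auto
    ultimately show ?thesis by blast
  qed
  \<comment> \<open>Integrals over (u, t] are differences of integrals from 0, the only ones that
    \<open>ito_diff\<close> provides.\<close>
  have incr: "\<exists>J. ito (\<lambda>r \<omega>. \<sigma> r \<omega> $ k * indicator {u<..t} r) J \<and>
      (AE \<omega> in M. X t \<omega> $ k - X u \<omega> $ k = tint u t (\<lambda>t \<omega>. b t \<omega> $ k) \<omega> + J \<omega>)"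
    if ut: "0 \<le> u" "u \<le> t" "t \<le> T" for u t
  proof -
    obtain J where J: "ito (\<lambda>r \<omega>. \<sigma> r \<omega> $ k * indicator {0<..t} r) J"
      "AE \<omega> in M. X t \<omega> $ k - X 0 \<omega> $ k = tint 0 t (\<lambda>t \<omega>. b t \<omega> $ k) \<omega> + J \<omega>"
      using ex[of t] ut by auto
    obtain K where K: "ito (\<lambda>r \<omega>. \<sigma> r \<omega> $ k * indicator {0<..u} r) K"
      "AE \<omega> in M. X u \<omega> $ k - X 0 \<omega> $ k = tint 0 u (\<lambda>t \<omega>. b t \<omega> $ k) \<omega> + K \<omega>"
      using ex[of u] ut by auto
    have "(\<lambda>r \<omega>. \<sigma> r \<omega> $ k * indicator {0<..t} r - \<sigma> r \<omega> $ k * indicator {0<..u} r)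
      = (\<lambda>r \<omega>. \<sigma> r \<omega> $ k * indicator {u<..t} r)"
      using ut by (intro ext) (auto simp: indicator_def)
    then have "ito (\<lambda>r \<omega>. \<sigma> r \<omega> $ k * indicator {u<..t} r) (\<lambda>\<omega>. J \<omega> - K \<omega>)"
      using ito_minus[OF J(1) K(1)] by simp
    moreover have "AE \<omega> in M. X t \<omega> $ k - X u \<omega> $ k = tint u t (\<lambda>t \<omega>. b t \<omega> $ k) \<omega> + (J \<omega> - K \<omega>)"
      using J(2) K(2) tint_join_AE[OF bk ut(1,2)] by eventually_elim simp
    ultimately show ?thesis by blast
  qed
  have meas: "(\<lambda>\<omega>. X t \<omega> $ k) \<in> borel_measurable M" if "t \<in> {0..T}" for t
    using meas_Fil_M[OF progressive_section[OF Xk(1) that]] that by simp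
  have LX: "Lsq M (\<lambda>\<omega>. X t \<omega> $ k)" if t: "t \<in> {0..T}" for t
  proof (cases "t0 \<le> t")
    case True
    obtain J where J: "ito (\<lambda>r \<omega>. \<sigma> r \<omega> $ k * indicator {t0<..t} r) J"
      "AE \<omega> in M. X t \<omega> $ k - X t0 \<omega> $ k = tint t0 t (\<lambda>t \<omega>. b t \<omega> $ k) \<omega> + J \<omega>"
      using incr[of t0 t] t t0 True by auto
    have "Lsq M (\<lambda>\<omega>. X t0 \<omega> $ k + (tint t0 t (\<lambda>t \<omega>. b t \<omega> $ k) \<omega> + J \<omega>))"
      using t t0 True by (intro Lsq_add init[OF k] tint_Lsq(1)[OF bk] itoD(2)[OF J(1)]) auto
    then show ?thesis by (rule Lsq_cong_AE[OF _ meas[OF t]]) (use J(2) in auto)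
  next
    case False
    obtain J where J: "ito (\<lambda>r \<omega>. \<sigma> r \<omega> $ k * indicator {t<..t0} r) J"
      "AE \<omega> in M. X t0 \<omega> $ k - X t \<omega> $ k = tint t t0 (\<lambda>t \<omega>. b t \<omega> $ k) \<omega> + J \<omega>"
      using incr[of t t0] t t0 False by auto
    have "Lsq M (\<lambda>\<omega>. X t0 \<omega> $ k - (tint t t0 (\<lambda>t \<omega>. b t \<omega> $ k) \<omega> + J \<omega>))"
      using t t0 False by (intro Lsq_add Lsq_diff init[OF k] tint_Lsq(1)[OF bk] itoD(2)[OF J(1)]) auto
    then show ?thesis by (rule Lsq_cong_AE[OF _ meas[OF t]]) (use J(2) in auto)
  qed
  show ?thesis unfolding itoproc_def
  proof (intro conjI bk sk Xk(2) ballI allI impI)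
    show "(\<lambda>\<omega>. X t \<omega> $ k) \<in> borel_measurable (Fil t)" if "t \<in> {0..T}" for t
      by (rule progressive_section[OF Xk(1) that])
  qed (use LX incr in auto)
qed

text \<open>The same simple processes serve, because on almost every path the inner time integrals
  coincide.\<close>

lemma has_ito_integral_cong_AE:
  assumes h: "has_ito_integral M T W f t J" and t: "0 \<le> t" "t \<le> T"
    and g: "progressive M T W g" and eq: "AE p in dt_dP. f (fst p) (snd p) = g (fst p) (snd p)"
  shows "has_ito_integral M T W g t J"
proof -
  have "(\<integral>\<^sup>+\<omega>. (\<integral>\<^sup>+s\<in>{0..t}. ennreal ((v s \<omega> - f s \<omega>)\<^sup>2) \<partial>lborel) \<partial>M)
    = (\<integral>\<^sup>+\<omega>. (\<integral>\<^sup>+s\<in>{0..t}. ennreal ((v s \<omega> - g s \<omega>)\<^sup>2) \<partial>lborel) \<partial>M)" for v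
  proof (rule nn_integral_cong_AE)
    show "AE \<omega> in M. (\<integral>\<^sup>+s\<in>{0..t}. ennreal ((v s \<omega> - f s \<omega>)\<^sup>2) \<partial>lborel)
      = (\<integral>\<^sup>+s\<in>{0..t}. ennreal ((v s \<omega> - g s \<omega>)\<^sup>2) \<partial>lborel)"
      using AE_dt_dP_path[OF eq]
    proof eventually_elim
      case (elim \<omega>)
      then have "AE s in lborel. s \<in> {0..T} \<longrightarrow> f s \<omega> = g s \<omega>"
        by (simp add: AE_restrict_space_iff)
      then show ?case
        by (intro nn_integral_cong_AE, eventually_elim) (use t in \<open>auto simp: indicator_def\<close>)
    qed
  qed
  then show ?thesis using h g unfolding has_ito_integral_def by simp
qed

text \<open>Feedback and decoupling hold only dt x dP almost everywhere. This exchanges coefficients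
  within \<open>ito_diff\<close>, the form in which the closed-loop equation is finally
  asserted.\<close>

lemma ito_diff_cong_AE:
  assumes X: "ito_diff M T W d b \<sigma> X" and b: "L2_vec d b" "L2_vec d b'" and s: "L2_vec d \<sigma>'"
    and eb: "AE p in dt_dP. b (fst p) (snd p) = b' (fst p) (snd p)"
    and es: "AE p in dt_dP. \<sigma> (fst p) (snd p) = \<sigma>' (fst p) (snd p)"
  shows "ito_diff M T W d b' \<sigma>' X"
  unfolding ito_diff_def
proof (intro conjI allI impI ballI)
  show "L2F M T W d X" using X by (simp add: ito_diff_def)
  fix k assume k: "k < d"
  show "AE \<omega> in M. continuous_on {0..T} (\<lambda>t. X t \<omega> $ k)" using X k by (simp add: ito_diff_def)
  fix t assume t: "t \<in> {0..T}"
  obtain J where J: "has_ito_integral M T W (\<lambda>s \<omega>. \<sigma> s \<omega> $ k) t J"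
    "AE \<omega> in M. set_integrable lborel {0..t} (\<lambda>s. b s \<omega> $ k) \<and>
            X t \<omega> $ k = X 0 \<omega> $ k + (LINT s:{0..t}|lborel. b s \<omega> $ k) + J \<omega>"
    using X k t unfolding ito_diff_def by meson
  have "has_ito_integral M T W (\<lambda>s \<omega>. \<sigma>' s \<omega> $ k) t J"
    using es t by (intro has_ito_integral_cong_AE[OF J(1)] L2_vecD(2)[OF s k]) auto
  moreover have "AE \<omega> in M. tint 0 t (\<lambda>s \<omega>. b s \<omega> $ k) \<omega> = tint 0 t (\<lambda>s \<omega>. b' s \<omega> $ k) \<omega>"
    using eb by (intro tint_cong_AE L2_vecD(3)[OF b(1) k] L2_vecD(3)[OF b(2) k]) auto
  then have "AE \<omega> in M. set_integrable lborel {0..t} (\<lambda>s. b' s \<omega> $ k) \<and>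
            X t \<omega> $ k = X 0 \<omega> $ k + (LINT s:{0..t}|lborel. b' s \<omega> $ k) + J \<omega>"
    using J(2) LINT_tint_AE[OF L2_vecD(3)[OF b(1) k], of t] LINT_tint_AE[OF L2_vecD(3)[OF b(2) k], of t] t
    by auto
  ultimately show "\<exists>J. has_ito_integral M T W (\<lambda>s \<omega>. \<sigma>' s \<omega> $ k) t J \<and>
     (AE \<omega> in M. set_integrable lborel {0..t} (\<lambda>s. b' s \<omega> $ k) \<and>
            X t \<omega> $ k = X 0 \<omega> $ k + (LINT s:{0..t}|lborel. b' s \<omega> $ k) + J \<omega>)" by blast
qed

text \<open>Turns the terminal integrals of \<open>terminal_ode\<close> into increments. A solution
  of X' + f = 0 has derivative -f, whence the sign.\<close>

lemma LINT_terminal_dt: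
  assumes f: "bdd_meas T f" and st: "0 \<le> s" "s \<le> t" "t \<le> T"
  shows "(LINT r:{t..T}|lborel. f r) - (LINT r:{s..T}|lborel. f r) = (\<integral>r. - f r * indicator {s<..t} r \<partial>dt)"
proof -
  obtain K where "\<forall>t\<in>{0..T}. \<bar>f t\<bar> \<le> K" using f by (auto simp: bdd_meas_def)
  then have L: "Lsq dt f" by (intro finite_measure.Lsq_bounded[OF finite_dt bdd_meas_dt[OF f], of K]) auto
  have eq: "(LINT r:{u..T}|lborel. f r) = (\<integral>r. f r * indicator {u<..T} r \<partial>dt)" if u: "0 \<le> u" "u \<le> T" for u
  proof -
    have "(LINT r:{u..T}|lborel. f r) = (\<integral>r. f r * indicator {u..T} r \<partial>dt)"
      unfolding set_lebesgue_integral_def by (subst integral_restrict_space)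
        (use u in \<open>auto simp: indicator_def intro!: Bochner_Integration.integral_cong\<close>)
    also have "\<dots> = (\<integral>r. f r * indicator {u<..T} r \<partial>dt)"
    proof (rule integral_cong_AE)
      show "(\<lambda>r. f r * indicator {u..T} r) \<in> borel_measurable dt"
        "(\<lambda>r. f r * indicator {u<..T} r) \<in> borel_measurable dt"
        using LsqD(1)[OF L] by (auto intro!: borel_measurable_times indicator_dt)
      show "AE r in dt. f r * indicator {u..T} r = f r * indicator {u<..T} r"
        using AE_dt_neq[of u] by eventually_elim (auto simp: indicator_def)
    qed
    finally show ?thesis .
  qed
  have "(LINT r:{t..T}|lborel. f r) - (LINT r:{s..T}|lborel. f r)
    = (\<integral>r. f r * indicator {t<..T} r - f r * indicator {s<..T} r \<partial>dt)"
    using eq[of t] eq[of s] st Lsq_dt_ind_integrable[OF L] by simp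
  also have "\<dots> = (\<integral>r. - f r * indicator {s<..t} r \<partial>dt)"
    using st by (intro Bochner_Integration.integral_cong refl) (auto simp: indicator_def)
  finally show ?thesis .
qed

end

section \<open>Decoupling by the Riccati equation\<close>

context wiener begin

text \<open>Provides the constant of \<open>linear_bsde_unique\<close> from the coefficients that
  multiply the two defects.\<close>

lemma riccati_residual_bound:
  assumes H: "bounded_coeff T m m H" and H': "bounded_coeff T m m H'"
  obtains K where "0 \<le> K" "\<And>t (e :: rvec) (z :: rvec) c. t \<in> {0..T} \<Longrightarrow> e \<in> carrier_vec m \<Longrightarrow> z \<in> carrier_vec m \<Longrightarrow> c < m \<Longrightarrow>
    \<bar>(H t *\<^sub>v e + H' t *\<^sub>v z) $ c\<bar> \<le> K * (\<Sum>k<m. \<bar>e $ k\<bar> + \<bar>z $ k\<bar>)"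
proof -
  obtain K where K: "0 \<le> K" "\<And>t a b. t \<in> {0..T} \<Longrightarrow> a < m \<Longrightarrow> b < m \<Longrightarrow> \<bar>H t $$ (a, b)\<bar> \<le> K"
    using bounded_coeff_entry_bound[OF H] by blast
  obtain K' where K': "0 \<le> K'" "\<And>t a b. t \<in> {0..T} \<Longrightarrow> a < m \<Longrightarrow> b < m \<Longrightarrow> \<bar>H' t $$ (a, b)\<bar> \<le> K'"
    using bounded_coeff_entry_bound[OF H'] by blast
  show thesis
  proof (rule that[of "K + K'"])
    show "0 \<le> K + K'" using K K' by simp
    fix t c and e z :: rvec
    assume t: "t \<in> {0..T}" and e: "e \<in> carrier_vec m" and z: "z \<in> carrier_vec m" and c: "c < m"
    have "(H t *\<^sub>v e + H' t *\<^sub>v z) $ c = (H t *\<^sub>v e) $ c + (H' t *\<^sub>v z) $ c"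
      using bounded_coeffD(1)[OF H' t] c by simp
    also have "\<dots> = (\<Sum>k<m. H t $$ (c, k) * e $ k + H' t $$ (c, k) * z $ k)"
      unfolding mult_mat_vec_index_sum[OF bounded_coeffD(1)[OF H t] e c]
        mult_mat_vec_index_sum[OF bounded_coeffD(1)[OF H' t] z c] by (simp add: sum.distrib)
    also have "\<bar>\<dots>\<bar> \<le> (\<Sum>k<m. (K + K') * (\<bar>e $ k\<bar> + \<bar>z $ k\<bar>))"
    proof (rule order_trans[OF sum_abs], rule sum_mono)
      fix k assume "k \<in> {..<m}"
      then have k: "k < m" by simp
      have "\<bar>H t $$ (c, k) * e $ k\<bar> \<le> (K + K') * \<bar>e $ k\<bar>"
        unfolding abs_mult using K(2)[OF t c k] K'(1) by (intro mult_right_mono) auto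
      moreover have "\<bar>H' t $$ (c, k) * z $ k\<bar> \<le> (K + K') * \<bar>z $ k\<bar>"
        unfolding abs_mult using K'(2)[OF t c k] K(1) by (intro mult_right_mono) auto
      ultimately show "\<bar>H t $$ (c, k) * e $ k + H' t $$ (c, k) * z $ k\<bar> \<le> (K + K') * (\<bar>e $ k\<bar> + \<bar>z $ k\<bar>)"
        unfolding distrib_left by linarith
    qed
    finally show "\<bar>(H t *\<^sub>v e + H' t *\<^sub>v z) $ c\<bar> \<le> (K + K') * (\<Sum>k<m. \<bar>e $ k\<bar> + \<bar>z $ k\<bar>)"
      by (simp add: sum_distrib_left)
  qed
qed

end

text \<open>Cancellation of vectors needs equal dimensions, so the rearrangement is isolated here
  and checked componentwise.\<close>

lemma residual_cancel:
  fixes q1 q2 q3 q4 q5 q6 r1 r2 r3 r4 :: rvec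
  assumes "q1 \<in> carrier_vec m" "q2 \<in> carrier_vec m" "q3 \<in> carrier_vec m" "q4 \<in> carrier_vec m"
    "q5 \<in> carrier_vec m" "q6 \<in> carrier_vec m" "r1 \<in> carrier_vec m" "r2 \<in> carrier_vec m"
    "r3 \<in> carrier_vec m" "r4 \<in> carrier_vec m"
  shows "- (r1 + r2 + q4) + (q1 + q2 + q3 + q4 + (q5 + q6)) - (q1 + r3 + r4)
    = - (((r1 - q2) + (r3 - q3)) + ((r2 - q5) + (r4 - q6)))"
  using assms by (intro eq_vecI) auto

text \<open>With \<open>e = Y - \<Phi> x\<close> and \<open>h = Z - \<Phi> \<sigma>\<close>, where \<open>\<sigma>\<close> is the diffusion of \<open>x\<close>, the Riccati
  equation is exactly what makes the drift of \<open>e\<close> linear in \<open>(e, h)\<close>.\<close>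

lemma riccati_residual:
  fixes A B1 B2 C D1 D2 AT CT Q \<Phi> \<Psi> I :: rmat
  assumes carr: "A \<in> carrier_mat n n" "B1 \<in> carrier_mat n m" "B2 \<in> carrier_mat n m"
      "C \<in> carrier_mat n n" "D1 \<in> carrier_mat n m" "D2 \<in> carrier_mat n m"
      "AT \<in> carrier_mat m m" "CT \<in> carrier_mat m m" "Q \<in> carrier_mat m n"
      "\<Phi> \<in> carrier_mat m n" "I \<in> carrier_mat m m"
    and v: "x \<in> carrier_vec n" "Y \<in> carrier_vec m" "Z \<in> carrier_vec m"
    and inv: "I * (1\<^sub>m m - \<Phi> * D2) = 1\<^sub>m m" "(1\<^sub>m m - \<Phi> * D2) * I = 1\<^sub>m m"
    and \<Psi>: "\<Psi> = I * (\<Phi> * C + \<Phi> * D1 * \<Phi>)"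
  defines "e \<equiv> Y - \<Phi> *\<^sub>v x"
    and "h \<equiv> Z - \<Phi> *\<^sub>v (C *\<^sub>v x + D1 *\<^sub>v Y + D2 *\<^sub>v Z)"
  shows "Z - \<Psi> *\<^sub>v x = I *\<^sub>v (h + \<Phi> *\<^sub>v (D1 *\<^sub>v e))"
    and "- (AT *\<^sub>v Y + CT *\<^sub>v Z + Q *\<^sub>v x)
      + (\<Phi> * A + AT * \<Phi> + \<Phi> * B1 * \<Phi> + Q + (CT + \<Phi> * B2) * \<Psi>) *\<^sub>v x
      - \<Phi> *\<^sub>v (A *\<^sub>v x + B1 *\<^sub>v Y + B2 *\<^sub>v Z)
      = - ((AT + \<Phi> * B1 + (CT + \<Phi> * B2) * I * \<Phi> * D1) *\<^sub>v e + ((CT + \<Phi> * B2) * I) *\<^sub>v h)"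
proof -
  let ?N = "1\<^sub>m m - \<Phi> * D2"
  have N: "?N \<in> carrier_mat m m" by (intro minus_carrier_mat mult_carrier_mat[OF carr(10,6)])
  have PC: "\<Phi> * C + \<Phi> * D1 * \<Phi> \<in> carrier_mat m n" using carr by simp
  have Psi: "\<Psi> \<in> carrier_mat m n" using carr PC by (simp add: \<Psi>)
  have ec: "e \<in> carrier_vec m" using carr v by (simp add: e_def)
  have hc: "h \<in> carrier_vec m" using carr v by (simp add: h_def)
  let ?p1 = "\<Phi> *\<^sub>v (C *\<^sub>v x)" and ?p2 = "\<Phi> *\<^sub>v (D1 *\<^sub>v Y)" and ?p3 = "\<Phi> *\<^sub>v (D2 *\<^sub>v Z)"
    and ?p4 = "\<Phi> *\<^sub>v (D1 *\<^sub>v (\<Phi> *\<^sub>v x))"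
  have pc: "?p1 \<in> carrier_vec m" "?p2 \<in> carrier_vec m" "?p3 \<in> carrier_vec m" "?p4 \<in> carrier_vec m"
    using carr v by simp_all
  have Px: "\<Phi> *\<^sub>v x \<in> carrier_vec m" using carr v by simp
  have PDP: "\<Phi> * D * \<Phi> \<in> carrier_mat m n" "(\<Phi> * D * \<Phi>) *\<^sub>v x = \<Phi> *\<^sub>v (D *\<^sub>v (\<Phi> *\<^sub>v x))"
    if D: "D \<in> carrier_mat n m" for D
    using assoc_mult_mat_vec[OF mult_carrier_mat[OF carr(10) D] carr(10) v(1)] assoc_mult_mat_vec[OF carr(10) D Px]
      mult_carrier_mat[OF mult_carrier_mat[OF carr(10) D] carr(10)] by (simp_all only:)
  have "?N *\<^sub>v (\<Psi> *\<^sub>v x) = (?N * \<Psi>) *\<^sub>v x"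
    by (rule assoc_mult_mat_vec[OF N Psi v(1), symmetric])
  also have "?N * \<Psi> = \<Phi> * C + \<Phi> * D1 * \<Phi>"
    unfolding \<Psi> using assoc_mult_mat[OF N carr(11) PC] inv(2) left_mult_one_mat[OF PC] by (simp only:)
  also have "(\<Phi> * C + \<Phi> * D1 * \<Phi>) *\<^sub>v x = ?p1 + ?p4"
    using add_mult_distrib_mat_vec[OF mult_carrier_mat[OF carr(10,4)] PDP(1)[OF carr(5)] v(1)]
      assoc_mult_mat_vec[OF carr(10,4) v(1)] PDP(2)[OF carr(5)] by (simp only:)
  finally have NPsi: "?N *\<^sub>v (\<Psi> *\<^sub>v x) = ?p1 + ?p4" .
  have NZ: "?N *\<^sub>v Z = Z - ?p3"
    using carr v by (simp add: minus_mult_distrib_mat_vec[of _ m m])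
  have PsiX: "\<Psi> *\<^sub>v x \<in> carrier_vec m" using Psi v by simp
  have wc: "Z - \<Psi> *\<^sub>v x \<in> carrier_vec m" using PsiX v by simp
  have Nw: "?N *\<^sub>v (Z - \<Psi> *\<^sub>v x) = (Z - ?p3) - (?p1 + ?p4)"
    using mult_minus_distrib_mat_vec[OF N v(3) PsiX] NPsi NZ by simp
  have hs: "h = Z - (?p1 + ?p2 + ?p3)"
    unfolding h_def using carr v by (simp add: mult_add_distrib_mat_vec[of _ m n])
  have De: "\<Phi> *\<^sub>v (D1 *\<^sub>v e) = ?p2 - ?p4"
    unfolding e_def using carr v
    by (simp add: mult_minus_distrib_mat_vec[of _ n m] mult_minus_distrib_mat_vec[of _ m n])
  \<comment> \<open>In h + \<Phi> D1 e the terms \<Phi> D1 Y cancel; what is left is (1 - \<Phi> D2)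
    applied to Z - \<Psi> x. Hence the defect of Z is a linear image of h and e.\<close>
  have "h + \<Phi> *\<^sub>v (D1 *\<^sub>v e) = (Z - ?p3) - (?p1 + ?p4)"
    unfolding hs De using pc v by (intro eq_vecI) auto
  then have "h + \<Phi> *\<^sub>v (D1 *\<^sub>v e) = ?N *\<^sub>v (Z - \<Psi> *\<^sub>v x)" using Nw by simp
  then have "I *\<^sub>v (h + \<Phi> *\<^sub>v (D1 *\<^sub>v e)) = (I * ?N) *\<^sub>v (Z - \<Psi> *\<^sub>v x)"
    using assoc_mult_mat_vec[OF carr(11) N wc] by simp
  then show w: "Z - \<Psi> *\<^sub>v x = I *\<^sub>v (h + \<Phi> *\<^sub>v (D1 *\<^sub>v e))" using inv(1) wc by simp
  \<comment> \<open>The q are the terms of the Riccati equation applied to x, the r those in Y and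
    Z. The terms \<Phi> A x and Q x occur twice and cancel; the others pair up to AT and \<Phi> B1
    acting on Y - \<Phi> x and to CT and \<Phi> B2 acting on Z - \<Psi> x.\<close>
  let ?q1 = "\<Phi> *\<^sub>v (A *\<^sub>v x)" and ?q2 = "AT *\<^sub>v (\<Phi> *\<^sub>v x)" and ?q3 = "\<Phi> *\<^sub>v (B1 *\<^sub>v (\<Phi> *\<^sub>v x))"
    and ?q4 = "Q *\<^sub>v x" and ?q5 = "CT *\<^sub>v (\<Psi> *\<^sub>v x)" and ?q6 = "\<Phi> *\<^sub>v (B2 *\<^sub>v (\<Psi> *\<^sub>v x))"
    and ?r1 = "AT *\<^sub>v Y" and ?r2 = "CT *\<^sub>v Z" and ?r3 = "\<Phi> *\<^sub>v (B1 *\<^sub>v Y)" and ?r4 = "\<Phi> *\<^sub>v (B2 *\<^sub>v Z)"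
  have qc: "?q1 \<in> carrier_vec m" "?q2 \<in> carrier_vec m" "?q3 \<in> carrier_vec m" "?q4 \<in> carrier_vec m"
    "?q5 \<in> carrier_vec m" "?q6 \<in> carrier_vec m" "?r1 \<in> carrier_vec m" "?r2 \<in> carrier_vec m"
    "?r3 \<in> carrier_vec m" "?r4 \<in> carrier_vec m"
    using carr v PsiX by simp_all
  have HB: "CT + \<Phi> * B2 \<in> carrier_mat m m" using carr by simp
  have "(\<Phi> * A + AT * \<Phi> + \<Phi> * B1 * \<Phi> + Q + (CT + \<Phi> * B2) * \<Psi>) *\<^sub>v x
    = ?q1 + ?q2 + ?q3 + ?q4 + (?q5 + ?q6)"
  proof -
    have c1: "\<Phi> * A \<in> carrier_mat m n" "AT * \<Phi> \<in> carrier_mat m n" "(CT + \<Phi> * B2) * \<Psi> \<in> carrier_mat m n"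
      by (rule mult_carrier_mat[OF carr(10,1)], rule mult_carrier_mat[OF carr(7,10)], rule mult_carrier_mat[OF HB Psi])
    have c2: "\<Phi> * A + AT * \<Phi> \<in> carrier_mat m n" "\<Phi> * A + AT * \<Phi> + \<Phi> * B1 * \<Phi> \<in> carrier_mat m n"
      "\<Phi> * A + AT * \<Phi> + \<Phi> * B1 * \<Phi> + Q \<in> carrier_mat m n"
      using c1 PDP(1)[OF carr(2)] carr(9) by simp_all
    have "((CT + \<Phi> * B2) * \<Psi>) *\<^sub>v x = (CT + \<Phi> * B2) *\<^sub>v (\<Psi> *\<^sub>v x)"
      by (rule assoc_mult_mat_vec[OF HB Psi v(1)])
    also have "\<dots> = ?q5 + ?q6"
      using add_mult_distrib_mat_vec[OF carr(8) mult_carrier_mat[OF carr(10,3)] PsiX]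
        assoc_mult_mat_vec[OF carr(10,3) PsiX] by (simp only:)
    finally have q56: "((CT + \<Phi> * B2) * \<Psi>) *\<^sub>v x = ?q5 + ?q6" .
    show ?thesis
      unfolding add_mult_distrib_mat_vec[OF c2(3) c1(3) v(1)] add_mult_distrib_mat_vec[OF c2(2) carr(9) v(1)]
        add_mult_distrib_mat_vec[OF c2(1) PDP(1)[OF carr(2)] v(1)] add_mult_distrib_mat_vec[OF c1(1,2) v(1)]
        q56 PDP(2)[OF carr(2)] assoc_mult_mat_vec[OF carr(10,1) v(1)] assoc_mult_mat_vec[OF carr(7,10) v(1)] ..
  qed
  moreover have "\<Phi> *\<^sub>v (A *\<^sub>v x + B1 *\<^sub>v Y + B2 *\<^sub>v Z) = ?q1 + ?r3 + ?r4"
    using carr v by (simp add: mult_add_distrib_mat_vec[of _ m n])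
  moreover have "(AT + \<Phi> * B1 + (CT + \<Phi> * B2) * I * \<Phi> * D1) *\<^sub>v e + ((CT + \<Phi> * B2) * I) *\<^sub>v h
    = ((?r1 - ?q2) + (?r3 - ?q3)) + ((?r2 - ?q5) + (?r4 - ?q6))"
  proof -
    let ?H = "CT + \<Phi> * B2" and ?d = "\<Phi> *\<^sub>v (D1 *\<^sub>v e)"
    have dc: "?d \<in> carrier_vec m" "I *\<^sub>v h \<in> carrier_vec m" "I *\<^sub>v ?d \<in> carrier_vec m"
      using carr ec hc by simp_all
    have PXd: "\<Phi> *\<^sub>v (D *\<^sub>v (u - u')) = \<Phi> *\<^sub>v (D *\<^sub>v u) - \<Phi> *\<^sub>v (D *\<^sub>v u')"
      if "D \<in> carrier_mat n m" "u \<in> carrier_vec m" "u' \<in> carrier_vec m" for D u u'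
      using mult_minus_distrib_mat_vec[OF that] mult_minus_distrib_mat_vec[OF carr(10)
        mult_mat_vec_carrier[OF that(1,2)] mult_mat_vec_carrier[OF that(1,3)]] by (simp only:)
    have HI: "?H * I \<in> carrier_mat m m" by (rule mult_carrier_mat[OF HB carr(11)])
    have s1: "(AT + \<Phi> * B1) *\<^sub>v e = (?r1 - ?q2) + (?r3 - ?q3)"
      unfolding e_def add_mult_distrib_mat_vec[OF carr(7) mult_carrier_mat[OF carr(10,2)] ec[unfolded e_def]]
        assoc_mult_mat_vec[OF carr(10,2) ec[unfolded e_def]] mult_minus_distrib_mat_vec[OF carr(7) v(2) Px]
        PXd[OF carr(2) v(2) Px] ..
    have s2: "(?H * I * \<Phi> * D1) *\<^sub>v e = ?H *\<^sub>v (I *\<^sub>v ?d)"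
      using assoc_mult_mat_vec[OF mult_carrier_mat[OF HI carr(10)] carr(5) ec]
        assoc_mult_mat_vec[OF HI carr(10) mult_mat_vec_carrier[OF carr(5) ec]]
        assoc_mult_mat_vec[OF HB carr(11) dc(1)] by (simp only:)
    have s3: "(?H * I) *\<^sub>v h = ?H *\<^sub>v (I *\<^sub>v h)"
      by (rule assoc_mult_mat_vec[OF HB carr(11) hc])
    have "?H *\<^sub>v (I *\<^sub>v ?d) + ?H *\<^sub>v (I *\<^sub>v h) = ?H *\<^sub>v (I *\<^sub>v (h + ?d))"
      unfolding mult_add_distrib_mat_vec[OF carr(11) hc dc(1)] mult_add_distrib_mat_vec[OF HB dc(2,3)]
      by (rule comm_add_vec[OF mult_mat_vec_carrier[OF HB dc(3)] mult_mat_vec_carrier[OF HB dc(2)]])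
    also have "\<dots> = ?H *\<^sub>v (Z - \<Psi> *\<^sub>v x)" using w by simp
    also have "\<dots> = (?r2 - ?q5) + (?r4 - ?q6)"
      unfolding add_mult_distrib_mat_vec[OF carr(8) mult_carrier_mat[OF carr(10,3)] wc]
        assoc_mult_mat_vec[OF carr(10,3) wc] mult_minus_distrib_mat_vec[OF carr(8) v(3) PsiX]
        PXd[OF carr(3) v(3) PsiX] ..
    finally have s4: "?H *\<^sub>v (I *\<^sub>v ?d) + ?H *\<^sub>v (I *\<^sub>v h) = (?r2 - ?q5) + (?r4 - ?q6)" .
    have AB: "AT + \<Phi> * B1 \<in> carrier_mat m m" by (rule add_carrier_mat[OF mult_carrier_mat[OF carr(10,2)]])
    have "(AT + \<Phi> * B1 + ?H * I * \<Phi> * D1) *\<^sub>v e = (AT + \<Phi> * B1) *\<^sub>v e + (?H * I * \<Phi> * D1) *\<^sub>v e"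
      by (rule add_mult_distrib_mat_vec[OF AB mult_carrier_mat[OF mult_carrier_mat[OF HI carr(10)] carr(5)] ec])
    then show ?thesis
      using assoc_add_vec[OF mult_mat_vec_carrier[OF AB ec] mult_mat_vec_carrier[OF HB dc(3)] mult_mat_vec_carrier[OF HB dc(2)]]
      unfolding s2 s3 s1 s4[symmetric] by (simp only:)
  qed
  ultimately show "- (AT *\<^sub>v Y + CT *\<^sub>v Z + Q *\<^sub>v x)
      + (\<Phi> * A + AT * \<Phi> + \<Phi> * B1 * \<Phi> + Q + (CT + \<Phi> * B2) * \<Psi>) *\<^sub>v x
      - \<Phi> *\<^sub>v (A *\<^sub>v x + B1 *\<^sub>v Y + B2 *\<^sub>v Z)
      = - ((AT + \<Phi> * B1 + (CT + \<Phi> * B2) * I * \<Phi> * D1) *\<^sub>v e + ((CT + \<Phi> * B2) * I) *\<^sub>v h)"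
    using residual_cancel[OF qc] by (simp only:)
qed

context wiener begin

text \<open>Free of the game: n and m are arbitrary and \<open>I\<close> is the inverse of 1 -
  \<Phi> D2. Level 3 is the case m = 3 n, once the controls have been eliminated and the equations
  are linear in (x, Y, Z).\<close>

lemma riccati_decoupling:
  fixes A B1 B2 C D1 D2 AT CT Q \<Phi> \<Psi> I :: mfun
  assumes coeff: "bounded_coeff T n n A" "bounded_coeff T n m B1" "bounded_coeff T n m B2"
      "bounded_coeff T n n C" "bounded_coeff T n m D1" "bounded_coeff T n m D2"
      "bounded_coeff T m m AT" "bounded_coeff T m m CT" "bounded_coeff T m n Q"
      "bounded_coeff T m n \<Phi>" "bounded_coeff T m m I"
    and inv: "\<And>t. t \<in> {0..T} \<Longrightarrow> I t * (1\<^sub>m m - \<Phi> t * D2 t) = 1\<^sub>m m"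
      "\<And>t. t \<in> {0..T} \<Longrightarrow> (1\<^sub>m m - \<Phi> t * D2 t) * I t = 1\<^sub>m m"
    and \<Psi>: "\<And>t. t \<in> {0..T} \<Longrightarrow> \<Psi> t = I t * (\<Phi> t * C t + \<Phi> t * D1 t * \<Phi> t)"
    and ric: "\<And>a b t. a < m \<Longrightarrow> b < n \<Longrightarrow> t \<in> {0..T} \<Longrightarrow> \<Phi> t $$ (a, b) = G $$ (a, b) +
      (LINT s:{t..T}|lborel. (\<Phi> s * A s + AT s * \<Phi> s + \<Phi> s * B1 s * \<Phi> s + Q s
         + (CT s + \<Phi> s * B2 s) * \<Psi> s) $$ (a, b))"
    and vec: "L2_vec n x" "L2_vec m Y" "L2_vec m Z"
    and X: "\<And>i. i < n \<Longrightarrow> itoproc (\<lambda>t \<omega>. (A t *\<^sub>v x t \<omega> + B1 t *\<^sub>v Y t \<omega> + B2 t *\<^sub>v Z t \<omega>) $ i)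
      (\<lambda>t \<omega>. (C t *\<^sub>v x t \<omega> + D1 t *\<^sub>v Y t \<omega> + D2 t *\<^sub>v Z t \<omega>) $ i) (\<lambda>t \<omega>. x t \<omega> $ i)"
    and YZ: "\<And>c. c < m \<Longrightarrow> itoproc (\<lambda>t \<omega>. (- (AT t *\<^sub>v Y t \<omega> + CT t *\<^sub>v Z t \<omega> + Q t *\<^sub>v x t \<omega>)) $ c)
      (\<lambda>t \<omega>. Z t \<omega> $ c) (\<lambda>t \<omega>. Y t \<omega> $ c)"
    and fin: "AE \<omega> in M. Y T \<omega> = \<Phi> T *\<^sub>v x T \<omega>"
  shows "AE p in dt_dP. Y (fst p) (snd p) = \<Phi> (fst p) *\<^sub>v x (fst p) (snd p)"
    and "AE p in dt_dP. Z (fst p) (snd p) = \<Psi> (fst p) *\<^sub>v x (fst p) (snd p)"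
proof -
  define \<Theta> where "\<Theta> s = \<Phi> s * A s + AT s * \<Phi> s + \<Phi> s * B1 s * \<Phi> s + Q s
         + (CT s + \<Phi> s * B2 s) * \<Psi> s" for s
  have bPsi: "bounded_coeff T m n \<Psi>"
  proof -
    have "bounded_coeff T m n (\<lambda>t. I t * (\<Phi> t * C t + \<Phi> t * D1 t * \<Phi> t))"
      by (intro bounded_coeff_mult[of T m m] bounded_coeff_add bounded_coeff_mult[of T m n]
        bounded_coeff_mult[of T m m _ n] coeff)
    then show ?thesis
      by (rule bounded_coeffI2[where f = "\<lambda>a b t. (I t * (\<Phi> t * C t + \<Phi> t * D1 t * \<Phi> t)) $$ (a, b)", rotated 2,
        OF bounded_coeffD(2)]) (use bounded_coeffD(1)[of T m n "\<lambda>t. I t * (\<Phi> t * C t + \<Phi> t * D1 t * \<Phi> t)"]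
          \<open>bounded_coeff T m n (\<lambda>t. I t * (\<Phi> t * C t + \<Phi> t * D1 t * \<Phi> t))\<close> in \<open>auto simp: \<Psi>\<close>)
  qed
  have bH: "bounded_coeff T m m (\<lambda>t. CT t + \<Phi> t * B2 t)"
    by (intro bounded_coeff_add bounded_coeff_mult[of T m n] coeff)
  have bTh: "bounded_coeff T m n \<Theta>"
    unfolding \<Theta>_def[abs_def]
    by (intro bounded_coeff_add bounded_coeff_mult[OF coeff(10,1)] bounded_coeff_mult[OF coeff(7,10)]
      bounded_coeff_mult[OF bounded_coeff_mult[OF coeff(10,2)] coeff(10)] coeff(9) bounded_coeff_mult[OF bH bPsi])
  let ?\<sigma> = "\<lambda>t \<omega>. C t *\<^sub>v x t \<omega> + D1 t *\<^sub>v Y t \<omega> + D2 t *\<^sub>v Z t \<omega>"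
  let ?b = "\<lambda>t \<omega>. A t *\<^sub>v x t \<omega> + B1 t *\<^sub>v Y t \<omega> + B2 t *\<^sub>v Z t \<omega>"
  let ?g = "\<lambda>t \<omega>. - (AT t *\<^sub>v Y t \<omega> + CT t *\<^sub>v Z t \<omega> + Q t *\<^sub>v x t \<omega>)"
  let ?e = "\<lambda>t \<omega>. Y t \<omega> - \<Phi> t *\<^sub>v x t \<omega>"
  let ?h = "\<lambda>t \<omega>. Z t \<omega> - \<Phi> t *\<^sub>v ?\<sigma> t \<omega>"
  define \<eta> where "\<eta> c t \<omega> = Y t \<omega> $ c - (\<Sum>i<n. \<Phi> t $$ (c, i) * x t \<omega> $ i)" for c t \<omega>
  define \<zeta> where "\<zeta> c t \<omega> = Z t \<omega> $ c - (\<Sum>i<n. \<Phi> t $$ (c, i) * ?\<sigma> t \<omega> $ i)" for c t \<omega>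
  \<comment> \<open>As \<Phi> has derivative - \<Theta>, the product \<Phi> x has drift - \<Theta> x
    + \<Phi> b, which is subtracted from the drift of Y.\<close>
  define f where "f c t \<omega> = ?g t \<omega> $ c - (\<Sum>i<n. - \<Theta> t $$ (c, i) * x t \<omega> $ i + \<Phi> t $$ (c, i) * ?b t \<omega> $ i)" for c t \<omega>
  have ito: "itoproc (f c) (\<zeta> c) (\<eta> c)" if c: "c < m" for c
    unfolding f_def[abs_def] \<zeta>_def[abs_def] \<eta>_def[abs_def]
  proof (rule itoproc_diff_sum[OF YZ[OF c]])
    fix i assume "i \<in> {..<n}"
    then have i: "i < n" by simp
    note P = bounded_coeffD(2)[OF coeff(10) c i] and Th = bounded_coeffD(2)[OF bTh c i]
    obtain K where K: "\<forall>t\<in>{0..T}. \<bar>\<Phi> t $$ (c, i)\<bar> \<le> K" using P by (auto simp: bdd_meas_def)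
    obtain L where L: "\<forall>t\<in>{0..T}. \<bar>\<Theta> t $$ (c, i)\<bar> \<le> L" using Th by (auto simp: bdd_meas_def)
    show "itoproc (\<lambda>t \<omega>. - \<Theta> t $$ (c, i) * x t \<omega> $ i + \<Phi> t $$ (c, i) * ?b t \<omega> $ i)
      (\<lambda>t \<omega>. \<Phi> t $$ (c, i) * ?\<sigma> t \<omega> $ i) (\<lambda>t \<omega>. \<Phi> t $$ (c, i) * x t \<omega> $ i)"
    proof (rule itoproc_mult[OF X[OF i] bdd_meas_dt[OF P] _ bdd_meas_dt[OF bdd_meas_uminus[OF Th]], of "max K L"])
      show "\<bar>\<Phi> s $$ (c, i)\<bar> \<le> max K L" "\<bar>- \<Theta> s $$ (c, i)\<bar> \<le> max K L" if "s \<in> {0..T}" for s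
        using K L that by (fastforce simp: le_max_iff_disj)+
      fix s t assume st: "0 \<le> s" "s \<le> t" "t \<le> T"
      then show "\<Phi> t $$ (c, i) - \<Phi> s $$ (c, i) = (\<integral>r. - \<Theta> r $$ (c, i) * indicator {s<..t} r \<partial>dt)"
        using LINT_terminal_dt[OF Th st] ric[OF c i, of s] ric[OF c i, of t] by (simp add: \<Theta>_def)
    qed
  qed simp
  note vx = L2_vecD(1)[OF vec(1)] and vY = L2_vecD(1)[OF vec(2)] and vZ = L2_vecD(1)[OF vec(3)]
  have carr: "A t \<in> carrier_mat n n" "B1 t \<in> carrier_mat n m" "B2 t \<in> carrier_mat n m"
      "C t \<in> carrier_mat n n" "D1 t \<in> carrier_mat n m" "D2 t \<in> carrier_mat n m"
      "AT t \<in> carrier_mat m m" "CT t \<in> carrier_mat m m" "Q t \<in> carrier_mat m n"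
      "\<Phi> t \<in> carrier_mat m n" "I t \<in> carrier_mat m m" if "t \<in> {0..T}" for t
    using coeff[THEN bounded_coeffD(1), OF that] by auto
  \<comment> \<open>The product rule works with sums of components, the Riccati algebra with
    vectors; this identifies the two on [0, T].\<close>
  have vec_eqs: "\<eta> c t \<omega> = ?e t \<omega> $ c" "\<zeta> c t \<omega> = ?h t \<omega> $ c"
    "f c t \<omega> = (?g t \<omega> + \<Theta> t *\<^sub>v x t \<omega> - \<Phi> t *\<^sub>v ?b t \<omega>) $ c"
    if t: "t \<in> {0..T}" and w: "\<omega> \<in> space M" and c: "c < m" for c t \<omega>
  proof -
    note cr = carr[OF t] and Th = bounded_coeffD(1)[OF bTh t]
    note v = vx[OF t w] vY[OF t w] vZ[OF t w]
    have s: "?\<sigma> t \<omega> \<in> carrier_vec n" and b: "?b t \<omega> \<in> carrier_vec n" using cr v by simp_all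
    have Pd: "\<Phi> t *\<^sub>v u \<in> carrier_vec m" for u by (rule carrier_vecI) (use cr(10) in simp)
    show "\<eta> c t \<omega> = ?e t \<omega> $ c"
      unfolding \<eta>_def mult_mat_vec_index_sum[OF cr(10) v(1) c, symmetric]
      using carrier_vecD[OF Pd] c by (simp only: index_minus_vec)
    show "\<zeta> c t \<omega> = ?h t \<omega> $ c"
      unfolding \<zeta>_def mult_mat_vec_index_sum[OF cr(10) s c, symmetric]
      using carrier_vecD[OF Pd] c by (simp only: index_minus_vec)
    have "(\<Sum>i<n. - \<Theta> t $$ (c, i) * x t \<omega> $ i + \<Phi> t $$ (c, i) * ?b t \<omega> $ i)
      = - (\<Theta> t *\<^sub>v x t \<omega>) $ c + (\<Phi> t *\<^sub>v ?b t \<omega>) $ c"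
      unfolding mult_mat_vec_index_sum[OF cr(10) b c] mult_mat_vec_index_sum[OF Th v(1) c]
      by (simp only: sum.distrib mult_minus_left sum_negf)
    moreover have "dim_vec (\<Theta> t *\<^sub>v x t \<omega>) = m" using Th by simp
    ultimately show "f c t \<omega> = (?g t \<omega> + \<Theta> t *\<^sub>v x t \<omega> - \<Phi> t *\<^sub>v ?b t \<omega>) $ c"
      using carrier_vecD[OF Pd] c unfolding f_def by (simp only: index_minus_vec index_add_vec)
  qed
  let ?H = "\<lambda>t. AT t + \<Phi> t * B1 t + (CT t + \<Phi> t * B2 t) * I t * \<Phi> t * D1 t"
  let ?H' = "\<lambda>t. (CT t + \<Phi> t * B2 t) * I t"
  have bH': "bounded_coeff T m m ?H'" by (rule bounded_coeff_mult[OF bH coeff(11)])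
  have bHH: "bounded_coeff T m m ?H"
    by (intro bounded_coeff_add coeff(7) bounded_coeff_mult[OF coeff(10,2)]
      bounded_coeff_mult[OF bounded_coeff_mult[OF bH' coeff(10)] coeff(5)])
  obtain K where K: "0 \<le> K" "\<And>t (e :: rvec) (z :: rvec) c. t \<in> {0..T} \<Longrightarrow> e \<in> carrier_vec m \<Longrightarrow> z \<in> carrier_vec m \<Longrightarrow> c < m \<Longrightarrow>
    \<bar>(?H t *\<^sub>v e + ?H' t *\<^sub>v z) $ c\<bar> \<le> K * (\<Sum>k<m. \<bar>e $ k\<bar> + \<bar>z $ k\<bar>)"
    by (rule riccati_residual_bound[OF bHH bH']) blast
  have eh: "?e t \<omega> \<in> carrier_vec m" "?h t \<omega> \<in> carrier_vec m" if t: "t \<in> {0..T}" and w: "\<omega> \<in> space M" for t \<omega>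
    using carr[OF t] vx[OF t w] vY[OF t w] vZ[OF t w] by simp_all
  have bnd: "AE p in dt_dP. \<bar>f c (fst p) (snd p)\<bar> \<le> K * (\<Sum>k<m. \<bar>\<eta> k (fst p) (snd p)\<bar> + \<bar>\<zeta> k (fst p) (snd p)\<bar>)"
    if c: "c < m" for c
  proof (rule AE_I2)
    fix p assume "p \<in> space dt_dP"
    then obtain t \<omega> where p: "p = (t, \<omega>)" and t: "t \<in> {0..T}" and w: "\<omega> \<in> space M" by (auto simp: space_dt_dP)
    have "?g t \<omega> + \<Theta> t *\<^sub>v x t \<omega> - \<Phi> t *\<^sub>v ?b t \<omega> = - (?H t *\<^sub>v ?e t \<omega> + ?H' t *\<^sub>v ?h t \<omega>)"
      unfolding \<Theta>_def by (rule riccati_residual(2)[OF carr[OF t] vx[OF t w] vY[OF t w] vZ[OF t w] inv[OF t] \<Psi>[OF t]])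
    moreover have "c < dim_vec (?H t *\<^sub>v ?e t \<omega> + ?H' t *\<^sub>v ?h t \<omega>)"
      using c bounded_coeffD(1)[OF bH' t] carr(10)[OF t] by simp
    ultimately have "f c t \<omega> = - (?H t *\<^sub>v ?e t \<omega> + ?H' t *\<^sub>v ?h t \<omega>) $ c"
      unfolding vec_eqs(3)[OF t w c] by (simp only: index_uminus_vec)
    then have "\<bar>f c t \<omega>\<bar> \<le> K * (\<Sum>k<m. \<bar>?e t \<omega> $ k\<bar> + \<bar>?h t \<omega> $ k\<bar>)"
      using K(2)[OF t eh[OF t w] c] by (simp only: abs_minus_cancel)
    also have "(\<Sum>k<m. \<bar>?e t \<omega> $ k\<bar> + \<bar>?h t \<omega> $ k\<bar>) = (\<Sum>k<m. \<bar>\<eta> k t \<omega>\<bar> + \<bar>\<zeta> k t \<omega>\<bar>)"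
      by (rule sum.cong) (simp_all only: vec_eqs(1,2)[OF t w] lessThan_iff)
    finally show "\<bar>f c (fst p) (snd p)\<bar> \<le> K * (\<Sum>k<m. \<bar>\<eta> k (fst p) (snd p)\<bar> + \<bar>\<zeta> k (fst p) (snd p)\<bar>)"
      by (simp add: p)
  qed
  have term0: "AE \<omega> in M. \<eta> c T \<omega> = 0" if c: "c < m" for c
    using fin AE_space
  proof eventually_elim
    case (elim \<omega>)
    have T: "T \<in> {0..T}" using T_pos by simp
    show ?case unfolding vec_eqs(1)[OF T elim(2) c] using elim(1) carr(10)[OF T] c by simp
  qed
  have e0: "AE p in dt_dP. \<forall>c\<in>{..<m}. \<eta> c (fst p) (snd p) = 0"
    using linear_bsde_unique(1)[OF ito term0 bnd] by (intro AE_finite_allI) auto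
  have h0: "AE p in dt_dP. \<forall>c\<in>{..<m}. \<zeta> c (fst p) (snd p) = 0"
    using linear_bsde_unique(2)[OF ito term0 bnd] by (intro AE_finite_allI) auto
  have both: "AE p in dt_dP. Y (fst p) (snd p) = \<Phi> (fst p) *\<^sub>v x (fst p) (snd p) \<and>
    Z (fst p) (snd p) = \<Psi> (fst p) *\<^sub>v x (fst p) (snd p)"
    using e0 h0 AE_space
  proof eventually_elim
    case (elim p)
    obtain t \<omega> where p: "p = (t, \<omega>)" and t: "t \<in> {0..T}" and w: "\<omega> \<in> space M"
      using elim(3) by (auto simp: space_dt_dP)
    note v = vx[OF t w] vY[OF t w] vZ[OF t w]
    have e: "?e t \<omega> = 0\<^sub>v m"
    proof (rule eq_vecI)
      show "?e t \<omega> $ c = 0\<^sub>v m $ c" if "c < dim_vec (0\<^sub>v m)" for c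
        using that elim(1) vec_eqs(1)[OF t w, of c] by (simp add: p)
    qed (use eh[OF t w] carr(10)[OF t] in simp)
    have h: "?h t \<omega> = 0\<^sub>v m"
    proof (rule eq_vecI)
      show "?h t \<omega> $ c = 0\<^sub>v m $ c" if "c < dim_vec (0\<^sub>v m)" for c
        using that elim(2) vec_eqs(2)[OF t w, of c] by (simp add: p)
    qed (use eh[OF t w] carr(10)[OF t] in simp)
    have sub0: "u = u'" if "u - u' = 0\<^sub>v m" "u \<in> carrier_vec m" "u' \<in> carrier_vec m" for u u' :: rvec
    proof (rule eq_vecI)
      fix i assume i: "i < dim_vec u'"
      then have "(u - u') $ i = 0" using that by simp
      then show "u $ i = u' $ i" using i by simp
    qed (use that in simp)
    have PsiC: "\<Psi> t \<in> carrier_mat m n" by (rule bounded_coeffD(1)[OF bPsi t])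
    \<comment> \<open>Vanishing of h says only Z = \<Phi> \<sigma>, where \<sigma> contains Z again;
      the inverse of 1 - \<Phi> D2 solves this for Z.\<close>
    have "Z t \<omega> - \<Psi> t *\<^sub>v x t \<omega> = I t *\<^sub>v (?h t \<omega> + \<Phi> t *\<^sub>v (D1 t *\<^sub>v ?e t \<omega>))"
      by (rule riccati_residual(1)[OF carr[OF t] v inv[OF t] \<Psi>[OF t]])
    also have "\<dots> = 0\<^sub>v m"
    proof -
      have z: "X *\<^sub>v 0\<^sub>v c = 0\<^sub>v r" if "X \<in> carrier_mat r c" for X :: rmat and r c
        by (rule eq_vecI) (use that in auto)
      have "D1 t *\<^sub>v 0\<^sub>v m = 0\<^sub>v n" "\<Phi> t *\<^sub>v 0\<^sub>v n = 0\<^sub>v m" "I t *\<^sub>v 0\<^sub>v m = 0\<^sub>v m"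
        by (rule z[OF carr(5)[OF t]], rule z[OF carr(10)[OF t]], rule z[OF carr(11)[OF t]])
      then show ?thesis unfolding e h by simp
    qed
    finally have z0: "Z t \<omega> - \<Psi> t *\<^sub>v x t \<omega> = 0\<^sub>v m" .
    have Z: "Z t \<omega> = \<Psi> t *\<^sub>v x t \<omega>"
      by (rule sub0[OF z0 v(3) mult_mat_vec_carrier[OF PsiC v(1)]])
    moreover have "Y t \<omega> = \<Phi> t *\<^sub>v x t \<omega>" by (rule sub0[OF e v(2) mult_mat_vec_carrier[OF carr(10)[OF t] v(1)]])
    ultimately show ?case by (simp add: p)
  qed
  show "AE p in dt_dP. Y (fst p) (snd p) = \<Phi> (fst p) *\<^sub>v x (fst p) (snd p)"
    "AE p in dt_dP. Z (fst p) (snd p) = \<Psi> (fst p) *\<^sub>v x (fst p) (snd p)"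
    by (rule eventually_mono[OF both], erule conjunct1 conjunct2)+
qed

end

section \<open>The coefficients of Level 3\<close>

lemma continuous_mfun_bounded_coeff:
  assumes "continuous_mfun T r c X" shows "bounded_coeff T r c X"
proof (rule bounded_coeffI)
  show "X t \<in> carrier_mat r c" if "t \<in> {0..T}" for t using assms that by (simp add: continuous_mfun_def)
  fix a b assume ab: "a < r" "b < c"
  have c: "continuous_on {0..T} (\<lambda>t. X t $$ (a, b))" using assms ab by (simp add: continuous_mfun_def)
  have "bounded ((\<lambda>t. X t $$ (a, b)) ` {0..T})"
    by (intro compact_imp_bounded compact_continuous_image c) simp
  then have "\<exists>K. \<forall>t\<in>{0..T}. \<bar>X t $$ (a, b)\<bar> \<le> K" by (auto simp: bounded_iff)
  then show "bdd_meas T (\<lambda>t. X t $$ (a, b))"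
    using borel_measurable_continuous_on_restrict[OF c] by (simp add: bdd_meas_def)
qed

text \<open>\<open>terminal_ode\<close> asks for an integrable right side, and integrability alone
  bounds the solution by |G| plus the integral of |f|. So P and \<Phi> are bounded although their
  equations contain them nonlinearly.\<close>

lemma terminal_ode_bounded_coeff:
  assumes ode: "terminal_ode T r c f G X" shows "bounded_coeff T r c X"
proof (rule bounded_coeffI)
  show "X t \<in> carrier_mat r c" if "t \<in> {0..T}" for t using ode that by (simp add: terminal_ode_def)
  fix a b assume ab: "a < r" "b < c"
  \<comment> \<open>After extension by 0, the integral over [t, T] runs over the whole line with an
    integrand jointly measurable in t and s, which makes it measurable in t.\<close>
  define H where "H s = indicator {0..T} s * f s $$ (a, b)" for s
  have iH: "integrable lborel H"
    using ode ab by (simp add: terminal_ode_def set_integrable_def H_def[abs_def])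
  then have H [measurable]: "H \<in> borel_measurable borel" by simp
  have Xt: "X t $$ (a, b) = G $$ (a, b) + (\<integral>s. (if t \<le> s then H s else 0) \<partial>lborel)" if t: "t \<in> {0..T}" for t
  proof -
    have "X t $$ (a, b) = G $$ (a, b) + (LINT s:{t..T}|lborel. f s $$ (a, b))"
      using ode ab t by (simp add: terminal_ode_def)
    also have "(LINT s:{t..T}|lborel. f s $$ (a, b)) = (\<integral>s. (if t \<le> s then H s else 0) \<partial>lborel)"
      unfolding set_lebesgue_integral_def using t
      by (intro Bochner_Integration.integral_cong) (auto simp: H_def indicator_def)
    finally show ?thesis .
  qed
  have m: "(\<lambda>t. \<integral>s. (if t \<le> s then H s else 0) \<partial>lborel) \<in> borel_measurable borel"
    by (rule lborel.borel_measurable_lebesgue_integral) measurable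
  have "\<bar>X t $$ (a, b)\<bar> \<le> \<bar>G $$ (a, b)\<bar> + (\<integral>s. \<bar>H s\<bar> \<partial>lborel)" if t: "t \<in> {0..T}" for t
  proof -
    have "\<bar>\<integral>s. (if t \<le> s then H s else 0) \<partial>lborel\<bar> \<le> (\<integral>s. \<bar>H s\<bar> \<partial>lborel)"
      using iH by (intro integral_abs_bound[THEN order_trans] integral_mono integrable_abs)
        (auto intro!: Bochner_Integration.integrable_bound[OF iH])
    then show ?thesis unfolding Xt[OF t] by linarith
  qed
  moreover have "(\<lambda>t. X t $$ (a, b)) \<in> borel_measurable (restrict_space borel {0..T})"
  proof -
    have "(\<lambda>t. G $$ (a, b) + (\<integral>s. (if t \<le> s then H s else 0) \<partial>lborel)) \<in> borel_measurable (restrict_space borel {0..T})"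
      using m by (intro measurable_restrict_space1 borel_measurable_add) simp_all
    then show ?thesis by (subst measurable_cong[OF Xt]) simp_all
  qed
  ultimately show "bdd_meas T (\<lambda>t. X t $$ (a, b))" unfolding bdd_meas_def by blast
qed

lemma terminal_ode_at_end:
  assumes ode: "terminal_ode T r c f G X" and T: "0 \<le> T" and G: "G \<in> carrier_mat r c"
  shows "X T = G"
proof (rule eq_matI)
  have X: "X T \<in> carrier_mat r c" using ode T by (simp add: terminal_ode_def)
  then show "dim_row (X T) = dim_row G" "dim_col (X T) = dim_col G" using G by auto
  fix a b assume "a < dim_row G" "b < dim_col G"
  then have ab: "a < r" "b < c" using G by auto
  have "(LINT s:{T..T}|lborel. f s $$ (a, b)) = 0"
    unfolding set_lebesgue_integral_def
    by (rule integral_eq_zero_AE) (use AE_lborel_singleton[of T] in \<open>eventually_elim, simp\<close>)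
  then show "X T $$ (a, b) = G $$ (a, b)" using ode ab T by (simp add: terminal_ode_def)
qed

text \<open>The bundle of properties that survives block diagonals and the addition of P^T R P, and
  that guarantees a bounded symmetric inverse.\<close>

definition pos_weight :: "real \<Rightarrow> nat \<Rightarrow> mfun \<Rightarrow> bool" where
  "pos_weight T d X \<longleftrightarrow> bounded_coeff T d d X \<and> unif_pos_def T d X \<and> (\<forall>t\<in>{0..T}. (X t)\<^sup>T = X t)"

lemma pos_weight_diag_Nil: "pos_weight T 0 (\<lambda>t. diag_block_mat [])"
  using bounded_coeff_Nil(3)[of T] unif_pos_def_diag_Nil[of T] by (simp add: pos_weight_def)

lemma pos_weight_diag_Cons:
  assumes X: "pos_weight T d X" and Y: "pos_weight T d' (\<lambda>t. diag_block_mat (Xs t))"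
  shows "pos_weight T (d + d') (\<lambda>t. diag_block_mat (X t # Xs t))"
  unfolding pos_weight_def
proof (intro conjI ballI)
  show "bounded_coeff T (d + d') (d + d') (\<lambda>t. diag_block_mat (X t # Xs t))"
    "unif_pos_def T (d + d') (\<lambda>t. diag_block_mat (X t # Xs t))"
    using X Y by (auto simp only: pos_weight_def intro!: bounded_coeff_diag_Cons unif_pos_def_diag_Cons)
  fix t assume t: "t \<in> {0..T}"
  have x: "X t \<in> carrier_mat d d" "diag_block_mat (Xs t) \<in> carrier_mat d' d'"
    using X Y t by (auto simp: pos_weight_def intro: bounded_coeffD(1))
  have s: "(X t)\<^sup>T = X t" "(diag_block_mat (Xs t))\<^sup>T = diag_block_mat (Xs t)"
    using X Y t by (auto simp: pos_weight_def)
  show "(diag_block_mat (X t # Xs t))\<^sup>T = diag_block_mat (X t # Xs t)"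
    using x s transpose_four_block_mat[OF x(1) zero_carrier_mat zero_carrier_mat x(2)] by (simp add: Let_def)
qed

text \<open>P^T R P is positive semidefinite, so the coercivity of X is kept. The blocks of
  \<open>Rc3\<close> have this form with P = \<open>rho\<close>.\<close>

lemma pos_weight_add_congruence:
  assumes X: "pos_weight T d X" and R: "pos_weight T k R" and P: "bounded_coeff T k d P"
  shows "pos_weight T d (\<lambda>t. X t + (P t)\<^sup>T * R t * P t)"
  unfolding pos_weight_def
proof (intro conjI ballI)
  have b: "bounded_coeff T d d X" "bounded_coeff T k k R" and u: "unif_pos_def T d X" "unif_pos_def T k R"
    using X R by (auto simp: pos_weight_def)
  have bP: "bounded_coeff T d d (\<lambda>t. (P t)\<^sup>T * R t * P t)"
    by (rule bounded_coeff_mult[OF bounded_coeff_mult[OF bounded_coeff_transpose[OF P] b(2)] P])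
  show "bounded_coeff T d d (\<lambda>t. X t + (P t)\<^sup>T * R t * P t)" by (rule bounded_coeff_add[OF b(1) bP])
  show "unif_pos_def T d (\<lambda>t. X t + (P t)\<^sup>T * R t * P t)"
    by (rule unif_pos_def_add_psd[OF u(1) psd_congruence[OF u(2) b(2) P] b(1) bP])
  fix t assume t: "t \<in> {0..T}"
  have c: "X t \<in> carrier_mat d d" "R t \<in> carrier_mat k k" "P t \<in> carrier_mat k d"
    using b P t by (auto intro: bounded_coeffD(1))
  have s: "(X t)\<^sup>T = X t" "(R t)\<^sup>T = R t" using X R t by (auto simp: pos_weight_def)
  have Pt: "(P t)\<^sup>T \<in> carrier_mat d k" using c by simp
  have "((P t)\<^sup>T * R t * P t)\<^sup>T = (P t)\<^sup>T * ((R t)\<^sup>T * ((P t)\<^sup>T)\<^sup>T)"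
    unfolding transpose_mult[OF mult_carrier_mat[OF Pt c(2)] c(3)] transpose_mult[OF Pt c(2)] ..
  also have "\<dots> = (P t)\<^sup>T * R t * P t" using s assoc_mult_mat[OF Pt c(2,3)] by simp
  finally have q: "((P t)\<^sup>T * R t * P t)\<^sup>T = (P t)\<^sup>T * R t * P t" .
  show "(X t + (P t)\<^sup>T * R t * P t)\<^sup>T = X t + (P t)\<^sup>T * R t * P t"
    using transpose_add[OF c(1) mult_carrier_mat[OF mult_carrier_mat[OF Pt c(2)] c(3)]] q s(1) by simp
qed

lemma pos_weight_minv:
  assumes "pos_weight T d X"
  shows "bounded_coeff T d d (\<lambda>t. minv (X t))" "t \<in> {0..T} \<Longrightarrow> (minv (X t))\<^sup>T = minv (X t)"
  using assms unif_pos_def_minv[of T d X] minv_symmetric[of "X t" d] bounded_coeffD(1)[of T d d X t]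
  by (auto simp: pos_weight_def)

lemma sym_weight_pos: "sym_weight T d X \<Longrightarrow> unif_pos_def T d X \<Longrightarrow> pos_weight T d X"
  by (simp add: sym_weight_def pos_weight_def)

text \<open>Unfolds comprehensions over \<open>I2\<close> and \<open>I3\<close> into explicit lists,
  to which the rules for \<open>Nil\<close> and \<open>Cons\<close> apply.\<close>

lemmas list_comp_simps = list.map concat.simps append.simps

locale game_coeffs =
  fixes g :: game
  assumes wf: "well_formed g" and cw: "control_weights_pos g" and team: "team_riccati g"
begin

section \<open>Boundedness of all coefficients of Level 3\<close>

lemma coeffs_state:
  "bounded_coeff (hor g) (dx g) (dx g) (cA g)" "bounded_coeff (hor g) (dx g) (dx g) (cC g)"
  "bounded_coeff (hor g) (dx g) (dv g) (cE g)"
  using wf by (auto simp: well_formed_def)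

lemma coeffs1:
  assumes "i \<in> {1, 2}"
  shows "bounded_coeff (hor g) (dx g) (d1 g i) (cB1 g i)" "bounded_coeff (hor g) (dx g) (d1 g i) (cD1 g i)"
    "pos_weight (hor g) (d1 g i) (wR1 g i)"
  using wf cw assms unfolding well_formed_def control_weights_pos_def by (blast intro: sym_weight_pos)+

lemma coeffs2:
  assumes "i \<in> {1, 2}" "j \<in> {1, 2, 3}"
  shows "bounded_coeff (hor g) (dx g) (d2 g i j) (cB2 g i j)" "bounded_coeff (hor g) (dx g) (d2 g i j) (cD2 g i j)"
    "bounded_coeff (hor g) (dx g) (d3 g j i) (cB3 g j i)" "bounded_coeff (hor g) (dx g) (d3 g j i) (cD3 g j i)"
    "pos_weight (hor g) (d2 g i j) (wR12 g i j)" "pos_weight (hor g) (d3 g j i) (wRb1 g j i)"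
    "pos_weight (hor g) (d2 g i j) (wR3 g i j)" "pos_weight (hor g) (d3 g j i) (wRb3 g j i)"
    "bounded_coeff (hor g) (d1 g i) (d2 g i j) (eta g i j)" "bounded_coeff (hor g) (d1 g i) (d3 g j i) (zeta g i j)"
    "bounded_coeff (hor g) (d2 g i j) (d3 g j i) (rho g i j)"
  using wf cw assms unfolding well_formed_def control_weights_pos_def
  by (blast intro: sym_weight_pos continuous_mfun_bounded_coeff)+

lemma coeffs3:
  assumes "j \<in> {1, 2, 3}"
  shows "bounded_coeff (hor g) (dx g) (dx g) (wQ3 g j)" "wG3 g j \<in> carrier_mat (dx g) (dx g)"
  using wf assms unfolding well_formed_def sym_weight_def sym_terminal_def by blast+

lemma teamP_coeff: "bounded_coeff (hor g) (dx g) (dx g) (teamP g)"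
  using team terminal_ode_bounded_coeff by (auto simp: team_riccati_def)

lemma idx: "(1::nat) \<in> {1, 2}" "(2::nat) \<in> {1, 2}" "(1::nat) \<in> {1, 2, 3}" "(2::nat) \<in> {1, 2, 3}" "(3::nat) \<in> {1, 2, 3}"
  by simp_all

text \<open>The common column dimension is hidden in \<open>obtains\<close>, since only the
  agreement of the three stacked matrices matters.\<close>

lemma stacked_coeffs:
  obtains d where "bounded_coeff (hor g) (dx g) d (Bc g)" "bounded_coeff (hor g) (dx g) d (Dc g)"
    "pos_weight (hor g) d (Rc g)"
proof -
  \<comment> \<open>Right nesting and the final 0 reproduce the dimensions of the
    \<open>Cons\<close> and \<open>Nil\<close> rules literally.\<close>
  let ?d = "d1 g 1 + (d1 g 2 + (d2 g 1 1 + (d2 g 1 2 + (d2 g 1 3 + (d2 g 2 1 + (d2 g 2 2 + (d2 g 2 3 +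
    (d3 g 1 1 + (d3 g 1 2 + (d3 g 2 1 + (d3 g 2 2 + (d3 g 3 1 + (d3 g 3 2 + 0)))))))))))))"
  show thesis
  proof (rule that[of ?d])
    show "bounded_coeff (hor g) (dx g) ?d (Bc g)"
      unfolding Bc_def[abs_def] list_comp_simps
      by (intro bounded_coeff_hcat_Cons bounded_coeff_Nil coeffs1 coeffs2 idx)
    show "bounded_coeff (hor g) (dx g) ?d (Dc g)"
      unfolding Dc_def[abs_def] list_comp_simps
      by (intro bounded_coeff_hcat_Cons bounded_coeff_Nil coeffs1 coeffs2 idx)
    show "pos_weight (hor g) ?d (Rc g)"
      unfolding Rc_def[abs_def] list_comp_simps
      by (intro pos_weight_diag_Cons pos_weight_diag_Nil coeffs1 coeffs2 idx)
  qed
qed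

lemma Lam_coeff: "bounded_coeff (hor g) (dx g) (dx g) (Lam g)"
proof -
  obtain d where d: "bounded_coeff (hor g) (dx g) d (Bc g)" "bounded_coeff (hor g) (dx g) d (Dc g)"
    "pos_weight (hor g) d (Rc g)" by (rule stacked_coeffs)
  note R = pos_weight_minv(1)[OF d(3)]
  have M: "bounded_coeff (hor g) (dx g) (dx g) (teamM g)"
    unfolding teamM_def[abs_def]
    by (rule bounded_coeff_add[OF bounded_coeff_const[OF one_carrier_mat]])
      (intro bounded_coeff_mult[OF bounded_coeff_mult[OF bounded_coeff_mult[OF teamP_coeff d(2)] R]] bounded_coeff_transpose d)
  have C: "bounded_coeff (hor g) (dx g) (dx g) (teamC g)"
    unfolding teamC_def[abs_def]
    by (rule bounded_coeff_diff[OF coeffs_state(2) bounded_coeff_mult[OF bounded_coeff_mult[OF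
      bounded_coeff_mult[OF d(2) R] bounded_coeff_transpose[OF d(1)]] teamP_coeff]])
  have "bounded_coeff (hor g) (dx g) (dx g) (\<lambda>t. minv (teamM g t))"
    using team by (intro bounded_coeff_minv_bounded_inverse[OF M]) (simp add: team_riccati_def)
  then show ?thesis
    unfolding Lam_def[abs_def] by (intro bounded_coeff_mult[OF bounded_coeff_mult[OF _ teamP_coeff] C])
qed

lemma K_coeff:
  "i \<in> {1, 2} \<Longrightarrow> bounded_coeff (hor g) (d1 g i) (dx g) (K1 g i)"
  "i \<in> {1, 2} \<Longrightarrow> j \<in> {1, 2, 3} \<Longrightarrow> bounded_coeff (hor g) (d2 g i j) (dx g) (K2 g i j)"
  "i \<in> {1, 2} \<Longrightarrow> j \<in> {1, 2, 3} \<Longrightarrow> bounded_coeff (hor g) (d3 g j i) (dx g) (K3 g j i)"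
  unfolding K1_def[abs_def] K2_def[abs_def] K3_def[abs_def]
  by (intro bounded_coeff_mult[OF pos_weight_minv(1)] bounded_coeff_add
      bounded_coeff_mult[OF bounded_coeff_transpose teamP_coeff] bounded_coeff_mult[OF bounded_coeff_transpose Lam_coeff]
      coeffs1 coeffs2; assumption)+

lemma xi_coeff:
  assumes "i \<in> {1, 2}" "j \<in> {1, 2, 3}" shows "bounded_coeff (hor g) (d1 g i) (dx g) (xi g i j)"
  unfolding xi_def[abs_def]
  by (intro bounded_coeff_add bounded_coeff_smult bounded_coeff_mult[OF coeffs2(9)] bounded_coeff_mult[OF coeffs2(10)]
    K_coeff assms)

lemma theta_coeff:
  assumes "i \<in> {1, 2}" "j \<in> {1, 2, 3}" shows "bounded_coeff (hor g) (d2 g i j) (dx g) (theta g i j)"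
  unfolding theta_def[abs_def]
  by (intro bounded_coeff_add bounded_coeff_uminus bounded_coeff_mult[OF coeffs2(11)] K_coeff assms)

lemma EEP_coeff: "bounded_coeff (hor g) (dx g) (dx g) (\<lambda>t. (1 / (gam g)\<^sup>2) \<cdot>\<^sub>m (cE g t * (cE g t)\<^sup>T * teamP g t))"
  by (intro bounded_coeff_smult bounded_coeff_mult[OF bounded_coeff_mult[OF coeffs_state(3)] teamP_coeff]
    bounded_coeff_transpose coeffs_state)

lemma hatA_coeff: "bounded_coeff (hor g) (dx g) (dx g) (hatA g)"
  unfolding hatA_def[abs_def] list_comp_simps
  by (intro bounded_coeff_add EEP_coeff coeffs_state bounded_coeff_msum_Cons bounded_coeff_msum_Nil
    bounded_coeff_mult[OF coeffs1(1)] bounded_coeff_mult[OF coeffs2(1)] bounded_coeff_mult[OF coeffs2(9)]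
    xi_coeff theta_coeff idx)

lemma hatC_coeff: "bounded_coeff (hor g) (dx g) (dx g) (hatC g)"
  unfolding hatC_def[abs_def] list_comp_simps
  by (intro bounded_coeff_add coeffs_state bounded_coeff_msum_Cons bounded_coeff_msum_Nil
    bounded_coeff_mult[OF coeffs1(2)] bounded_coeff_mult[OF coeffs2(2)] bounded_coeff_mult[OF coeffs2(9)]
    xi_coeff theta_coeff idx)

lemma du3_eq: "du3 g j = d3 g j 1 + (d3 g j 2 + 0)"
  by (simp add: du3_def)

lemma hat3_coeff:
  assumes j: "j \<in> {1, 2, 3}"
  shows "bounded_coeff (hor g) (dx g) (du3 g j) (hatB3 g j)" "bounded_coeff (hor g) (dx g) (du3 g j) (hatD3 g j)"
    "bounded_coeff (hor g) (dx g) (dx g) (hatQ3 g j)" "bounded_coeff (hor g) (dx g) (du3 g j) (S3 g j)"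
    "pos_weight (hor g) (du3 g j) (Rc3 g j)"
proof -
  show "bounded_coeff (hor g) (dx g) (du3 g j) (hatB3 g j)"
    unfolding hatB3_def[abs_def] du3_eq list_comp_simps
    by (intro bounded_coeff_hcat_Cons bounded_coeff_Nil bounded_coeff_add bounded_coeff_mult[OF coeffs1(1)]
      bounded_coeff_mult[OF coeffs2(1)] bounded_coeff_mult[OF coeffs2(9)] coeffs2 idx j)
  show "bounded_coeff (hor g) (dx g) (du3 g j) (hatD3 g j)"
    unfolding hatD3_def[abs_def] du3_eq list_comp_simps
    by (intro bounded_coeff_hcat_Cons bounded_coeff_Nil bounded_coeff_add bounded_coeff_mult[OF coeffs1(2)]
      bounded_coeff_mult[OF coeffs2(2)] bounded_coeff_mult[OF coeffs2(9)] coeffs2 idx j)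
  have R: "bounded_coeff (hor g) (d2 g i j) (d2 g i j) (wR3 g i j)" if "i \<in> {1, 2}" for i
    using coeffs2(7)[OF that j] by (simp add: pos_weight_def)
  have TR: "bounded_coeff (hor g) (dx g) (d2 g i j) (\<lambda>t. (theta g i j t)\<^sup>T * wR3 g i j t)" if "i \<in> {1, 2}" for i
    by (rule bounded_coeff_mult[OF bounded_coeff_transpose[OF theta_coeff[OF that j]] R[OF that]])
  show "bounded_coeff (hor g) (dx g) (dx g) (hatQ3 g j)"
    unfolding hatQ3_def[abs_def] list_comp_simps
    by (intro bounded_coeff_add bounded_coeff_msum_Cons bounded_coeff_msum_Nil coeffs3 bounded_coeff_mult[OF TR]
      theta_coeff idx j)
  show "bounded_coeff (hor g) (dx g) (du3 g j) (S3 g j)"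
    unfolding S3_def[abs_def] du3_eq list_comp_simps
    by (intro bounded_coeff_hcat_Cons bounded_coeff_Nil bounded_coeff_mult[OF TR] coeffs2 idx j)
  show "pos_weight (hor g) (du3 g j) (Rc3 g j)"
    unfolding Rc3_def[abs_def] du3_eq list_comp_simps
    by (intro pos_weight_diag_Cons pos_weight_diag_Nil pos_weight_add_congruence[OF coeffs2(8) coeffs2(7)] coeffs2(11) idx j)
qed

end

section \<open>Algebra with three blocks\<close>

lemma colvec3: "colvec [v1, v2, v3] = v1 @\<^sub>v (v2 @\<^sub>v (v3 @\<^sub>v 0\<^sub>v 0))"
  by (simp add: colvec_def)

lemma add_0_right_vec: "(v :: rvec) \<in> carrier_vec r \<Longrightarrow> v + 0\<^sub>v r = v"
  by simp

lemma hcat3_carrier: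
  "X1 \<in> carrier_mat r n \<Longrightarrow> X2 \<in> carrier_mat r n \<Longrightarrow> X3 \<in> carrier_mat r n \<Longrightarrow> hcat r [X1, X2, X3] \<in> carrier_mat r (3 * n)"
  by (rule carrier_matI) (use hcat_carrier[of r "[X1, X2, X3]"] in auto)

lemma hcat3_mult:
  assumes X: "X1 \<in> carrier_mat r n" "X2 \<in> carrier_mat r n" "X3 \<in> carrier_mat r n"
    and v: "v1 \<in> carrier_vec n" "v2 \<in> carrier_vec n" "v3 \<in> carrier_vec n"
  shows "hcat r [X1, X2, X3] *\<^sub>v colvec [v1, v2, v3] = X1 *\<^sub>v v1 + (X2 *\<^sub>v v2 + X3 *\<^sub>v v3)"
proof -
  have c0: "hcat r [] \<in> carrier_mat r 0" by (simp add: hcat_Nil)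
  have c1: "hcat r [X3] \<in> carrier_mat r (n + 0)" using hcat_carrier[of r "[X3]"] X by simp
  have c2: "hcat r [X2, X3] \<in> carrier_mat r (n + (n + 0))" using hcat_carrier[of r "[X2, X3]"] X by simp
  have v0: "(0\<^sub>v 0 :: rvec) \<in> carrier_vec 0" by simp
  have z: "hcat r [] *\<^sub>v (0\<^sub>v 0 :: rvec) = 0\<^sub>v r" by (rule eq_vecI) (auto simp: hcat_Nil)
  have a3: "v3 @\<^sub>v 0\<^sub>v 0 \<in> carrier_vec (n + 0)" and a2: "v2 @\<^sub>v (v3 @\<^sub>v 0\<^sub>v 0) \<in> carrier_vec (n + (n + 0))"
    using v by (auto intro!: carrier_vecI)
  show ?thesis
    unfolding colvec3 hcat_Cons_mult[OF X(1) c2 v(1) a2] hcat_Cons_mult[OF X(2) c1 v(2) a3]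
      hcat_Cons_mult[OF X(3) c0 v(3) v0] z add_0_right_vec[OF mult_mat_vec_carrier[OF X(3) v(3)]] ..
qed

lemma vcat3_mult:
  assumes X: "X1 \<in> carrier_mat n c" "X2 \<in> carrier_mat n c" "X3 \<in> carrier_mat n c"
    and v: "v \<in> carrier_vec c"
  shows "vcat c [X1, X2, X3] *\<^sub>v v = colvec [X1 *\<^sub>v v, X2 *\<^sub>v v, X3 *\<^sub>v v]"
proof -
  have c0: "vcat c [] \<in> carrier_mat 0 c" by (simp add: vcat_Nil)
  have c1: "vcat c [X3] \<in> carrier_mat (n + 0) c" using vcat_carrier[of c "[X3]"] X by simp
  have c2: "vcat c [X2, X3] \<in> carrier_mat (n + (n + 0)) c" using vcat_carrier[of c "[X2, X3]"] X by simp
  have z: "vcat c [] *\<^sub>v v = 0\<^sub>v 0" by (rule eq_vecI) (auto simp: vcat_Nil)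
  show ?thesis
    unfolding colvec3 vcat_Cons_mult[OF X(1) c2 v] vcat_Cons_mult[OF X(2) c1 v] vcat_Cons_mult[OF X(3) c0 v] z ..
qed

lemma diag3_transpose_mult:
  assumes X: "X1 \<in> carrier_mat n n" "X2 \<in> carrier_mat n n" "X3 \<in> carrier_mat n n"
    and v: "v1 \<in> carrier_vec n" "v2 \<in> carrier_vec n" "v3 \<in> carrier_vec n"
  shows "(diag_block_mat [X1, X2, X3])\<^sup>T *\<^sub>v colvec [v1, v2, v3] = colvec [X1\<^sup>T *\<^sub>v v1, X2\<^sup>T *\<^sub>v v2, X3\<^sup>T *\<^sub>v v3]"
proof -
  have c0: "(diag_block_mat [] :: rmat) \<in> carrier_mat 0 0" by simp
  have c1: "diag_block_mat [X3] \<in> carrier_mat (n + 0) (n + 0)"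
    by (rule carrier_matI) (use X in \<open>auto simp: dim_diag_block_mat\<close>)
  have c2: "diag_block_mat [X2, X3] \<in> carrier_mat (n + (n + 0)) (n + (n + 0))"
    by (rule carrier_matI) (use X in \<open>auto simp: dim_diag_block_mat\<close>)
  have v0: "(0\<^sub>v 0 :: rvec) \<in> carrier_vec 0" by simp
  have z: "(diag_block_mat [] :: rmat)\<^sup>T *\<^sub>v 0\<^sub>v 0 = 0\<^sub>v 0" by (rule eq_vecI) auto
  have a3: "v3 @\<^sub>v 0\<^sub>v 0 \<in> carrier_vec (n + 0)" and a2: "v2 @\<^sub>v (v3 @\<^sub>v 0\<^sub>v 0) \<in> carrier_vec (n + (n + 0))"
    using v by (auto intro!: carrier_vecI)
  show ?thesis
    unfolding colvec3 diag_Cons_transpose_mult[OF X(1) c2 v(1) a2] diag_Cons_transpose_mult[OF X(2) c1 v(2) a3]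
      diag_Cons_transpose_mult[OF X(3) c0 v(3) v0] z ..
qed

lemma msum3_carrier:
  "X1 \<in> carrier_mat r c \<Longrightarrow> X2 \<in> carrier_mat r c \<Longrightarrow> X3 \<in> carrier_mat r c \<Longrightarrow> msum r c [X1, X2, X3] \<in> carrier_mat r c"
  by (simp add: msum_def)

lemma msum3: "X3 \<in> carrier_mat r c \<Longrightarrow> msum r c [X1, X2, X3] = X1 + (X2 + X3)"
  by (simp add: msum_def)

lemma msum3_mult:
  assumes X: "X1 \<in> carrier_mat r c" "X2 \<in> carrier_mat r c" "X3 \<in> carrier_mat r c" and v: "v \<in> carrier_vec c"
  shows "msum r c [X1, X2, X3] *\<^sub>v v = X1 *\<^sub>v v + (X2 *\<^sub>v v + X3 *\<^sub>v v)"
  unfolding msum3[OF X(3)] add_mult_distrib_mat_vec[OF X(1) add_carrier_mat[OF X(3)] v]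
    add_mult_distrib_mat_vec[OF X(2,3) v] ..

lemma vsum3: "(v3 :: rvec) \<in> carrier_vec r \<Longrightarrow> vsum r [v1, v2, v3] = v1 + (v2 + v3)"
  by (simp add: vsum_def)

lemma uminus_mult_vec: "(X :: rmat) \<in> carrier_mat r c \<Longrightarrow> v \<in> carrier_vec c \<Longrightarrow> - X *\<^sub>v v = - (X *\<^sub>v v)"
  by simp

lemma mult_uminus_vec:
  assumes "(X :: rmat) \<in> carrier_mat r c" "v \<in> carrier_vec c" shows "X *\<^sub>v - v = - (X *\<^sub>v v)"
  using assms by (intro eq_vecI) auto

lemma prod3_mult_vec:
  assumes "(X :: rmat) \<in> carrier_mat r d" "Y \<in> carrier_mat d e" "Z \<in> carrier_mat e c" "v \<in> carrier_vec c"
  shows "(X * Y * Z) *\<^sub>v v = X *\<^sub>v (Y *\<^sub>v (Z *\<^sub>v v))"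
  unfolding assoc_mult_mat_vec[OF mult_carrier_mat[OF assms(1,2)] assms(3,4)]
    assoc_mult_mat_vec[OF assms(1,2) mult_mat_vec_carrier[OF assms(3,4)]] ..

lemma prod3_carrier:
  "(X :: rmat) \<in> carrier_mat r d \<Longrightarrow> Y \<in> carrier_mat d e \<Longrightarrow> Z \<in> carrier_mat e c \<Longrightarrow> X * Y * Z \<in> carrier_mat r c"
  by (rule mult_carrier_mat[OF mult_carrier_mat])

lemma prod3_transpose:
  assumes "(X :: rmat) \<in> carrier_mat n d" "Y \<in> carrier_mat d d" "Z \<in> carrier_mat n d" "Y\<^sup>T = Y"
  shows "(X * Y * Z\<^sup>T)\<^sup>T = Z * Y * X\<^sup>T"
proof -
  have Zt: "Z\<^sup>T \<in> carrier_mat d n" using assms by simp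
  have "(X * Y * Z\<^sup>T)\<^sup>T = (Z\<^sup>T)\<^sup>T * (Y\<^sup>T * X\<^sup>T)"
    unfolding transpose_mult[OF mult_carrier_mat[OF assms(1,2)] Zt] transpose_mult[OF assms(1,2)] ..
  also have "\<dots> = Z * Y * X\<^sup>T"
    using assms assoc_mult_mat[OF assms(3,2), of "X\<^sup>T" n] by simp
  finally show ?thesis .
qed

lemma transpose_minus_mat:
  "(X :: rmat) \<in> carrier_mat r c \<Longrightarrow> Y \<in> carrier_mat r c \<Longrightarrow> (X - Y)\<^sup>T = X\<^sup>T - Y\<^sup>T"
  by (intro eq_matI) auto

lemma feedback_mult:
  assumes X: "(X :: rmat) \<in> carrier_mat n d" and R: "R \<in> carrier_mat d d"
    and F: "S \<in> carrier_mat n d" "B \<in> carrier_mat n d" "D \<in> carrier_mat n d"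
    and v: "x \<in> carrier_vec n" "y \<in> carrier_vec n" "z \<in> carrier_vec n"
  shows "X *\<^sub>v - (R *\<^sub>v (S\<^sup>T *\<^sub>v x + B\<^sup>T *\<^sub>v y + D\<^sup>T *\<^sub>v z))
    = - ((X * R * S\<^sup>T) *\<^sub>v x + (X * R * B\<^sup>T) *\<^sub>v y + (X * R * D\<^sup>T) *\<^sub>v z)"
proof -
  have t: "S\<^sup>T \<in> carrier_mat d n" "B\<^sup>T \<in> carrier_mat d n" "D\<^sup>T \<in> carrier_mat d n" using F by simp_all
  note w = mult_mat_vec_carrier[OF t(1) v(1)] mult_mat_vec_carrier[OF t(2) v(2)] mult_mat_vec_carrier[OF t(3) v(3)]
  note Rw = mult_mat_vec_carrier[OF R w(1)] mult_mat_vec_carrier[OF R w(2)] mult_mat_vec_carrier[OF R w(3)]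
  have s: "R *\<^sub>v (S\<^sup>T *\<^sub>v x + B\<^sup>T *\<^sub>v y + D\<^sup>T *\<^sub>v z) = R *\<^sub>v (S\<^sup>T *\<^sub>v x) + R *\<^sub>v (B\<^sup>T *\<^sub>v y) + R *\<^sub>v (D\<^sup>T *\<^sub>v z)"
    unfolding mult_add_distrib_mat_vec[OF R add_carrier_vec[OF w(1,2)] w(3)] mult_add_distrib_mat_vec[OF R w(1,2)] ..
  show ?thesis
    unfolding s mult_uminus_vec[OF X add_carrier_vec[OF add_carrier_vec[OF Rw(1,2)] Rw(3)]]
      mult_add_distrib_mat_vec[OF X add_carrier_vec[OF Rw(1,2)] Rw(3)] mult_add_distrib_mat_vec[OF X Rw(1,2)]
      prod3_mult_vec[OF X R t(1) v(1)] prod3_mult_vec[OF X R t(2) v(2)] prod3_mult_vec[OF X R t(3) v(3)] ..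
qed

text \<open>Regroups the contributions of the players by origin: p from the state, q from the
  costates, w from their diffusions.\<close>

lemma state_cancel:
  fixes a :: rvec
  assumes "a \<in> carrier_vec n" "p1 \<in> carrier_vec n" "p2 \<in> carrier_vec n" "p3 \<in> carrier_vec n"
    "q1 \<in> carrier_vec n" "q2 \<in> carrier_vec n" "q3 \<in> carrier_vec n"
    "w1 \<in> carrier_vec n" "w2 \<in> carrier_vec n" "w3 \<in> carrier_vec n"
  shows "a + (- (p1 + q1 + w1) + (- (p2 + q2 + w2) + - (p3 + q3 + w3)))
    = (a - (p1 + (p2 + p3))) + (- q1 + (- q2 + - q3)) + (- w1 + (- w2 + - w3))"
  using assms by (intro eq_vecI) auto

text \<open>\<open>F\<close>, \<open>H\<close> stand for \<open>A\<close>, \<open>B\<close> in the drift and for \<open>C\<close>, \<open>D\<close> in the diffusion.\<close>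

lemma closed_loop_state:
  fixes F :: rmat and H R S B D :: "nat \<Rightarrow> rmat" and y z :: "nat \<Rightarrow> rvec"
  assumes F: "F \<in> carrier_mat n n" and x: "x \<in> carrier_vec n"
    and c: "\<And>j. j \<in> {1, 2, 3} \<Longrightarrow> H j \<in> carrier_mat n (d j)" "\<And>j. j \<in> {1, 2, 3} \<Longrightarrow> R j \<in> carrier_mat (d j) (d j)"
      "\<And>j. j \<in> {1, 2, 3} \<Longrightarrow> S j \<in> carrier_mat n (d j)" "\<And>j. j \<in> {1, 2, 3} \<Longrightarrow> B j \<in> carrier_mat n (d j)"
      "\<And>j. j \<in> {1, 2, 3} \<Longrightarrow> D j \<in> carrier_mat n (d j)"
    and v: "\<And>j. j \<in> {1, 2, 3} \<Longrightarrow> y j \<in> carrier_vec n" "\<And>j. j \<in> {1, 2, 3} \<Longrightarrow> z j \<in> carrier_vec n"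
    and u: "\<And>j. j \<in> {1, 2, 3} \<Longrightarrow> u j = - (R j *\<^sub>v ((S j)\<^sup>T *\<^sub>v x + (B j)\<^sup>T *\<^sub>v y j + (D j)\<^sup>T *\<^sub>v z j))"
  shows "F *\<^sub>v x + vsum n [H j *\<^sub>v u j. j \<leftarrow> I3]
    = (F - msum n n [H j * R j * (S j)\<^sup>T. j \<leftarrow> I3]) *\<^sub>v x
      + hcat n [- (H j * R j * (B j)\<^sup>T). j \<leftarrow> I3] *\<^sub>v colvec [y j. j \<leftarrow> I3]
      + hcat n [- (H j * R j * (D j)\<^sup>T). j \<leftarrow> I3] *\<^sub>v colvec [z j. j \<leftarrow> I3]"
proof -
  have i: "(1::nat) \<in> {1, 2, 3}" "(2::nat) \<in> {1, 2, 3}" "(3::nat) \<in> {1, 2, 3}" by simp_all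
  have T: "(S j)\<^sup>T \<in> carrier_mat (d j) n" "(B j)\<^sup>T \<in> carrier_mat (d j) n" "(D j)\<^sup>T \<in> carrier_mat (d j) n"
    if "j \<in> {1, 2, 3}" for j using c(3-5)[OF that] by simp_all
  have p: "H j * R j * (S j)\<^sup>T \<in> carrier_mat n n" "H j * R j * (B j)\<^sup>T \<in> carrier_mat n n"
    "H j * R j * (D j)\<^sup>T \<in> carrier_mat n n" if j: "j \<in> {1, 2, 3}" for j
    by (rule prod3_carrier[OF c(1)[OF j] c(2)[OF j] T(1)[OF j]], rule prod3_carrier[OF c(1)[OF j] c(2)[OF j] T(2)[OF j]],
        rule prod3_carrier[OF c(1)[OF j] c(2)[OF j] T(3)[OF j]])
  have m: "- (H j * R j * (B j)\<^sup>T) \<in> carrier_mat n n" "- (H j * R j * (D j)\<^sup>T) \<in> carrier_mat n n" if j: "j \<in> {1, 2, 3}" for j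
    using p[OF j] by simp_all
  have pv: "(H j * R j * (S j)\<^sup>T) *\<^sub>v x \<in> carrier_vec n" "(H j * R j * (B j)\<^sup>T) *\<^sub>v y j \<in> carrier_vec n"
    "(H j * R j * (D j)\<^sup>T) *\<^sub>v z j \<in> carrier_vec n" if j: "j \<in> {1, 2, 3}" for j
    by (rule mult_mat_vec_carrier[OF p(1)[OF j] x], rule mult_mat_vec_carrier[OF p(2)[OF j] v(1)[OF j]],
      rule mult_mat_vec_carrier[OF p(3)[OF j] v(2)[OF j]])
  have Hu: "H j *\<^sub>v u j = - ((H j * R j * (S j)\<^sup>T) *\<^sub>v x + (H j * R j * (B j)\<^sup>T) *\<^sub>v y j + (H j * R j * (D j)\<^sup>T) *\<^sub>v z j)"
    if j: "j \<in> {1, 2, 3}" for j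
    unfolding u[OF j]
    by (rule feedback_mult[OF c(1)[OF j] c(2)[OF j] c(3)[OF j] c(4)[OF j] c(5)[OF j] x v(1)[OF j] v(2)[OF j]])
  have Huc: "H 3 *\<^sub>v u 3 \<in> carrier_vec n" by (rule carrier_vecI) (use c(1)[OF i(3)] in simp)
  show ?thesis
    unfolding list_comp_simps vsum3[OF Huc]
    unfolding Hu[OF i(1)] Hu[OF i(2)] Hu[OF i(3)]
      hcat3_mult[OF m(1)[OF i(1)] m(1)[OF i(2)] m(1)[OF i(3)] v(1)[OF i(1)] v(1)[OF i(2)] v(1)[OF i(3)]]
      hcat3_mult[OF m(2)[OF i(1)] m(2)[OF i(2)] m(2)[OF i(3)] v(2)[OF i(1)] v(2)[OF i(2)] v(2)[OF i(3)]]
      minus_mult_distrib_mat_vec[OF F msum3_carrier[OF p(1)[OF i(1)] p(1)[OF i(2)] p(1)[OF i(3)]] x]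
      msum3_mult[OF p(1)[OF i(1)] p(1)[OF i(2)] p(1)[OF i(3)] x]
      uminus_mult_vec[OF p(2)[OF i(1)] v(1)[OF i(1)]] uminus_mult_vec[OF p(2)[OF i(2)] v(1)[OF i(2)]]
      uminus_mult_vec[OF p(2)[OF i(3)] v(1)[OF i(3)]]
      uminus_mult_vec[OF p(3)[OF i(1)] v(2)[OF i(1)]] uminus_mult_vec[OF p(3)[OF i(2)] v(2)[OF i(2)]]
      uminus_mult_vec[OF p(3)[OF i(3)] v(2)[OF i(3)]]
    by (rule state_cancel[OF mult_mat_vec_carrier[OF F x] pv(1)[OF i(1)] pv(1)[OF i(2)] pv(1)[OF i(3)]
      pv(2)[OF i(1)] pv(2)[OF i(2)] pv(2)[OF i(3)] pv(3)[OF i(1)] pv(3)[OF i(2)] pv(3)[OF i(3)]])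
qed

lemma costate_cancel:
  fixes a :: rvec
  assumes "a \<in> carrier_vec n" "b \<in> carrier_vec n" "c \<in> carrier_vec n"
    "p \<in> carrier_vec n" "q \<in> carrier_vec n" "w \<in> carrier_vec n"
  shows "a + b + c + - (p + q + w) = (a - q) + (b - w) + (c - p)"
  using assms by (intro eq_vecI) auto

text \<open>The control contributes S R B^T y and S R D^T z. By symmetry of R these are the
  transposes of B R S^T and D R S^T, which is how they merge with A^T and C^T.\<close>

lemma closed_loop_costate:
  fixes A C Q R S B D :: rmat
  assumes c: "A \<in> carrier_mat n n" "C \<in> carrier_mat n n" "Q \<in> carrier_mat n n"
    "R \<in> carrier_mat d d" "S \<in> carrier_mat n d" "B \<in> carrier_mat n d" "D \<in> carrier_mat n d"
    and v: "x \<in> carrier_vec n" "y \<in> carrier_vec n" "z \<in> carrier_vec n" and sym: "R\<^sup>T = R"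
    and u: "u = - (R *\<^sub>v (S\<^sup>T *\<^sub>v x + B\<^sup>T *\<^sub>v y + D\<^sup>T *\<^sub>v z))"
  shows "A\<^sup>T *\<^sub>v y + C\<^sup>T *\<^sub>v z + Q *\<^sub>v x + S *\<^sub>v u
    = (A - B * R * S\<^sup>T)\<^sup>T *\<^sub>v y + (C - D * R * S\<^sup>T)\<^sup>T *\<^sub>v z + (Q - S * R * S\<^sup>T) *\<^sub>v x"
proof -
  have T: "S\<^sup>T \<in> carrier_mat d n" "B\<^sup>T \<in> carrier_mat d n" "D\<^sup>T \<in> carrier_mat d n" "A\<^sup>T \<in> carrier_mat n n" "C\<^sup>T \<in> carrier_mat n n"
    using c by simp_all
  note p = prod3_carrier[OF c(5,4) T(1)] prod3_carrier[OF c(5,4) T(2)] prod3_carrier[OF c(5,4) T(3)]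
    prod3_carrier[OF c(6,4) T(1)] prod3_carrier[OF c(7,4) T(1)]
  have tA: "(A - B * R * S\<^sup>T)\<^sup>T = A\<^sup>T - S * R * B\<^sup>T"
    unfolding transpose_minus_mat[OF c(1) p(4)] prod3_transpose[OF c(6,4,5) sym] ..
  have tC: "(C - D * R * S\<^sup>T)\<^sup>T = C\<^sup>T - S * R * D\<^sup>T"
    unfolding transpose_minus_mat[OF c(2) p(5)] prod3_transpose[OF c(7,4,5) sym] ..
  show ?thesis
    unfolding u feedback_mult[OF c(5,4,5,6,7) v] tA tC minus_mult_distrib_mat_vec[OF T(4) p(2) v(2)]
      minus_mult_distrib_mat_vec[OF T(5) p(3) v(3)] minus_mult_distrib_mat_vec[OF c(3) p(1) v(1)]
    by (rule costate_cancel[OF mult_mat_vec_carrier[OF T(4) v(2)] mult_mat_vec_carrier[OF T(5) v(3)]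
      mult_mat_vec_carrier[OF c(3) v(1)] mult_mat_vec_carrier[OF p(1) v(1)] mult_mat_vec_carrier[OF p(2) v(2)]
      mult_mat_vec_carrier[OF p(3) v(3)]])
qed

lemma colvec3_add:
  assumes "a1 \<in> carrier_vec n" "a2 \<in> carrier_vec n" "a3 \<in> carrier_vec n" "b1 \<in> carrier_vec n" "b2 \<in> carrier_vec n" "b3 \<in> carrier_vec n"
  shows "colvec [a1, a2, a3] + colvec [b1, b2, b3] = colvec [a1 + b1, a2 + b2, a3 + (b3 :: rvec)]"
  using assms unfolding colvec3 by (intro eq_vecI) auto

lemma colvec3_uminus:
  "- colvec [a1, a2, a3] = colvec [- a1, - a2, - (a3 :: rvec)]"
  unfolding colvec3 by (intro eq_vecI) auto

text \<open>The zero blocks discard the other players, so the row selects the costate of player j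
  from the stacked vector.\<close>

lemma row_at_mult:
  assumes j: "j \<in> {1, 2, 3}" and X: "X \<in> carrier_mat d (dx g)"
    and v: "\<And>k. k \<in> {1, 2, 3} \<Longrightarrow> y k \<in> carrier_vec (dx g)"
  shows "row_at g j X *\<^sub>v colvec [y k. k \<leftarrow> I3] = X *\<^sub>v y j"
    "row_at g j X \<in> carrier_mat d (3 * dx g)"
proof -
  have i: "(1::nat) \<in> {1, 2, 3}" "(2::nat) \<in> {1, 2, 3}" "(3::nat) \<in> {1, 2, 3}" by simp_all
  define b where "b k = (if k = j then X else 0\<^sub>m (dim_row X) (dx g))" for k :: nat
  have b: "b k \<in> carrier_mat d (dx g)" for k using X by (simp add: b_def)
  have r: "row_at g j X = hcat d [b 1, b 2, b 3]"
    using X unfolding row_at_def b_def list_comp_simps by simp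
  show "row_at g j X \<in> carrier_mat d (3 * dx g)" unfolding r by (rule hcat3_carrier[OF b b b])
  have by': "b k *\<^sub>v y k = (if k = j then X *\<^sub>v y j else 0\<^sub>v d)" if "k \<in> {1, 2, 3}" for k
    using v[OF that] X by (auto simp: b_def intro!: eq_vecI)
  have Xy: "X *\<^sub>v y j \<in> carrier_vec d" by (rule mult_mat_vec_carrier[OF X v[OF j]])
  show "row_at g j X *\<^sub>v colvec [y k. k \<leftarrow> I3] = X *\<^sub>v y j"
    unfolding r list_comp_simps hcat3_mult[OF b b b v[OF i(1)] v[OF i(2)] v[OF i(3)]]
      by'[OF i(1)] by'[OF i(2)] by'[OF i(3)] using j Xy by auto
qed

lemma colvec3_index:
  assumes "v1 \<in> carrier_vec n" "v2 \<in> carrier_vec n" "v3 \<in> carrier_vec n" "c < 3 * n"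
  shows "colvec [v1, v2, v3] $ c = (if c < n then v1 $ c else if c < 2 * n then v2 $ (c - n) else v3 $ (c - 2 * n))"
  using assms by (auto simp: colvec3 mult_2)

context wiener begin

text \<open>Equality holds everywhere on [0, T] and \<open>space M\<close>, so the process itself
  may be replaced too, which almost everywhere equality in dt x dP would not justify at a fixed
  time.\<close>

lemma itoproc_cong:
  assumes X: "itoproc b \<sigma> X"
    and eq: "\<And>s \<omega>. s \<in> {0..T} \<Longrightarrow> \<omega> \<in> space M \<Longrightarrow> b s \<omega> = b' s \<omega>"
      "\<And>s \<omega>. s \<in> {0..T} \<Longrightarrow> \<omega> \<in> space M \<Longrightarrow> \<sigma> s \<omega> = \<sigma>' s \<omega>"
      "\<And>s \<omega>. s \<in> {0..T} \<Longrightarrow> \<omega> \<in> space M \<Longrightarrow> X s \<omega> = X' s \<omega>"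
  shows "itoproc b' \<sigma>' X'"
proof -
  have "L2_proc b'" using itoprocD(1)[OF X] L2_proc_cong[of b b'] eq(1) by blast
  moreover have "L2_proc \<sigma>'" using itoprocD(2)[OF X] L2_proc_cong[of \<sigma> \<sigma>'] eq(2) by blast
  ultimately have X': "itoproc b' \<sigma>' X"
    by (intro itoproc_cong_AE[OF X] AE_I2) (auto simp: space_dt_dP eq)
  show ?thesis unfolding itoproc_def
  proof (intro conjI ballI allI impI itoprocD(1,2)[OF X'])
    show "L2_proc X'" using itoprocD(3)[OF X] L2_proc_cong[of X X'] eq(3) by blast
    show "X' t \<in> borel_measurable (Fil t)" if t: "t \<in> {0..T}" for t
      using itoprocD(4)[OF X t] measurable_cong[of "Fil t" "X t" "X' t" borel] eq(3)[OF t] by simp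
    show "Lsq M (X' t)" if t: "t \<in> {0..T}" for t
      using itoprocD(5)[OF X t] Lsq_cong[of M "X t" "X' t"] eq(3)[OF t] by simp
    fix s t assume st: "0 \<le> s" "s \<le> t" "t \<le> T"
    obtain J where J: "ito (\<lambda>r \<omega>. \<sigma>' r \<omega> * indicator {s<..t} r) J"
      "AE \<omega> in M. X t \<omega> - X s \<omega> = tint s t b' \<omega> + J \<omega>" by (rule itoprocE[OF X' st])
    have "AE \<omega> in M. X' t \<omega> - X' s \<omega> = tint s t b' \<omega> + J \<omega>"
      using J(2) AE_space by eventually_elim (use eq(3)[of t] eq(3)[of s] st in auto)
    then show "\<exists>J. ito (\<lambda>r \<omega>. \<sigma>' r \<omega> * indicator {s<..t} r) J \<and>
      (AE \<omega> in M. X' t \<omega> - X' s \<omega> = tint s t b' \<omega> + J \<omega>)" using J(1) by blast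
  qed
qed

lemma itoproc_colvec3:
  assumes X: "\<And>j k. j \<in> {1, 2, 3} \<Longrightarrow> k < n \<Longrightarrow>
      itoproc (\<lambda>t \<omega>. b j t \<omega> $ k) (\<lambda>t \<omega>. \<sigma> j t \<omega> $ k) (\<lambda>t \<omega>. X j t \<omega> $ k)"
    and v: "\<And>j. j \<in> {1, 2, 3} \<Longrightarrow> L2_vec n (b j)" "\<And>j. j \<in> {1, 2, 3} \<Longrightarrow> L2_vec n (\<sigma> j)"
      "\<And>j. j \<in> {1, 2, 3} \<Longrightarrow> L2_vec n (X j)"
    and c: "c < 3 * n"
  shows "itoproc (\<lambda>t \<omega>. colvec [b j t \<omega>. j \<leftarrow> I3] $ c) (\<lambda>t \<omega>. colvec [\<sigma> j t \<omega>. j \<leftarrow> I3] $ c)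
    (\<lambda>t \<omega>. colvec [X j t \<omega>. j \<leftarrow> I3] $ c)"
proof -
  \<comment> \<open>Decodes c as component k of block j.\<close>
  define j where "j = (if c < n then 1 else if c < 2 * n then 2 else 3 :: nat)"
  define k where "k = (if c < n then c else if c < 2 * n then c - n else c - 2 * n)"
  have jk: "j \<in> {1, 2, 3}" "k < n" using c by (auto simp: j_def k_def)
  have ix: "f j t \<omega> $ k = colvec [f j t \<omega>. j \<leftarrow> I3] $ c"
    if "\<And>j. j \<in> {1, 2, 3} \<Longrightarrow> L2_vec n (f j)" "t \<in> {0..T}" "\<omega> \<in> space M" for f :: "nat \<Rightarrow> 'a vproc" and t \<omega>
    unfolding list_comp_simps
    by (subst colvec3_index[OF L2_vecD(1)[OF that(1)[of 1] that(2,3)] L2_vecD(1)[OF that(1)[of 2] that(2,3)]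
      L2_vecD(1)[OF that(1)[of 3] that(2,3)] c]) (simp_all add: j_def k_def)
  show ?thesis
    by (rule itoproc_cong[OF X[OF jk]]) (rule ix[OF v(1)] ix[OF v(2)] ix[OF v(3)]; assumption)+
qed

lemma L2_vec_empty: "L2_vec 0 (\<lambda>t \<omega>. 0\<^sub>v 0)"
  by (simp add: L2_vec_def)

lemma L2_vec_colvec3:
  assumes v: "\<And>j. j \<in> {1, 2, 3} \<Longrightarrow> L2_vec n (f j)"
  shows "L2_vec (3 * n) (\<lambda>t \<omega>. colvec [f j t \<omega>. j \<leftarrow> I3])"
proof -
  have "L2_vec (n + (n + (n + 0))) (\<lambda>t \<omega>. colvec [f j t \<omega>. j \<leftarrow> I3])"
    unfolding list_comp_simps colvec3 by (intro L2_vec_append L2_vec_empty v) simp_all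
  moreover have "n + (n + (n + 0)) = 3 * n" by simp
  ultimately show ?thesis by (simp only:)
qed

end

section \<open>The closed loop of the Level 3 equilibrium\<close>

locale nash_game = game_coeffs g + wiener M "hor g" W
  for g :: game and M :: "'a measure" and W :: "'a rproc"
begin

text \<open>Every player acts on the state, so all three feedback terms are subtracted here; block j
  of \<open>blkA\<close> subtracts only that of player j.\<close>

abbreviation closedA :: mfun where
  "closedA t \<equiv> hatA g t - msum (dx g) (dx g) [hatB3 g j t * minv (Rc3 g j t) * (S3 g j t)\<^sup>T. j \<leftarrow> I3]"

abbreviation closedC :: mfun where
  "closedC t \<equiv> hatC g t - msum (dx g) (dx g) [hatD3 g j t * minv (Rc3 g j t) * (S3 g j t)\<^sup>T. j \<leftarrow> I3]"

lemma Rinv: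
  assumes j: "j \<in> {1, 2, 3}"
  shows "bounded_coeff (hor g) (du3 g j) (du3 g j) (\<lambda>t. minv (Rc3 g j t))"
    "t \<in> {0..hor g} \<Longrightarrow> (minv (Rc3 g j t))\<^sup>T = minv (Rc3 g j t)"
  using pos_weight_minv[OF hat3_coeff(5)[OF j]] by auto

lemma triple_coeff:
  assumes j: "j \<in> {1, 2, 3}"
    and X: "bounded_coeff (hor g) (dx g) (du3 g j) X" and Y: "bounded_coeff (hor g) (dx g) (du3 g j) Y"
  shows "bounded_coeff (hor g) (dx g) (dx g) (\<lambda>t. X t * minv (Rc3 g j t) * (Y t)\<^sup>T)"
  by (rule bounded_coeff_mult[OF bounded_coeff_mult[OF X Rinv(1)[OF j]] bounded_coeff_transpose[OF Y]])

lemma three_dx: "dx g + (dx g + (dx g + 0)) = 3 * dx g"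
  by simp

lemma block_coeffs:
  "bounded_coeff (hor g) (dx g) (dx g) closedA" "bounded_coeff (hor g) (dx g) (dx g) closedC"
  "bounded_coeff (hor g) (dx g) (3 * dx g) (blkB1 g)" "bounded_coeff (hor g) (dx g) (3 * dx g) (blkB2 g)"
  "bounded_coeff (hor g) (dx g) (3 * dx g) (blkD1 g)" "bounded_coeff (hor g) (dx g) (3 * dx g) (blkD2 g)"
  "bounded_coeff (hor g) (3 * dx g) (3 * dx g) (\<lambda>t. (blkA g t)\<^sup>T)"
  "bounded_coeff (hor g) (3 * dx g) (3 * dx g) (\<lambda>t. (blkC g t)\<^sup>T)"
  "bounded_coeff (hor g) (3 * dx g) (dx g) (blkQ g)"
  unfolding blkB1_def[abs_def] blkB2_def[abs_def] blkD1_def[abs_def] blkD2_def[abs_def] blkA_def[abs_def]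
    blkC_def[abs_def] blkQ_def[abs_def] list_comp_simps three_dx[symmetric]
  by (intro bounded_coeff_transpose bounded_coeff_hcat_Cons bounded_coeff_vcat_Cons bounded_coeff_diag_Cons
    bounded_coeff_Nil bounded_coeff_diff bounded_coeff_uminus bounded_coeff_msum_Cons bounded_coeff_msum_Nil
    triple_coeff hat3_coeff hatA_coeff hatC_coeff idx)+

lemma pointwise_carriers:
  assumes j: "j \<in> {1, 2, 3}" and t: "t \<in> {0..hor g}"
  shows "hatB3 g j t \<in> carrier_mat (dx g) (du3 g j)" "hatD3 g j t \<in> carrier_mat (dx g) (du3 g j)"
    "S3 g j t \<in> carrier_mat (dx g) (du3 g j)" "minv (Rc3 g j t) \<in> carrier_mat (du3 g j) (du3 g j)"
    "hatQ3 g j t \<in> carrier_mat (dx g) (dx g)"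
    "hatA g t \<in> carrier_mat (dx g) (dx g)" "hatC g t \<in> carrier_mat (dx g) (dx g)"
  by (rule bounded_coeffD(1)[OF _ t], rule hat3_coeff[OF j] Rinv[OF j] hatA_coeff hatC_coeff)+

definition feedback :: "real \<Rightarrow> rvec \<Rightarrow> (nat \<Rightarrow> rvec) \<Rightarrow> (nat \<Rightarrow> rvec) \<Rightarrow> nat \<Rightarrow> rvec" where
  "feedback t x y z j = - (minv (Rc3 g j t) *\<^sub>v ((S3 g j t)\<^sup>T *\<^sub>v x
     + (hatB3 g j t)\<^sup>T *\<^sub>v y j + (hatD3 g j t)\<^sup>T *\<^sub>v z j))"

lemma state_closed_loop:
  assumes t: "t \<in> {0..hor g}" and x: "x \<in> carrier_vec (dx g)"
    and v: "\<And>j. j \<in> {1, 2, 3} \<Longrightarrow> y j \<in> carrier_vec (dx g)" "\<And>j. j \<in> {1, 2, 3} \<Longrightarrow> z j \<in> carrier_vec (dx g)"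
    and u: "\<And>j. j \<in> {1, 2, 3} \<Longrightarrow> u j = feedback t x y z j"
  shows "hatA g t *\<^sub>v x + vsum (dx g) [hatB3 g k t *\<^sub>v u k. k \<leftarrow> I3]
      = closedA t *\<^sub>v x + blkB1 g t *\<^sub>v colvec [y j. j \<leftarrow> I3] + blkB2 g t *\<^sub>v colvec [z j. j \<leftarrow> I3]"
    "hatC g t *\<^sub>v x + vsum (dx g) [hatD3 g k t *\<^sub>v u k. k \<leftarrow> I3]
      = closedC t *\<^sub>v x + blkD1 g t *\<^sub>v colvec [y j. j \<leftarrow> I3] + blkD2 g t *\<^sub>v colvec [z j. j \<leftarrow> I3]"
proof -
  note c = pointwise_carriers[OF _ t]
  show "hatA g t *\<^sub>v x + vsum (dx g) [hatB3 g k t *\<^sub>v u k. k \<leftarrow> I3]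
      = closedA t *\<^sub>v x + blkB1 g t *\<^sub>v colvec [y j. j \<leftarrow> I3] + blkB2 g t *\<^sub>v colvec [z j. j \<leftarrow> I3]"
    unfolding blkB1_def blkB2_def
    by (rule closed_loop_state[where d = "du3 g", OF c(6)[OF idx(3)] x c(1) c(4) c(3) c(1) c(2) v u[unfolded feedback_def]])
  show "hatC g t *\<^sub>v x + vsum (dx g) [hatD3 g k t *\<^sub>v u k. k \<leftarrow> I3]
      = closedC t *\<^sub>v x + blkD1 g t *\<^sub>v colvec [y j. j \<leftarrow> I3] + blkD2 g t *\<^sub>v colvec [z j. j \<leftarrow> I3]"
    unfolding blkD1_def blkD2_def
    by (rule closed_loop_state[where d = "du3 g", OF c(7)[OF idx(3)] x c(2) c(4) c(3) c(1) c(2) v u[unfolded feedback_def]])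
qed

text \<open>The costate equation of player j contains no control but that of j, hence the block
  diagonal form.\<close>

lemma costate_closed_loop:
  assumes t: "t \<in> {0..hor g}" and x: "x \<in> carrier_vec (dx g)"
    and v: "\<And>j. j \<in> {1, 2, 3} \<Longrightarrow> y j \<in> carrier_vec (dx g)" "\<And>j. j \<in> {1, 2, 3} \<Longrightarrow> z j \<in> carrier_vec (dx g)"
    and u: "\<And>j. j \<in> {1, 2, 3} \<Longrightarrow> u j = feedback t x y z j"
  shows "colvec [- ((hatA g t)\<^sup>T *\<^sub>v y j + (hatC g t)\<^sup>T *\<^sub>v z j + hatQ3 g j t *\<^sub>v x + S3 g j t *\<^sub>v u j). j \<leftarrow> I3]
    = - ((blkA g t)\<^sup>T *\<^sub>v colvec [y j. j \<leftarrow> I3] + (blkC g t)\<^sup>T *\<^sub>v colvec [z j. j \<leftarrow> I3] + blkQ g t *\<^sub>v x)"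
proof -
  note c = pointwise_carriers[OF _ t]
  define Aj where "Aj j = hatA g t - hatB3 g j t * minv (Rc3 g j t) * (S3 g j t)\<^sup>T" for j
  define Cj where "Cj j = hatC g t - hatD3 g j t * minv (Rc3 g j t) * (S3 g j t)\<^sup>T" for j
  define Qj where "Qj j = hatQ3 g j t - S3 g j t * minv (Rc3 g j t) * (S3 g j t)\<^sup>T" for j
  have e: "(hatA g t)\<^sup>T *\<^sub>v y j + (hatC g t)\<^sup>T *\<^sub>v z j + hatQ3 g j t *\<^sub>v x + S3 g j t *\<^sub>v u j
    = (Aj j)\<^sup>T *\<^sub>v y j + (Cj j)\<^sup>T *\<^sub>v z j + Qj j *\<^sub>v x" if j: "j \<in> {1, 2, 3}" for j
    unfolding Aj_def Cj_def Qj_def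
    by (rule closed_loop_costate[OF c(6)[OF j] c(7)[OF j] c(5)[OF j] c(4)[OF j] c(3)[OF j] c(1)[OF j] c(2)[OF j]
      x v(1)[OF j] v(2)[OF j] Rinv(2)[OF j t] u[OF j, unfolded feedback_def]])
  have m: "Aj j \<in> carrier_mat (dx g) (dx g)" "Cj j \<in> carrier_mat (dx g) (dx g)" "Qj j \<in> carrier_mat (dx g) (dx g)"
    if j: "j \<in> {1, 2, 3}" for j
    unfolding Aj_def Cj_def Qj_def
    by (intro minus_carrier_mat mult_carrier_mat[OF mult_carrier_mat[OF _ c(4)[OF j]]] transpose_carrier_mat[THEN iffD2] c[OF j])+
  have w: "(Aj j)\<^sup>T *\<^sub>v y j \<in> carrier_vec (dx g)" "(Cj j)\<^sup>T *\<^sub>v z j \<in> carrier_vec (dx g)" "Qj j *\<^sub>v x \<in> carrier_vec (dx g)"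
    if j: "j \<in> {1, 2, 3}" for j
    using m[OF j] v[OF j] x by (auto intro!: carrier_vecI)
  show ?thesis
    unfolding list_comp_simps e[OF idx(3)] e[OF idx(4)] e[OF idx(5)]
    unfolding blkA_def blkC_def blkQ_def list_comp_simps Aj_def[symmetric] Cj_def[symmetric] Qj_def[symmetric]
      diag3_transpose_mult[OF m(1)[OF idx(3)] m(1)[OF idx(4)] m(1)[OF idx(5)] v(1)[OF idx(3)] v(1)[OF idx(4)] v(1)[OF idx(5)]]
      diag3_transpose_mult[OF m(2)[OF idx(3)] m(2)[OF idx(4)] m(2)[OF idx(5)] v(2)[OF idx(3)] v(2)[OF idx(4)] v(2)[OF idx(5)]]
      vcat3_mult[OF m(3)[OF idx(3)] m(3)[OF idx(4)] m(3)[OF idx(5)] x]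
      colvec3_add[OF w(1)[OF idx(3)] w(1)[OF idx(4)] w(1)[OF idx(5)] w(2)[OF idx(3)] w(2)[OF idx(4)] w(2)[OF idx(5)]]
      colvec3_add[OF add_carrier_vec[OF w(1,2)[OF idx(3)]] add_carrier_vec[OF w(1,2)[OF idx(4)]]
        add_carrier_vec[OF w(1,2)[OF idx(5)]] w(3)[OF idx(3)] w(3)[OF idx(4)] w(3)[OF idx(5)]]
      colvec3_uminus ..
qed

text \<open>In \<open>Psi\<close> the factor \<Phi> is distributed over the sum of the players.
  Factored out, it shows the coefficient \<open>closedC\<close>, as
  \<open>riccati_decoupling\<close> requires.\<close>

lemma Psi_eq:
  assumes t: "t \<in> {0..hor g}" and \<Phi>: "\<Phi> t \<in> carrier_mat (3 * dx g) (dx g)"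
  shows "Psi g \<Phi> t = minv (PhiM g \<Phi> t) * (\<Phi> t * closedC t + \<Phi> t * blkD1 g t * \<Phi> t)"
proof -
  note c = pointwise_carriers[OF _ t]
  have St: "(S3 g j t)\<^sup>T \<in> carrier_mat (du3 g j) (dx g)" if j: "j \<in> {1, 2, 3}" for j using c(3)[OF j] by simp
  have p: "hatD3 g j t * minv (Rc3 g j t) * (S3 g j t)\<^sup>T \<in> carrier_mat (dx g) (dx g)" if j: "j \<in> {1, 2, 3}" for j
    by (rule prod3_carrier[OF c(2)[OF j] c(4)[OF j] St[OF j]])
  have q: "\<Phi> t * hatD3 g j t * minv (Rc3 g j t) * (S3 g j t)\<^sup>T = \<Phi> t * (hatD3 g j t * minv (Rc3 g j t) * (S3 g j t)\<^sup>T)"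
    if j: "j \<in> {1, 2, 3}" for j
    unfolding assoc_mult_mat[OF \<Phi> c(2)[OF j] c(4)[OF j]]
    by (rule assoc_mult_mat[OF \<Phi> mult_carrier_mat[OF c(2)[OF j] c(4)[OF j]] St[OF j]])
  have "\<Phi> t * hatC g t - msum (3 * dx g) (dx g) [\<Phi> t * hatD3 g j t * minv (Rc3 g j t) * (S3 g j t)\<^sup>T. j \<leftarrow> I3]
    = \<Phi> t * closedC t"
    unfolding list_comp_simps q[OF idx(3)] q[OF idx(4)] q[OF idx(5)] msum3[OF mult_carrier_mat[OF \<Phi> p[OF idx(5)]]]
      msum3[OF p[OF idx(5)]]
      mult_minus_distrib_mat[OF \<Phi> c(7)[OF idx(3)] add_carrier_mat[OF add_carrier_mat[OF p[OF idx(5)]]]]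
      mult_add_distrib_mat[OF \<Phi> p[OF idx(3)] add_carrier_mat[OF p[OF idx(5)]]]
      mult_add_distrib_mat[OF \<Phi> p[OF idx(4)] p[OF idx(5)]] ..
  then show ?thesis unfolding Psi_def by (simp only:)
qed

lemma terminal_stack:
  assumes "x \<in> carrier_vec (dx g)"
  shows "blkG g *\<^sub>v x = colvec [wG3 g j *\<^sub>v x. j \<leftarrow> I3]"
  unfolding blkG_def list_comp_simps by (rule vcat3_mult[OF coeffs3(2)[OF idx(3)] coeffs3(2)[OF idx(4)] coeffs3(2)[OF idx(5)] assms])

lemma blkG_carrier: "blkG g \<in> carrier_mat (3 * dx g) (dx g)"
  unfolding blkG_def list_comp_simps
  by (rule carrier_matI) (use vcat_carrier[of "dx g" "[wG3 g 1, wG3 g 2, wG3 g 3]"] coeffs3(2)[OF idx(3)]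
    coeffs3(2)[OF idx(4)] coeffs3(2)[OF idx(5)] in \<open>auto simp del: One_nat_def\<close>)

lemma closed_loop_representation:
  fixes u y z :: "nat \<Rightarrow> 'a vproc" and x :: "'a vproc" and \<Phi> :: mfun
  assumes u: "\<And>j. j \<in> {1, 2, 3} \<Longrightarrow> L2F M (hor g) W (du3 g j) (u j)"
    and fb: "\<And>j. j \<in> {1, 2, 3} \<Longrightarrow> AE p in dt_dP. u j (fst p) (snd p)
      = feedback (fst p) (x (fst p) (snd p)) (\<lambda>j. y j (fst p) (snd p)) (\<lambda>j. z j (fst p) (snd p)) j"
    and fbsde: "nash_fbsde M W g u x y z"
    and ric: "Phi_riccati g \<Phi>"
  shows "\<And>j. j \<in> {1, 2, 3} \<Longrightarrow> AE p in dt_dP. u j (fst p) (snd p) = - ((minv (Rc3 g j (fst p)) * ((S3 g j (fst p))\<^sup>T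
          + row_at g j ((hatB3 g j (fst p))\<^sup>T) * \<Phi> (fst p)
          + row_at g j ((hatD3 g j (fst p))\<^sup>T) * Psi g \<Phi> (fst p))) *\<^sub>v x (fst p) (snd p))"
    and "ito_sde M (hor g) W (dx g) (xinit g)
      (\<lambda>t \<omega>. (closedA t + blkB1 g t * \<Phi> t + blkB2 g t * Psi g \<Phi> t) *\<^sub>v x t \<omega>)
      (\<lambda>t \<omega>. (closedC t + blkD1 g t * \<Phi> t + blkD2 g t * Psi g \<Phi> t) *\<^sub>v x t \<omega>) x"
proof -
  let ?T = "hor g" and ?n = "dx g"
  let ?Y = "\<lambda>t \<omega>. colvec [y j t \<omega>. j \<leftarrow> I3]" and ?Z = "\<lambda>t \<omega>. colvec [z j t \<omega>. j \<leftarrow> I3]"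
  let ?b = "\<lambda>t \<omega>. hatA g t *\<^sub>v x t \<omega> + vsum ?n [hatB3 g k t *\<^sub>v u k t \<omega>. k \<leftarrow> I3]"
  let ?s = "\<lambda>t \<omega>. hatC g t *\<^sub>v x t \<omega> + vsum ?n [hatD3 g k t *\<^sub>v u k t \<omega>. k \<leftarrow> I3]"
  let ?b' = "\<lambda>t \<omega>. closedA t *\<^sub>v x t \<omega> + blkB1 g t *\<^sub>v ?Y t \<omega> + blkB2 g t *\<^sub>v ?Z t \<omega>"
  let ?s' = "\<lambda>t \<omega>. closedC t *\<^sub>v x t \<omega> + blkD1 g t *\<^sub>v ?Y t \<omega> + blkD2 g t *\<^sub>v ?Z t \<omega>"
  let ?g = "\<lambda>j t \<omega>. - ((hatA g t)\<^sup>T *\<^sub>v y j t \<omega> + (hatC g t)\<^sup>T *\<^sub>v z j t \<omega> + hatQ3 g j t *\<^sub>v x t \<omega> + S3 g j t *\<^sub>v u j t \<omega>)"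
  have sde: "ito_diff M ?T W ?n ?b ?s x" and x0: "AE \<omega> in M. x 0 \<omega> = xinit g"
    using fbsde by (simp_all add: nash_fbsde_def lq_state_def level3_game_def ito_sde_def)
  have bsde: "L2F M ?T W ?n (z j)" "ito_diff M ?T W ?n (?g j) (z j) (y j)"
    "AE \<omega> in M. y j ?T \<omega> = wG3 g j *\<^sub>v x ?T \<omega>" if j: "j \<in> {1, 2, 3}" for j
    using fbsde j unfolding nash_fbsde_def by blast+
  have Lx: "L2_vec ?n x" using sde by (intro L2F_L2_vec) (simp add: ito_diff_def)
  have Lu: "L2_vec (du3 g j) (u j)" if j: "j \<in> {1, 2, 3}" for j by (rule L2F_L2_vec[OF u[OF j]])
  have Lz: "L2_vec ?n (z j)" if j: "j \<in> {1, 2, 3}" for j by (rule L2F_L2_vec[OF bsde(1)[OF j]])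
  have Ly: "L2_vec ?n (y j)" if j: "j \<in> {1, 2, 3}" for j
    using bsde(2)[OF j] by (intro L2F_L2_vec) (simp add: ito_diff_def)
  have LY: "L2_vec (3 * ?n) ?Y" by (rule L2_vec_colvec3[OF Ly])
  have LZ: "L2_vec (3 * ?n) ?Z" by (rule L2_vec_colvec3[OF Lz])
  have Lg: "L2_vec ?n (?g j)" if j: "j \<in> {1, 2, 3}" for j
    by (intro L2_vec_uminus L2_vec_add L2_vec_mat_mult[OF _ Ly] L2_vec_mat_mult[OF _ Lz] L2_vec_mat_mult[OF _ Lx]
      L2_vec_mat_mult[OF _ Lu] bounded_coeff_transpose hatA_coeff hatC_coeff hat3_coeff j)
  have L0: "L2_vec ?n (\<lambda>t \<omega>. 0\<^sub>v ?n)"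
    by (rule L2_vecI[where f = "\<lambda>k t \<omega>. 0"]) (simp_all add: progressive_0 L2_proc_0)
  have Lb: "L2_vec ?n ?b" and Ls: "L2_vec ?n ?s"
    unfolding vsum_def list_comp_simps foldr.simps comp_def id_apply
    by (intro L2_vec_add L2_vec_mat_mult[OF _ Lx] L2_vec_mat_mult[OF _ Lu] L0 hatA_coeff hatC_coeff hat3_coeff idx)+
  have Lb': "L2_vec ?n ?b'" and Ls': "L2_vec ?n ?s'"
    by (intro L2_vec_add L2_vec_mat_mult[OF _ Lx] L2_vec_mat_mult[OF _ LY] L2_vec_mat_mult[OF _ LZ] block_coeffs)+
  have fb3: "AE p in dt_dP. \<forall>j\<in>{1, 2, 3}. u j (fst p) (snd p)
      = feedback (fst p) (x (fst p) (snd p)) (\<lambda>j. y j (fst p) (snd p)) (\<lambda>j. z j (fst p) (snd p)) j"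
    by (rule AE_finite_allI) (use fb in auto)
  \<comment> \<open>All rewritings on one event of full measure, since the feedback law holds only
    almost everywhere.\<close>
  have eqs: "AE p in dt_dP. ?b (fst p) (snd p) = ?b' (fst p) (snd p) \<and> ?s (fst p) (snd p) = ?s' (fst p) (snd p) \<and>
    colvec [?g j (fst p) (snd p). j \<leftarrow> I3] = - ((blkA g (fst p))\<^sup>T *\<^sub>v ?Y (fst p) (snd p)
      + (blkC g (fst p))\<^sup>T *\<^sub>v ?Z (fst p) (snd p) + blkQ g (fst p) *\<^sub>v x (fst p) (snd p))"
    using fb3 AE_space
  proof eventually_elim
    case (elim p)
    obtain t \<omega> where p: "p = (t, \<omega>)" and t: "t \<in> {0..?T}" and w: "\<omega> \<in> space M" using elim(2) by (auto simp: space_dt_dP)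
    have uj: "u j t \<omega> = feedback t (x t \<omega>) (\<lambda>j. y j t \<omega>) (\<lambda>j. z j t \<omega>) j" if "j \<in> {1, 2, 3}" for j
      using bspec[OF elim(1) that] by (simp add: p)
    show ?case unfolding p fst_conv snd_conv
      by (intro conjI state_closed_loop[where y = "\<lambda>j. y j t \<omega>" and z = "\<lambda>j. z j t \<omega>" and u = "\<lambda>j. u j t \<omega>"]
        costate_closed_loop[where y = "\<lambda>j. y j t \<omega>" and z = "\<lambda>j. z j t \<omega>" and u = "\<lambda>j. u j t \<omega>"] t uj
        L2_vecD(1)[OF Lx t w] L2_vecD(1)[OF Ly t w] L2_vecD(1)[OF Lz t w]) assumption+
  qed
  have sde': "ito_diff M ?T W ?n ?b' ?s' x"
    by (rule ito_diff_cong_AE[OF sde Lb Lb' Ls']) (use eqs in \<open>auto elim: eventually_mono\<close>)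
  have T0: "0 \<in> {0..?T}" "?T \<in> {0..?T}" using T_pos by simp_all
  \<comment> \<open>The initial state is almost surely constant: this is the fixed-time moment for
    the forward equation.\<close>
  have initL: "Lsq M (\<lambda>\<omega>. x 0 \<omega> $ i)" if i: "i < ?n" for i
  proof (rule Lsq_cong_AE[of M "\<lambda>\<omega>. xinit g $ i"])
    show "Lsq M (\<lambda>\<omega>. xinit g $ i)" by (simp add: Lsq_def)
    show "(\<lambda>\<omega>. x 0 \<omega> $ i) \<in> borel_measurable M"
      by (rule meas_Fil_M[OF progressive_section[OF L2_vecD(2)[OF Lx i] T0(1)]]) (use T_pos in simp)
    show "AE \<omega> in M. xinit g $ i = x 0 \<omega> $ i" using x0 by eventually_elim simp
  qed
  have X: "itoproc (\<lambda>t \<omega>. ?b' t \<omega> $ i) (\<lambda>t \<omega>. ?s' t \<omega> $ i) (\<lambda>t \<omega>. x t \<omega> $ i)" if i: "i < ?n" for i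
    by (rule ito_diff_itoproc[OF sde' Lb' Ls' T0(1) initL i])
  have xT: "Lsq M (\<lambda>\<omega>. x ?T \<omega> $ i)" if i: "i < ?n" for i by (rule itoprocD(5)[OF X[OF i] T0(2)])
  \<comment> \<open>For the costates the moment is available at the horizon, as a linear image of
    x(T). This is why the state is treated before them.\<close>
  have yT: "Lsq M (\<lambda>\<omega>. y j ?T \<omega> $ k)" if j: "j \<in> {1, 2, 3}" and k: "k < ?n" for j k
  proof (rule Lsq_cong_AE[of M "\<lambda>\<omega>. \<Sum>i<?n. wG3 g j $$ (k, i) * x ?T \<omega> $ i"])
    show "Lsq M (\<lambda>\<omega>. \<Sum>i<?n. wG3 g j $$ (k, i) * x ?T \<omega> $ i)" by (intro Lsq_sum Lsq_cmult xT) simp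
    show "(\<lambda>\<omega>. y j ?T \<omega> $ k) \<in> borel_measurable M"
      by (rule meas_Fil_M[OF progressive_section[OF L2_vecD(2)[OF Ly[OF j] k] T0(2)]]) simp
    show "AE \<omega> in M. (\<Sum>i<?n. wG3 g j $$ (k, i) * x ?T \<omega> $ i) = y j ?T \<omega> $ k"
      using bsde(3)[OF j] AE_space
    proof eventually_elim
      case (elim \<omega>)
      show ?case unfolding elim(1) mult_mat_vec_index_sum[OF coeffs3(2)[OF j] L2_vecD(1)[OF Lx T0(2) elim(2)] k] ..
    qed
  qed
  have y_ito: "itoproc (\<lambda>t \<omega>. ?g j t \<omega> $ k) (\<lambda>t \<omega>. z j t \<omega> $ k) (\<lambda>t \<omega>. y j t \<omega> $ k)"
    if j: "j \<in> {1, 2, 3}" and k: "k < ?n" for j k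
    by (rule ito_diff_itoproc[OF bsde(2)[OF j] Lg[OF j] Lz[OF j] T0(2) yT[OF j] k])
  let ?G = "\<lambda>t \<omega>. - ((blkA g t)\<^sup>T *\<^sub>v ?Y t \<omega> + (blkC g t)\<^sup>T *\<^sub>v ?Z t \<omega> + blkQ g t *\<^sub>v x t \<omega>)"
  have LG: "L2_vec (3 * ?n) ?G"
    by (intro L2_vec_uminus L2_vec_add L2_vec_mat_mult[OF _ Lx] L2_vec_mat_mult[OF _ LY] L2_vec_mat_mult[OF _ LZ] block_coeffs)
  have YZ: "itoproc (\<lambda>t \<omega>. ?G t \<omega> $ c) (\<lambda>t \<omega>. ?Z t \<omega> $ c) (\<lambda>t \<omega>. ?Y t \<omega> $ c)" if c: "c < 3 * ?n" for c
  proof (rule itoproc_cong_AE[OF itoproc_colvec3[where b = ?g and \<sigma> = z and X = y, OF y_ito Lg Lz Ly c]])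
    show "L2_proc (\<lambda>t \<omega>. ?G t \<omega> $ c)" by (rule L2_vecD(3)[OF LG c])
    show "AE p in dt_dP. colvec [?g j (fst p) (snd p). j \<leftarrow> I3] $ c = ?G (fst p) (snd p) $ c"
      using eqs by (rule eventually_mono) (simp only:)
    show "L2_proc (\<lambda>t \<omega>. ?Z t \<omega> $ c)" by (rule L2_vecD(3)[OF LZ c])
    show "AE p in dt_dP. ?Z (fst p) (snd p) $ c = ?Z (fst p) (snd p) $ c" by (rule AE_I2) (rule refl)
  qed
  have ode: "terminal_ode ?T (3 * ?n) ?n (Phi_rhs g \<Phi>) (blkG g) \<Phi>"
    and bi: "has_bounded_inverse ?T (3 * ?n) (PhiM g \<Phi>)" using ric by (simp_all add: Phi_riccati_def)
  have bPhi: "bounded_coeff ?T (3 * ?n) ?n \<Phi>" by (rule terminal_ode_bounded_coeff[OF ode])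
  note Pc = bounded_coeffD(1)[OF bPhi]
  have bM: "bounded_coeff ?T (3 * ?n) (3 * ?n) (PhiM g \<Phi>)" unfolding PhiM_def[abs_def]
    by (intro bounded_coeff_diff bounded_coeff_const one_carrier_mat bounded_coeff_mult[OF bPhi block_coeffs(6)])
  have bI: "bounded_coeff ?T (3 * ?n) (3 * ?n) (\<lambda>t. minv (PhiM g \<Phi> t))"
    by (rule bounded_coeff_minv_bounded_inverse[OF bM bi])
  have inv: "minv (PhiM g \<Phi> t) * (1\<^sub>m (3 * ?n) - \<Phi> t * blkD2 g t) = 1\<^sub>m (3 * ?n)"
    "(1\<^sub>m (3 * ?n) - \<Phi> t * blkD2 g t) * minv (PhiM g \<Phi> t) = 1\<^sub>m (3 * ?n)" if t: "t \<in> {0..?T}" for t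
    using minv_inverse(2,3)[of "PhiM g \<Phi> t" "3 * ?n"] bi t by (auto simp: has_bounded_inverse_def PhiM_def)
  have PhiT: "\<Phi> ?T = blkG g"
    by (rule terminal_ode_at_end[OF ode _ blkG_carrier]) (use T_pos in simp)
  have fin: "AE \<omega> in M. ?Y ?T \<omega> = \<Phi> ?T *\<^sub>v x ?T \<omega>"
    using bsde(3)[OF idx(3)] bsde(3)[OF idx(4)] bsde(3)[OF idx(5)] AE_space
  proof eventually_elim
    case (elim \<omega>)
    show ?case
      unfolding PhiT terminal_stack[OF L2_vecD(1)[OF Lx T0(2) elim(4)]] list_comp_simps elim(1-3) ..
  qed
  have rhs: "\<Phi> t $$ (a, b) = blkG g $$ (a, b) + (LINT s:{t..?T}|lborel. (\<Phi> s * closedA s + (blkA g s)\<^sup>T * \<Phi> s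
      + \<Phi> s * blkB1 g s * \<Phi> s + blkQ g s + ((blkC g s)\<^sup>T + \<Phi> s * blkB2 g s) * Psi g \<Phi> s) $$ (a, b))"
    if "a < 3 * ?n" "b < ?n" "t \<in> {0..?T}" for a b t
    using ode that unfolding terminal_ode_def Phi_rhs_def by blast
  have dec: "AE p in dt_dP. ?Y (fst p) (snd p) = \<Phi> (fst p) *\<^sub>v x (fst p) (snd p)"
    "AE p in dt_dP. ?Z (fst p) (snd p) = Psi g \<Phi> (fst p) *\<^sub>v x (fst p) (snd p)"
    by (rule riccati_decoupling[OF block_coeffs(1) block_coeffs(3) block_coeffs(4) block_coeffs(2) block_coeffs(5)
      block_coeffs(6) block_coeffs(7) block_coeffs(8) block_coeffs(9) bPhi bI inv Psi_eq[where \<Phi> = \<Phi>, OF _ Pc] rhs Lx LY LZ X YZ fin]; assumption)+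
  have Pcr: "Psi g \<Phi> t \<in> carrier_mat (3 * ?n) ?n" if t: "t \<in> {0..?T}" for t
    unfolding Psi_eq[where \<Phi> = \<Phi>, OF t Pc[OF t]]
    by (rule mult_carrier_mat[OF bounded_coeffD(1)[OF bI t] add_carrier_mat[OF mult_carrier_mat[OF
      mult_carrier_mat[OF Pc[OF t] bounded_coeffD(1)[OF block_coeffs(5) t]] Pc[OF t]]]])
  show "AE p in dt_dP. u j (fst p) (snd p) = - ((minv (Rc3 g j (fst p)) * ((S3 g j (fst p))\<^sup>T
          + row_at g j ((hatB3 g j (fst p))\<^sup>T) * \<Phi> (fst p)
          + row_at g j ((hatD3 g j (fst p))\<^sup>T) * Psi g \<Phi> (fst p))) *\<^sub>v x (fst p) (snd p))"
    if j: "j \<in> {1, 2, 3}" for j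
    using fb[OF j] dec(1) dec(2) AE_space
  proof eventually_elim
    case (elim p)
    obtain t \<omega> where p: "p = (t, \<omega>)" and t: "t \<in> {0..?T}" and w: "\<omega> \<in> space M" using elim(4) by (auto simp: space_dt_dP)
    note c = pointwise_carriers[OF j t] and xc = L2_vecD(1)[OF Lx t w]
    have tc: "(S3 g j t)\<^sup>T \<in> carrier_mat (du3 g j) ?n" "(hatB3 g j t)\<^sup>T \<in> carrier_mat (du3 g j) ?n"
      "(hatD3 g j t)\<^sup>T \<in> carrier_mat (du3 g j) ?n" using c by simp_all
    note rB = row_at_mult[OF j tc(2)] and rD = row_at_mult[OF j tc(3)]
    \<comment> \<open>The dimensions do not depend on the stacked vectors; zero vectors merely
      instantiate the assumption on y.\<close>
    have rBc: "row_at g j ((hatB3 g j t)\<^sup>T) \<in> carrier_mat (du3 g j) (3 * ?n)"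
      by (rule rB(2)[where y = "\<lambda>_. 0\<^sub>v ?n"]) simp
    have rDc: "row_at g j ((hatD3 g j t)\<^sup>T) \<in> carrier_mat (du3 g j) (3 * ?n)"
      by (rule rD(2)[where y = "\<lambda>_. 0\<^sub>v ?n"]) simp
    note m1 = mult_carrier_mat[OF rBc Pc[OF t]] and m2 = mult_carrier_mat[OF rDc Pcr[OF t]]
    have Yp: "?Y t \<omega> = \<Phi> t *\<^sub>v x t \<omega>" and Zp: "?Z t \<omega> = Psi g \<Phi> t *\<^sub>v x t \<omega>"
      using elim(2,3) by (simp_all only: p fst_conv snd_conv)
    have "(minv (Rc3 g j t) * ((S3 g j t)\<^sup>T + row_at g j ((hatB3 g j t)\<^sup>T) * \<Phi> t
        + row_at g j ((hatD3 g j t)\<^sup>T) * Psi g \<Phi> t)) *\<^sub>v x t \<omega>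
      = minv (Rc3 g j t) *\<^sub>v (((S3 g j t)\<^sup>T + row_at g j ((hatB3 g j t)\<^sup>T) * \<Phi> t
        + row_at g j ((hatD3 g j t)\<^sup>T) * Psi g \<Phi> t) *\<^sub>v x t \<omega>)"
      by (rule assoc_mult_mat_vec[OF c(4) add_carrier_mat[OF m2] xc])
    also have "((S3 g j t)\<^sup>T + row_at g j ((hatB3 g j t)\<^sup>T) * \<Phi> t + row_at g j ((hatD3 g j t)\<^sup>T) * Psi g \<Phi> t) *\<^sub>v x t \<omega>
      = (S3 g j t)\<^sup>T *\<^sub>v x t \<omega> + row_at g j ((hatB3 g j t)\<^sup>T) *\<^sub>v ?Y t \<omega> + row_at g j ((hatD3 g j t)\<^sup>T) *\<^sub>v ?Z t \<omega>"
      unfolding add_mult_distrib_mat_vec[OF add_carrier_mat[OF m1] m2 xc] add_mult_distrib_mat_vec[OF tc(1) m1 xc]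
        assoc_mult_mat_vec[OF rBc Pc[OF t] xc] assoc_mult_mat_vec[OF rDc Pcr[OF t] xc] Yp Zp ..
    also have "row_at g j ((hatB3 g j t)\<^sup>T) *\<^sub>v ?Y t \<omega> = (hatB3 g j t)\<^sup>T *\<^sub>v y j t \<omega>"
      by (rule rB(1)[where y = "\<lambda>j. y j t \<omega>"]) (rule L2_vecD(1)[OF Ly t w])
    also have "row_at g j ((hatD3 g j t)\<^sup>T) *\<^sub>v ?Z t \<omega> = (hatD3 g j t)\<^sup>T *\<^sub>v z j t \<omega>"
      by (rule rD(1)[where y = "\<lambda>j. z j t \<omega>"]) (rule L2_vecD(1)[OF Lz t w])
    finally show ?case using elim(1) unfolding p fst_conv snd_conv feedback_def by (simp only:)
  qed
  let ?b2 = "\<lambda>t \<omega>. (closedA t + blkB1 g t * \<Phi> t + blkB2 g t * Psi g \<Phi> t) *\<^sub>v x t \<omega>"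
  let ?s2 = "\<lambda>t \<omega>. (closedC t + blkD1 g t * \<Phi> t + blkD2 g t * Psi g \<Phi> t) *\<^sub>v x t \<omega>"
  have bPsi: "bounded_coeff ?T (3 * ?n) ?n (Psi g \<Phi>)"
  proof -
    have b: "bounded_coeff ?T (3 * ?n) ?n (\<lambda>t. minv (PhiM g \<Phi> t) * (\<Phi> t * closedC t + \<Phi> t * blkD1 g t * \<Phi> t))"
      by (intro bounded_coeff_mult[OF bI] bounded_coeff_add bounded_coeff_mult[OF bPhi block_coeffs(2)]
        bounded_coeff_mult[OF bounded_coeff_mult[OF bPhi block_coeffs(5)] bPhi])
    show ?thesis
      by (rule bounded_coeffI2[OF Pcr arg_cong[OF Psi_eq[where \<Phi> = \<Phi>, OF _ Pc]] bounded_coeffD(2)[OF b]])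
  qed
  have bb2: "bounded_coeff ?T ?n ?n (\<lambda>t. closedA t + blkB1 g t * \<Phi> t + blkB2 g t * Psi g \<Phi> t)"
    by (rule bounded_coeff_add[OF bounded_coeff_add[OF block_coeffs(1) bounded_coeff_mult[OF block_coeffs(3) bPhi]]
      bounded_coeff_mult[OF block_coeffs(4) bPsi]])
  have bs2: "bounded_coeff ?T ?n ?n (\<lambda>t. closedC t + blkD1 g t * \<Phi> t + blkD2 g t * Psi g \<Phi> t)"
    by (rule bounded_coeff_add[OF bounded_coeff_add[OF block_coeffs(2) bounded_coeff_mult[OF block_coeffs(5) bPhi]]
      bounded_coeff_mult[OF block_coeffs(6) bPsi]])
  have lin: "(F + G * \<Phi> t + H * Psi g \<Phi> t) *\<^sub>v v = F *\<^sub>v v + G *\<^sub>v (\<Phi> t *\<^sub>v v) + H *\<^sub>v (Psi g \<Phi> t *\<^sub>v v)"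
    if t: "t \<in> {0..?T}" and v: "v \<in> carrier_vec ?n" and F: "F \<in> carrier_mat ?n ?n"
      and G: "G \<in> carrier_mat ?n (3 * ?n)" and H: "H \<in> carrier_mat ?n (3 * ?n)" for t v F G H
    unfolding add_mult_distrib_mat_vec[OF add_carrier_mat[OF mult_carrier_mat[OF G Pc[OF t]]] mult_carrier_mat[OF H Pcr[OF t]] v]
      add_mult_distrib_mat_vec[OF F mult_carrier_mat[OF G Pc[OF t]] v]
      assoc_mult_mat_vec[OF G Pc[OF t] v] assoc_mult_mat_vec[OF H Pcr[OF t] v] ..
  have eq2: "AE p in dt_dP. ?b' (fst p) (snd p) = ?b2 (fst p) (snd p) \<and> ?s' (fst p) (snd p) = ?s2 (fst p) (snd p)"
    using dec(1) dec(2) AE_space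
  proof eventually_elim
    case (elim p)
    obtain t \<omega> where p: "p = (t, \<omega>)" and t: "t \<in> {0..?T}" and w: "\<omega> \<in> space M" using elim(3) by (auto simp: space_dt_dP)
    note xc = L2_vecD(1)[OF Lx t w] and b = block_coeffs[THEN bounded_coeffD(1), OF t]
    have Yp: "?Y t \<omega> = \<Phi> t *\<^sub>v x t \<omega>" and Zp: "?Z t \<omega> = Psi g \<Phi> t *\<^sub>v x t \<omega>"
      using elim(1,2) by (simp_all only: p fst_conv snd_conv)
    show ?case unfolding p fst_conv snd_conv Yp Zp lin[OF t xc b(1,3,4)] lin[OF t xc b(2,5,6)] by (rule conjI[OF refl refl])
  qed
  have "ito_diff M ?T W ?n ?b2 ?s2 x"
    by (rule ito_diff_cong_AE[OF sde' Lb' L2_vec_mat_mult[OF bb2 Lx] L2_vec_mat_mult[OF bs2 Lx]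
      eventually_mono[OF eq2 conjunct1] eventually_mono[OF eq2 conjunct2]])
  then show "ito_sde M ?T W ?n (xinit g) ?b2 ?s2 x" using x0 by (simp only: ito_sde_def simp_thms)
qed

end

theorem proposition3p6:
  fixes L :: leader_data
  shows "\<exists>\<gamma>0>0. \<forall>(g::game) (M::'a measure) W xbar u x y z \<Phi>.
    leader_data.truncate g = L \<longrightarrow> \<gamma>0 \<le> gam g \<longrightarrow>
    well_formed g \<longrightarrow> brownian_basis M (hor g) W \<longrightarrow>
    state_weights_psd g \<longrightarrow> control_weights_pos g \<longrightarrow>
    team_riccati g \<longrightarrow> team_trajectory M W g xbar \<longrightarrow>
    open_loop_nash M W (level2_game g) (xinit g) (team_uc g xbar) \<longrightarrow>
    (\<forall>i\<in>{1,2}. unif_pos_def (hor g) (dc g i) (Rc2 g i)) \<longrightarrow>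
    (\<forall>i\<in>{1,2}. unif_convex M W (level2_game g) i) \<longrightarrow>
    (\<forall>j\<in>{1,2,3}. unif_convex M W (level3_game g) j) \<longrightarrow>
    open_loop_nash M W (level3_game g) (xinit g) u \<longrightarrow>
    (\<forall>j\<in>{1,2,3}. proc_eq M (hor g) (u j)
       (\<lambda>t \<omega>. - (minv (Rc3 g j t) *\<^sub>v ((S3 g j t)\<^sup>T *\<^sub>v x t \<omega>
          + (hatB3 g j t)\<^sup>T *\<^sub>v y j t \<omega> + (hatD3 g j t)\<^sup>T *\<^sub>v z j t \<omega>)))) \<longrightarrow>
    nash_fbsde M W g u x y z \<longrightarrow>
    Phi_riccati g \<Phi> \<longrightarrow>
    (\<forall>j\<in>{1,2,3}. proc_eq M (hor g) (u j)
       (\<lambda>t \<omega>. - ((minv (Rc3 g j t) * ((S3 g j t)\<^sup>T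
          + row_at g j ((hatB3 g j t)\<^sup>T) * \<Phi> t
          + row_at g j ((hatD3 g j t)\<^sup>T) * Psi g \<Phi> t)) *\<^sub>v x t \<omega>))) \<and>
    ito_sde M (hor g) W (dx g) (xinit g)
      (\<lambda>t \<omega>. (hatA g t
         - msum (dx g) (dx g) [hatB3 g j t * minv (Rc3 g j t) * (S3 g j t)\<^sup>T. j \<leftarrow> I3]
         + blkB1 g t * \<Phi> t + blkB2 g t * Psi g \<Phi> t) *\<^sub>v x t \<omega>)
      (\<lambda>t \<omega>. (hatC g t
         - msum (dx g) (dx g) [hatD3 g j t * minv (Rc3 g j t) * (S3 g j t)\<^sup>T. j \<leftarrow> I3]
         + blkD1 g t * \<Phi> t + blkD2 g t * Psi g \<Phi> t) *\<^sub>v x t \<omega>)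
      x"
proof (intro exI[of _ "1 :: real"] conjI allI impI)
  fix g :: game and M :: "'a measure" and W :: "'a rproc" and xbar x :: "'a vproc" and u y z :: "nat \<Rightarrow> 'a vproc"
    and \<Phi> :: mfun
  assume wf: "well_formed g" and bm: "brownian_basis M (hor g) W" and cw: "control_weights_pos g"
    and team: "team_riccati g" and nash: "open_loop_nash M W (level3_game g) (xinit g) u"
    and fb: "\<forall>j\<in>{1,2,3}. proc_eq M (hor g) (u j)
       (\<lambda>t \<omega>. - (minv (Rc3 g j t) *\<^sub>v ((S3 g j t)\<^sup>T *\<^sub>v x t \<omega>
          + (hatB3 g j t)\<^sup>T *\<^sub>v y j t \<omega> + (hatD3 g j t)\<^sup>T *\<^sub>v z j t \<omega>)))"
    and fbsde: "nash_fbsde M W g u x y z" and ric: "Phi_riccati g \<Phi>"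
  interpret nash_game g M W
    by unfold_locales (use wf bm cw team in \<open>auto simp: well_formed_def\<close>)
  \<comment> \<open>Admissibility is the first half of the equilibrium property; it makes the drifts
    and diffusions square integrable before the feedback is inserted.\<close>
  have u: "L2F M (hor g) W (du3 g j) (u j)" if "j \<in> {1, 2, 3}" for j
  proof -
    have "\<forall>k\<in>set (lq_players (level3_game g)). L2F M (lq_hor (level3_game g)) W (lq_udim (level3_game g) k) (u k)"
      using nash unfolding open_loop_nash_def by (rule conjunct1)
    then show ?thesis using that by (auto simp: level3_game_def)
  qed
  have fb': "AE p in dt_dP. u j (fst p) (snd p)
      = feedback (fst p) (x (fst p) (snd p)) (\<lambda>j. y j (fst p) (snd p)) (\<lambda>j. z j (fst p) (snd p)) j"
    if "j \<in> {1, 2, 3}" for j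
    using bspec[OF fb that] by (simp only: proc_eq_def split_beta' feedback_def)
  note rep = closed_loop_representation[OF u fb' fbsde ric]
  show "\<forall>j\<in>{1,2,3}. proc_eq M (hor g) (u j)
       (\<lambda>t \<omega>. - ((minv (Rc3 g j t) * ((S3 g j t)\<^sup>T
          + row_at g j ((hatB3 g j t)\<^sup>T) * \<Phi> t
          + row_at g j ((hatD3 g j t)\<^sup>T) * Psi g \<Phi> t)) *\<^sub>v x t \<omega>))"
    unfolding proc_eq_def split_beta' using rep(1) by (intro ballI)
  show "ito_sde M (hor g) W (dx g) (xinit g)
      (\<lambda>t \<omega>. (hatA g t
         - msum (dx g) (dx g) [hatB3 g j t * minv (Rc3 g j t) * (S3 g j t)\<^sup>T. j \<leftarrow> I3]
         + blkB1 g t * \<Phi> t + blkB2 g t * Psi g \<Phi> t) *\<^sub>v x t \<omega>)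
      (\<lambda>t \<omega>. (hatC g t
         - msum (dx g) (dx g) [hatD3 g j t * minv (Rc3 g j t) * (S3 g j t)\<^sup>T. j \<leftarrow> I3]
         + blkD1 g t * \<Phi> t + blkD2 g t * Psi g \<Phi> t) *\<^sub>v x t \<omega>)
      x"
    by (rule rep(2))
qed simp

end
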